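(* There is an algorithm which, given an $(s,t)$-layered graph $G_L=(V(G_L),E(G_L),w)$ and the vertices $s,t$, either outputs an $s\to t$ next-to-shortest path in $G_L$ (if one exists) or correctly reports that none exists, in time $O\big(|V_B(G_L)|^2\,|E_{FP}(G_L)|\,(|E(G_L)|+|V(G_L)|\log|V(G_L)|)\big)$.
   Context: Graphs are finite simple directed graphs with positive real edge weights; paths have no repeated vertices; $d_G$ is shortest-path distance. An $s\to t$ path $P$ is not-shortest if $w(P)>d_G(s,t)$; a next-to-shortest path is a not-shortest $s\to t$ path of minimum length among such. An edge $(u,v)$ is a back-edge if $d_G(s,u)+w(u,v)>d_G(s,v)$ and a forward-edge if $d_G(s,u)+w(u,v)=d_G(s,v)$. $V_B(G)$ is the set of vertices incident to a back-edge; $E_{FP}(G)$ is the set of ordered pairs $((u_1,v_1),(u_2,v_2))$ of forward-edges with $d_G(s,u_1)=d_G(s,u_2)$. $G$ is $(s,t)$-layered if (1) $d_G(s,u)+d_G(u,t)=d_G(s,t)$ (finite) for all $u$; (2) $d_G(s,u)\ne d_G(s,v)$ for every edge $(u,v)$; (3) for every edge $(u,v)$ with $d_G(s,u)<d_G(s,v)$ and every $x$, $d_G(s,x)\le d_G(s,u)$ or $d_G(s,x)\ge d_G(s,u)+w(u,v)$.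
   Formalization: When $V_B(G_L)$ is empty the stated product is $0$, which no algorithm's running time can meet; in exactly that case the time bound is taken to be $O(|V(G_L)|+|E(G_L)|)$ instead; otherwise the bound is as stated. *)

theory Defs
  imports "Graph_Theory.Shortest_Path"
begin

section \<open>Layered graphs and next-to-shortest paths\<close>

text \<open>
  Graphs are those of the \<^locale>\<open>digraph\<close> locale (finite, loopfree, no parallel arcs); paths are
  \<^emph>\<open>apath\<close>s, i.e. arc lists whose vertex sequence is repetition-free; \<^emph>\<open>\<mu> w u v\<close> is the distance
  (infinite if there is no walk from \<^emph>\<open>u\<close> to \<^emph>\<open>v\<close>).
\<close>

context wf_digraph
begin

definition not_shortest :: "'b weight_fun \<Rightarrow> 'a \<Rightarrow> 'a \<Rightarrow> 'b awalk \<Rightarrow> bool" where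
  "not_shortest w s t p \<longleftrightarrow> apath s p t \<and> ereal (awalk_cost w p) > \<mu> w s t"

definition next_to_shortest :: "'b weight_fun \<Rightarrow> 'a \<Rightarrow> 'a \<Rightarrow> 'b awalk \<Rightarrow> bool" where
  "next_to_shortest w s t p \<longleftrightarrow>
     not_shortest w s t p \<and> (\<forall>q. not_shortest w s t q \<longrightarrow> awalk_cost w p \<le> awalk_cost w q)"

definition back_edge :: "'b weight_fun \<Rightarrow> 'a \<Rightarrow> 'b \<Rightarrow> bool" where
  "back_edge w s e \<longleftrightarrow> e \<in> arcs G \<and> \<mu> w s (tail G e) + ereal (w e) > \<mu> w s (head G e)"

definition forward_edge :: "'b weight_fun \<Rightarrow> 'a \<Rightarrow> 'b \<Rightarrow> bool" where
  "forward_edge w s e \<longleftrightarrow> e \<in> arcs G \<and> \<mu> w s (tail G e) + ereal (w e) = \<mu> w s (head G e)"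

definition V_B :: "'b weight_fun \<Rightarrow> 'a \<Rightarrow> 'a set" where
  "V_B w s = {v \<in> verts G. \<exists>e. back_edge w s e \<and> (tail G e = v \<or> head G e = v)}"

definition E_FP :: "'b weight_fun \<Rightarrow> 'a \<Rightarrow> ('b \<times> 'b) set" where
  "E_FP w s = {(e1, e2). forward_edge w s e1 \<and> forward_edge w s e2 \<and>
     \<mu> w s (tail G e1) = \<mu> w s (tail G e2)}"

end

locale st_layered = digraph G
  for G :: "('a, 'b) pre_digraph" (structure) +
  fixes w :: "'b weight_fun" and s t :: 'a
  assumes weight_pos: "e \<in> arcs G \<Longrightarrow> w e > 0"
    and s_in_verts: "s \<in> verts G"
    and t_in_verts: "t \<in> verts G"
    and dist_finite: "\<mu> w s t < \<infinity>"
    and on_shortest_path: "u \<in> verts G \<Longrightarrow> \<mu> w s u + \<mu> w u t = \<mu> w s t"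
    and dist_ends_neq: "e \<in> arcs G \<Longrightarrow> \<mu> w s (tail G e) \<noteq> \<mu> w s (head G e)"
    and no_vertex_between:
      "\<lbrakk> e \<in> arcs G; \<mu> w s (tail G e) < \<mu> w s (head G e); x \<in> verts G \<rbrakk> \<Longrightarrow>
         \<mu> w s x \<le> \<mu> w s (tail G e) \<or> \<mu> w s x \<ge> \<mu> w s (tail G e) + ereal (w e)"


section \<open>Random access machine\<close>

text \<open>
  A unit-cost random access machine with two kinds of memory cells, one for natural numbers (also
  used as addresses) and one for real numbers. Both memories are split into arrays of unbounded
  length; a program mentions only finitely many of them, each by a fixed name, so this amounts to a
  single linear memory with interleaved arrays. The first argument of \<^emph>\<open>nmem\<close> and \<^emph>\<open>rmem\<close> is the
  array, the second one the index.

  There is no multiplication, and real numbers can only be added, subtracted and compared, in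
  particular neither rounded nor converted to natural numbers. Subtraction of natural numbers is
  truncated. A program is a finite syntax tree and hence independent of the input.
\<close>

record ram_state =
  nmem :: "nat \<Rightarrow> nat \<Rightarrow> nat"
  rmem :: "nat \<Rightarrow> nat \<Rightarrow> real"

datatype nexp = NConst nat | NCell nat nexp | NAdd nexp nexp | NSub nexp nexp

datatype rexp = RZero | RCell nat nexp | RAdd rexp rexp | RSub rexp rexp

datatype bexp = NLess nexp nexp | RLess rexp rexp | BNot bexp | BAnd bexp bexp

datatype com =
    Skip
  | NStore nat nexp nexp  \<comment> \<open>array, index, value\<close>
  | RStore nat nexp rexp  \<comment> \<open>array, index, value\<close>
  | Seq com com
  | IfThenElse bexp com com
  | While bexp com

primrec nval :: "nexp \<Rightarrow> ram_state \<Rightarrow> nat" where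
  "nval (NConst k) \<sigma> = k"
| "nval (NCell a i) \<sigma> = nmem \<sigma> a (nval i \<sigma>)"
| "nval (NAdd x y) \<sigma> = nval x \<sigma> + nval y \<sigma>"
| "nval (NSub x y) \<sigma> = nval x \<sigma> - nval y \<sigma>"

primrec rval :: "rexp \<Rightarrow> ram_state \<Rightarrow> real" where
  "rval RZero \<sigma> = 0"
| "rval (RCell a i) \<sigma> = rmem \<sigma> a (nval i \<sigma>)"
| "rval (RAdd x y) \<sigma> = rval x \<sigma> + rval y \<sigma>"
| "rval (RSub x y) \<sigma> = rval x \<sigma> - rval y \<sigma>"

primrec bval :: "bexp \<Rightarrow> ram_state \<Rightarrow> bool" where
  "bval (NLess x y) \<sigma> \<longleftrightarrow> nval x \<sigma> < nval y \<sigma>"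
| "bval (RLess x y) \<sigma> \<longleftrightarrow> rval x \<sigma> < rval y \<sigma>"
| "bval (BNot b) \<sigma> \<longleftrightarrow> \<not> bval b \<sigma>"
| "bval (BAnd b c) \<sigma> \<longleftrightarrow> bval b \<sigma> \<and> bval c \<sigma>"

text \<open>Evaluating an expression takes one step per node of its syntax tree.\<close>

primrec ncost :: "nexp \<Rightarrow> nat" where
  "ncost (NConst k) = 1"
| "ncost (NCell a i) = 1 + ncost i"
| "ncost (NAdd x y) = 1 + ncost x + ncost y"
| "ncost (NSub x y) = 1 + ncost x + ncost y"

primrec rcost :: "rexp \<Rightarrow> nat" where
  "rcost RZero = 1"
| "rcost (RCell a i) = 1 + ncost i"
| "rcost (RAdd x y) = 1 + rcost x + rcost y"
| "rcost (RSub x y) = 1 + rcost x + rcost y"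

primrec bcost :: "bexp \<Rightarrow> nat" where
  "bcost (NLess x y) = 1 + ncost x + ncost y"
| "bcost (RLess x y) = 1 + rcost x + rcost y"
| "bcost (BNot b) = 1 + bcost b"
| "bcost (BAnd b c) = 1 + bcost b + bcost c"

text \<open>\<^emph>\<open>exec c \<sigma> k \<sigma>'\<close>: started in \<^emph>\<open>\<sigma>\<close>, the program \<^emph>\<open>c\<close> halts in \<^emph>\<open>\<sigma>'\<close> after \<^emph>\<open>k\<close> steps.\<close>

inductive exec :: "com \<Rightarrow> ram_state \<Rightarrow> nat \<Rightarrow> ram_state \<Rightarrow> bool" where
  Skip: "exec Skip \<sigma> 1 \<sigma>"
| NStore: "exec (NStore a i x) \<sigma> (1 + ncost i + ncost x)
    (\<sigma>\<lparr>nmem := (nmem \<sigma>)(a := (nmem \<sigma> a)(nval i \<sigma> := nval x \<sigma>))\<rparr>)"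
| RStore: "exec (RStore a i x) \<sigma> (1 + ncost i + rcost x)
    (\<sigma>\<lparr>rmem := (rmem \<sigma>)(a := (rmem \<sigma> a)(nval i \<sigma> := rval x \<sigma>))\<rparr>)"
| Seq: "\<lbrakk> exec c1 \<sigma> k1 \<sigma>1; exec c2 \<sigma>1 k2 \<sigma>2 \<rbrakk> \<Longrightarrow> exec (Seq c1 c2) \<sigma> (k1 + k2) \<sigma>2"
| IfTrue: "\<lbrakk> bval b \<sigma>; exec c1 \<sigma> k \<sigma>' \<rbrakk> \<Longrightarrow>
    exec (IfThenElse b c1 c2) \<sigma> (1 + bcost b + k) \<sigma>'"
| IfFalse: "\<lbrakk> \<not> bval b \<sigma>; exec c2 \<sigma> k \<sigma>' \<rbrakk> \<Longrightarrow>
    exec (IfThenElse b c1 c2) \<sigma> (1 + bcost b + k) \<sigma>'"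
| WhileFalse: "\<not> bval b \<sigma> \<Longrightarrow> exec (While b c) \<sigma> (1 + bcost b) \<sigma>"
| WhileTrue: "\<lbrakk> bval b \<sigma>; exec c \<sigma> k1 \<sigma>1; exec (While b c) \<sigma>1 k2 \<sigma>2 \<rbrakk> \<Longrightarrow>
    exec (While b c) \<sigma> (1 + bcost b + k1 + k2) \<sigma>2"

inductive_cases exec_elims:
  "exec Skip \<sigma> k \<sigma>'"
  "exec (NStore a i x) \<sigma> k \<sigma>'"
  "exec (RStore a i y) \<sigma> k \<sigma>'"
  "exec (Seq c1 c2) \<sigma> k \<sigma>'"
  "exec (IfThenElse b c1 c2) \<sigma> k \<sigma>'"
inductive_cases exec_WhileE: "exec (While b c) \<sigma> k \<sigma>'"

lemma exec_deterministic:
  "exec c \<sigma> k \<sigma>' \<Longrightarrow> exec c \<sigma> l \<sigma>'' \<Longrightarrow> k = l \<and> \<sigma>' = \<sigma>''"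
proof (induction arbitrary: l \<sigma>'' rule: exec.induct)
  case (WhileFalse b \<sigma> c)
  from WhileFalse.prems WhileFalse.hyps show ?case by (auto elim: exec_WhileE)
next
  case (WhileTrue b \<sigma> c k1 \<sigma>1 k2 \<sigma>2)
  from WhileTrue.prems WhileTrue.hyps(1) obtain l1 \<tau> l2
    where "exec c \<sigma> l1 \<tau>" "exec (While b c) \<tau> l2 \<sigma>''" "l = 1 + bcost b + l1 + l2"
    by (auto elim: exec_WhileE)
  with WhileTrue.IH show ?case by blast
next
  case (Seq c1 \<sigma> k1 \<sigma>1 c2 k2 \<sigma>2)
  from Seq.prems obtain l1 \<tau> l2
    where "exec c1 \<sigma> l1 \<tau>" "exec c2 \<tau> l2 \<sigma>''" "l = l1 + l2"
    by (auto elim: exec_elims(4))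
  with Seq.IH show ?case by blast
next
  case (IfTrue b \<sigma> c1 k \<sigma>' c2)
  from IfTrue.prems IfTrue.hyps(1) obtain l1
    where "exec c1 \<sigma> l1 \<sigma>''" "l = 1 + bcost b + l1"
    by (auto elim: exec_elims(5))
  with IfTrue.IH show ?case by blast
next
  case (IfFalse b \<sigma> c2 k \<sigma>' c1)
  from IfFalse.prems IfFalse.hyps(1) obtain l1
    where "exec c2 \<sigma> l1 \<sigma>''" "l = 1 + bcost b + l1"
    by (auto elim: exec_elims(5))
  with IfFalse.IH show ?case by blast
qed (auto elim: exec_elims(1-3))


section \<open>Input and output\<close>

text \<open>
  An input graph has vertices \<^emph>\<open>0, \<dots>, n - 1\<close> and arcs \<^emph>\<open>0, \<dots>, m - 1\<close>. It is passed as the list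
  of its arcs, in arbitrary order: array 0 contains \<^emph>\<open>n, m, s, t\<close>, arrays 1 and 2 contain the tails
  and heads of the arcs, real array 0 contains their weights. All other cells are 0.
\<close>

definition numbered :: "(nat, nat) pre_digraph \<Rightarrow> bool" where
  "numbered G \<longleftrightarrow> verts G = {..<card (verts G)} \<and> arcs G = {..<card (arcs G)}"

definition input_state ::
  "(nat, nat) pre_digraph \<Rightarrow> nat weight_fun \<Rightarrow> nat \<Rightarrow> nat \<Rightarrow> ram_state" where
  "input_state G w s t = \<lparr>
     nmem = (\<lambda>_ _. 0)(
       0 := (\<lambda>_. 0)(0 := card (verts G), 1 := card (arcs G), 2 := s, 3 := t),
       1 := (\<lambda>e. if e < card (arcs G) then tail G e else 0),
       2 := (\<lambda>e. if e < card (arcs G) then head G e else 0)),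
     rmem = (\<lambda>_ _. 0)(
       0 := (\<lambda>e. if e < card (arcs G) then w e else 0)) \<rparr>"

text \<open>
  Cell 0 of array 3 tells whether a path is output (nonzero) or none is reported to exist (zero).
  In the former case cell 1 of array 3 is the number of arcs of the path, and array 4 lists these
  arcs from the first to the last.
\<close>

definition ram_output :: "ram_state \<Rightarrow> nat awalk option" where
  "ram_output \<sigma> = (if nmem \<sigma> 3 0 = 0 then None else Some (map (nmem \<sigma> 4) [0..<nmem \<sigma> 3 1]))"

definition correct_output ::
  "(nat, nat) pre_digraph \<Rightarrow> nat weight_fun \<Rightarrow> nat \<Rightarrow> nat \<Rightarrow> nat awalk option \<Rightarrow> bool" where
  "correct_output G w s t r \<longleftrightarrow> (case r of
      None \<Rightarrow> \<not> (\<exists>p. wf_digraph.next_to_shortest G w s t p)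
    | Some p \<Rightarrow> wf_digraph.next_to_shortest G w s t p)"

text \<open>
  The function inside the O. If there is no back-edge, the product is 0, which cannot bound the
  running time of any program; in this degenerate case it is replaced by the size of the input.
\<close>

definition time_bound ::
  "(nat, nat) pre_digraph \<Rightarrow> nat weight_fun \<Rightarrow> nat \<Rightarrow> real" where
  "time_bound G w s =
     (let n = real (card (verts G)); m = real (card (arcs G)) in
      if wf_digraph.V_B G w s = {} then n + m
      else real (card (wf_digraph.V_B G w s)) ^ 2 * real (card (wf_digraph.E_FP G w s))
           * (m + n * log 2 n))"

end

theory Submission
  imports Defs
begin

text \<open>
  Let \<open>d v\<close> be the distance from \<open>s\<close>. The excess \<open>w e + d (src e) - d (dst e)\<close> of an arc is 0 on
  forward arcs and positive on back arcs, and a next-to-shortest path is a simple path from \<open>s\<close>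
  to \<open>t\<close> of least positive excess. Split an optimal path into a forward path \<open>A\<close> from \<open>s\<close> to the
  tail \<open>x\<close> of the first back arc, a middle part \<open>M\<close> from \<open>x\<close> to the head \<open>y\<close> of the last back
  arc, and a forward path \<open>B\<close> from \<open>y\<close> to \<open>t\<close>. Let \<open>p\<close> be the lowest vertex of \<open>A\<close> reachable by
  forward arcs from the interior of \<open>M\<close> (or \<open>x\<close>), and let \<open>e1\<close> and \<open>e2\<close> be the arcs of \<open>A\<close> and
  \<open>B\<close> entering the level of \<open>p\<close>. An exchange argument shows that \<open>M\<close> avoids the ancestors of the
  tail of \<open>e1\<close>, the vertex \<open>p\<close>, and \<open>Bh\<close> for \<^emph>\<open>every\<close> choice of disjoint forward paths \<open>Ah\<close> from
  \<open>p\<close> to \<open>x\<close> and \<open>Bh\<close> from the head of \<open>e2\<close> to \<open>t\<close>.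

  So for all \<open>x\<close>, \<open>e1\<close>, \<open>e2\<close> it suffices to fix one such pair, to remove these vertices, and to
  compute shortest paths from \<open>x\<close> to the back arcs whose head \<open>y\<close> can be completed by disjoint
  forward paths from \<open>s\<close> to the tail of \<open>e1\<close> and from \<open>y\<close> to the tail of \<open>e2\<close>. Conversely, a
  candidate that is not a simple path can be shortcut to a cheaper path, so the cheapest
  candidate is a next-to-shortest path.
\<close>

section \<open>Paths in layered graphs\<close>

locale layered_arcs =
  fixes n m :: nat and src dst :: "nat \<Rightarrow> nat" and w :: "nat \<Rightarrow> real"
    and s t :: nat and d :: "nat \<Rightarrow> real"
  assumes src_less: "e < m \<Longrightarrow> src e < n" and dst_less: "e < m \<Longrightarrow> dst e < n"
    and weight_pos: "e < m \<Longrightarrow> 0 < w e"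
    and s_less: "s < n" and t_less: "t < n"
    and level_neq: "e < m \<Longrightarrow> d (src e) \<noteq> d (dst e)"
    and tight: "e < m \<Longrightarrow> d (src e) < d (dst e) \<Longrightarrow> d (dst e) = d (src e) + w e"
    and no_level_between:
      "e < m \<Longrightarrow> d (src e) < d (dst e) \<Longrightarrow> v < n \<Longrightarrow> d v \<le> d (src e) \<or> d (dst e) \<le> d v"
    and reachable_from_s: "v < n \<Longrightarrow> (s, v) \<in> {(src e, dst e) | e. e < m \<and> d (src e) < d (dst e)}\<^sup>*"
    and reaches_t: "v < n \<Longrightarrow> (v, t) \<in> {(src e, dst e) | e. e < m \<and> d (src e) < d (dst e)}\<^sup>*"
begin

lemma reversed: "layered_arcs n m dst src w t s (\<lambda>v. - d v)"
proof -
  have converse: "{(dst e, src e) | e. e < m \<and> - d (dst e) < - d (src e)}\<^sup>* =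
    ({(src e, dst e) | e. e < m \<and> d (src e) < d (dst e)}\<^sup>*)\<inverse>"
    unfolding rtrancl_converse[symmetric] by (rule arg_cong[where f = rtrancl]) auto
  show ?thesis
  proof (unfold_locales, unfold converse,
      goal_cases tail head weight source sink levels gap between from_source to_sink)
    case (gap e)
    then show ?case using tight[of e] by simp
  next
    case (between e v)
    then show ?case using no_level_between[of e v] by auto
  qed (use src_less dst_less weight_pos s_less t_less level_neq[symmetric] reachable_from_s reaches_t
    in auto)
qed

definition forward :: "nat \<Rightarrow> bool" where
  "forward e \<longleftrightarrow> e < m \<and> d (src e) < d (dst e)"

definition excess :: "nat \<Rightarrow> real" where
  "excess e = w e + d (src e) - d (dst e)"

lemma forwardD:
  assumes "forward e"
  shows "e < m" "d (src e) < d (dst e)" "src e < n" "dst e < n"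
  using assms src_less dst_less by (auto simp: forward_def)

lemma excess_forward: "forward e \<Longrightarrow> excess e = 0"
  using tight[of e] by (auto simp: forward_def excess_def)

lemma excess_back: "e < m \<Longrightarrow> \<not> forward e \<Longrightarrow> 0 < excess e"
  using weight_pos[of e] level_neq[of e] by (auto simp: forward_def excess_def)

lemma excess_nonneg: "e < m \<Longrightarrow> 0 \<le> excess e"
  using excess_forward excess_back by fastforce

lemma back_descends: "e < m \<Longrightarrow> \<not> forward e \<Longrightarrow> d (dst e) < d (src e)"
  using level_neq[of e] by (auto simp: forward_def)

lemma forward_no_level_between: "forward e \<Longrightarrow> v < n \<Longrightarrow> d v \<le> d (src e) \<or> d (dst e) \<le> d v"
  using no_level_between by (auto simp: forward_def)

lemma forward_same_dst_level:
  assumes "forward e" "forward f" "d (src e) = d (src f)"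
  shows "d (dst e) = d (dst f)"
  using assms forward_no_level_between[of e "dst f"] forward_no_level_between[of f "dst e"]
    forwardD[of e] forwardD[of f] by auto

text \<open>
  Paths are represented by their vertex sets, which is all that matters for splicing:
  \<open>path_in F a S b k\<close> is a simple path from \<open>a\<close> to \<open>b\<close> with arcs in \<open>F\<close>, vertex set \<open>S\<close> and
  total excess \<open>k\<close>. Its weight is \<open>k + d b - d a\<close>.
\<close>

inductive path_in :: "nat set \<Rightarrow> nat \<Rightarrow> nat set \<Rightarrow> nat \<Rightarrow> real \<Rightarrow> bool" for F where
  nil: "a < n \<Longrightarrow> path_in F a {a} a 0"
| cons: "e \<in> F \<Longrightarrow> e < m \<Longrightarrow> path_in F (dst e) S b k \<Longrightarrow> src e \<notin> S \<Longrightarrow>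
    path_in F (src e) (insert (src e) S) b (excess e + k)"

abbreviation path :: "nat \<Rightarrow> nat set \<Rightarrow> nat \<Rightarrow> real \<Rightarrow> bool" where
  "path \<equiv> path_in UNIV"

abbreviation forward_path :: "nat \<Rightarrow> nat set \<Rightarrow> nat \<Rightarrow> bool" where
  "forward_path a S b \<equiv> path a S b 0"

lemma path_inD:
  assumes "path_in F a S b k"
  shows "a < n" "b < n" "S \<subseteq> {..<n}" "finite S" "a \<in> S" "b \<in> S" "0 \<le> k"
  using assms by (induction rule: path_in.induct) (auto simp: src_less excess_nonneg)

lemma path_in_cong:
  assumes "path_in F a S b k" "\<And>e. e \<in> F \<Longrightarrow> e < m \<Longrightarrow> src e \<in> S - {b} \<Longrightarrow> dst e \<in> S - {a} \<Longrightarrow> e \<in> F'"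
  shows "path_in F' a S b k"
  using assms
proof (induction rule: path_in.induct)
  case (cons e S b k)
  note ends = path_inD[OF cons.hyps(3)]
  then have "e \<in> F'" using cons by auto
  moreover have "path_in F' (dst e) S b k" using cons by auto
  ultimately show ?case using cons.hyps by (intro path_in.cons)
qed (rule path_in.nil)

lemma path_in_append:
  assumes "path_in F a S b k" "path_in F b T c l" "S \<inter> T \<subseteq> {b}"
  shows "path_in F a (S \<union> T) c (k + l)"
  using assms
proof (induction rule: path_in.induct)
  case (nil a)
  then show ?case using path_inD[OF nil.prems(1)] by (simp add: insert_absorb)
next
  case (cons e S b k)
  then have "path_in F (src e) (insert (src e) (S \<union> T)) c (excess e + (k + l))"
    using path_inD[OF cons.hyps(3)] by (intro path_in.cons) auto
  then show ?case by (simp add: add.assoc)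
qed

lemma path_in_join:
  assumes "path_in F a S (src e) k" "e \<in> F" "e < m" "path_in F (dst e) T c l" "S \<inter> T = {}"
  shows "path_in F a (S \<union> T) c (k + (excess e + l))"
proof -
  have "src e \<in> S" using path_inD[OF assms(1)] by blast
  moreover from this have "path_in F (src e) (insert (src e) T) c (excess e + l)"
    using path_in.cons assms by blast
  then have "path_in F a (S \<union> insert (src e) T) c (k + (excess e + l))"
    using path_in_append[OF assms(1)] assms(5) by blast
  ultimately show ?thesis by (simp add: insert_absorb)
qed

lemma path_in_snoc:
  assumes "path_in F a S (src e) k" "e \<in> F" "e < m" "dst e \<notin> S"
  shows "path_in F a (insert (dst e) S) (dst e) (k + excess e)"
  using path_in_join[OF assms(1-3) path_in.nil] assms(3,4) dst_less by auto

lemma path_in_reversed: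
  "path_in F a S b k \<Longrightarrow> layered_arcs.path_in n m dst src w (\<lambda>v. - d v) F b S a k"
proof (induction rule: path_in.induct)
  interpret rev: layered_arcs n m dst src w t s "\<lambda>v. - d v" by (rule reversed)
  case (nil a)
  then show ?case by (rule rev.path_in.nil)
next
  interpret rev: layered_arcs n m dst src w t s "\<lambda>v. - d v" by (rule reversed)
  case (cons e S b k)
  have "rev.excess e = excess e" by (simp add: rev.excess_def excess_def)
  then show ?case using rev.path_in_snoc[of F b S e k] cons by (simp add: add.commute)
qed

lemma reversed_rewrites:
  "layered_arcs.forward m dst src (\<lambda>v. - d v) = forward"
  "layered_arcs.excess dst src w (\<lambda>v. - d v) = excess"
  "layered_arcs.path_in n m dst src w (\<lambda>v. - d v) F b S a k = path_in F a S b k"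
proof -
  interpret rev: layered_arcs n m dst src w t s "\<lambda>v. - d v" by (rule reversed)
  show "rev.forward = forward" "rev.excess = excess"
    by (auto simp: rev.forward_def forward_def rev.excess_def excess_def)
  show "rev.path_in F b S a k = path_in F a S b k"
    using path_in_reversed rev.path_in_reversed by auto
qed

lemma path_in_loop: "path_in F a S a k \<Longrightarrow> S = {a} \<and> k = 0"
  by (erule path_in.cases) (use path_inD in auto)

lemma path_in_first_meet:
  assumes "path_in F a S b k" "S \<inter> X \<noteq> {}"
  obtains z S1 S2 k1 k2 where "path_in F a S1 z k1" "path_in F z S2 b k2" "S = S1 \<union> S2"
    "S1 \<inter> S2 = {z}" "S1 \<inter> X = {z}" "k = k1 + k2"
  using assms
proof (induction arbitrary: thesis rule: path_in.induct)
  case (nil a)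
  then show ?case using path_in.nil by (intro nil.prems(1)[of "{a}" a 0 "{a}" 0]) auto
next
  case (cons e S b k)
  show ?case
  proof (cases "src e \<in> X")
    case True
    show ?thesis
      by (rule cons.prems(1)[OF path_in.nil path_in.cons]) (use True cons.hyps src_less in auto)
  next
    case False
    then have meets: "S \<inter> X \<noteq> {}" using cons.prems(2) by blast
    obtain z S1 S2 k1 k2 where split: "path_in F (dst e) S1 z k1" "path_in F z S2 b k2"
      "S = S1 \<union> S2" "S1 \<inter> S2 = {z}" "S1 \<inter> X = {z}" "k = k1 + k2"
      using cons.IH[OF _ meets] by blast
    moreover have "path_in F (src e) (insert (src e) S1) z (excess e + k1)"
      using split cons.hyps by (auto intro: path_in.cons)
    moreover have "src e \<notin> S1 \<union> S2" using split(3) cons.hyps(4) by simp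
    ultimately show ?thesis
      using False by (intro cons.prems(1)[of "insert (src e) S1" z "excess e + k1" S2 k2]) auto
  qed
qed

lemma path_in_split:
  assumes "path_in F a S b k" "z \<in> S"
  obtains S1 S2 k1 k2 where "path_in F a S1 z k1" "path_in F z S2 b k2" "S = S1 \<union> S2"
    "S1 \<inter> S2 = {z}" "k = k1 + k2"
proof -
  have "S \<inter> {z} \<noteq> {}" using assms(2) by blast
  then show thesis
  proof (rule path_in_first_meet[OF assms(1)])
    fix z' S1 S2 k1 k2
    assume "path_in F a S1 z' k1" "path_in F z' S2 b k2" "S = S1 \<union> S2" "S1 \<inter> S2 = {z'}"
      "S1 \<inter> {z} = {z'}" "k = k1 + k2"
    moreover from this have "z' = z" by blast
    ultimately show thesis using that by blast
  qed
qed

lemma path_last_back: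
  assumes "path a S b k" "0 < k"
  obtains N e B l where "path a N (src e) l" "e < m" "\<not> forward e" "forward_path (dst e) B b"
    "N \<inter> B = {}" "S = N \<union> B" "k = l + excess e"
  using assms
proof (induction arbitrary: thesis rule: path_in.induct)
  case (cons e S b k)
  have ends: "0 \<le> k" "path (src e) {src e} (src e) 0"
    using path_inD[OF cons.hyps(3)] cons.hyps(2) src_less path_in.nil by auto
  show ?case
  proof (cases "k = 0")
    case True
    then have "\<not> forward e" using cons.prems(2) excess_forward by force
    then show ?thesis using cons.hyps True ends by (intro cons.prems(1)[of "{src e}" e 0 S]) auto
  next
    case False
    then have pos: "0 < k" using ends(1) by simp
    obtain N f B l where f: "path (dst e) N (src f) l" "f < m" "\<not> forward f"
      "forward_path (dst f) B b" "N \<inter> B = {}" "S = N \<union> B" "k = l + excess f"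
      using cons.IH[OF _ pos] by blast
    have walk: "path (src e) (insert (src e) N) (src f) (excess e + l)"
      using f cons.hyps by (auto intro: path_in.cons)
    show ?thesis by (rule cons.prems(1)[OF walk f(2-4)]) (use f cons.hyps(4) in auto)
  qed
qed auto

end

context layered_arcs
begin

interpretation rev: layered_arcs n m dst src w t s "\<lambda>v. - d v"
  rewrites "layered_arcs.forward m dst src (\<lambda>v. - d v) = forward"
    and "layered_arcs.excess dst src w (\<lambda>v. - d v) = excess"
    and "layered_arcs.path_in n m dst src w (\<lambda>v. - d v) F b S a k = path_in F a S b k"
  by (rule reversed) (simp_all only: reversed_rewrites)

lemma forward_same_src_level: "forward e \<Longrightarrow> forward f \<Longrightarrow> d (dst e) = d (dst f) \<Longrightarrow> d (src e) = d (src f)"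
  using rev.forward_same_dst_level[of e f] by simp

lemma path_in_last_meet:
  assumes "path_in F a S b k" "S \<inter> X \<noteq> {}"
  obtains z S1 S2 k1 k2 where "path_in F a S1 z k1" "path_in F z S2 b k2" "S = S1 \<union> S2"
    "S1 \<inter> S2 = {z}" "S2 \<inter> X = {z}" "k = k1 + k2"
proof (rule rev.path_in_first_meet[OF assms])
  fix z S1 S2 k1 k2
  assume "path_in F z S1 b k1" "path_in F a S2 z k2" "S = S1 \<union> S2" "S1 \<inter> S2 = {z}" "S1 \<inter> X = {z}"
    "k = k1 + k2"
  then show thesis by (intro that[of S2 z k2 S1 k1]) auto
qed

lemma path_first_back:
  assumes "path a S b k" "0 < k"
  obtains A e N l where "forward_path a A (src e)" "e < m" "\<not> forward e" "path (dst e) N b l"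
    "A \<inter> N = {}" "S = A \<union> N" "k = excess e + l"
  by (rule rev.path_last_back[OF assms]) (auto intro: that)

lemma forward_path_refl: "a < n \<Longrightarrow> forward_path a {a} a"
  by (rule path_in.nil)

lemma forward_path_cases [consumes 1, case_names nil cons]:
  assumes "forward_path a S b"
  obtains "a < n" "S = {a}" "b = a"
  | e T where "forward e" "src e = a" "S = insert a T" "a \<notin> T" "forward_path (dst e) T b"
  using assms
proof (cases rule: path_in.cases)
  case (cons e T k)
  have "excess e = 0" "k = 0"
    using cons(3) excess_nonneg[OF cons(5)] path_inD(7)[OF cons(6)] by linarith+
  moreover from this have "forward e" using excess_back[OF cons(5)] by force
  ultimately show ?thesis using cons that(2) by blast
qed (use that(1) in auto)

lemma forward_path_induct [consumes 1, case_names nil cons]: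
  assumes "forward_path a S b" "\<And>a. a < n \<Longrightarrow> P a {a} a"
    "\<And>e S b. forward e \<Longrightarrow> src e \<notin> S \<Longrightarrow> forward_path (dst e) S b \<Longrightarrow> P (dst e) S b \<Longrightarrow>
      P (src e) (insert (src e) S) b"
  shows "P a S b"
  using path_inD(4)[OF assms(1)] assms(1)
proof (induction S arbitrary: a rule: finite_psubset_induct)
  case (psubset S)
  from psubset.prems show ?case
  proof (cases rule: forward_path_cases)
    case (cons e T)
    then show ?thesis using psubset.IH[of T] assms(3)[of e T b] by blast
  qed (use assms(2) in simp)
qed

lemma forward_path_levels: "forward_path a S b \<Longrightarrow> v \<in> S \<Longrightarrow> d a \<le> d v \<and> d v \<le> d b"
proof (induction arbitrary: v rule: forward_path_induct)
  case (cons e S b)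
  show ?case
    using cons.IH[OF path_inD(5)[OF cons.hyps(3)]] cons.IH[of v] cons.prems forwardD(2)[OF cons.hyps(1)]
    by auto
qed simp

lemma forward_path_step:
  assumes "forward e" "forward_path (dst e) S b"
  shows "forward_path (src e) (insert (src e) S) b"
proof -
  have "src e \<notin> S" using forward_path_levels[OF assms(2)] forwardD(2)[OF assms(1)] by force
  then show ?thesis using path_in.cons[OF _ _ assms(2)] assms(1) forwardD excess_forward by fastforce
qed

lemma forward_path_inj:
  assumes "forward_path a S b" "u \<in> S" "v \<in> S" "d u = d v"
  shows "u = v"
  using assms
proof (induction rule: forward_path_induct)
  case (cons e S b)
  then show ?case using forward_path_levels[OF cons.hyps(3)] forwardD(2)[OF cons.hyps(1)] by force
qed simp

lemma forward_path_append:
  assumes "forward_path a S b" "forward_path b T c"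
  shows "forward_path a (S \<union> T) c"
proof -
  have "S \<inter> T \<subseteq> {b}"
  proof
    fix v assume v: "v \<in> S \<inter> T"
    then have "d v = d b"
      using forward_path_levels[OF assms(1)] forward_path_levels[OF assms(2)] by fastforce
    then show "v \<in> {b}" using forward_path_inj[OF assms(1)] path_inD(6)[OF assms(1)] v by blast
  qed
  then show ?thesis using path_in_append[OF assms] by simp
qed

lemma forward_path_join:
  assumes "forward_path a S (src e)" "forward e" "forward_path (dst e) T b"
  shows "forward_path a (S \<union> T) b"
  using forward_path_append[OF assms(1) forward_path_step[OF assms(2,3)]] path_inD(6)[OF assms(1)]
  by (simp add: insert_absorb)

lemma forward_path_same_level:
  assumes "forward_path a S b" "d a = d b"
  shows "a = b" "S = {a}"
proof -
  show "a = b" using forward_path_inj[OF assms(1)] path_inD[OF assms(1)] assms(2) by blast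
  then show "S = {a}" using path_in_loop assms(1) by blast
qed

lemma path_descending_pos:
  assumes "path a S b k" "d b \<le> d a" "a \<noteq> b"
  shows "0 < k"
proof -
  have "k \<noteq> 0"
  proof
    assume "k = 0"
    then have "forward_path a S b" using assms(1) by simp
    moreover from this have "d a \<le> d b" using forward_path_levels path_inD(5) by blast
    ultimately show False using forward_path_same_level(1) assms(2,3) by force
  qed
  then show ?thesis using path_inD(7)[OF assms(1)] by linarith
qed

abbreviation below :: "nat set \<Rightarrow> nat \<Rightarrow> nat set" where
  "below S z \<equiv> {v \<in> S. d v \<le> d z}"

abbreviation above :: "nat set \<Rightarrow> nat \<Rightarrow> nat set" where
  "above S z \<equiv> {v \<in> S. d z \<le> d v}"

lemma forward_path_above: "forward_path a S b \<Longrightarrow> z \<in> S \<Longrightarrow> forward_path z (above S z) b"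
proof (induction rule: forward_path_induct)
  case (nil a)
  then show ?case by (auto intro: forward_path_refl simp: Collect_conv_if)
next
  case (cons e S b)
  have higher: "d (src e) < d v" if "v \<in> S" for v
    using forward_path_levels[OF cons.hyps(3) that] forwardD(2)[OF cons.hyps(1)] by simp
  show ?case
  proof (cases "z = src e")
    case True
    then have "above (insert (src e) S) z = insert (src e) S" using higher by force
    then show ?thesis using cons.hyps True forward_path_step by simp
  next
    case False
    then have "above (insert (src e) S) z = above S z" using higher cons.prems by force
    then show ?thesis using cons False by simp
  qed
qed

lemma forward_path_hits_level:
  "forward_path a S b \<Longrightarrow> v < n \<Longrightarrow> d a \<le> d v \<Longrightarrow> d v \<le> d b \<Longrightarrow> \<exists>u\<in>S. d u = d v"
proof (induction rule: forward_path_induct)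
  case (cons e S b)
  then show ?case using forward_no_level_between[OF cons.hyps(1) cons.prems(1)] by force
qed simp

lemma forward_path_arc_into:
  "forward_path a S b \<Longrightarrow> z \<in> S \<Longrightarrow> z \<noteq> a \<Longrightarrow> \<exists>e. forward e \<and> src e \<in> S \<and> dst e = z"
proof (induction rule: forward_path_induct)
  case (cons e S b)
  then show ?case by (cases "z = dst e") auto
qed simp

lemma rtrancl_forward_path:
  assumes "(a, b) \<in> {(src e, dst e) | e. e < m \<and> d (src e) < d (dst e)}\<^sup>*" "b < n"
  shows "\<exists>S. forward_path a S b"
  using assms
proof (induction rule: converse_rtrancl_induct)
  case base
  then show ?case using forward_path_refl by blast
next
  case (step y z)
  then obtain e S where "y = src e" "z = dst e" "forward e" "forward_path z S b"
    by (auto simp: forward_def)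
  then show ?case using forward_path_step by blast
qed

lemma ex_forward_path_from_s: "v < n \<Longrightarrow> \<exists>S. forward_path s S v"
  using rtrancl_forward_path reachable_from_s by blast

lemma ex_forward_path_to_t: "v < n \<Longrightarrow> \<exists>S. forward_path v S t"
  using rtrancl_forward_path reaches_t t_less by blast

lemma level_ge_s: "v < n \<Longrightarrow> d s \<le> d v"
  using ex_forward_path_from_s forward_path_levels path_inD(6) by blast

definition lowest :: "nat set \<Rightarrow> nat" where
  "lowest X = arg_min_on d X"

lemma lowest_in: "finite X \<Longrightarrow> X \<noteq> {} \<Longrightarrow> lowest X \<in> X"
  and lowest_le: "finite X \<Longrightarrow> v \<in> X \<Longrightarrow> d (lowest X) \<le> d v"
  unfolding lowest_def by (auto intro: arg_min_if_finite arg_min_least)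

end

context layered_arcs
begin

interpretation rev: layered_arcs n m dst src w t s "\<lambda>v. - d v"
  rewrites "layered_arcs.forward m dst src (\<lambda>v. - d v) = forward"
    and "layered_arcs.excess dst src w (\<lambda>v. - d v) = excess"
    and "layered_arcs.path_in n m dst src w (\<lambda>v. - d v) F b S a k = path_in F a S b k"
  by (rule reversed) (simp_all only: reversed_rewrites)

lemma forward_path_below: "forward_path a S b \<Longrightarrow> z \<in> S \<Longrightarrow> forward_path a (below S z) z"
  using rev.forward_path_above[of a S b z] by simp

lemma level_le_t: "v < n \<Longrightarrow> d v \<le> d t"
  using rev.level_ge_s[of v] by simp

definition highest :: "nat set \<Rightarrow> nat" where
  "highest X = arg_min_on (\<lambda>v. - d v) X"

lemma highest_in: "finite X \<Longrightarrow> X \<noteq> {} \<Longrightarrow> highest X \<in> X"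
  and highest_ge: "finite X \<Longrightarrow> v \<in> X \<Longrightarrow> d v \<le> d (highest X)"
  using rev.lowest_in[of X] rev.lowest_le[of X v] unfolding highest_def rev.lowest_def by auto

lemma forward_path_segment:
  assumes "forward_path a S b" "u \<in> S" "v \<in> S" "d u \<le> d v"
  shows "forward_path u {z \<in> S. d u \<le> d z \<and> d z \<le> d v} v"
proof -
  have "forward_path u (below (above S u) v) v"
    using forward_path_below[OF forward_path_above[OF assms(1,2)]] assms(3,4) by blast
  moreover have "below (above S u) v = {z \<in> S. d u \<le> d z \<and> d z \<le> d v}" by blast
  ultimately show ?thesis by simp
qed

definition switch :: "nat set \<Rightarrow> nat set \<Rightarrow> nat \<Rightarrow> nat set" where
  "switch S T c = below S c \<union> above T c"

lemma forward_path_switch: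
  assumes "forward_path a S b" "forward_path a' T b'" "c \<in> S" "c \<in> T"
  shows "forward_path a (switch S T c) b'"
  unfolding switch_def
  using forward_path_append[OF forward_path_below[OF assms(1,3)] forward_path_above[OF assms(2,4)]] .

lemma switch_disjoint: "S \<inter> X = {} \<Longrightarrow> above T c \<inter> X = {} \<Longrightarrow> switch S T c \<inter> X = {}"
  unfolding switch_def by blast

definition nonshortest_excess :: "real \<Rightarrow> bool" where
  "nonshortest_excess k \<longleftrightarrow> 0 < k \<and> (\<exists>S. path s S t k)"

lemma nonshortest_excess_detour:
  assumes A: "forward_path s A a'" "a \<in> A" and B: "forward_path b' B t" "b \<in> B" and AB: "A \<inter> B = {}"
    and M: "path a M b k" "M \<inter> A \<subseteq> {a}" "M \<inter> B \<subseteq> {b}" and k: "0 < k"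
  shows "path s (below A a \<union> M \<union> above B b) t k" "nonshortest_excess k"
proof -
  have "path s (below A a \<union> M) b (0 + k)"
    by (rule path_in_append[OF forward_path_below[OF A] M(1)]) (use M(2) in blast)
  then have "path s (below A a \<union> M \<union> above B b) t (0 + k + 0)"
    by (rule path_in_append[OF _ forward_path_above[OF B]]) (use M(3) AB in blast)
  then show "path s (below A a \<union> M \<union> above B b) t k" by simp
  then show "nonshortest_excess k" using k unfolding nonshortest_excess_def by blast
qed

lemma finite_path_excesses: "finite S \<Longrightarrow> finite {k. path a S b k}"
proof (induction S arbitrary: a rule: finite_psubset_induct)
  case (psubset S)
  have "{k. path a S b k} \<subseteq>
    {0} \<union> (\<Union>e\<in>{..<m}. (+) (excess e) ` {k. a \<in> S \<and> path (dst e) (S - {a}) b k})"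
  proof
    fix k assume "k \<in> {k. path a S b k}"
    then have "path a S b k" by simp
    then show "k \<in> {0} \<union> (\<Union>e\<in>{..<m}. (+) (excess e) ` {k. a \<in> S \<and> path (dst e) (S - {a}) b k})"
      by (cases rule: path_in.cases) auto
  qed
  moreover have "finite {k. a \<in> S \<and> path (dst e) (S - {a}) b k}" for e
    using psubset.IH[of "S - {a}"] by (cases "a \<in> S") (auto simp: psubset_eq)
  then have "finite ({0} \<union> (\<Union>e\<in>{..<m}. (+) (excess e) ` {k. a \<in> S \<and> path (dst e) (S - {a}) b k}))"
    by blast
  ultimately show ?case by (rule finite_subset)
qed

lemma least_nonshortest_excess:
  assumes "nonshortest_excess k"
  obtains C where "nonshortest_excess C" "\<And>l. nonshortest_excess l \<Longrightarrow> C \<le> l"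
proof -
  have "{k. nonshortest_excess k} \<subseteq> (\<Union>S\<in>Pow {..<n}. {k. path s S t k})"
    by (auto simp: nonshortest_excess_def dest: path_inD(3))
  moreover have "finite (\<Union>S\<in>Pow {..<n}. {k. path s S t k})"
    by (rule finite_UN_I) (auto intro: finite_path_excesses finite_subset)
  ultimately have "finite {k. nonshortest_excess k}" by (rule finite_subset)
  then show thesis using that[of "Min {k. nonshortest_excess k}"] assms Min_in Min_le by blast
qed

definition low_pair :: "nat \<Rightarrow> nat \<Rightarrow> nat \<Rightarrow> nat set \<Rightarrow> nat set \<Rightarrow> bool" where
  "low_pair y p q A B \<longleftrightarrow> forward_path s A p \<and> forward_path y B q \<and> A \<inter> B = {}"

definition high_pair :: "nat \<Rightarrow> nat \<Rightarrow> nat \<Rightarrow> nat set \<Rightarrow> nat set \<Rightarrow> bool" where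
  "high_pair x p q A B \<longleftrightarrow> forward_path p A x \<and> forward_path q B t \<and> A \<inter> B = {}"

definition ancestors :: "nat \<Rightarrow> nat set" where
  "ancestors p = {v. \<exists>S. forward_path v S p}"

end

section \<open>Soundness: cheapest candidates are simple paths\<close>

locale candidate = layered_arcs +
  fixes e1 e2 x y :: nat and Al Ah Bl Bh M :: "nat set" and k :: real
  assumes e1: "forward e1" and e2: "forward e2" and src_level: "d (src e1) = d (src e2)"
    and low: "low_pair y (src e1) (src e2) Al Bl"
    and high: "high_pair x (dst e1) (dst e2) Ah Bh"
    and middle: "path x M y k"
    and avoids: "(M - {x, y}) \<inter> (Al \<union> {dst e1} \<union> Bh) = {}"
begin

abbreviation "A \<equiv> Al \<union> Ah"
abbreviation "B \<equiv> Bl \<union> Bh"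

lemma Al: "forward_path s Al (src e1)" and Bl: "forward_path y Bl (src e2)"
  and low_disjoint: "Al \<inter> Bl = {}"
  and Ah: "forward_path (dst e1) Ah x" and Bh: "forward_path (dst e2) Bh t"
  and high_disjoint: "Ah \<inter> Bh = {}"
  using low high by (auto simp: low_pair_def high_pair_def)

lemma A_path: "forward_path s A x" and B_path: "forward_path y B t"
  using forward_path_join[OF Al e1 Ah] forward_path_join[OF Bl e2 Bh] by auto

lemma low_level: "v \<in> Al \<union> Bl \<Longrightarrow> d v \<le> d (src e1)"
  using forward_path_levels[OF Al] forward_path_levels[OF Bl] src_level by auto

lemma high_level: "v \<in> Ah \<union> Bh \<Longrightarrow> d (dst e1) \<le> d v"
  using forward_path_levels[OF Ah] forward_path_levels[OF Bh] forward_same_dst_level[OF e1 e2 src_level]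
  by auto

lemma low_high_disjoint: "(Al \<union> Bl) \<inter> (Ah \<union> Bh) = {}"
  using low_level high_level forwardD(2)[OF e1] by (meson disjoint_iff not_le order_less_le_trans)

lemma A_B_disjoint: "A \<inter> B = {}"
  using low_high_disjoint low_disjoint high_disjoint by blast

lemma ends: "x \<in> M" "y \<in> M" "x \<in> Ah" "y \<in> Bl" "dst e1 \<in> Ah" "t \<in> Bh"
  using path_inD(5,6)[OF middle] path_inD(5,6)[OF Ah] path_inD(5)[OF Bl] path_inD(6)[OF Bh] by auto

lemma below_x: "below A x = A" and above_y: "above B y = B"
  using forward_path_levels[OF A_path] forward_path_levels[OF B_path] by blast+

text \<open>
  If the middle part \<open>M\<close> meets the forward parts again, shortcutting at the first vertex of \<open>B\<close>,
  or at the last vertex of \<open>A\<close>, leaves a back arc in place and strictly lowers the excess.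
\<close>

lemma cheaper_if_meets_B:
  assumes "M \<inter> B \<noteq> {y}"
  shows "\<exists>l. nonshortest_excess l \<and> l < k"
proof -
  have "M \<inter> B \<noteq> {}" using ends by blast
  then obtain z M1 M2 k1 k2 where z: "path x M1 z k1" "path z M2 y k2" "M = M1 \<union> M2" "M1 \<inter> M2 = {z}"
    "M1 \<inter> B = {z}" "k = k1 + k2"
    by (rule path_in_first_meet[OF middle])
  have "z \<noteq> y"
  proof
    assume "z = y"
    then have "M2 = {y}" using z(2) path_in_loop by blast
    then have "M = M1" using z(3,4) \<open>z = y\<close> by blast
    then show False using z(5) assms \<open>z = y\<close> by simp
  qed
  moreover have "z \<noteq> x" using z(5) A_B_disjoint ends by blast
  ultimately have zB: "z \<in> Bl" using z(3,5) avoids by blast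
  have k2: "0 < k2"
    using path_descending_pos[OF z(2)] \<open>z \<noteq> y\<close> forward_path_levels[OF Bl zB] by blast
  have "M1 \<inter> A \<noteq> {}" using ends path_inD(5)[OF z(1)] by blast
  then obtain v N1 N2 l1 l2 where v: "path x N1 v l1" "path v N2 z l2" "M1 = N1 \<union> N2"
    "N1 \<inter> N2 = {v}" "N2 \<inter> A = {v}" "k1 = l1 + l2"
    by (rule path_in_last_meet[OF z(1)])
  have "v \<noteq> y" using v(5) A_B_disjoint ends by blast
  then have "v \<in> Ah" using v(3,5) z(3) avoids ends by blast
  then have "d z < d v" using low_level[of z] high_level[of v] forwardD(2)[OF e1] zB by simp
  then have l2: "0 < l2" using path_descending_pos[OF v(2)] by auto
  have "nonshortest_excess l2"
    by (rule nonshortest_excess_detour(2)[OF A_path _ B_path _ A_B_disjoint v(2) _ _ l2])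
      (use v(3,5) z(5) zB in auto)
  moreover have "l2 < k" using v(6) z(6) k2 path_inD(7)[OF v(1)] by linarith
  ultimately show ?thesis by blast
qed

lemma cheaper_if_meets_A:
  assumes "M \<inter> B = {y}" "M \<inter> A \<noteq> {x}"
  shows "\<exists>l. nonshortest_excess l \<and> l < k"
proof -
  have "M \<inter> A \<noteq> {}" using ends by blast
  then obtain z M1 M2 k1 k2 where z: "path x M1 z k1" "path z M2 y k2" "M = M1 \<union> M2" "M1 \<inter> M2 = {z}"
    "M2 \<inter> A = {z}" "k = k1 + k2"
    by (rule path_in_last_meet[OF middle])
  have "z \<noteq> x"
  proof
    assume "z = x"
    then have "M1 = {x}" using z(1) path_in_loop by blast
    then have "M = M2" using z(3,4) \<open>z = x\<close> by blast
    then show False using z(5) assms(2) \<open>z = x\<close> by simp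
  qed
  moreover have "z \<noteq> y" using z(5) A_B_disjoint ends by blast
  ultimately have zA: "z \<in> Ah" using z(3,5) avoids by blast
  have "0 < k1"
    using path_descending_pos[OF z(1)] \<open>z \<noteq> x\<close> forward_path_levels[OF Ah zA] by blast
  moreover have "d y < d z" using low_level[of y] high_level[of z] ends forwardD(2)[OF e1] zA by simp
  then have k2: "0 < k2" using path_descending_pos[OF z(2)] by auto
  have "nonshortest_excess k2"
    by (rule nonshortest_excess_detour(2)[OF A_path _ B_path _ A_B_disjoint z(2) _ _ k2])
      (use assms(1) z(3,5) ends in auto)
  ultimately show ?thesis using z(6) by auto
qed

lemma excess_pos: "0 < k"
  using path_descending_pos[OF middle] low_level[of y] high_level[of x] ends forwardD(2)[OF e1] by force

theorem simple_or_cheaper: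
  obtains (cheaper) l where "nonshortest_excess l" "l < k"
  | (simple) "M \<inter> A = {x}" "M \<inter> B = {y}" "path s (A \<union> M \<union> B) t k"
proof -
  have "path s (A \<union> M \<union> B) t k" if "M \<inter> A = {x}" "M \<inter> B = {y}"
    using nonshortest_excess_detour(1)[OF A_path _ B_path _ A_B_disjoint middle _ _ excess_pos] that ends
    unfolding below_x above_y by blast
  then show thesis using that cheaper_if_meets_A cheaper_if_meets_B by blast
qed

end

section \<open>Completeness: removing vertices keeps an optimal path\<close>

text \<open>
  \<open>N\<close> is the middle part of an optimal path: from the tail \<open>x\<close> of its first back arc to the tail
  of its last back arc \<open>el\<close>.
\<close>

locale optimal_middle = layered_arcs +
  fixes x :: nat and N :: "nat set" and el :: nat and k :: real
  assumes N: "path x N (src el) k" and el: "el < m" "\<not> forward el"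
    and optimal: "nonshortest_excess l \<Longrightarrow> k + excess el \<le> l"
    and starts_back: "N = {x} \<or> (\<exists>e N' k'. e < m \<and> \<not> forward e \<and> src e = x \<and> N = insert x N' \<and> x \<notin> N' \<and>
      path (dst e) N' (src el) k' \<and> k = excess e + k')"
begin

abbreviation "y \<equiv> dst el"

definition middle :: "nat set" where
  "middle = N - {x}"

definition completion :: "nat set \<Rightarrow> nat set \<Rightarrow> bool" where
  "completion A B \<longleftrightarrow> forward_path s A x \<and> forward_path y B t \<and> A \<inter> N = {x} \<and> N \<inter> B = {} \<and> A \<inter> B = {}"

lemma completionD:
  assumes "completion A B"
  shows "forward_path s A x" "forward_path y B t" "A \<inter> N = {x}" "N \<inter> B = {}" "A \<inter> B = {}"
    "A \<inter> middle = {}" "B \<inter> middle = {}"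
  using assms by (auto simp: completion_def middle_def)

lemma disjoint_N_iff: "N \<inter> S = {} \<longleftrightarrow> x \<notin> S \<and> S \<inter> middle = {}"
  and meets_N_in_x_iff: "S \<inter> N = {x} \<longleftrightarrow> x \<in> S \<and> S \<inter> middle = {}"
  using path_inD(5)[OF N] by (auto simp: middle_def)

lemma last_arc_excess: "0 < excess el"
  using excess_back el .

lemma first_meet_pos:
  assumes "N \<inter> X \<noteq> {}" "x \<notin> X"
  obtains z N1 N2 k1 k2 where "path x N1 z k1" "path z N2 (src el) k2" "N = N1 \<union> N2" "N1 \<inter> N2 = {z}"
    "N1 \<inter> X = {z}" "x \<notin> N2" "0 < k1" "k = k1 + k2"
proof -
  have "N \<noteq> {x}" using assms by blast
  then obtain e N' k' where e: "e < m" "\<not> forward e" "src e = x" "N = insert x N'" "x \<notin> N'"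
    "path (dst e) N' (src el) k'" "k = excess e + k'"
    using starts_back by blast
  have "N' \<inter> X \<noteq> {}" using assms e(4) by blast
  then obtain z S1 S2 k1 k2 where z: "path (dst e) S1 z k1" "path z S2 (src el) k2" "N' = S1 \<union> S2"
    "S1 \<inter> S2 = {z}" "S1 \<inter> X = {z}" "k' = k1 + k2"
    by (rule path_in_first_meet[OF e(6)])
  show thesis
  proof (rule that)
    show "path x (insert x S1) z (excess e + k1)" using path_in.cons[of e UNIV S1 z k1] e z by auto
    show "0 < excess e + k1" using excess_back[OF e(1,2)] path_inD(7)[OF z(1)] by linarith
    show "N = insert x S1 \<union> S2" "x \<notin> S2" using e(4,5) z(3) by blast+
    show "insert x S1 \<inter> S2 = {z}" "insert x S1 \<inter> X = {z}" using e(5) z(3-5) assms(2) by blast+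
  qed (use e(7) z in simp_all)
qed

lemma split_at:
  assumes "z \<in> middle"
  obtains N1 N2 k1 k2 where "path x N1 z k1" "path z N2 (src el) k2" "N = N1 \<union> N2" "N1 \<inter> N2 = {z}"
    "N2 \<subseteq> middle" "0 < k1" "k = k1 + k2"
proof (rule first_meet_pos)
  show "N \<inter> {z} \<noteq> {}" "x \<notin> {z}" using assms by (auto simp: middle_def)
  fix z' N1 N2 k1 k2
  assume "path x N1 z' k1" "path z' N2 (src el) k2" "N = N1 \<union> N2" "N1 \<inter> N2 = {z'}" "N1 \<inter> {z} = {z'}"
    "x \<notin> N2" "0 < k1" "k = k1 + k2"
  moreover from this have "z' = z" by blast
  moreover have "N2 \<subseteq> middle" using \<open>N = N1 \<union> N2\<close> \<open>x \<notin> N2\<close> unfolding middle_def by blast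
  ultimately show thesis using that by blast
qed

lemma optimal_detour:
  assumes "forward_path s A a'" "a \<in> A" "forward_path b' B t" "b \<in> B" "A \<inter> B = {}"
    "path a J b l" "J \<inter> A \<subseteq> {a}" "J \<inter> B \<subseteq> {b}" "0 < l"
  shows "k + excess el \<le> l"
  using optimal nonshortest_excess_detour(2)[OF assms] .

lemma optimal_detour_to_last_arc:
  assumes "forward_path s A a'" "a \<in> A" "forward_path y B t" "A \<inter> B = {}"
    "path a J (src el) l" "J \<inter> A \<subseteq> {a}" "J \<inter> B = {}"
  shows "k \<le> l"
proof -
  have yB: "y \<in> B" using path_inD(5)[OF assms(3)] .
  then have J: "path a (insert y J) y (l + excess el)"
    using path_in_snoc[OF assms(5)] assms(7) el(1) by blast
  have "k + excess el \<le> l + excess el"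
    by (rule optimal_detour[OF assms(1-3) yB assms(4) J])
      (use yB assms(4,6,7) last_arc_excess path_inD(7)[OF assms(5)] in auto)
  then show ?thesis by simp
qed

lemma no_link_from_A:
  assumes "completion A B" "forward_path a J z" "a \<in> A" "z \<in> middle" "J \<inter> A = {a}" "J \<inter> middle = {z}"
    "J \<inter> B = {}"
  shows False
proof -
  note AB = completionD[OF assms(1)]
  obtain N1 N2 k1 k2 where z: "path x N1 z k1" "path z N2 (src el) k2" "N = N1 \<union> N2" "N1 \<inter> N2 = {z}"
    "N2 \<subseteq> middle" "0 < k1" "k = k1 + k2"
    by (rule split_at[OF assms(4)])
  have "path a (J \<union> N2) (src el) (0 + k2)"
    by (rule path_in_append[OF assms(2) z(2)]) (use assms(6) z(5) in blast)
  then have "k \<le> 0 + k2"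
    by (rule optimal_detour_to_last_arc[OF AB(1) assms(3) AB(2,5)])
      (use assms(5,7) z(5) AB(6,7) in blast)+
  then show False using z(6,7) by simp
qed

lemma no_link_to_B:
  assumes "completion A B" "forward_path z J b" "b \<in> B" "z \<in> middle" "J \<inter> B = {b}" "J \<inter> middle = {z}"
    "J \<inter> A = {}"
  shows False
proof -
  note AB = completionD[OF assms(1)]
  obtain N1 N2 k1 k2 where z: "path x N1 z k1" "path z N2 (src el) k2" "N = N1 \<union> N2" "N1 \<inter> N2 = {z}"
    "N2 \<subseteq> middle" "0 < k1" "k = k1 + k2"
    by (rule split_at[OF assms(4)])
  have xA: "x \<in> A" using path_inD(6)[OF AB(1)] .
  have N1: "N1 \<subseteq> insert x middle" using z(3) unfolding middle_def by blast
  have "N1 \<inter> J \<subseteq> {z}" using xA N1 assms(6,7) by blast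
  then have "path x (N1 \<union> J) b (k1 + 0)" by (rule path_in_append[OF z(1) assms(2)])
  moreover have "(N1 \<union> J) \<inter> A \<subseteq> {x}" "(N1 \<union> J) \<inter> B \<subseteq> {b}"
    using AB(6,7) N1 xA AB(5) assms(5,7) by blast+
  ultimately have "k + excess el \<le> k1 + 0"
    using optimal_detour[OF AB(1) xA AB(2) assms(3) AB(5)] z(6) by simp
  then show False using z(7) path_inD(7)[OF z(2)] last_arc_excess by simp
qed

lemma path_to_middle_meets_B:
  assumes "completion A B" "forward_path a J z" "a \<in> A" "z \<in> middle"
  shows "J \<inter> B \<noteq> {}"
proof
  assume "J \<inter> B = {}"
  note J = assms(2) path_inD(4-6)[OF assms(2)]
  define a' where "a' = highest (J \<inter> A)"
  have a': "a' \<in> J" "a' \<in> A" "u \<in> J \<Longrightarrow> u \<in> A \<Longrightarrow> d u \<le> d a'" for u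
    using highest_in[of "J \<inter> A"] highest_ge[of "J \<inter> A"] J assms(3) by (auto simp: a'_def)
  define z' where "z' = lowest (above J a' \<inter> middle)"
  have "z \<in> above J a' \<inter> middle" using forward_path_levels[OF assms(2) a'(1)] J assms(4) by blast
  then have z': "z' \<in> J" "d a' \<le> d z'" "z' \<in> middle" "u \<in> J \<Longrightarrow> d a' \<le> d u \<Longrightarrow> u \<in> middle \<Longrightarrow> d z' \<le> d u" for u
    using lowest_in[of "above J a' \<inter> middle"] lowest_le[of "above J a' \<inter> middle"] J(2)
    by (auto simp: z'_def)
  define K where "K = {u \<in> J. d a' \<le> d u \<and> d u \<le> d z'}"
  have K: "forward_path a' K z'" using forward_path_segment[OF J(1) a'(1) z'(1,2)] by (simp add: K_def)
  have "K \<inter> A = {a'}"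
    using a' z'(2) forward_path_inj[OF J(1)] by (auto simp: K_def intro: order_antisym)
  moreover have "K \<inter> middle = {z'}"
    using z' forward_path_inj[OF J(1)] by (auto simp: K_def intro: order_antisym)
  moreover have "K \<inter> B = {}" using \<open>J \<inter> B = {}\<close> by (auto simp: K_def)
  ultimately show False using no_link_from_A[OF assms(1) K a'(2) z'(3)] by blast
qed

lemma path_from_middle_meets_A:
  assumes "completion A B" "forward_path z J b" "b \<in> B" "z \<in> middle"
  shows "\<exists>a \<in> J \<inter> A. \<forall>u \<in> J \<inter> middle. d u < d a"
proof -
  note J = assms(2) path_inD(4-6)[OF assms(2)]
  define z' where "z' = highest (J \<inter> middle)"
  have z': "z' \<in> J" "z' \<in> middle" "u \<in> J \<Longrightarrow> u \<in> middle \<Longrightarrow> d u \<le> d z'" for u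
    using highest_in[of "J \<inter> middle"] highest_ge[of "J \<inter> middle"] J assms(4) by (auto simp: z'_def)
  define b' where "b' = lowest (above J z' \<inter> B)"
  have "b \<in> above J z' \<inter> B" using forward_path_levels[OF assms(2) z'(1)] J assms(3) by blast
  then have b': "b' \<in> J" "d z' \<le> d b'" "b' \<in> B" "u \<in> J \<Longrightarrow> d z' \<le> d u \<Longrightarrow> u \<in> B \<Longrightarrow> d b' \<le> d u" for u
    using lowest_in[of "above J z' \<inter> B"] lowest_le[of "above J z' \<inter> B"] J(2) by (auto simp: b'_def)
  define K where "K = {u \<in> J. d z' \<le> d u \<and> d u \<le> d b'}"
  have K: "forward_path z' K b'" using forward_path_segment[OF J(1) z'(1) b'(1,2)] by (simp add: K_def)
  have "K \<inter> middle = {z'}"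
    using z' b'(2) forward_path_inj[OF J(1)] by (auto simp: K_def intro: order_antisym)
  moreover have "K \<inter> B = {b'}"
    using b' forward_path_inj[OF J(1)] by (auto simp: K_def intro: order_antisym)
  ultimately have "K \<inter> A \<noteq> {}" using no_link_to_B[OF assms(1) K b'(3) z'(2)] by blast
  then obtain a where a: "a \<in> J" "a \<in> A" "d z' \<le> d a" by (auto simp: K_def)
  have "a \<noteq> z'" using completionD(6)[OF assms(1)] a(2) z'(2) by blast
  then have "d z' < d a" using forward_path_inj[OF J(1) z'(1) a(1)] a(3) by fastforce
  then have "\<forall>u \<in> J \<inter> middle. d u < d a" using z'(3) by fastforce
  then show ?thesis using a by blast
qed

lemma middle_above_y:
  assumes "completion A B" "z \<in> middle"
  shows "d y < d z"
proof (rule ccontr)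
  assume "\<not> d y < d z"
  note AB = completionD[OF assms(1)]
  obtain N1 N2 k1 k2 where z: "path x N1 z k1" "path z N2 (src el) k2" "N = N1 \<union> N2" "N1 \<inter> N2 = {z}"
    "N2 \<subseteq> middle" "0 < k1" "k = k1 + k2"
    by (rule split_at[OF assms(2)])
  obtain S where S: "forward_path s S z" using ex_forward_path_from_s path_inD(1)[OF z(2)] by blast
  note zS = path_inD(4,6)[OF S]
  define u where "u = lowest (S \<inter> N2)"
  have u: "u \<in> S" "u \<in> N2" "v \<in> S \<Longrightarrow> v \<in> N2 \<Longrightarrow> d u \<le> d v" for v
    using lowest_in[of "S \<inter> N2"] lowest_le[of "S \<inter> N2"] zS path_inD(5)[OF z(2)] by (auto simp: u_def)
  obtain N3 N4 k3 k4 where N4: "path z N3 u k3" "path u N4 (src el) k4" "N2 = N3 \<union> N4" "k2 = k3 + k4"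
    using path_in_split[OF z(2) u(2)] .
  have "S \<inter> B = {}"
  proof (rule ccontr)
    assume "S \<inter> B \<noteq> {}"
    then obtain a where a: "a \<in> S" "a \<in> B" by blast
    have "d a = d z"
      using forward_path_levels[OF S a(1)] forward_path_levels[OF AB(2) a(2)] \<open>\<not> d y < d z\<close> by simp
    then have "a = z" using forward_path_inj[OF S a(1) zS(2)] by blast
    then show False using a(2) AB(7) assms(2) by blast
  qed
  have "N4 \<inter> below S u \<subseteq> {u}"
  proof
    fix v assume v: "v \<in> N4 \<inter> below S u"
    then have "d u \<le> d v" using u(3) N4(3) by blast
    then show "v \<in> {u}" using forward_path_inj[OF S, of v u] v u(1) by auto
  qed
  then have "k \<le> k4"
    using optimal_detour_to_last_arc[OF forward_path_below[OF S u(1)] _ AB(2) _ N4(2)]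
      u(1) \<open>S \<inter> B = {}\<close> AB(7) N4(3) z(5) by blast
  then show False using z(6,7) N4(4) path_inD(7)[OF N4(1)] by linarith
qed

end

text \<open>
  A completion is split at the arcs \<open>e1\<close> and \<open>e2\<close> entering the level of \<open>dst e1\<close>, the lowest
  vertex of \<open>A0\<close> reachable from the middle part.
\<close>

locale split_completion = optimal_middle +
  fixes A0 B0 :: "nat set" and e1 e2 :: nat
  assumes completion: "completion A0 B0"
    and e1: "forward e1" "src e1 \<in> A0" "dst e1 \<in> A0"
    and e2: "forward e2" "src e2 \<in> B0" "dst e2 \<in> B0"
    and dst_level: "d (dst e1) = d (dst e2)" and y_low: "d y \<le> d (src e2)"
    and not_reached_below: "\<lbrakk>a \<in> A0; z \<in> middle; forward_path z S a\<rbrakk> \<Longrightarrow> d (dst e1) \<le> d a"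
    and reached: "middle \<noteq> {} \<Longrightarrow> \<exists>z\<in>middle. \<exists>S. forward_path z S (dst e1)"
begin

abbreviation "p \<equiv> dst e1"
abbreviation "q \<equiv> dst e2"
abbreviation "Al \<equiv> below A0 (src e1)"
abbreviation "Bl \<equiv> below B0 (src e2)"

lemmas A0_B0 = completionD[OF completion]

lemma Al: "forward_path s Al (src e1)" and Bl: "forward_path y Bl (src e2)"
  using forward_path_below[OF A0_B0(1) e1(2)] forward_path_below[OF A0_B0(2) e2(2)] .

lemma low_lt: "u \<in> Al \<union> Bl \<Longrightarrow> d u < d p"
  using forwardD(2)[OF e1(1)] forwardD(2)[OF e2(1)] dst_level by auto

lemma high_ge: "forward_path p S b \<Longrightarrow> u \<in> S \<Longrightarrow> d p \<le> d u" "forward_path q S b \<Longrightarrow> u \<in> S \<Longrightarrow> d p \<le> d u"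
  using forward_path_levels dst_level by fastforce+

lemma low_high_disjoint:
  assumes "forward_path p S b \<or> forward_path q S b"
  shows "Al \<inter> S = {}" "Bl \<inter> S = {}"
proof -
  have ge: "d p \<le> d u" if "u \<in> S" for u using assms high_ge that by blast
  show "Al \<inter> S = {}" "Bl \<inter> S = {}" using low_lt ge by (meson disjoint_iff UnI1 UnI2 not_le)+
qed

definition free_pair :: "nat set \<Rightarrow> nat set \<Rightarrow> bool" where
  "free_pair A B \<longleftrightarrow> high_pair x p q A B \<and> A \<inter> middle = {} \<and> B \<inter> middle = {}"

lemma free_pairD:
  assumes "free_pair A B"
  shows "forward_path p A x" "forward_path q B t" "A \<inter> B = {}" "A \<inter> middle = {}" "B \<inter> middle = {}"
  using assms by (auto simp: free_pair_def high_pair_def)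

lemma ex_free_pair: "free_pair (above A0 p) (above B0 q)"
  using forward_path_above[OF A0_B0(1) e1(3)] forward_path_above[OF A0_B0(2) e2(3)] A0_B0(5-7)
  unfolding free_pair_def high_pair_def by blast

lemma completion_free_pair:
  assumes "free_pair A B"
  shows "completion (Al \<union> A) (Bl \<union> B)"
proof -
  note AB = free_pairD[OF assms]
  have xA: "x \<in> A" using path_inD(6)[OF AB(1)] .
  have disjoint: "(Al \<union> A) \<inter> (Bl \<union> B) = {}"
    using low_high_disjoint(1)[of B t] low_high_disjoint(2)[of A x] AB(1-3) A0_B0(5) by blast
  have "x \<notin> B0" using A0_B0(4) disjoint_N_iff by blast
  then have "N \<inter> (Bl \<union> B) = {}" "(Al \<union> A) \<inter> N = {x}"
    unfolding disjoint_N_iff meets_N_in_x_iff using A0_B0(6,7) AB(3-5) xA by blast+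
  then show ?thesis
    using forward_path_join[OF Al e1(1) AB(1)] forward_path_join[OF Bl e2(1) AB(2)] disjoint
    by (simp add: completion_def)
qed

lemma link_from_middle:
  assumes "middle \<noteq> {}"
  obtains z J where "z \<in> middle" "forward_path z J p" "J \<inter> middle = {z}" "J \<inter> B0 = {}" "d z < d p"
proof -
  obtain z1 S where S: "z1 \<in> middle" "forward_path z1 S p" using reached[OF assms] by blast
  note zS = path_inD(4,5)[OF S(2)]
  define z where "z = highest (S \<inter> middle)"
  have z: "z \<in> S" "z \<in> middle" "u \<in> S \<Longrightarrow> u \<in> middle \<Longrightarrow> d u \<le> d z" for u
    using highest_in[of "S \<inter> middle"] highest_ge[of "S \<inter> middle"] S(1) zS by (auto simp: z_def)
  define J where "J = above S z"
  have J: "forward_path z J p" unfolding J_def by (rule forward_path_above[OF S(2) z(1)])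
  note zJ = path_inD(5,6)[OF J]
  have "J \<inter> middle = {z}"
    using z zJ(1) forward_path_inj[OF S(2)] unfolding J_def by (auto intro: order_antisym)
  moreover have p: "u = p" if "u \<in> J" "u \<in> A0" for u
  proof -
    have "d p \<le> d u" using not_reached_below[OF that(2) z(2) forward_path_below[OF J that(1)]] .
    then show ?thesis using forward_path_levels[OF J that(1)] forward_path_inj[OF J that(1) zJ(2)]
      by simp
  qed
  have "J \<inter> B0 = {}"
  proof (rule ccontr)
    assume "J \<inter> B0 \<noteq> {}"
    then obtain b where b: "b \<in> J" "b \<in> B0" by blast
    obtain u where u: "u \<in> J" "u \<in> A0" "d u \<le> d b"
      using path_from_middle_meets_A[OF completion forward_path_below[OF J b(1)] b(2) z(2)] by blast
    then have "d b = d p" using p[OF u(1,2)] forward_path_levels[OF J b(1)] by simp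
    then have "b = p" using forward_path_inj[OF J b(1) zJ(2)] by blast
    then show False using b(2) e1(3) A0_B0(5) by blast
  qed
  moreover have "z \<noteq> p" using z(2) e1(3) A0_B0(6) by blast
  then have "d z < d p" using forward_path_levels[OF J zJ(1)] forward_path_inj[OF J zJ] by fastforce
  ultimately show thesis by (intro that[OF z(2) J])
qed

lemma path_to_split:
  obtains S where "forward_path s S (src e2)" "\<forall>u\<in>S. d u < d p" "\<forall>u\<in>S. d u \<le> d y \<or> u \<in> B0"
proof -
  obtain S where S: "forward_path s S y" using ex_forward_path_from_s path_inD(1)[OF Bl] by blast
  show thesis
  proof (rule that[OF forward_path_append[OF S Bl]])
    have "d y < d p" using y_low forwardD(2)[OF e2(1)] dst_level by simp
    then show "\<forall>u \<in> S \<union> Bl. d u < d p" using low_lt forward_path_levels[OF S] by fastforce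
  qed (use forward_path_levels[OF S] in auto)
qed

end

text \<open>
  Suppose that \<open>Bh\<close> meets the middle part. Among all pairs avoiding it, \<open>Au\<close> and \<open>Bu\<close> cross \<open>Ah\<close>
  and \<open>Bh\<close> least often. Following \<open>Bu\<close> up to its last crossing with \<open>Ah\<close> and then \<open>Ah\<close> gives \<open>K\<close>,
  following \<open>Au\<close> up to its last crossing with \<open>Bh\<close> and then \<open>Bh\<close> gives \<open>R\<close>. If they met, a detour
  would save a crossing. Now \<open>K\<close>, a proper part of the middle, and \<open>R\<close> can be joined to a cheaper
  path.
\<close>

locale least_crossing_pair = split_completion +
  fixes Ah Bh Au Bu :: "nat set"
  assumes high: "high_pair x p q Ah Bh" and meets_middle: "Bh \<inter> middle \<noteq> {}"
    and free: "free_pair Au Bu"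
    and least: "free_pair A B \<Longrightarrow> card (Bh \<inter> Au) + card (Ah \<inter> Bu) \<le> card (Bh \<inter> A) + card (Ah \<inter> B)"
begin

lemma Ah: "forward_path p Ah x" and Bh: "forward_path q Bh t" and Ah_Bh: "Ah \<inter> Bh = {}"
  using high by (auto simp: high_pair_def)

lemmas Au_Bu = free_pairD[OF free]
lemmas Au = Au_Bu(1)
lemmas Bu = Au_Bu(2)
lemmas completion' = completion_free_pair[OF free]

lemma finite_Ah: "finite Ah" and finite_Bh: "finite Bh"
  using path_inD(4) Ah Bh by blast+

lemma Ah_meets_middle: "Ah \<inter> middle \<noteq> {}"
proof
  assume Ah_free: "Ah \<inter> middle = {}"
  have xA: "x \<in> Ah" using path_inD(6)[OF Ah] .
  have "N \<inter> Bh \<noteq> {}" "x \<notin> Bh" using meets_middle Ah_Bh xA by (auto simp: middle_def)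
  then obtain z N1 N2 k1 k2 where z: "path x N1 z k1" "path z N2 (src el) k2" "N = N1 \<union> N2"
    "N1 \<inter> N2 = {z}" "N1 \<inter> Bh = {z}" "x \<notin> N2" "0 < k1" "k = k1 + k2"
    by (rule first_meet_pos)
  have "N1 \<subseteq> insert x middle" using z(3) unfolding middle_def by blast
  then have "N1 \<inter> (Al \<union> Ah) \<subseteq> {x}" using Ah_free A0_B0(6) by blast
  moreover have "(Al \<union> Ah) \<inter> Bh = {}" using low_high_disjoint(1) Bh Ah_Bh by blast
  moreover have "z \<in> Bh" "N1 \<inter> Bh \<subseteq> {z}" using z(5) by blast+
  ultimately have "k + excess el \<le> k1"
    using optimal_detour[OF forward_path_join[OF Al e1(1) Ah] _ Bh _ _ z(1) _ _ z(7)] xA by blast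
  then show False using z(8) path_inD(7)[OF z(2)] last_arc_excess by simp
qed

lemma Au_meets_Bh_above:
  assumes "u \<in> Bh" "u \<in> middle"
  shows "\<exists>a \<in> Bh \<inter> Au. d u < d a"
proof -
  have path: "forward_path u (above Bh u) t" using forward_path_above[OF Bh assms(1)] .
  have "t \<in> Bl \<union> Bu" using path_inD(6)[OF Bu] by blast
  then obtain a where "a \<in> above Bh u \<inter> (Al \<union> Au)" "d u < d a"
    using path_from_middle_meets_A[OF completion' path _ assms(2)] path_inD(5)[OF path] assms(2) by blast
  moreover have "Al \<inter> Bh = {}" using low_high_disjoint(1) Bh by blast
  ultimately show ?thesis by blast
qed

lemma Bu_meets_path_to_middle:
  assumes "u \<in> Au" "forward_path u J z" "z \<in> middle"
  shows "J \<inter> Bu \<noteq> {}"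
proof -
  have "J \<inter> (Bl \<union> Bu) \<noteq> {}"
    using path_to_middle_meets_B[OF completion' assms(2) _ assms(3)] assms(1) by blast
  moreover have "J \<inter> Bl = {}"
  proof -
    have "d p \<le> d v" if "v \<in> J" for v
      using high_ge(1)[OF Au assms(1)] forward_path_levels[OF assms(2) that] by simp
    then show ?thesis using low_lt by (meson disjoint_iff UnI2 not_le)
  qed
  ultimately show ?thesis by blast
qed

definition a_last :: nat where "a_last = highest (Bh \<inter> Au)"
definition b_last :: nat where "b_last = highest (Ah \<inter> Bu)"

lemma a_last: "a_last \<in> Bh" "a_last \<in> Au" "u \<in> Bh \<Longrightarrow> u \<in> Au \<Longrightarrow> d u \<le> d a_last"
proof -
  have "Bh \<inter> Au \<noteq> {}" using Au_meets_Bh_above meets_middle by blast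
  then show "a_last \<in> Bh" "a_last \<in> Au" "u \<in> Bh \<Longrightarrow> u \<in> Au \<Longrightarrow> d u \<le> d a_last"
    using highest_in[of "Bh \<inter> Au"] highest_ge[of "Bh \<inter> Au"] finite_Bh by (auto simp: a_last_def)
qed

lemma b_last: "b_last \<in> Ah" "b_last \<in> Bu" "u \<in> Ah \<Longrightarrow> u \<in> Bu \<Longrightarrow> d u \<le> d b_last"
proof -
  obtain z where z: "z \<in> Ah" "z \<in> middle" using Ah_meets_middle by blast
  have "Ah \<inter> Bu \<noteq> {}"
    using Bu_meets_path_to_middle[OF path_inD(5)[OF Au] forward_path_below[OF Ah z(1)] z(2)] by blast
  then show "b_last \<in> Ah" "b_last \<in> Bu" "u \<in> Ah \<Longrightarrow> u \<in> Bu \<Longrightarrow> d u \<le> d b_last"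
    using highest_in[of "Ah \<inter> Bu"] highest_ge[of "Ah \<inter> Bu"] finite_Ah by (auto simp: b_last_def)
qed

lemma Bh_free_above_a_last: "u \<in> Bh \<Longrightarrow> d a_last \<le> d u \<Longrightarrow> u \<notin> middle"
  using Au_meets_Bh_above[of u] a_last(3) by force

lemma no_Ah_Au_between:
  assumes "a \<in> Ah" "a \<in> Au" "d b_last \<le> d a" "d a \<le> d a_last"
  shows False
proof -
  let ?A = "switch Au Ah a"
  have "a \<noteq> a_last" "a \<noteq> b_last" using assms a_last(1) b_last(2) Ah_Bh Au_Bu(3) by blast+
  then have strict: "d b_last < d a" "d a < d a_last"
    using forward_path_inj[OF Ah b_last(1) assms(1)] forward_path_inj[OF Au assms(2) a_last(2)]
      assms(3,4)
    by force+
  have Bu_free: "above Ah a \<inter> Bu = {}" using b_last(3) strict(1) by force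
  have "z \<notin> middle" if "z \<in> above Ah a" for z
  proof
    assume "z \<in> middle"
    then have "below (above Ah a) z \<inter> Bu \<noteq> {}"
      by (rule Bu_meets_path_to_middle[OF assms(2)
        forward_path_below[OF forward_path_above[OF Ah assms(1)] that]])
    then show False using Bu_free by blast
  qed
  then have "above Ah a \<inter> middle = {}" by blast
  then have "free_pair ?A Bu"
    using switch_disjoint[OF Au_Bu(3) Bu_free] switch_disjoint[OF Au_Bu(4)]
      forward_path_switch[OF Au Ah assms(2,1)] Au_Bu(2,5) by (simp add: free_pair_def high_pair_def)
  then have "card (Bh \<inter> Au) \<le> card (Bh \<inter> ?A)" using least[of ?A Bu] by simp
  also have "\<dots> \<le> card (Bh \<inter> Au - {a_last})"
    using finite_Bh strict(2) Ah_Bh by (intro card_mono) (auto simp: switch_def)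
  also have "\<dots> < card (Bh \<inter> Au)" using finite_Bh a_last by (intro card_Diff1_less) auto
  finally show False by simp
qed

lemma no_Bh_Bu_between:
  assumes "b \<in> Bh" "b \<in> Bu" "d a_last \<le> d b" "d b \<le> d b_last"
  shows False
proof -
  let ?B = "switch Bu Bh b"
  have "b \<noteq> a_last" "b \<noteq> b_last" using assms a_last(2) b_last(1) Ah_Bh Au_Bu(3) by blast+
  then have strict: "d a_last < d b" "d b < d b_last"
    using forward_path_inj[OF Bh a_last(1) assms(1)] forward_path_inj[OF Bu assms(2) b_last(2)]
      assms(3,4)
    by force+
  have "above Bh b \<inter> Au = {}" using a_last(3) strict(1) by force
  moreover have "above Bh b \<inter> middle = {}" using Bh_free_above_a_last assms(3) by force
  ultimately have "?B \<inter> Au = {}" "?B \<inter> middle = {}" using switch_disjoint Au_Bu(3,5) by blast+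
  then have "free_pair Au ?B"
    using forward_path_switch[OF Bu Bh assms(2,1)] Au_Bu(1,4)
    by (simp add: free_pair_def high_pair_def Int_commute)
  then have "card (Ah \<inter> Bu) \<le> card (Ah \<inter> ?B)" using least[of Au ?B] by simp
  also have "\<dots> \<le> card (Ah \<inter> Bu - {b_last})"
    using finite_Ah strict(2) Ah_Bh by (intro card_mono) (auto simp: switch_def)
  also have "\<dots> < card (Ah \<inter> Bu)" using finite_Ah b_last by (intro card_Diff1_less) auto
  finally show False by simp
qed

definition K :: "nat set" where "K = switch Bu Ah b_last"
definition R :: "nat set" where "R = switch Au Bh a_last"

lemma K: "forward_path q K x" and R: "forward_path p R t"
  unfolding K_def R_def
  using forward_path_switch[OF Bu Ah b_last(2,1)] forward_path_switch[OF Au Bh a_last(2,1)] .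

lemma K_R_disjoint: "K \<inter> R = {}"
  using no_Ah_Au_between no_Bh_Bu_between Au_Bu(3) Ah_Bh unfolding K_def R_def switch_def by blast

lemma R_middle_disjoint: "R \<inter> middle = {}"
  using Bh_free_above_a_last Au_Bu(4) unfolding R_def switch_def by blast

lemma contradiction: False
proof -
  obtain z J where J: "z \<in> middle" "forward_path z J p" "J \<inter> middle = {z}" "J \<inter> B0 = {}" "d z < d p"
    by (rule link_from_middle) (use meets_middle in blast)
  note J_levels = forward_path_levels[OF J(2)]
  have pR: "p \<in> R" and xK: "x \<in> K" using path_inD(5)[OF R] path_inD(6)[OF K] .
  have level_p: "u = p" if "u \<in> J" "d p \<le> d u" for u
    using forward_path_inj[OF J(2) that(1)] J_levels[OF that(1)] path_inD(6)[OF J(2)] that(2) by simp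
  have JK: "J \<inter> K = {}" using level_p high_ge(2)[OF K] K_R_disjoint pR by blast
  have JR: "J \<inter> R \<subseteq> {p}" using level_p high_ge(1)[OF R] by blast
  obtain N1 N2 k1 k2 where N1: "path x N1 z k1" "path z N2 (src el) k2" "N = N1 \<union> N2" "N1 \<inter> N2 = {z}"
    "N2 \<subseteq> middle" "0 < k1" "k = k1 + k2"
    by (rule split_at[OF J(1)])
  have "N1 \<inter> K \<noteq> {}" using path_inD(5)[OF N1(1)] xK by blast
  then obtain u N3 N4 k3 k4 where u: "path x N3 u k3" "path u N4 z k4" "N1 = N3 \<union> N4" "N3 \<inter> N4 = {u}"
    "N4 \<inter> K = {u}" "k1 = k3 + k4"
    by (rule path_in_last_meet[OF N1(1)])
  have uK: "u \<in> K" using u(5) by blast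
  then have k4: "0 < k4" using path_descending_pos[OF u(2)] high_ge(2)[OF K uK] J(5) by force
  have N4: "N4 \<subseteq> insert x middle" using u(3) N1(3) unfolding middle_def by blast
  obtain S where S: "forward_path s S (src e2)" "\<forall>u\<in>S. d u < d p" "\<forall>u\<in>S. d u \<le> d y \<or> u \<in> B0"
    by (rule path_to_split)
  have SR: "S \<inter> R = {}" and SK: "S \<inter> K = {}" using S(2) high_ge(1)[OF R] high_ge(2)[OF K] by force+
  have "u \<notin> middle" "u \<notin> J" if "u \<in> S" for u
    using S(3) that middle_above_y[OF completion] J_levels[of u] J(1,4) A0_B0(7) by force+
  then have SM: "S \<inter> middle = {}" and SJ: "S \<inter> J = {}" by blast+
  have A: "forward_path s (S \<union> below K u) u"
    using forward_path_join[OF S(1) e2(1) forward_path_below[OF K uK]] .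
  have "N4 \<inter> J \<subseteq> {z}" using J(3) N4 JK xK by blast
  then have "path u (N4 \<union> J) p (k4 + 0)" by (rule path_in_append[OF u(2) J(2)])
  moreover have "(S \<union> below K u) \<inter> R = {}" using SR K_R_disjoint by blast
  moreover have "(N4 \<union> J) \<inter> (S \<union> below K u) \<subseteq> {u}" using SJ SM SK JK N4 xK u(5) by blast
  moreover have "(N4 \<union> J) \<inter> R \<subseteq> {p}" using JR N4 R_middle_disjoint K_R_disjoint xK by blast
  ultimately have "k + excess el \<le> k4 + 0"
    using optimal_detour[OF A path_inD(6)[OF A] R pR] k4 by simp
  then show False
    using u(6) N1(7) path_inD(7)[OF u(1)] path_inD(7)[OF N1(2)] last_arc_excess by linarith
qed

end

context split_completion
begin

lemma high_pair_avoids_middle: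
  assumes high: "high_pair x p q Ah Bh"
  shows "Bh \<inter> middle = {}"
proof (rule ccontr)
  assume meets: "Bh \<inter> middle \<noteq> {}"
  obtain P where P: "case_prod free_pair P"
    and least: "\<And>Q. case_prod free_pair Q \<Longrightarrow>
      card (Bh \<inter> fst P) + card (Ah \<inter> snd P) \<le> card (Bh \<inter> fst Q) + card (Ah \<inter> snd Q)"
    using ex_has_least_nat[of "case_prod free_pair" "(above A0 p, above B0 q)"
        "\<lambda>P. card (Bh \<inter> fst P) + card (Ah \<inter> snd P)"] ex_free_pair by auto
  interpret least_crossing_pair n m src dst w s t d x N el k A0 B0 e1 e2 Ah Bh "fst P" "snd P"
  proof unfold_locales
    show "free_pair (fst P) (snd P)" using P by (simp add: case_prod_unfold)
    show "card (Bh \<inter> fst P) + card (Ah \<inter> snd P) \<le> card (Bh \<inter> A) + card (Ah \<inter> B)"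
      if "free_pair A B" for A B
      using least[of "(A, B)"] that by simp
  qed (fact high meets)+
  show False by (rule contradiction)
qed

end

context layered_arcs
begin

definition completes :: "nat \<Rightarrow> nat \<Rightarrow> nat \<Rightarrow> real \<Rightarrow> bool" where
  "completes x e1 e2 C \<longleftrightarrow>
    (\<exists>N k el Al Bl. path x N (src el) k \<and> el < m \<and> \<not> forward el \<and> C = k + excess el \<and>
    low_pair (dst el) (src e1) (src e2) Al Bl \<and> (N - {x}) \<inter> (ancestors (src e1) \<union> {dst e1}) = {} \<and>
    (\<forall>Ah Bh. high_pair x (dst e1) (dst e2) Ah Bh \<longrightarrow> (N - {x}) \<inter> Bh = {}))"

definition split_arcs :: "nat \<Rightarrow> nat \<Rightarrow> nat \<Rightarrow> bool" where
  "split_arcs x e1 e2 \<longleftrightarrow> forward e1 \<and> forward e2 \<and> d (src e1) = d (src e2) \<and>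
    (\<exists>A B. high_pair x (dst e1) (dst e2) A B)"

end

context optimal_middle
begin

lemma lowest_reached_vertex:
  assumes "completion A B"
  obtains p where "p \<in> A" "d y < d p" "\<forall>a\<in>A. \<forall>z\<in>middle. \<forall>S. forward_path z S a \<longrightarrow> d p \<le> d a"
    "middle \<noteq> {} \<longrightarrow> (\<exists>z\<in>middle. \<exists>S. forward_path z S p)"
proof (cases "middle = {}")
  case True
  then have "x = src el" using path_inD(6)[OF N] by (auto simp: middle_def)
  then show thesis using that[of x] back_descends[OF el] completionD(3)[OF assms] True by blast
next
  case False
  then obtain z where z: "z \<in> middle" by blast
  then have "z < n" using path_inD(3)[OF N] by (auto simp: middle_def)
  then obtain S where S: "forward_path z S t" using ex_forward_path_to_t by blast
  obtain a where a: "a \<in> S" "a \<in> A"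
    using path_from_middle_meets_A[OF assms S path_inD(6)[OF completionD(2)[OF assms]] z] by blast
  define X where "X = {a \<in> A. \<exists>z\<in>middle. \<exists>S. forward_path z S a}"
  have X: "finite X" "X \<noteq> {}"
    using path_inD(4)[OF completionD(1)[OF assms]] a z forward_path_below[OF S a(1)]
    by (auto simp: X_def)
  then obtain z' S' where z': "z' \<in> middle" "forward_path z' S' (lowest X)"
    using lowest_in[OF X] by (auto simp: X_def)
  show thesis
  proof (rule that)
    show "lowest X \<in> A" using lowest_in[OF X] by (simp add: X_def)
    show "d y < d (lowest X)"
      using middle_above_y[OF assms z'(1)] forward_path_levels[OF z'(2)] path_inD(6)[OF z'(2)] by force
    show "\<forall>a\<in>A. \<forall>z\<in>middle. \<forall>S. forward_path z S a \<longrightarrow> d (lowest X) \<le> d a"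
      using lowest_le[OF X(1)] by (auto simp: X_def)
  qed (use z' in blast)
qed

lemma completes_split:
  assumes "completion A B"
  shows "\<exists>e1 e2. split_arcs x e1 e2 \<and> completes x e1 e2 (k + excess el)"
proof -
  note AB = completionD[OF assms]
  obtain p where p: "p \<in> A" "d y < d p" "\<forall>a\<in>A. \<forall>z\<in>middle. \<forall>S. forward_path z S a \<longrightarrow> d p \<le> d a"
    "middle \<noteq> {} \<longrightarrow> (\<exists>z\<in>middle. \<exists>S. forward_path z S p)"
    using lowest_reached_vertex[OF assms] .
  have yp: "y < n" "p < n" using path_inD(1)[OF AB(2)] path_inD(3)[OF AB(1)] p(1) by auto
  have "p \<noteq> s" using level_ge_s[OF yp(1)] p(2) by force
  then obtain e1 where e1: "forward e1" "src e1 \<in> A" "dst e1 = p"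
    using forward_path_arc_into[OF AB(1) p(1)] by blast
  obtain q where q: "q \<in> B" "d q = d p"
    using forward_path_hits_level[OF AB(2) yp(2)] p(2) level_le_t[OF yp(2)] by force
  have "q \<noteq> y" using q p(2) by force
  then obtain e2 where e2: "forward e2" "src e2 \<in> B" "dst e2 = q"
    using forward_path_arc_into[OF AB(2) q(1)] by blast
  have src_level: "d (src e1) = d (src e2)"
    using forward_same_src_level[OF e1(1) e2(1)] e1(3) e2(3) q(2) by simp
  interpret split_completion n m src dst w s t d x N el k A B e1 e2
  proof unfold_locales
    show "d (dst e1) \<le> d a" if "a \<in> A" "z \<in> middle" "forward_path z S a" for a z S
      using p(3) that e1(3) by blast
    show "\<exists>z\<in>middle. \<exists>S. forward_path z S (dst e1)" if "middle \<noteq> {}" using p(4) that e1(3) by blast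
    show "d y \<le> d (src e2)" using forward_path_levels[OF AB(2) e2(2)] by blast
  qed (use assms e1 e2 p(1) q in simp_all)
  have "high_pair x (dst e1) (dst e2) (above A (dst e1)) (above B (dst e2))"
    using ex_free_pair unfolding free_pair_def by blast
  then have "split_arcs x e1 e2" using e1(1) e2(1) src_level unfolding split_arcs_def by blast
  moreover have "completes x e1 e2 (k + excess el)" unfolding completes_def
  proof (intro exI conjI allI impI)
    show "low_pair y (src e1) (src e2) Al Bl" using Al Bl AB(5) unfolding low_pair_def by blast
    have "middle \<inter> ancestors (src e1) = {}"
      using not_reached_below[OF e1(2)] forwardD(2)[OF e1(1)] unfolding ancestors_def by force
    then show "(N - {x}) \<inter> (ancestors (src e1) \<union> {dst e1}) = {}"
      using AB(6) e1(3) p(1) unfolding middle_def by blast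
    show "(N - {x}) \<inter> Bh = {}" if "high_pair x (dst e1) (dst e2) Ah Bh" for Ah Bh
      using high_pair_avoids_middle[OF that] unfolding middle_def by blast
  qed (use N el in auto)
  ultimately show ?thesis by blast
qed

end

context layered_arcs
begin

lemma optimal_decomposition:
  assumes "path s S t C" "0 < C" "\<And>l. nonshortest_excess l \<Longrightarrow> C \<le> l"
  obtains x N el k A B eb where "optimal_middle n m src dst w s t d x N el k" "C = k + excess el"
    "optimal_middle.completion n m src dst w s t d x N el A B" "eb < m" "\<not> forward eb" "src eb = x"
proof -
  note thesis = that
  obtain N0 el B l where last: "path s N0 (src el) l" "el < m" "\<not> forward el" "forward_path (dst el) B t"
    "N0 \<inter> B = {}" "S = N0 \<union> B" "C = l + excess el"
    by (rule path_last_back[OF assms(1,2)])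
  have decompose: thesis
    if middle: "path x N (src el) l" and A: "forward_path s A x" "A \<inter> N = {x}" "N0 = A \<union> N"
      and eb: "eb < m" "\<not> forward eb" "src eb = x"
      and starts_back: "N = {x} \<or> (\<exists>e N' k'. e < m \<and> \<not> forward e \<and> src e = x \<and> N = insert x N' \<and> x \<notin> N' \<and>
        path (dst e) N' (src el) k' \<and> l = excess e + k')"
    for x N A eb
  proof -
    interpret optimal_middle n m src dst w s t d x N el l
      using middle starts_back last(2,3,7) assms(3) by unfold_locales auto
    have "completion A B" using A last(4,5) unfolding completion_def by blast
    then show thesis by (rule thesis[OF optimal_middle_axioms last(7) _ eb])
  qed
  show thesis
  proof (cases "l = 0")
    case True
    have "N0 \<inter> {src el} = {src el}" "N0 = N0 \<union> {src el}" using path_inD(6)[OF last(1)] by blast+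
    then show thesis
      using decompose[OF _ _ _ _ last(2,3)] last(1) path_in.nil[OF src_less[OF last(2)]] True by blast
  next
    case False
    then have "0 < l" using path_inD(7)[OF last(1)] by simp
    then obtain A eb N' k' where eb: "forward_path s A (src eb)" "eb < m" "\<not> forward eb"
      "path (dst eb) N' (src el) k'" "A \<inter> N' = {}" "N0 = A \<union> N'" "l = excess eb + k'"
      by (rule path_first_back[OF last(1)])
    have tail: "src eb \<in> A" "src eb \<notin> N'" using path_inD(6)[OF eb(1)] eb(5) by auto
    have "path (src eb) (insert (src eb) N') (src el) l"
      using path_in.cons[OF _ eb(2,4) tail(2)] eb(7) by simp
    then show thesis
    proof (rule decompose[OF _ eb(1) _ _ eb(2,3)])
      show "A \<inter> insert (src eb) N' = {src eb}" "N0 = A \<union> insert (src eb) N'" using tail eb(5,6) by blast+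
    qed (use eb tail in blast)+
  qed
qed

theorem ex_completing_split:
  assumes "nonshortest_excess C" "\<And>l. nonshortest_excess l \<Longrightarrow> C \<le> l"
  obtains x e1 e2 e where "e < m" "\<not> forward e" "src e = x" "split_arcs x e1 e2" "completes x e1 e2 C"
proof -
  obtain S where S: "path s S t C" "0 < C" using assms(1) by (auto simp: nonshortest_excess_def)
  obtain x N el k A B eb where "optimal_middle n m src dst w s t d x N el k" and C: "C = k + excess el"
    and AB: "optimal_middle.completion n m src dst w s t d x N el A B"
    and eb: "eb < m" "\<not> forward eb" "src eb = x"
    using optimal_decomposition[OF S assms(2)] .
  then interpret optimal_middle n m src dst w s t d x N el k by blast
  show thesis using completes_split[OF AB] that eb unfolding C by blast
qed

end

section \<open>Total correctness with time bounds\<close>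

notation Seq (infixr ";;" 60)
notation NCell ("_\<langle>_\<rangle>" [1000, 0] 999)
notation RCell ("_\<langle>_\<rangle>\<^sub>r" [1000, 0] 999)
notation NStore ("(_\<langle>_\<rangle> ::=/ _)" [1000, 0, 61] 61)
notation RStore ("(_\<langle>_\<rangle>\<^sub>r ::=/ _)" [1000, 0, 61] 61)
notation BAnd (infixr "AND" 35)

abbreviation var :: "nat \<Rightarrow> nexp" where
  "var a \<equiv> a\<langle>NConst 0\<rangle>"

abbreviation assign :: "nat \<Rightarrow> nexp \<Rightarrow> com" ("(_ ::=/ _)" [1000, 61] 61) where
  "a ::= x \<equiv> a\<langle>NConst 0\<rangle> ::= x"

definition Eq :: "nexp \<Rightarrow> nexp \<Rightarrow> bexp" where
  "Eq x y = (BNot (NLess x y) AND BNot (NLess y x))"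

definition Nonzero :: "nexp \<Rightarrow> bexp" where
  "Nonzero x = NLess (NConst 0) x"

definition Or :: "bexp \<Rightarrow> bexp \<Rightarrow> bexp" (infixr "OR" 30) where
  "(b OR c) = BNot (BNot b AND BNot c)"

definition When :: "bexp \<Rightarrow> com \<Rightarrow> com" where
  "When b c = IfThenElse b c Skip"

definition For :: "nat \<Rightarrow> nexp \<Rightarrow> com \<Rightarrow> com" where
  "For a b c = a ::= NConst 0 ;; While (NLess (var a) b) (c ;; a ::= NAdd (var a) (NConst 1))"

lemma bexp_simps [simp]:
  "bval (Eq x y) \<sigma> \<longleftrightarrow> nval x \<sigma> = nval y \<sigma>"
  "bval (Nonzero x) \<sigma> \<longleftrightarrow> nval x \<sigma> \<noteq> 0"
  "bval (b OR c) \<sigma> \<longleftrightarrow> bval b \<sigma> \<or> bval c \<sigma>"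
  "bcost (Eq x y) = 2 * (ncost x + ncost y) + 5"
  "bcost (Nonzero x) = ncost x + 2"
  "bcost (b OR c) = bcost b + bcost c + 4"
  by (auto simp: Eq_def Nonzero_def Or_def)

definition nupd :: "ram_state \<Rightarrow> nat \<Rightarrow> nat \<Rightarrow> nat \<Rightarrow> ram_state" where
  "nupd \<sigma> a i x = \<sigma>\<lparr>nmem := (nmem \<sigma>)(a := (nmem \<sigma> a)(i := x))\<rparr>"

definition rupd :: "ram_state \<Rightarrow> nat \<Rightarrow> nat \<Rightarrow> real \<Rightarrow> ram_state" where
  "rupd \<sigma> a i x = \<sigma>\<lparr>rmem := (rmem \<sigma>)(a := (rmem \<sigma> a)(i := x))\<rparr>"

lemma mem_upd [simp]:
  "nmem (nupd \<sigma> a i x) b = (if b = a then (nmem \<sigma> a)(i := x) else nmem \<sigma> b)"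
  "rmem (nupd \<sigma> a i x) = rmem \<sigma>"
  "nmem (rupd \<sigma> a i y) = nmem \<sigma>"
  "rmem (rupd \<sigma> a i y) b = (if b = a then (rmem \<sigma> a)(i := y) else rmem \<sigma> b)"
  by (auto simp: nupd_def rupd_def)

subsection \<open>Frames\<close>

fun nat_writes :: "com \<Rightarrow> nat set" where
  "nat_writes (NStore a i x) = {a}"
| "nat_writes (Seq c1 c2) = nat_writes c1 \<union> nat_writes c2"
| "nat_writes (IfThenElse b c1 c2) = nat_writes c1 \<union> nat_writes c2"
| "nat_writes (While b c) = nat_writes c"
| "nat_writes _ = {}"

fun real_writes :: "com \<Rightarrow> nat set" where
  "real_writes (RStore a i x) = {a}"
| "real_writes (Seq c1 c2) = real_writes c1 \<union> real_writes c2"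
| "real_writes (IfThenElse b c1 c2) = real_writes c1 \<union> real_writes c2"
| "real_writes (While b c) = real_writes c"
| "real_writes _ = {}"

primrec nat_reads :: "nexp \<Rightarrow> nat set" where
  "nat_reads (NConst k) = {}"
| "nat_reads (NCell a i) = insert a (nat_reads i)"
| "nat_reads (NAdd x y) = nat_reads x \<union> nat_reads y"
| "nat_reads (NSub x y) = nat_reads x \<union> nat_reads y"

lemma writes_simps [simp]:
  "nat_writes (When b c) = nat_writes c" "real_writes (When b c) = real_writes c"
  "nat_writes (For a x c) = insert a (nat_writes c)" "real_writes (For a x c) = real_writes c"
  by (auto simp: When_def For_def)

definition frame :: "com \<Rightarrow> ram_state \<Rightarrow> ram_state \<Rightarrow> bool" where
  "frame c \<sigma> \<tau> \<longleftrightarrow> (\<forall>a. a \<notin> nat_writes c \<longrightarrow> nmem \<tau> a = nmem \<sigma> a) \<and>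
    (\<forall>a. a \<notin> real_writes c \<longrightarrow> rmem \<tau> a = rmem \<sigma> a)"

lemma frameD:
  assumes "frame c \<sigma> \<tau>"
  shows "a \<notin> nat_writes c \<Longrightarrow> nmem \<tau> a = nmem \<sigma> a" "a \<notin> real_writes c \<Longrightarrow> rmem \<tau> a = rmem \<sigma> a"
  using assms by (auto simp: frame_def)

lemma frame_trans:
  "frame c1 \<sigma> \<sigma>' \<Longrightarrow> frame c2 \<sigma>' \<sigma>'' \<Longrightarrow> nat_writes c1 \<union> nat_writes c2 \<subseteq> nat_writes c \<Longrightarrow>
   real_writes c1 \<union> real_writes c2 \<subseteq> real_writes c \<Longrightarrow> frame c \<sigma> \<sigma>''"
  unfolding frame_def by (metis Un_iff subsetD)

lemma exec_frame: "exec c \<sigma> k \<tau> \<Longrightarrow> frame c \<sigma> \<tau>"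
  by (induction rule: exec.induct) (auto simp: frame_def)

lemma nval_cong: "(\<And>a. a \<in> nat_reads x \<Longrightarrow> nmem \<tau> a = nmem \<sigma> a) \<Longrightarrow> nval x \<tau> = nval x \<sigma>"
  by (induction x) auto

subsection \<open>Reaching a state within a number of steps\<close>

definition reaches :: "com \<Rightarrow> ram_state \<Rightarrow> nat \<Rightarrow> ram_state \<Rightarrow> bool" where
  "reaches c \<sigma> k \<tau> \<longleftrightarrow> (\<exists>l\<le>k. exec c \<sigma> l \<tau>)"

definition runs :: "com \<Rightarrow> ram_state \<Rightarrow> (ram_state \<Rightarrow> bool) \<Rightarrow> nat \<Rightarrow> bool" where
  "runs c \<sigma> Q k \<longleftrightarrow> (\<exists>\<tau>. reaches c \<sigma> k \<tau> \<and> Q \<tau>)"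

lemma reaches_exec: "exec c \<sigma> k \<tau> \<Longrightarrow> reaches c \<sigma> k \<tau>"
  unfolding reaches_def by blast

lemma reaches_mono: "reaches c \<sigma> k \<tau> \<Longrightarrow> k \<le> l \<Longrightarrow> reaches c \<sigma> l \<tau>"
  unfolding reaches_def by (meson order_trans)

lemma reaches_frame: "reaches c \<sigma> k \<tau> \<Longrightarrow> frame c \<sigma> \<tau>"
  unfolding reaches_def using exec_frame by blast

lemma reaches_Seq:
  assumes "reaches c1 \<sigma> k1 \<sigma>1" "reaches c2 \<sigma>1 k2 \<sigma>2"
  shows "reaches (c1 ;; c2) \<sigma> (k1 + k2) \<sigma>2"
  using assms exec.Seq unfolding reaches_def by (meson add_mono)

lemma reaches_If:
  assumes "reaches (if bval b \<sigma> then c1 else c2) \<sigma> k \<tau>"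
  shows "reaches (IfThenElse b c1 c2) \<sigma> (1 + bcost b + k) \<tau>"
proof -
  obtain l where "l \<le> k" "exec (if bval b \<sigma> then c1 else c2) \<sigma> l \<tau>"
    using assms unfolding reaches_def by blast
  then show ?thesis unfolding reaches_def
    using exec.IfTrue[of b \<sigma> c1 l \<tau> c2] exec.IfFalse[of b \<sigma> c2 l \<tau> c1]
    by (intro exI[of _ "1 + bcost b + l"]) (auto split: if_splits)
qed

lemma reaches_WhileFalse: "\<not> bval b \<sigma> \<Longrightarrow> reaches (While b c) \<sigma> (1 + bcost b) \<sigma>"
  by (rule reaches_exec) (rule exec.WhileFalse)

lemma reaches_WhileTrue:
  assumes "bval b \<sigma>" "reaches c \<sigma> k1 \<sigma>1" "reaches (While b c) \<sigma>1 k2 \<sigma>2"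
  shows "reaches (While b c) \<sigma> (1 + bcost b + k1 + k2) \<sigma>2"
proof -
  obtain l1 l2 where "l1 \<le> k1" "exec c \<sigma> l1 \<sigma>1" "l2 \<le> k2" "exec (While b c) \<sigma>1 l2 \<sigma>2"
    using assms(2,3) unfolding reaches_def by blast
  then show ?thesis unfolding reaches_def
    using exec.WhileTrue[OF assms(1)] by (intro exI[of _ "1 + bcost b + l1 + l2"]) auto
qed

lemma runsI: "reaches c \<sigma> k \<tau> \<Longrightarrow> Q \<tau> \<Longrightarrow> k \<le> l \<Longrightarrow> runs c \<sigma> Q l"
  unfolding runs_def using reaches_mono by blast

lemma runsE:
  assumes "runs c \<sigma> Q k"
  obtains \<tau> where "reaches c \<sigma> k \<tau>" "frame c \<sigma> \<tau>" "Q \<tau>"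
  using assms reaches_frame unfolding runs_def by blast

lemma runs_conseq:
  assumes "runs c \<sigma> Q k" "\<And>\<tau>. Q \<tau> \<Longrightarrow> frame c \<sigma> \<tau> \<Longrightarrow> R \<tau>" "k \<le> l"
  shows "runs c \<sigma> R l"
proof -
  obtain \<tau> where "reaches c \<sigma> k \<tau>" "frame c \<sigma> \<tau>" "Q \<tau>" using assms(1) by (rule runsE)
  then show ?thesis using runsI assms(2,3) by blast
qed

lemma runs_Seq:
  assumes "runs c1 \<sigma> Q k1" "\<And>\<tau>. Q \<tau> \<Longrightarrow> frame c1 \<sigma> \<tau> \<Longrightarrow> runs c2 \<tau> R k2"
  shows "runs (c1 ;; c2) \<sigma> R (k1 + k2)"
proof -
  obtain \<sigma>1 where first: "reaches c1 \<sigma> k1 \<sigma>1" "frame c1 \<sigma> \<sigma>1" "Q \<sigma>1" using assms(1) by (rule runsE)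
  obtain \<tau> where "reaches c2 \<sigma>1 k2 \<tau>" "R \<tau>" using assms(2)[OF first(3,2)] by (rule runsE)
  then show ?thesis using runsI[OF reaches_Seq[OF first(1)]] by blast
qed

lemma runs_When:
  assumes "bval b \<sigma> \<Longrightarrow> runs c \<sigma> Q k" "\<not> bval b \<sigma> \<Longrightarrow> Q \<sigma>" "2 + bcost b + k \<le> l"
  shows "runs (When b c) \<sigma> Q l"
proof -
  have "reaches Skip \<sigma> (k + 1) \<sigma>" using reaches_mono[OF reaches_exec[OF exec.Skip]] by simp
  moreover obtain \<tau> where "bval b \<sigma> \<Longrightarrow> reaches c \<sigma> k \<tau> \<and> Q \<tau>" using assms(1) runsE by metis
  ultimately have "reaches (if bval b \<sigma> then c else Skip) \<sigma> (k + 1) (if bval b \<sigma> then \<tau> else \<sigma>)"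
    using reaches_mono[of c \<sigma> k \<tau> "k + 1"] by simp
  from reaches_If[OF this] show ?thesis
    unfolding When_def by (rule runsI) (use assms(2,3) \<open>bval b \<sigma> \<Longrightarrow> reaches c \<sigma> k \<tau> \<and> Q \<tau>\<close> in auto)
qed

subsection \<open>Loop-free programs\<close>

fun run :: "com \<Rightarrow> ram_state \<Rightarrow> ram_state" where
  "run Skip \<sigma> = \<sigma>"
| "run (NStore a i x) \<sigma> = nupd \<sigma> a (nval i \<sigma>) (nval x \<sigma>)"
| "run (RStore a i x) \<sigma> = rupd \<sigma> a (nval i \<sigma>) (rval x \<sigma>)"
| "run (Seq c1 c2) \<sigma> = run c2 (run c1 \<sigma>)"
| "run (IfThenElse b c1 c2) \<sigma> = (if bval b \<sigma> then run c1 \<sigma> else run c2 \<sigma>)"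
| "run (While b c) \<sigma> = \<sigma>"

fun loop_free :: "com \<Rightarrow> bool" where
  "loop_free (Seq c1 c2) \<longleftrightarrow> loop_free c1 \<and> loop_free c2"
| "loop_free (IfThenElse b c1 c2) \<longleftrightarrow> loop_free c1 \<and> loop_free c2"
| "loop_free (While b c) \<longleftrightarrow> False"
| "loop_free _ \<longleftrightarrow> True"

fun max_cost :: "com \<Rightarrow> nat" where
  "max_cost Skip = 1"
| "max_cost (NStore a i x) = 1 + ncost i + ncost x"
| "max_cost (RStore a i x) = 1 + ncost i + rcost x"
| "max_cost (Seq c1 c2) = max_cost c1 + max_cost c2"
| "max_cost (IfThenElse b c1 c2) = 1 + bcost b + (max_cost c1 + max_cost c2)"
| "max_cost (While b c) = 0"

lemma When_simps [simp]:
  "run (When b c) \<sigma> = (if bval b \<sigma> then run c \<sigma> else \<sigma>)"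
  "loop_free (When b c) \<longleftrightarrow> loop_free c"
  "max_cost (When b c) = bcost b + max_cost c + 2"
  by (auto simp: When_def)

lemma reaches_run_max_cost: "loop_free c \<Longrightarrow> reaches c \<sigma> (max_cost c) (run c \<sigma>)"
proof (induction c arbitrary: \<sigma>)
  case (Seq c1 c2)
  then show ?case using reaches_Seq[OF Seq.IH] by simp
next
  case (IfThenElse b c1 c2)
  then have "reaches (if bval b \<sigma> then c1 else c2) \<sigma> (max_cost c1 + max_cost c2)
    (run (IfThenElse b c1 c2) \<sigma>)"
    using reaches_mono[of c1 \<sigma> "max_cost c1" "run c1 \<sigma>" "max_cost c1 + max_cost c2"]
      reaches_mono[of c2 \<sigma> "max_cost c2" "run c2 \<sigma>" "max_cost c1 + max_cost c2"] by simp
  from reaches_If[OF this] show ?case by simp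
next
  case Skip
  show ?case using reaches_exec[OF exec.Skip] by simp
next
  case (NStore a i x)
  show ?case using reaches_exec[OF exec.NStore[of a i x \<sigma>]] by (simp add: nupd_def)
next
  case (RStore a i x)
  show ?case using reaches_exec[OF exec.RStore[of a i x \<sigma>]] by (simp add: rupd_def)
qed simp

lemma reaches_run: "loop_free c \<Longrightarrow> max_cost c \<le> k \<Longrightarrow> reaches c \<sigma> k (run c \<sigma>)"
  using reaches_mono[OF reaches_run_max_cost] .

lemma runs_run: "loop_free c \<Longrightarrow> Q (run c \<sigma>) \<Longrightarrow> max_cost c \<le> k \<Longrightarrow> runs c \<sigma> Q k"
  using runsI[OF reaches_run_max_cost] .

lemma runs_run_Seq:
  assumes "loop_free c1" "runs c2 (run c1 \<sigma>) Q k2" "max_cost c1 + k2 \<le> k"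
  shows "runs (c1 ;; c2) \<sigma> Q k"
proof -
  obtain \<tau> where "reaches c2 (run c1 \<sigma>) k2 \<tau>" "Q \<tau>" using assms(2) by (rule runsE)
  then show ?thesis using runsI[OF reaches_Seq[OF reaches_run_max_cost[OF assms(1)]]] assms(3) by blast
qed

subsection \<open>Counting loops\<close>

definition fresh_counter :: "nat \<Rightarrow> nexp \<Rightarrow> com \<Rightarrow> bool" where
  "fresh_counter a b c \<longleftrightarrow> a \<notin> nat_reads b \<and> a \<notin> nat_writes c \<and> nat_reads b \<inter> nat_writes c = {}"

lemma frame_For_bound: "frame (For a b c) \<sigma> \<tau> \<Longrightarrow> fresh_counter a b c \<Longrightarrow> nval b \<tau> = nval b \<sigma>"
  by (rule nval_cong) (auto simp: frame_def fresh_counter_def)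

lemma runs_For:
  assumes bound: "nval b \<sigma> = N" and fresh: "fresh_counter a b c"
    and stable: "\<And>i \<tau> x. I i (nupd \<tau> a 0 x) \<longleftrightarrow> I i \<tau>"
    and init: "I 0 \<sigma>"
    and step: "\<And>i \<tau>. i < N \<Longrightarrow> nmem \<tau> a 0 = i \<Longrightarrow> I i \<tau> \<Longrightarrow> frame (For a b c) \<sigma> \<tau> \<Longrightarrow>
      runs c \<tau> (I (Suc i)) (T i)"
    and exit: "\<And>\<tau>. I N \<tau> \<Longrightarrow> frame (For a b c) \<sigma> \<tau> \<Longrightarrow> Q \<tau>"
    and time: "(\<Sum>i<N. T i) + N * (ncost b + 10) + ncost b + 10 \<le> k"
  shows "runs (For a b c) \<sigma> Q k"
proof -
  let ?body = "c ;; a ::= NAdd (var a) (NConst 1)"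
  let ?loop = "While (NLess (var a) b) ?body"
  let ?time = "\<lambda>i. (\<Sum>j=i..<N. T j) + (N - i) * (ncost b + 10) + ncost b + 4"
  have bound': "nval b \<tau> = N" if "frame (For a b c) \<sigma> \<tau>" for \<tau>
    using frame_For_bound[OF that fresh] bound by simp
  have loop: "\<exists>\<tau>'. reaches ?loop \<tau> (?time i) \<tau>' \<and> I N \<tau>' \<and> frame (For a b c) \<sigma> \<tau>'"
    if "i \<le> N" "nmem \<tau> a 0 = i" "I i \<tau>" "frame (For a b c) \<sigma> \<tau>" for i \<tau>
    using that
  proof (induction i arbitrary: \<tau> rule: inc_induct)
    case base
    then have "reaches ?loop \<tau> (?time N) \<tau>"
      using bound'[OF base(3)] reaches_mono[OF reaches_WhileFalse] by simp
    then show ?case using base by blast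
  next
    case (step i)
    obtain \<tau>1 where c: "reaches c \<tau> (T i) \<tau>1" "frame c \<tau> \<tau>1" "I (Suc i) \<tau>1"
      using assms(5)[OF step.hyps(2) step.prems] by (rule runsE)
    let ?\<tau>2 = "nupd \<tau>1 a 0 (Suc i)"
    have "nmem \<tau>1 a 0 = i" using frameD(1)[OF c(2)] fresh step.prems(1) by (simp add: fresh_counter_def)
    then have body: "reaches ?body \<tau> (T i + 6) ?\<tau>2"
      using reaches_Seq[OF c(1) reaches_run[of "a ::= NAdd (var a) (NConst 1)" 6]] by simp
    have "frame (For a b c) \<sigma> ?\<tau>2" using c(2) step.prems(3) by (auto simp: frame_def)
    then obtain \<tau>3 where rest: "reaches ?loop ?\<tau>2 (?time (Suc i)) \<tau>3" "I N \<tau>3" "frame (For a b c) \<sigma> \<tau>3"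
      using step.IH[of ?\<tau>2] c(3) stable by auto
    have "bval (NLess (var a) b) \<tau>" using bound'[OF step.prems(3)] step.hyps step.prems by simp
    from reaches_WhileTrue[OF this body rest(1)] have "reaches ?loop \<tau> (?time i) \<tau>3"
      using step.hyps by (rule_tac reaches_mono)
        (auto simp: sum.atLeast_Suc_lessThan Suc_diff_Suc[symmetric])
    then show ?case using rest(2,3) by blast
  qed
  have "frame (For a b c) \<sigma> (nupd \<sigma> a 0 0)" by (auto simp: frame_def)
  then obtain \<tau> where \<tau>: "reaches ?loop (nupd \<sigma> a 0 0) (?time 0) \<tau>" "I N \<tau>" "frame (For a b c) \<sigma> \<tau>"
    using loop[of 0 "nupd \<sigma> a 0 0"] init stable by auto
  have "reaches (a ::= NConst 0) \<sigma> 3 (nupd \<sigma> a 0 0)" using reaches_run[of "a ::= NConst 0" 3 \<sigma>] by simp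
  then have "reaches (For a b c) \<sigma> (3 + ?time 0) \<tau>" unfolding For_def by (rule reaches_Seq[OF _ \<tau>(1)])
  then show ?thesis
    by (rule runsI) (use \<tau>(2,3) exit time in \<open>simp_all add: atLeast0LessThan\<close>)
qed

lemma runs_For_const:
  assumes "nval b \<sigma> = N" "fresh_counter a b c" "\<And>i \<tau> x. I i (nupd \<tau> a 0 x) \<longleftrightarrow> I i \<tau>" "I 0 \<sigma>"
    "\<And>i \<tau>. i < N \<Longrightarrow> nmem \<tau> a 0 = i \<Longrightarrow> I i \<tau> \<Longrightarrow> frame (For a b c) \<sigma> \<tau> \<Longrightarrow> runs c \<tau> (I (Suc i)) T"
    "\<And>\<tau>. I N \<tau> \<Longrightarrow> frame (For a b c) \<sigma> \<tau> \<Longrightarrow> Q \<tau>" "T + ncost b + 10 \<le> K"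
  shows "runs (For a b c) \<sigma> Q ((N + 1) * K)"
proof (rule runs_For[where I = I and T = "\<lambda>_. T", OF assms(1-6)])
  show "(\<Sum>i<N. T) + N * (ncost b + 10) + ncost b + 10 \<le> (N + 1) * K"
    using mult_le_mono2[OF assms(7), of "N + 1"] by (simp add: algebra_simps)
qed

lemma runs_For_run:
  assumes "nval b \<sigma> = N" "fresh_counter a b c" "\<And>i \<tau> x. I i (nupd \<tau> a 0 x) \<longleftrightarrow> I i \<tau>" "loop_free c" "I 0 \<sigma>"
    "\<And>i \<tau>. i < N \<Longrightarrow> nmem \<tau> a 0 = i \<Longrightarrow> I i \<tau> \<Longrightarrow> frame (For a b c) \<sigma> \<tau> \<Longrightarrow> I (Suc i) (run c \<tau>)"
    "\<And>\<tau>. I N \<tau> \<Longrightarrow> frame (For a b c) \<sigma> \<tau> \<Longrightarrow> Q \<tau>" "max_cost c + ncost b + 10 \<le> K"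
  shows "runs (For a b c) \<sigma> Q ((N + 1) * K)"
  by (rule runs_For_const[where I = I and T = "max_cost c", OF assms(1-3,5) _ assms(7,8)])
    (auto intro: runs_run assms(4,6))

lemma sum_if_le: "(\<Sum>i<n. if P i then K else c) \<le> n * c + card {i. i < n \<and> P i} * (K :: nat)"
proof (induction n)
  case (Suc n)
  have "{i. i < Suc n \<and> P i} = (if P n then insert n {i. i < n \<and> P i} else {i. i < n \<and> P i})"
    by (auto simp: less_Suc_eq)
  then have "card {i. i < Suc n \<and> P i} = card {i. i < n \<and> P i} + (if P n then 1 else 0)" by simp
  then show ?case using Suc.IH by auto
qed simp

lemma runs_For_When:
  assumes "nval b \<sigma> = N" "fresh_counter a b c" "\<And>i \<tau> x. I i (nupd \<tau> a 0 x) \<longleftrightarrow> I i \<tau>" "I 0 \<sigma>"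
    "\<And>i \<tau>. i < N \<Longrightarrow> nmem \<tau> a 0 = i \<Longrightarrow> I i \<tau> \<Longrightarrow> frame (For a b c) \<sigma> \<tau> \<Longrightarrow> bval g \<tau> \<longleftrightarrow> P i"
    "\<And>i \<tau>. i < N \<Longrightarrow> nmem \<tau> a 0 = i \<Longrightarrow> I i \<tau> \<Longrightarrow> frame (For a b c) \<sigma> \<tau> \<Longrightarrow> P i \<Longrightarrow> runs c \<tau> (I (Suc i)) T"
    "\<And>i \<tau>. i < N \<Longrightarrow> nmem \<tau> a 0 = i \<Longrightarrow> I i \<tau> \<Longrightarrow> frame (For a b c) \<sigma> \<tau> \<Longrightarrow> \<not> P i \<Longrightarrow> I (Suc i) \<tau>"
    "\<And>\<tau>. I N \<tau> \<Longrightarrow> frame (For a b c) \<sigma> \<tau> \<Longrightarrow> Q \<tau>" "bcost g + ncost b + 12 \<le> K"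
  shows "runs (For a b (When g c)) \<sigma> Q ((N + 1) * K + card {i. i < N \<and> P i} * T)"
proof (rule runs_For[where I = I and T = "\<lambda>i. 2 + bcost g + (if P i then T else 0)"])
  have frame_eq: "frame (For a b (When g c)) = frame (For a b c)" by (simp add: frame_def fun_eq_iff)
  show "runs (When g c) \<tau> (I (Suc i)) (2 + bcost g + (if P i then T else 0))"
    if "i < N" "nmem \<tau> a 0 = i" "I i \<tau>" "frame (For a b (When g c)) \<sigma> \<tau>" for i \<tau>
  proof (rule runs_When)
    note step = that(1-3) that(4)[unfolded frame_eq]
    show "runs c \<tau> (I (Suc i)) (if P i then T else 0)" if "bval g \<tau>"
      using that assms(5,6)[OF step] by simp
    show "I (Suc i) \<tau>" if "\<not> bval g \<tau>" using that assms(5,7)[OF step] by simp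
  qed simp
  have "(\<Sum>i<N. if P i then T else 0) \<le> card {i. i < N \<and> P i} * T" using sum_if_le[of P T 0 N] by simp
  moreover have "N * (2 + bcost g) + N * (ncost b + 10) + ncost b + 10 \<le>
    (N + 1) * (bcost g + ncost b + 12)"
    by (simp add: algebra_simps)
  moreover have "(N + 1) * (bcost g + ncost b + 12) \<le> (N + 1) * K" using assms(9) by (rule mult_le_mono2)
  ultimately show "(\<Sum>i<N. 2 + bcost g + (if P i then T else 0)) + N * (ncost b + 10) + ncost b + 10
    \<le> (N + 1) * K + card {i. i < N \<and> P i} * T"
    unfolding sum.distrib by simp
  show "Q \<tau>" if "I N \<tau>" "frame (For a b (When g c)) \<sigma> \<tau>" for \<tau> using assms(8) that unfolding frame_eq .
qed (use assms(1-4) in \<open>auto simp: fresh_counter_def\<close>)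

section \<open>Shortest paths avoiding removed vertices\<close>

text \<open>
  The arrays of the program. Those that are only used at index 0 serve as variables. In all
  arrays containing pointers to arcs except \<open>Succ\<close>, \<open>Parent\<close>, \<open>Some_Out\<close> and \<open>Some_In\<close>, an arc
  \<open>e\<close> is represented by \<open>e + 1\<close>, since 0 means that there is none.
\<close>

abbreviation (input) Header :: nat where "Header \<equiv> 0"
abbreviation (input) Src :: nat where "Src \<equiv> Suc 0"
abbreviation (input) Dst :: nat where "Dst \<equiv> 2"
abbreviation (input) Weight :: nat where "Weight \<equiv> 0"
abbreviation (input) Found :: nat where "Found \<equiv> 3"
abbreviation (input) Out_Arcs :: nat where "Out_Arcs \<equiv> 4"

abbreviation (input) num_verts :: nexp where "num_verts \<equiv> Header\<langle>NConst 0\<rangle>"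
abbreviation (input) num_arcs :: nexp where "num_arcs \<equiv> Header\<langle>NConst 1\<rangle>"
abbreviation (input) start_vertex :: nexp where "start_vertex \<equiv> Header\<langle>NConst 2\<rangle>"
abbreviation (input) end_vertex :: nexp where "end_vertex \<equiv> Header\<langle>NConst 3\<rangle>"

abbreviation (input) Vertex :: nat where "Vertex \<equiv> 10"
abbreviation (input) Round :: nat where "Round \<equiv> 11"
abbreviation (input) Position :: nat where "Position \<equiv> 12"
abbreviation (input) Arc :: nat where "Arc \<equiv> 13"
abbreviation (input) Order :: nat where "Order \<equiv> 30"
abbreviation (input) Reached :: nat where "Reached \<equiv> 31"
abbreviation (input) Parent :: nat where "Parent \<equiv> 32"
abbreviation (input) Removed :: nat where "Removed \<equiv> 33"
abbreviation (input) Source :: nat where "Source \<equiv> 34"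
abbreviation (input) Rounds :: nat where "Rounds \<equiv> 35"
abbreviation (input) Path_Dist :: nat where "Path_Dist \<equiv> 2"

definition relax :: com where
  "relax =
    Arc ::= Order\<langle>var Position\<rangle> ;;
    When (Nonzero (Reached\<langle>Src\<langle>var Arc\<rangle>\<rangle>) AND BNot (Nonzero (Removed\<langle>Dst\<langle>var Arc\<rangle>\<rangle>)) AND
        (BNot (Nonzero (Reached\<langle>Dst\<langle>var Arc\<rangle>\<rangle>)) OR
          RLess (RAdd (Path_Dist\<langle>Src\<langle>var Arc\<rangle>\<rangle>\<^sub>r) (Weight\<langle>var Arc\<rangle>\<^sub>r)) (Path_Dist\<langle>Dst\<langle>var Arc\<rangle>\<rangle>\<^sub>r)))
      (Path_Dist\<langle>Dst\<langle>var Arc\<rangle>\<rangle>\<^sub>r ::= RAdd (Path_Dist\<langle>Src\<langle>var Arc\<rangle>\<rangle>\<^sub>r) (Weight\<langle>var Arc\<rangle>\<^sub>r) ;;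
       Reached\<langle>Dst\<langle>var Arc\<rangle>\<rangle> ::= NConst 1 ;;
       Parent\<langle>Dst\<langle>var Arc\<rangle>\<rangle> ::= var Arc)"

definition relax_rounds :: com where
  "relax_rounds = For Round (var Rounds) (For Position num_arcs relax)"

definition shortest_paths :: com where
  "shortest_paths =
    For Vertex num_verts (Reached\<langle>var Vertex\<rangle> ::= NConst 0) ;;
    (Reached\<langle>var Source\<rangle> ::= NConst 1 ;; Path_Dist\<langle>var Source\<rangle>\<^sub>r ::= RZero) ;;
    relax_rounds"

lemma shortest_paths_writes [simp]:
  "nat_writes relax = {Arc, Reached, Parent}" "real_writes relax = {Path_Dist}" "loop_free relax"
  "nat_writes relax_rounds = {Round, Position, Arc, Reached, Parent}"
  "real_writes relax_rounds = {Path_Dist}"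
  "nat_writes shortest_paths = {Vertex, Round, Position, Arc, Reached, Parent}"
  "real_writes shortest_paths = {Path_Dist}"
  by (auto simp: relax_def relax_rounds_def shortest_paths_def)

context layered_arcs
begin

definition has_input :: "ram_state \<Rightarrow> bool" where
  "has_input \<sigma> \<longleftrightarrow> nmem \<sigma> Header 0 = n \<and> nmem \<sigma> Header (Suc 0) = m \<and> nmem \<sigma> Header 2 = s \<and>
    nmem \<sigma> Header 3 = t \<and> (\<forall>e<m. nmem \<sigma> Src e = src e \<and> nmem \<sigma> Dst e = dst e \<and> rmem \<sigma> Weight e = w e)"

lemma has_inputD:
  assumes "has_input \<sigma>"
  shows "nmem \<sigma> Header 0 = n" "nmem \<sigma> Header (Suc 0) = m" "nmem \<sigma> Header 2 = s" "nmem \<sigma> Header 3 = t"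
    "e < m \<Longrightarrow> nmem \<sigma> Src e = src e" "e < m \<Longrightarrow> nmem \<sigma> Dst e = dst e" "e < m \<Longrightarrow> rmem \<sigma> Weight e = w e"
  using assms by (auto simp: has_input_def)

lemma has_input_frame:
  assumes "has_input \<sigma>" "frame c \<sigma> \<tau>" "nat_writes c \<inter> {Header, Src, Dst} = {}" "Weight \<notin> real_writes c"
  shows "has_input \<tau>"
  using assms by (auto simp: has_input_def frame_def)

subsection \<open>Walks found by relaxing arcs\<close>

text \<open>
  \<open>relaxed_walk ord R x k i v c\<close>: a walk of weight \<open>c\<close> from \<open>x\<close> to \<open>v\<close> never entering \<open>R\<close> is
  found by \<open>k\<close> rounds of relaxing all arcs in the order \<open>ord\<close> followed by relaxing the first \<open>i\<close>
  arcs.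
\<close>

inductive relaxed_walk :: "(nat \<Rightarrow> nat) \<Rightarrow> nat set \<Rightarrow> nat \<Rightarrow> nat \<Rightarrow> nat \<Rightarrow> nat \<Rightarrow> real \<Rightarrow> bool"
  for ord :: "nat \<Rightarrow> nat" and R :: "nat set" and x :: nat where
  source: "relaxed_walk ord R x k i x 0"
| relax: "relaxed_walk ord R x k j (src (ord j)) c \<Longrightarrow> j < i \<Longrightarrow> i \<le> m \<Longrightarrow> dst (ord j) \<notin> R \<Longrightarrow>
    relaxed_walk ord R x k i (dst (ord j)) (c + w (ord j))"
| next_round: "relaxed_walk ord R x k m v c \<Longrightarrow> relaxed_walk ord R x (Suc k) i v c"

lemma relaxed_walk_SucE:
  assumes "relaxed_walk ord R x k (Suc i) v c" "i < m"
  obtains (earlier) "relaxed_walk ord R x k i v c"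
  | (relaxed) c' where "v = dst (ord i)" "dst (ord i) \<notin> R" "relaxed_walk ord R x k i (src (ord i)) c'"
    "c = c' + w (ord i)"
  using assms(1)
proof (cases rule: relaxed_walk.cases)
  case (relax j c')
  show ?thesis
  proof (cases "j = i")
    case False
    then have "j < i" "i \<le> m" using relax(4) assms(2) by auto
    then show ?thesis using relax that(1) relaxed_walk.relax by blast
  qed (use relax that(2) in blast)
qed (use that(1) relaxed_walk.intros in blast)+

lemma relaxed_walk_0E:
  assumes "relaxed_walk ord R x k 0 v c"
  obtains "v = x" "c = 0" | l where "k = Suc l" "relaxed_walk ord R x l m v c"
  using assms by (cases rule: relaxed_walk.cases) auto

lemma relaxed_walk_later_round: "relaxed_walk ord R x k m v c \<Longrightarrow> k < l \<Longrightarrow> relaxed_walk ord R x l i v c"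
proof (induction l arbitrary: i)
  case (Suc l)
  then show ?case by (cases "k = l") (auto intro: relaxed_walk.next_round)
qed simp

lemma relaxed_walk_mono:
  assumes "relaxed_walk ord R x k i v c" "i \<le> m" "j \<le> m" "k < l \<or> k = l \<and> i \<le> j"
  shows "relaxed_walk ord R x l j v c"
proof -
  have same_round: "relaxed_walk ord R x k i' v c" if "i \<le> i'" "i' \<le> m" for i'
    using assms(1) by (cases rule: relaxed_walk.cases) (use that in \<open>auto intro: relaxed_walk.intros\<close>)
  show ?thesis
    using assms(4) relaxed_walk_later_round[OF same_round[OF assms(2) order_refl]] same_round
      assms(3) by blast
qed

definition enumerates :: "(nat \<Rightarrow> nat) \<Rightarrow> (nat \<Rightarrow> nat) \<Rightarrow> bool" where
  "enumerates ord ps \<longleftrightarrow> (\<forall>e<m. ps e < m \<and> ord (ps e) = e)"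

lemma enumerates_inverse:
  assumes "enumerates ord ps" "i < m"
  shows "ord i < m" "ps (ord i) = i"
proof -
  have "inj_on ps {..<m}" using assms(1)
    by (intro inj_on_inverseI[where g = ord]) (auto simp: enumerates_def)
  then have "ps ` {..<m} = {..<m}" using assms(1) by (intro endo_inj_surj) (auto simp: enumerates_def)
  then obtain e where "e < m" "i = ps e" using assms(2) by blast
  then show "ord i < m" "ps (ord i) = i" using assms(1) by (auto simp: enumerates_def)
qed

lemma relaxed_walk_forward_path:
  assumes ord: "enumerates ord ps"
  shows "forward_path x S v \<Longrightarrow> relaxed_walk ord {} x (card S) 0 v (d v - d x)"
proof (induction "card S" arbitrary: S v rule: less_induct)
  case less
  show ?case
  proof (cases "v = x")
    case True
    then show ?thesis using relaxed_walk.source[of _ _ x] by simp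
  next
    case False
    note vS = path_inD(4,6)[OF less.prems]
    obtain e where e: "forward e" "src e \<in> S" "dst e = v"
      using forward_path_arc_into[OF less.prems vS(2) False] by blast
    then obtain i where i: "i < m" "ord i = e" using ord forwardD(1) unfolding enumerates_def by blast
    let ?S = "below S (src e)"
    have "v \<notin> ?S" using forwardD(2)[OF e(1)] e(3) by auto
    then have card: "card ?S < card S" using vS by (intro psubset_card_mono) auto
    then have "relaxed_walk ord {} x (card ?S) 0 (src e) (d (src e) - d x)"
      using less.hyps forward_path_below[OF less.prems e(2)] by blast
    then have "relaxed_walk ord {} x (card ?S) i (src e) (d (src e) - d x)"
      using relaxed_walk_mono i(1) by simp
    then have "relaxed_walk ord {} x (card ?S) m v (d (src e) - d x + w e)"
      using relaxed_walk.relax[of ord "{}" x "card ?S" i _ m] i e(3) by simp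
    moreover have "d (src e) - d x + w e = d v - d x" using tight[of e] e forwardD by auto
    ultimately show ?thesis using relaxed_walk_later_round card by simp
  qed
qed

definition level_order :: "(nat \<Rightarrow> nat) \<Rightarrow> (nat \<Rightarrow> nat) \<Rightarrow> bool" where
  "level_order ord ps \<longleftrightarrow>
    enumerates ord ps \<and> (\<forall>e<m. \<forall>f<m. d (src e) < d (src f) \<longrightarrow> ps e < ps f)"

definition back_heads :: "nat set" where
  "back_heads = {v. v < n \<and> (\<exists>e<m. \<not> forward e \<and> dst e = v)}"

definition back_tails :: "nat set" where
  "back_tails = {v. v < n \<and> (\<exists>e<m. \<not> forward e \<and> src e = v)}"

lemma finite_back_heads: "finite back_heads" and finite_back_tails: "finite back_tails"
  unfolding back_heads_def back_tails_def by auto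

text \<open>
  If the arcs are relaxed in the order of the levels of their tails, a path without back arcs is
  found in a single round, and a new round is only needed after each back arc.
\<close>

lemma relaxed_walk_path:
  assumes ord: "level_order ord ps"
  shows "path a S v k \<Longrightarrow> (S - {a}) \<inter> R = {} \<Longrightarrow>
    (\<And>i. i \<le> m \<Longrightarrow> (\<And>e. e < m \<Longrightarrow> d (src e) < d a \<Longrightarrow> ps e < i) \<Longrightarrow> relaxed_walk ord R x b i a c) \<Longrightarrow>
    relaxed_walk ord R x (b + card ((S - {a}) \<inter> back_heads)) m v (c + k + d v - d a)"
proof (induction arbitrary: b c rule: path_in.induct)
  case (nil a)
  then show ?case using ord by (simp add: level_order_def enumerates_def)
next
  case (cons e S v k)
  note S = path_inD(4,5)[OF cons.hyps(3)]
  have e: "ord (ps e) = e" "ps e < m" "\<And>f. f < m \<Longrightarrow> d (src f) < d (src e) \<Longrightarrow> ps f < ps e"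
    using ord cons.hyps(2) by (auto simp: level_order_def enumerates_def)
  have tail: "insert (src e) S - {src e} = S" using cons.hyps(4) by auto
  have "dst e \<notin> R" using cons.prems(1) S unfolding tail by blast
  then have relax_e: "relaxed_walk ord R x b i (dst e) (c + w e)" if "ps e < i" "i \<le> m" for i
    using relaxed_walk.relax[of ord R x b "ps e" c i] cons.prems(2)[of "ps e"] e that by simp
  obtain b' where b': "b' + card ((S - {dst e}) \<inter> back_heads) \<le> b + card (S \<inter> back_heads)"
    "\<And>i. i \<le> m \<Longrightarrow> (\<And>f. f < m \<Longrightarrow> d (src f) < d (dst e) \<Longrightarrow> ps f < i) \<Longrightarrow>
      relaxed_walk ord R x b' i (dst e) (c + w e)"
  proof (cases "forward e")
    case True
    show thesis
    proof (rule that[of b])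
      show "b + card ((S - {dst e}) \<inter> back_heads) \<le> b + card (S \<inter> back_heads)"
        using S(1) by (intro add_left_mono card_mono) auto
    qed (use relax_e forwardD(1,2)[OF True] in blast)
  next
    case False
    have "dst e \<in> S \<inter> back_heads" using S False cons.hyps(2) dst_less by (auto simp: back_heads_def)
    moreover have "(S - {dst e}) \<inter> back_heads = S \<inter> back_heads - {dst e}" by blast
    ultimately have "Suc (card ((S - {dst e}) \<inter> back_heads)) = card (S \<inter> back_heads)"
      using S(1) by (metis card_Suc_Diff1 finite_Int)
    then show thesis using that[of "Suc b"] relaxed_walk.next_round[OF relax_e[OF e(2) order_refl]]
      by simp
  qed
  have "relaxed_walk ord R x (b' + card ((S - {dst e}) \<inter> back_heads)) m v
    (c + w e + k + d v - d (dst e))"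
    by (rule cons.IH[OF _ b'(2)]) (use cons.prems(1) in \<open>unfold tail, blast\<close>)
  then have "relaxed_walk ord R x (b + card (S \<inter> back_heads)) m v (c + w e + k + d v - d (dst e))"
    using b'(1) by (rule_tac relaxed_walk_mono) auto
  then show ?case unfolding tail by (simp add: excess_def algebra_simps)
qed

definition relaxed :: "(nat \<Rightarrow> nat) \<Rightarrow> nat set \<Rightarrow> nat \<Rightarrow> nat \<Rightarrow> nat \<Rightarrow> (nat \<Rightarrow> nat) \<Rightarrow> (nat \<Rightarrow> real) \<Rightarrow> bool" where
  "relaxed ord R x k i reached cost \<longleftrightarrow>
    (\<forall>v c. relaxed_walk ord R x k i v c \<longrightarrow> reached v \<noteq> 0 \<and> cost v \<le> c)"

lemma relaxed_next_round: "relaxed ord R x k m reached cost \<Longrightarrow> reached x \<noteq> 0 \<Longrightarrow> cost x = 0 \<Longrightarrow>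
  relaxed ord R x (Suc k) 0 reached cost"
  unfolding relaxed_def by (auto elim: relaxed_walk_0E)

lemma relaxed_skip:
  assumes "relaxed ord R x k i reached cost" "i < m"
    "reached (src (ord i)) = 0 \<or> dst (ord i) \<in> R \<or>
      reached (dst (ord i)) \<noteq> 0 \<and> cost (dst (ord i)) \<le> cost (src (ord i)) + w (ord i)"
  shows "relaxed ord R x k (Suc i) reached cost"
  unfolding relaxed_def
proof (intro allI impI)
  fix v c assume "relaxed_walk ord R x k (Suc i) v c"
  then show "reached v \<noteq> 0 \<and> cost v \<le> c"
    using assms(2)
  proof (cases rule: relaxed_walk_SucE)
    case (relaxed c')
    then have "reached (src (ord i)) \<noteq> 0" "cost (src (ord i)) \<le> c'" using assms(1)
      unfolding relaxed_def by blast+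
    then show ?thesis using relaxed assms(3) by auto
  qed (use assms(1) in \<open>simp add: relaxed_def\<close>)
qed

lemma relaxed_mono:
  assumes "relaxed ord R x k i reached cost" "\<And>v. reached v \<noteq> 0 \<Longrightarrow> reached' v \<noteq> 0 \<and> cost' v \<le> cost v"
  shows "relaxed ord R x k i reached' cost'"
  using assms unfolding relaxed_def by (meson order_trans)

definition parent_tree :: "nat set \<Rightarrow> nat \<Rightarrow> (nat \<Rightarrow> nat) \<Rightarrow> (nat \<Rightarrow> real) \<Rightarrow> (nat \<Rightarrow> nat) \<Rightarrow> bool" where
  "parent_tree R x reached cost parent \<longleftrightarrow> reached x \<noteq> 0 \<and> cost x = 0 \<and>
    (\<forall>v<n. reached v \<noteq> 0 \<longrightarrow> 0 \<le> cost v \<and> (v \<noteq> x \<longrightarrow> parent v < m \<and> dst (parent v) = v \<and> v \<notin> R \<and>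
      reached (src (parent v)) \<noteq> 0 \<and> cost (src (parent v)) + w (parent v) \<le> cost v))"

lemma parent_treeD:
  assumes "parent_tree R x reached cost parent"
  shows "reached x \<noteq> 0" "cost x = 0" "v < n \<Longrightarrow> reached v \<noteq> 0 \<Longrightarrow> 0 \<le> cost v"
    "v < n \<Longrightarrow> reached v \<noteq> 0 \<Longrightarrow> v \<noteq> x \<Longrightarrow> parent v < m \<and> dst (parent v) = v \<and> v \<notin> R \<and>
      reached (src (parent v)) \<noteq> 0 \<and> cost (src (parent v)) + w (parent v) \<le> cost v"
  using assms unfolding parent_tree_def by blast+

lemma parent_tree_update:
  assumes tree: "parent_tree R x reached cost parent"
    and e: "e < m" "reached (src e) \<noteq> 0" "dst e \<notin> R"
      "reached (dst e) = 0 \<or> cost (src e) + w e < cost (dst e)"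
  shows "parent_tree R x (reached(dst e := Suc 0)) (cost(dst e := cost (src e) + w e))
    (parent(dst e := e))"
proof -
  let ?reached = "reached(dst e := Suc 0)" and ?cost = "cost(dst e := cost (src e) + w e)"
    and ?parent = "parent(dst e := e)"
  have ends: "src e < n" "dst e < n" "src e \<noteq> dst e" using e(1) src_less dst_less level_neq[of e] by auto
  have pos: "0 < cost (src e) + w e"
    using parent_treeD(3)[OF tree ends(1) e(2)] weight_pos[OF e(1)] by simp
  then have x: "dst e \<noteq> x" using e(4) parent_treeD(1,2)[OF tree] by auto
  have "0 \<le> ?cost v \<and> (v \<noteq> x \<longrightarrow> ?parent v < m \<and> dst (?parent v) = v \<and> v \<notin> R \<and>
      ?reached (src (?parent v)) \<noteq> 0 \<and> ?cost (src (?parent v)) + w (?parent v) \<le> ?cost v)"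
    if v: "v < n" "?reached v \<noteq> 0" for v
  proof (cases "v = dst e")
    case True
    then show ?thesis using e ends pos by simp
  next
    case False
    then have reached: "reached v \<noteq> 0" using v(2) by simp
    note old = parent_treeD(3,4)[OF tree v(1) reached]
    have "?cost (src (parent v)) \<le> cost (src (parent v))" if "v \<noteq> x" using e(4) old(2)[OF that] by auto
    then show ?thesis using False old by auto
  qed
  then show ?thesis using x parent_treeD(1,2)[OF tree] unfolding parent_tree_def by simp
qed

lemma parent_tree_dist_ge:
  assumes tree: "parent_tree R x reached cost parent"
  shows "v < n \<Longrightarrow> reached v \<noteq> 0 \<Longrightarrow> d v - d x \<le> cost v"
proof (induction v rule: measure_induct_rule[of "\<lambda>v. card {u. u < n \<and> reached u \<noteq> 0 \<and> cost u < cost v}"])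
  case (less v)
  show ?case
  proof (cases "v = x")
    case True
    then show ?thesis using parent_treeD(2)[OF tree] by simp
  next
    case False
    define e where "e = parent v"
    have e: "e < m" "dst e = v" "reached (src e) \<noteq> 0" "cost (src e) + w e \<le> cost v"
      using parent_treeD(4)[OF tree less.prems False] by (auto simp: e_def)
    have closer: "cost (src e) < cost v" using e(4) weight_pos[OF e(1)] by linarith
    then have "{u. u < n \<and> reached u \<noteq> 0 \<and> cost u < cost (src e)} \<subset>
      {u. u < n \<and> reached u \<noteq> 0 \<and> cost u < cost v}"
      using src_less[OF e(1)] e(3) by force
    then have "card {u. u < n \<and> reached u \<noteq> 0 \<and> cost u < cost (src e)} <
      card {u. u < n \<and> reached u \<noteq> 0 \<and> cost u < cost v}"
      by (intro psubset_card_mono) auto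
    then have "d (src e) - d x \<le> cost (src e)" using less.IH src_less[OF e(1)] e(3) by blast
    moreover have "d v \<le> d (src e) + w e" using excess_nonneg[OF e(1)] e(2) by (simp add: excess_def)
    ultimately show ?thesis using e(4) by linarith
  qed
qed

subsection \<open>The program\<close>

definition shortest_inv :: "(nat \<Rightarrow> nat) \<Rightarrow> nat set \<Rightarrow> nat \<Rightarrow> nat \<Rightarrow> nat \<Rightarrow> ram_state \<Rightarrow> bool" where
  "shortest_inv ord R x k i \<tau> \<longleftrightarrow> parent_tree R x (nmem \<tau> Reached) (rmem \<tau> Path_Dist) (nmem \<tau> Parent) \<and>
    relaxed ord R x k i (nmem \<tau> Reached) (rmem \<tau> Path_Dist)"

lemma shortest_inv_nupd:
  "a \<notin> {Reached, Parent} \<Longrightarrow> shortest_inv ord R x k i (nupd \<tau> a j v) \<longleftrightarrow> shortest_inv ord R x k i \<tau>"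
  by (simp add: shortest_inv_def)

lemma shortest_inv_relax:
  assumes inv: "shortest_inv ord R x k i \<tau>" and input: "has_input \<tau>" and i: "i < m" "ord i < m"
    "nmem \<tau> Position 0 = i"
    and ord: "nmem \<tau> Order = ord" and R: "{v. nmem \<tau> Removed v \<noteq> 0} = R"
  shows "shortest_inv ord R x k (Suc i) (run relax \<tau>)"
proof -
  define e where "e = ord i"
  let ?reached = "nmem \<tau> Reached" and ?cost = "rmem \<tau> Path_Dist"
  let ?improves = "?reached (src e) \<noteq> 0 \<and> dst e \<notin> R \<and>
    (?reached (dst e) = 0 \<or> ?cost (src e) + w e < ?cost (dst e))"
  have tree: "parent_tree R x ?reached ?cost (nmem \<tau> Parent)"
    and relaxed: "relaxed ord R x k i ?reached ?cost"
    using inv by (auto simp: shortest_inv_def)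
  have "nmem \<tau> Removed v \<noteq> 0 \<longleftrightarrow> v \<in> R" for v using R by auto
  then have run: "nmem (run relax \<tau>) Reached =
    (if ?improves then ?reached(dst e := Suc 0) else ?reached)"
    "rmem (run relax \<tau>) Path_Dist = (if ?improves then ?cost(dst e := ?cost (src e) + w e) else ?cost)"
    "nmem (run relax \<tau>) Parent = (if ?improves then (nmem \<tau> Parent)(dst e := e) else nmem \<tau> Parent)"
    using i by (auto simp: relax_def ord has_inputD[OF input] e_def)
  show ?thesis
  proof (cases ?improves)
    case True
    let ?reached' = "?reached(dst e := Suc 0)" and ?cost' = "?cost(dst e := ?cost (src e) + w e)"
    have "src e \<noteq> dst e" using level_neq[of e] i by (auto simp: e_def)
    moreover have "relaxed ord R x k i ?reached' ?cost'" using relaxed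
      by (rule relaxed_mono) (use True in auto)
    ultimately have "relaxed ord R x k (Suc i) ?reached' ?cost'"
      using i(1) by (rule_tac relaxed_skip) (auto simp: e_def)
    then show ?thesis
      using parent_tree_update[OF tree, of e] True i unfolding shortest_inv_def run by (simp add: e_def)
  next
    case False
    then have "relaxed ord R x k (Suc i) ?reached ?cost"
      by (intro relaxed_skip[OF relaxed i(1)]) (auto simp: e_def)
    then show ?thesis using tree False unfolding shortest_inv_def run by (simp only: if_False)
  qed
qed

lemma runs_relax_rounds:
  assumes input: "has_input \<sigma>" and ord: "nmem \<sigma> Order = ord" "\<And>i. i < m \<Longrightarrow> ord i < m"
    and R: "{v. nmem \<sigma> Removed v \<noteq> 0} = R" and r: "nmem \<sigma> Rounds 0 = r"
    and inv: "shortest_inv ord R x 0 0 \<sigma>"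
  shows "runs relax_rounds \<sigma> (shortest_inv ord R x r 0) ((r + 1) * ((m + 1) * 100 + 20))"
  unfolding relax_rounds_def
proof (rule runs_For_const[where I = "\<lambda>k. shortest_inv ord R x k 0" and T = "(m + 1) * 100"],
    goal_cases bound fresh stable init step exit time)
  case (step k \<tau>)
  have input1: "has_input \<tau>" by (rule has_input_frame[OF input step(4)]) auto
  show ?case
  proof (rule runs_For_run[where I = "shortest_inv ord R x k"],
    goal_cases bound fresh stable loop_free init step exit time)
    case (step i \<tau>')
    have "has_input \<tau>'" by (rule has_input_frame[OF input1 step(4)]) auto
    moreover have "nmem \<tau>' Order = ord" "nmem \<tau>' Removed = nmem \<sigma> Removed"
      using ord frameD(1)[OF step(4)] frameD(1)[OF \<open>frame _ \<sigma> \<tau>\<close>] by simp_all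
    ultimately show ?case
      using shortest_inv_relax[OF step(3)] step(1,2) ord(2) R by auto
  next
    case (exit \<tau>')
    then show ?case using relaxed_next_round parent_treeD(1,2) unfolding shortest_inv_def by blast
  qed (use step(3) has_inputD(2)[OF input1] in \<open>auto simp: fresh_counter_def shortest_inv_nupd
    relax_def\<close>)
qed (use inv r in \<open>auto simp: fresh_counter_def shortest_inv_nupd\<close>)

definition shortest_paths_time :: "nat \<Rightarrow> nat" where
  "shortest_paths_time r = (n + 1) * 20 + 8 + (r + 1) * ((m + 1) * 100 + 20)"

lemma runs_shortest_paths:
  assumes input: "has_input \<sigma>" and ord: "\<And>i. i < m \<Longrightarrow> nmem \<sigma> Order i < m"
    and x: "nmem \<sigma> Source 0 = x" "x < n" and r: "nmem \<sigma> Rounds 0 = r"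
  shows "runs shortest_paths \<sigma> (shortest_inv (nmem \<sigma> Order) {v. nmem \<sigma> Removed v \<noteq> 0} x r 0)
    (shortest_paths_time r)"
proof -
  let ?clear = "For Vertex num_verts (Reached\<langle>var Vertex\<rangle> ::= NConst 0)"
  let ?init = "Reached\<langle>var Source\<rangle> ::= NConst 1 ;; Path_Dist\<langle>var Source\<rangle>\<^sub>r ::= RZero"
  let ?inv = "\<lambda>k. shortest_inv (nmem \<sigma> Order) {v. nmem \<sigma> Removed v \<noteq> 0} x k 0"
  have "runs ?clear \<sigma> (\<lambda>\<tau>. \<forall>v<n. nmem \<tau> Reached v = 0) ((n + 1) * 20)"
    by (rule runs_For_run[where I = "\<lambda>i \<tau>. \<forall>v<i. nmem \<tau> Reached v = 0"])
      (auto simp: fresh_counter_def has_inputD[OF input] less_Suc_eq)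
  then obtain \<tau>1 where \<tau>1: "reaches ?clear \<sigma> ((n + 1) * 20) \<tau>1" "frame ?clear \<sigma> \<tau>1"
    "\<forall>v<n. nmem \<tau>1 Reached v = 0"
    by (rule runsE)
  let ?\<tau>2 = "run ?init \<tau>1"
  have \<tau>2: "reaches ?init \<tau>1 8 ?\<tau>2" by (rule reaches_run) auto
  have frame: "frame (?clear ;; ?init) \<sigma> ?\<tau>2"
    using frame_trans[OF \<tau>1(2) reaches_frame[OF \<tau>2]] by simp
  have "has_input ?\<tau>2" by (rule has_input_frame[OF input frame]) auto
  moreover have "nmem ?\<tau>2 Order = nmem \<sigma> Order" "nmem ?\<tau>2 Removed = nmem \<sigma> Removed"
    "nmem ?\<tau>2 Rounds 0 = r"
    using r frameD(1)[OF \<tau>1(2)] by auto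
  moreover have "?inv 0 ?\<tau>2"
    using \<tau>1(3) x frameD(1)[OF \<tau>1(2)]
    by (auto simp: shortest_inv_def parent_tree_def relaxed_def elim: relaxed_walk_0E)
  ultimately have "runs relax_rounds ?\<tau>2 (?inv r) ((r + 1) * ((m + 1) * 100 + 20))"
    using runs_relax_rounds ord by simp
  then obtain \<tau>3 where \<tau>3: "reaches relax_rounds ?\<tau>2 ((r + 1) * ((m + 1) * 100 + 20)) \<tau>3" "?inv r \<tau>3"
    by (rule runsE)
  show ?thesis
    unfolding shortest_paths_def
    by (rule runsI[OF reaches_Seq[OF \<tau>1(1) reaches_Seq[OF \<tau>2 \<tau>3(1)]]])
      (use \<tau>3(2) in \<open>simp_all add: shortest_paths_time_def\<close>)
qed

end

section \<open>Detecting graphs without back arcs in linear time\<close>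

abbreviation (input) Index :: nat where "Index \<equiv> 14"
abbreviation (input) Index2 :: nat where "Index2 \<equiv> 15"
abbreviation (input) First_Out :: nat where "First_Out \<equiv> 20"
abbreviation (input) Next_Out :: nat where "Next_Out \<equiv> 21"
abbreviation (input) Seen :: nat where "Seen \<equiv> 22"
abbreviation (input) Queue :: nat where "Queue \<equiv> 23"
abbreviation (input) Front :: nat where "Front \<equiv> 24"
abbreviation (input) Back :: nat where "Back \<equiv> 25"
abbreviation (input) Current :: nat where "Current \<equiv> 26"
abbreviation (input) Not_Tight :: nat where "Not_Tight \<equiv> 27"
abbreviation (input) Potential :: nat where "Potential \<equiv> Suc 0"

definition link_arc :: com where
  "link_arc =
    Next_Out\<langle>var Index\<rangle> ::= First_Out\<langle>Src\<langle>var Index\<rangle>\<rangle> ;;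
    First_Out\<langle>Src\<langle>var Index\<rangle>\<rangle> ::= NAdd (var Index) (NConst 1)"

definition adjacency :: com where
  "adjacency = For Index num_arcs link_arc"

definition search_step :: com where
  "search_step = IfThenElse (Nonzero (var Current))
    (Index2 ::= NSub (var Current) (NConst 1) ;;
     When (BNot (Nonzero (Seen\<langle>Dst\<langle>var Index2\<rangle>\<rangle>)))
       (Potential\<langle>Dst\<langle>var Index2\<rangle>\<rangle>\<^sub>r ::= RAdd (Potential\<langle>Src\<langle>var Index2\<rangle>\<rangle>\<^sub>r) (Weight\<langle>var Index2\<rangle>\<^sub>r) ;;
        Seen\<langle>Dst\<langle>var Index2\<rangle>\<rangle> ::= NConst 1 ;;
        Queue\<langle>var Back\<rangle> ::= Dst\<langle>var Index2\<rangle> ;;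
        Back ::= NAdd (var Back) (NConst 1)) ;;
     Current ::= Next_Out\<langle>var Index2\<rangle>)
    (When (NLess (var Front) (var Back))
      (Current ::= First_Out\<langle>Queue\<langle>var Front\<rangle>\<rangle> ;;
       Front ::= NAdd (var Front) (NConst 1)))"

definition search_init :: com where
  "search_init = Seen\<langle>start_vertex\<rangle> ::= NConst 1 ;; Queue\<langle>NConst 0\<rangle> ::= start_vertex ;;
    Back ::= NConst 1"

definition search :: com where
  "search = search_init ;; For Index (NAdd (NAdd num_verts num_arcs) (NConst 1)) search_step"

definition tight_check :: com where
  "tight_check = For Index num_arcs
    (When (RLess (RAdd (Potential\<langle>Src\<langle>var Index\<rangle>\<rangle>\<^sub>r) (Weight\<langle>var Index\<rangle>\<^sub>r))
      (Potential\<langle>Dst\<langle>var Index\<rangle>\<rangle>\<^sub>r) OR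
        RLess (Potential\<langle>Dst\<langle>var Index\<rangle>\<rangle>\<^sub>r) (RAdd (Potential\<langle>Src\<langle>var Index\<rangle>\<rangle>\<^sub>r) (Weight\<langle>var Index\<rangle>\<^sub>r)))
      (Not_Tight ::= NConst 1))"

definition precheck :: com where
  "precheck = adjacency ;; search ;; tight_check"

lemma precheck_writes [simp]:
  "nat_writes link_arc = {First_Out, Next_Out}" "real_writes link_arc = {}" "loop_free link_arc"
  "nat_writes adjacency = {Index, First_Out, Next_Out}" "real_writes adjacency = {}"
  "nat_writes search_step = {Index2, Seen, Queue, Front, Back, Current}"
  "real_writes search_step = {Potential}" "loop_free search_step"
  "nat_writes search_init = {Seen, Queue, Back}" "real_writes search_init = {}" "loop_free search_init"
  "nat_writes search = {Index, Index2, Seen, Queue, Front, Back, Current}"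
  "real_writes search = {Potential}"
  "nat_writes tight_check = {Index, Not_Tight}" "real_writes tight_check = {}"
  "nat_writes precheck =
    {Index, Index2, First_Out, Next_Out, Seen, Queue, Front, Back, Current, Not_Tight}"
  "real_writes precheck = {Potential}"
  by (auto simp: link_arc_def adjacency_def search_step_def search_init_def search_def
    tight_check_def precheck_def)

context layered_arcs
begin

definition last_out_before :: "nat \<Rightarrow> nat \<Rightarrow> nat \<Rightarrow> bool" where
  "last_out_before u b p \<longleftrightarrow> p \<le> b \<and> (p = 0 \<or> src (p - 1) = u) \<and> (\<forall>f. p \<le> f \<and> f < b \<longrightarrow> src f \<noteq> u)"

definition out_lists :: "ram_state \<Rightarrow> bool" where
  "out_lists \<tau> \<longleftrightarrow> (\<forall>u. last_out_before u m (nmem \<tau> First_Out u)) \<and>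
    (\<forall>e<m. last_out_before (src e) e (nmem \<tau> Next_Out e))"

lemma runs_adjacency:
  assumes input: "has_input \<sigma>" and empty: "nmem \<sigma> First_Out = (\<lambda>_. 0)"
  shows "runs adjacency \<sigma> out_lists ((m + 1) * 40)"
  unfolding adjacency_def
proof (rule runs_For_run[where I = "\<lambda>i \<tau>. (\<forall>u. last_out_before u i (nmem \<tau> First_Out u)) \<and>
      (\<forall>e<i. last_out_before (src e) e (nmem \<tau> Next_Out e))"],
    goal_cases bound fresh stable loop_free init step exit time)
  case (step i \<tau>)
  have input1: "has_input \<tau>" by (rule has_input_frame[OF input step(4)]) auto
  have "last_out_before u (Suc i) (if u = src i then Suc i else nmem \<tau> First_Out u)" for u
    using step(3)[THEN conjunct1, rule_format, of u] by (auto simp: last_out_before_def less_Suc_eq)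
  moreover have "last_out_before (src e) e
    (if e = i then nmem \<tau> First_Out (src i) else nmem \<tau> Next_Out e)"
    if "e < Suc i" for e
    using step(3) that by (auto simp: less_Suc_eq)
  ultimately show ?case using step(1,2) by (simp add: link_arc_def has_inputD[OF input1] fun_upd_def)
qed (auto simp: fresh_counter_def has_inputD[OF input] empty last_out_before_def out_lists_def
  link_arc_def)

definition scanned :: "(nat \<Rightarrow> nat) \<Rightarrow> nat \<Rightarrow> nat \<Rightarrow> nat set" where
  "scanned queue front current = {f. f < m \<and> ((\<exists>j. Suc j < front \<and> src f = queue j) \<or>
    (0 < front \<and> src f = queue (front - 1) \<and> current \<le> f))}"

text \<open>
  In each step an arc is scanned or a vertex is taken from the queue, so after \<open>n + m + 1\<close> steps
  the queue is exhausted.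
\<close>

definition search_inv :: "nat \<Rightarrow> (nat \<Rightarrow> nat) \<Rightarrow> (nat \<Rightarrow> nat) \<Rightarrow> nat \<Rightarrow> nat \<Rightarrow> nat \<Rightarrow> (nat \<Rightarrow> real) \<Rightarrow> bool" where
  "search_inv i seen queue front back current pot \<longleftrightarrow>
    front \<le> back \<and> inj_on queue {..<back} \<and> queue ` {..<back} \<subseteq> {..<n} \<and>
    (\<forall>v. seen v \<noteq> 0 \<longleftrightarrow> v \<in> queue ` {..<back}) \<and> seen s \<noteq> 0 \<and> (front = 0 \<longrightarrow> current = 0) \<and>
    (current \<noteq> 0 \<longrightarrow> current \<le> m \<and> src (current - 1) = queue (front - 1)) \<and>
    (\<forall>f \<in> scanned queue front current. seen (dst f) \<noteq> 0) \<and>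
    (front = back \<and> current = 0 \<or> i \<le> front + card (scanned queue front current)) \<and>
    ((\<forall>e<m. forward e) \<and> d s = 0 \<longrightarrow> (\<forall>v. seen v \<noteq> 0 \<longrightarrow> pot v = d v))"

lemma search_invD:
  assumes "search_inv i seen queue front back current pot"
  shows "front \<le> back" "inj_on queue {..<back}" "queue ` {..<back} \<subseteq> {..<n}"
    "seen v \<noteq> 0 \<longleftrightarrow> v \<in> queue ` {..<back}" "seen s \<noteq> 0" "front = 0 \<Longrightarrow> current = 0"
    "current \<noteq> 0 \<Longrightarrow> current \<le> m \<and> src (current - 1) = queue (front - 1)"
    "f \<in> scanned queue front current \<Longrightarrow> seen (dst f) \<noteq> 0"
    "front = back \<and> current = 0 \<or> i \<le> front + card (scanned queue front current)"
    "\<forall>e<m. forward e \<Longrightarrow> d s = 0 \<Longrightarrow> seen v \<noteq> 0 \<Longrightarrow> pot v = d v"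
  using assms unfolding search_inv_def by blast+

lemma search_invI:
  assumes "front \<le> back" "inj_on queue {..<back}" "queue ` {..<back} \<subseteq> {..<n}"
    "\<And>v. seen v \<noteq> 0 \<longleftrightarrow> v \<in> queue ` {..<back}" "seen s \<noteq> 0" "front = 0 \<Longrightarrow> current = 0"
    "current \<noteq> 0 \<Longrightarrow> current \<le> m \<and> src (current - 1) = queue (front - 1)"
    "\<And>f. f \<in> scanned queue front current \<Longrightarrow> seen (dst f) \<noteq> 0"
    "front = back \<and> current = 0 \<or> i \<le> front + card (scanned queue front current)"
    "\<And>v. \<forall>e<m. forward e \<Longrightarrow> d s = 0 \<Longrightarrow> seen v \<noteq> 0 \<Longrightarrow> pot v = d v"
  shows "search_inv i seen queue front back current pot"
  using assms unfolding search_inv_def by blast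

lemma scanned_cong: "(\<And>j. j < front \<Longrightarrow> queue j = queue' j) \<Longrightarrow> scanned queue front current =
  scanned queue' front current"
  unfolding scanned_def by (auto simp: Suc_lessD)

lemma search_inv_idle:
  assumes "search_inv i seen queue front back 0 pot" "\<not> front < back"
  shows "search_inv (Suc i) seen queue front back 0 pot"
  using assms unfolding search_inv_def by (elim conjE) (intro conjI; (assumption | simp))

lemma search_inv_visit:
  assumes inv: "search_inv i seen queue front back current pot" and current: "current \<noteq> 0"
    and v: "v = dst (current - 1)" "seen v = 0"
  shows "search_inv i (seen(v := Suc 0)) (queue(back := v)) front (Suc back) current
    (pot(v := pot (src (current - 1)) + w (current - 1)))"
proof -
  note inv' = search_invD[OF inv]
  have front: "front \<le> back" "0 < front" using inv'(1,6) current by auto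
  have arc: "current - 1 < m" "src (current - 1) = queue (front - 1)" using inv'(7) current by auto
  have v_new: "v \<notin> queue ` {..<back}" using inv'(4)[of v] v(2) by simp
  have queue: "(queue(back := v)) ` {..<Suc back} = insert v (queue ` {..<back})"
    by (auto simp: lessThan_Suc image_def)
  have "queue (front - 1) \<in> queue ` {..<back}" using front by auto
  then have tail_seen: "seen (src (current - 1)) \<noteq> 0" using inv'(4) arc(2) by simp
  have scanned: "scanned (queue(back := v)) front current = scanned queue front current"
    by (rule scanned_cong) (use front in simp)
  show ?thesis
  proof (rule search_invI)
    show "inj_on (queue(back := v)) {..<Suc back}" using inv'(2) v_new
      by (auto simp: lessThan_Suc inj_on_def)
    show "(seen(v := Suc 0)) u \<noteq> 0 \<longleftrightarrow> u \<in> (queue(back := v)) ` {..<Suc back}" for u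
      unfolding queue using inv'(4)[of u] by simp
    show "(pot(v := pot (src (current - 1)) + w (current - 1))) u = d u"
      if "\<forall>e<m. forward e" "d s = 0" "(seen(v := Suc 0)) u \<noteq> 0" for u
    proof (cases "u = v")
      case True
      then show ?thesis
        using inv'(10)[OF that(1,2) tail_seen] that(1) arc(1) v(1) tight[of "current - 1"]
          forwardD(2) by simp
    qed (use inv'(10) that in simp)
    show "(queue(back := v)) ` {..<Suc back} \<subseteq> {..<n}" unfolding queue
      using inv'(3) dst_less arc(1) v(1) by simp
    show "(seen(v := Suc 0)) (dst f) \<noteq> 0" if "f \<in> scanned (queue(back := v)) front current" for f
      using inv'(8) that unfolding scanned by simp
    show "front = Suc back \<and> current = 0 \<or> i \<le> front + card (scanned (queue(back := v)) front current)"
      using inv'(9) current unfolding scanned by blast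
  qed (use inv'(1,5,7) front arc current in auto)
qed

lemma search_inv_next:
  assumes inv: "search_inv i seen queue front back current pot" and current: "current \<noteq> 0"
    and v: "seen (dst (current - 1)) \<noteq> 0"
    and next_arc: "last_out_before (src (current - 1)) (current - 1) p"
  shows "search_inv (Suc i) seen queue front back p pot"
proof -
  note inv' = search_invD[OF inv]
  have arc: "current - 1 < m" "src (current - 1) = queue (front - 1)" "0 < front" "front \<le> back"
    using inv'(1,6,7) current by auto
  have "p \<le> f \<longleftrightarrow> f = current - 1 \<or> current \<le> f" if "src f = queue (front - 1)" for f
    using next_arc that arc(2) current unfolding last_out_before_def by (cases "f < current - 1") auto
  then have scanned: "scanned queue front p = insert (current - 1) (scanned queue front current)"
    unfolding scanned_def using arc by blast
  have "queue j \<noteq> queue (front - 1)" if "Suc j < front" for j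
  proof -
    have "j < back" "front - 1 < back" "j \<noteq> front - 1" using that arc by auto
    then show ?thesis using inj_onD[OF inv'(2), of j "front - 1"] by auto
  qed
  then have "current - 1 \<notin> scanned queue front current" using current arc(2) unfolding scanned_def
    by force
  moreover have "finite (scanned queue front current)" unfolding scanned_def by simp
  ultimately have card: "card (scanned queue front p) = Suc (card (scanned queue front current))"
    unfolding scanned by simp
  show ?thesis
  proof (rule search_invI)
    show "seen (dst f) \<noteq> 0" if "f \<in> scanned queue front p" for f using inv'(8) v that
      unfolding scanned by auto
    show "front = back \<and> p = 0 \<or> Suc i \<le> front + card (scanned queue front p)"
      using inv'(9) current unfolding card by auto
  qed (use inv'(1-5,10) next_arc arc in \<open>auto simp: last_out_before_def\<close>)
qed

lemma search_inv_pop: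
  assumes inv: "search_inv i seen queue front back 0 pot" and nonempty: "front < back"
    and first_arc: "last_out_before (queue front) m p"
  shows "search_inv (Suc i) seen queue (Suc front) back p pot"
proof -
  note inv' = search_invD[OF inv]
  have "\<not> (f < m \<and> src f = queue front \<and> p \<le> f)" for f using first_arc
    by (auto simp: last_out_before_def)
  moreover have "j < front \<longleftrightarrow> Suc j < front \<or> 0 < front \<and> j = front - 1" for j by auto
  then have "(\<exists>j. j < front \<and> src f = queue j) \<longleftrightarrow>
    (\<exists>j. Suc j < front \<and> src f = queue j) \<or> (0 < front \<and> src f = queue (front - 1))" for f
    by metis
  ultimately have scanned: "scanned queue (Suc front) p = scanned queue front 0"
    unfolding scanned_def by auto
  show ?thesis
  proof (rule search_invI)
    show "seen (dst f) \<noteq> 0" if "f \<in> scanned queue (Suc front) p" for f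
      using inv'(8) that unfolding scanned by blast
    show "Suc front = back \<and> p = 0 \<or> Suc i \<le> Suc front + card (scanned queue (Suc front) p)"
      using inv'(9) nonempty unfolding scanned by auto
  qed (use inv'(1-5,10) first_arc nonempty in \<open>auto simp: last_out_before_def\<close>)
qed

lemma search_inv_done:
  assumes inv: "search_inv (n + m + 1) seen queue front back current pot"
    and no_back: "\<forall>e<m. forward e" "d s = 0" and v: "v < n"
  shows "pot v = d v"
proof -
  note inv' = search_invD[OF inv]
  have "back \<le> n" using inv'(2,3) card_mono[of "{..<n}" "queue ` {..<back}"] by (simp add: card_image)
  moreover have "card (scanned queue front current) \<le> m"
    using card_mono[of "{..<m}" "scanned queue front current"] by (auto simp: scanned_def)
  ultimately have exhausted: "front = back" "current = 0" using inv'(1,9) by auto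
  have closed: "seen (dst e) \<noteq> 0" if "seen (src e) \<noteq> 0" "e < m" for e
  proof -
    have "src e \<in> queue ` {..<back}" using that(1) inv'(4) by blast
    then obtain j where "j < back" "src e = queue j" by blast
    then have "Suc j < front \<and> src e = queue j \<or> 0 < front \<and> src e = queue (front - 1) \<and> current \<le> e"
      using exhausted by (cases "Suc j = front") auto
    then have "e \<in> scanned queue front current" using that(2) unfolding scanned_def by blast
    then show ?thesis by (rule inv'(8))
  qed
  have "seen v \<noteq> 0" using reachable_from_s[OF v]
    by (induction rule: rtrancl_induct) (use inv'(5) closed in blast)+
  then show ?thesis using inv'(10) no_back by blast
qed

abbreviation search_state :: "nat \<Rightarrow> ram_state \<Rightarrow> bool" where
  "search_state i \<tau> \<equiv> search_inv i (nmem \<tau> Seen) (nmem \<tau> Queue) (nmem \<tau> Front 0) (nmem \<tau> Back 0)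
    (nmem \<tau> Current 0) (rmem \<tau> Potential)"

lemma search_state_step:
  assumes inv: "search_state i \<tau>" and input: "has_input \<tau>" and lists: "out_lists \<tau>"
  shows "search_state (Suc i) (run search_step \<tau>)"
proof (cases "nmem \<tau> Current 0 = 0")
  case True
  show ?thesis
  proof (cases "nmem \<tau> Front 0 < nmem \<tau> Back 0")
    case nonempty: True
    show ?thesis
      using search_inv_pop[OF inv[unfolded True] nonempty] lists True nonempty
      by (simp add: search_step_def out_lists_def)
  next
    case False
    then show ?thesis using search_inv_idle[OF inv[unfolded True]] True by (simp add: search_step_def)
  qed
next
  case False
  let ?e = "nmem \<tau> Current 0 - 1"
  have e: "?e < m" "nmem \<tau> Current 0 - Suc 0 < m" using search_invD(7)[OF inv False] False by auto
  have next_arc: "last_out_before (src ?e) ?e (nmem \<tau> Next_Out ?e)" using lists e(1)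
    by (simp add: out_lists_def)
  show ?thesis
  proof (cases "nmem \<tau> Seen (dst ?e) = 0")
    case True
    show ?thesis
      using search_inv_next[OF search_inv_visit[OF inv False refl True] False _ next_arc] False True
      by (simp add: search_step_def has_inputD[OF input] e(2))
  next
    case seen: False
    show ?thesis
      using search_inv_next[OF inv False seen next_arc] False seen
      by (simp add: search_step_def has_inputD[OF input] e(2))
  qed
qed

lemma runs_search:
  assumes input: "has_input \<sigma>" and lists: "out_lists \<sigma>"
    and empty: "\<And>a. a \<in> {Seen, Queue, Front, Back, Current} \<Longrightarrow> nmem \<sigma> a = (\<lambda>_. 0)"
      "rmem \<sigma> Potential = (\<lambda>_. 0)"
  shows "runs search \<sigma> (\<lambda>\<tau>. (\<forall>e<m. forward e) \<longrightarrow> d s = 0 \<longrightarrow> (\<forall>v<n. rmem \<tau> Potential v = d v))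
    (20 + (n + m + 2) * 100)"
  unfolding search_def
proof (rule runs_Seq)
  show "runs search_init \<sigma> (\<lambda>\<tau>. \<tau> = run search_init \<sigma>) 20"
    by (rule runs_run) (simp_all add: search_init_def)
  fix \<tau> assume \<tau>: "\<tau> = run search_init \<sigma>" and frame: "frame search_init \<sigma> \<tau>"
  have input1: "has_input \<tau>" by (rule has_input_frame[OF input frame]) auto
  have lists1: "out_lists \<tau>" using lists frameD(1)[OF frame] by (simp add: out_lists_def)
  let ?bound = "NAdd (NAdd num_verts num_arcs) (NConst 1)"
  have "runs (For Index ?bound search_step) \<tau>
     (\<lambda>\<tau>. (\<forall>e<m. forward e) \<longrightarrow> d s = 0 \<longrightarrow> (\<forall>v<n. rmem \<tau> Potential v = d v)) ((n + m + 1 + 1) * 100)"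
  proof (rule runs_For_run[where I = search_state],
    goal_cases bound fresh stable loop_free init step exit time)
    case init
    show ?case unfolding \<tau> search_init_def
      using empty has_inputD(3)[OF input] s_less by (auto simp: search_inv_def scanned_def inj_on_def)
  next
    case (step i \<tau>')
    have "has_input \<tau>'" by (rule has_input_frame[OF input1 step(4)]) auto
    moreover have "out_lists \<tau>'" using lists1 frameD(1)[OF step(4)] by (simp add: out_lists_def)
    ultimately show ?case using search_state_step step(3) by blast
  qed (use search_inv_done in \<open>auto simp: fresh_counter_def has_inputD[OF input1] search_step_def\<close>)
  then show "runs (For Index ?bound search_step) \<tau>
     (\<lambda>\<tau>. (\<forall>e<m. forward e) \<longrightarrow> d s = 0 \<longrightarrow> (\<forall>v<n. rmem \<tau> Potential v = d v)) ((n + m + 2) * 100)" by simp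
qed

lemma runs_tight_check:
  assumes input: "has_input \<sigma>" and init: "nmem \<sigma> Not_Tight 0 = 0"
  shows "runs tight_check \<sigma>
    (\<lambda>\<tau>. nmem \<tau> Not_Tight 0 = 0 \<longleftrightarrow>
      (\<forall>e<m. rmem \<sigma> Potential (src e) + w e = rmem \<sigma> Potential (dst e))) ((m + 1) * 60)"
  unfolding tight_check_def
proof (rule runs_For_run[where I = "\<lambda>i \<tau>. (nmem \<tau> Not_Tight 0 = 0 \<longleftrightarrow>
      (\<forall>e<i. rmem \<sigma> Potential (src e) + w e = rmem \<sigma> Potential (dst e)))"],
    goal_cases bound fresh stable loop_free init step exit time)
  case (step i \<tau>)
  have input1: "has_input \<tau>" by (rule has_input_frame[OF input step(4)]) auto
  have "rmem \<tau> Potential = rmem \<sigma> Potential" using frameD(2)[OF step(4)] by simp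
  then show ?case using step(1-3) by (auto simp: has_inputD[OF input1] less_Suc_eq)
qed (auto simp: fresh_counter_def has_inputD[OF input] init)

definition precheck_time :: nat where
  "precheck_time = (m + 1) * 40 + (20 + (n + m + 2) * 100 + (m + 1) * 60)"

definition potential :: "(nat \<Rightarrow> real) \<Rightarrow> bool" where
  "potential pot \<longleftrightarrow> (\<forall>e<m. pot (src e) + w e = pot (dst e))"

lemma runs_precheck:
  assumes input: "has_input \<sigma>"
    and empty: "\<And>a. a \<in> {20..27} \<Longrightarrow> nmem \<sigma> a = (\<lambda>_. 0)" "rmem \<sigma> Potential = (\<lambda>_. 0)" and "d s = 0"
  shows "runs precheck \<sigma> (\<lambda>\<tau>. if nmem \<tau> Not_Tight 0 = 0 then \<exists>pot. potential pot
    else \<exists>e<m. \<not> forward e) precheck_time"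
proof -
  obtain \<tau>1 where \<tau>1: "reaches adjacency \<sigma> ((m + 1) * 40) \<tau>1" "frame adjacency \<sigma> \<tau>1" "out_lists \<tau>1"
    by (rule runsE[OF runs_adjacency[OF input]]) (use empty in auto)
  have input1: "has_input \<tau>1" by (rule has_input_frame[OF input \<tau>1(2)]) auto
  obtain \<tau>2 where \<tau>2: "reaches search \<tau>1 (20 + (n + m + 2) * 100) \<tau>2" "frame search \<tau>1 \<tau>2"
    "(\<forall>e<m. forward e) \<longrightarrow> d s = 0 \<longrightarrow> (\<forall>v<n. rmem \<tau>2 Potential v = d v)"
    by (rule runsE[OF runs_search[OF input1 \<tau>1(3)]]) (use empty frameD[OF \<tau>1(2)] in auto)
  have input2: "has_input \<tau>2" by (rule has_input_frame[OF input1 \<tau>2(2)]) auto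
  obtain \<tau>3 where \<tau>3: "reaches tight_check \<tau>2 ((m + 1) * 60) \<tau>3"
    "nmem \<tau>3 Not_Tight 0 = 0 \<longleftrightarrow> potential (rmem \<tau>2 Potential)"
    unfolding potential_def
    by (rule runsE[OF runs_tight_check[OF input2]]) (use empty frameD[OF \<tau>1(2)] frameD[OF \<tau>2(2)] in auto)
  have "potential (rmem \<tau>2 Potential)" if "\<forall>e<m. forward e"
    unfolding potential_def
    using \<tau>2(3) \<open>d s = 0\<close> that tight forwardD(2) src_less dst_less by simp
  then show ?thesis
    unfolding precheck_def
    by (intro runsI[OF reaches_Seq[OF \<tau>1(1) reaches_Seq[OF \<tau>2(1) \<tau>3(1)]]])
      (use \<tau>3(2) in \<open>auto simp: precheck_time_def\<close>)
qed

lemma path_excess_potential: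
  assumes "potential pot" "path a S b k"
  shows "k = (pot b - pot a) - (d b - d a)"
  using assms(2)
proof (induction rule: path_in.induct)
  case (cons e S b k)
  then have "pot (src e) + w e = pot (dst e)" using assms(1) by (simp add: potential_def)
  then show ?case using cons.IH by (simp add: excess_def)
qed simp

lemma potential_no_nonshortest:
  assumes "potential pot"
  shows "\<not> nonshortest_excess k"
proof
  assume "nonshortest_excess k"
  then obtain S where S: "path s S t k" "0 < k" unfolding nonshortest_excess_def by blast
  obtain T where "forward_path s T t" using ex_forward_path_from_s t_less by blast
  then show False using path_excess_potential[OF assms S(1)] path_excess_potential[OF assms] S(2)
    by fastforce
qed

end

section \<open>Levels and orders\<close>

abbreviation (input) Level :: nat where "Level \<equiv> 3"
abbreviation (input) Is_Forward :: nat where "Is_Forward \<equiv> 36"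
abbreviation (input) Rank :: nat where "Rank \<equiv> 37"
abbreviation (input) Rev_Order :: nat where "Rev_Order \<equiv> 38"
abbreviation (input) Some_Out :: nat where "Some_Out \<equiv> 39"
abbreviation (input) Some_In :: nat where "Some_In \<equiv> 40"
abbreviation (input) Back_Tail :: nat where "Back_Tail \<equiv> 41"
abbreviation (input) Back_Head :: nat where "Back_Head \<equiv> 42"
abbreviation (input) Times_N :: nat where "Times_N \<equiv> 43"
abbreviation (input) Times_N2 :: nat where "Times_N2 \<equiv> 44"

definition distances_init :: com where
  "distances_init = Source ::= start_vertex ;; Rounds ::= num_verts"

definition distances :: com where
  "distances =
    For Index num_arcs (Order\<langle>var Index\<rangle> ::= var Index) ;;
    distances_init ;;
    shortest_paths ;;
    For Index num_verts (Level\<langle>var Index\<rangle>\<^sub>r ::= Path_Dist\<langle>var Index\<rangle>\<^sub>r)"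

definition classify_step :: com where
  "classify_step = IfThenElse (RLess (Level\<langle>Src\<langle>var Index\<rangle>\<rangle>\<^sub>r) (Level\<langle>Dst\<langle>var Index\<rangle>\<rangle>\<^sub>r))
    (Is_Forward\<langle>var Index\<rangle> ::= NConst 1 ;;
     Some_Out\<langle>Src\<langle>var Index\<rangle>\<rangle> ::= var Index ;;
     Some_In\<langle>Dst\<langle>var Index\<rangle>\<rangle> ::= var Index)
    (Back_Tail\<langle>Src\<langle>var Index\<rangle>\<rangle> ::= NConst 1 ;;
     Back_Head\<langle>Dst\<langle>var Index\<rangle>\<rangle> ::= NConst 1)"

definition classify :: com where
  "classify = For Index num_arcs classify_step"

definition rank_test :: bexp where
  "rank_test =
    (RLess (Level\<langle>Src\<langle>var Index2\<rangle>\<rangle>\<^sub>r) (Level\<langle>Src\<langle>var Index\<rangle>\<rangle>\<^sub>r) OR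
     BNot (RLess (Level\<langle>Src\<langle>var Index\<rangle>\<rangle>\<^sub>r) (Level\<langle>Src\<langle>var Index2\<rangle>\<rangle>\<^sub>r)) AND NLess (var Index2)
       (var Index))"

definition rank :: com where
  "rank = For Index num_arcs (For Index2 num_arcs
    (When rank_test (Rank\<langle>var Index\<rangle> ::= NAdd (Rank\<langle>var Index\<rangle>) (NConst 1))))"

definition arrange :: com where
  "arrange = For Index num_arcs
    (Order\<langle>Rank\<langle>var Index\<rangle>\<rangle> ::= var Index ;;
     Rev_Order\<langle>NSub (NSub num_arcs (NConst 1)) (Rank\<langle>var Index\<rangle>)\<rangle> ::= var Index)"

definition count_heads :: com where
  "count_heads = Rounds ::= NConst 1 ;;
    For Index num_verts (When (Nonzero (Back_Head\<langle>var Index\<rangle>))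
      (Rounds ::= NAdd (var Rounds) (NConst 1)))"

definition multiples :: "nat \<Rightarrow> nexp \<Rightarrow> com" where
  "multiples a x = For Index num_verts (a\<langle>NAdd (var Index) (NConst 1)\<rangle> ::= NAdd (a\<langle>var Index\<rangle>) x)"

definition prepare :: com where
  "prepare = distances ;; classify ;; rank ;; arrange ;; count_heads ;;
    multiples Times_N num_verts ;; multiples Times_N2 (Times_N\<langle>num_verts\<rangle>)"

lemma prepare_writes [simp]:
  "nat_writes distances_init = {Source, Rounds}" "real_writes distances_init = {}"
  "nat_writes distances = {Vertex, Round, Position, Arc, Index, Order, Reached, Parent, Source, Rounds}"
  "real_writes distances = {Path_Dist, Level}"
  "nat_writes classify = {Index, Is_Forward, Some_Out, Some_In, Back_Tail, Back_Head}"
  "real_writes classify = {}"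
  "nat_writes rank = {Index, Index2, Rank}" "real_writes rank = {}"
  "nat_writes arrange = {Index, Order, Rev_Order}" "real_writes arrange = {}"
  "nat_writes count_heads = {Index, Rounds}" "real_writes count_heads = {}"
  "nat_writes (multiples a x) = {Index, a}" "real_writes (multiples a x) = {}"
  "nat_writes prepare =
    {Vertex, Round, Position, Arc, Index, Index2, Order, Reached, Parent, Source, Rounds,
    Is_Forward, Rank, Rev_Order, Some_Out, Some_In, Back_Tail, Back_Head, Times_N, Times_N2}"
  "real_writes prepare = {Path_Dist, Level}"
  by (auto simp: distances_init_def distances_def classify_step_def classify_def rank_def arrange_def
      count_heads_def multiples_def prepare_def)

context layered_arcs
begin

definition has_levels :: "ram_state \<Rightarrow> bool" where
  "has_levels \<tau> \<longleftrightarrow> (\<forall>v<n. rmem \<tau> Level v = d v)"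

lemma shortest_inv_levels:
  assumes inv: "shortest_inv ord {} s n 0 \<tau>" and ord: "enumerates ord ps" and "d s = 0" and v: "v < n"
  shows "rmem \<tau> Path_Dist v = d v"
proof -
  have tree: "parent_tree {} s (nmem \<tau> Reached) (rmem \<tau> Path_Dist) (nmem \<tau> Parent)"
    using inv by (simp add: shortest_inv_def)
  obtain S where S: "forward_path s S v" using ex_forward_path_from_s[OF v] by blast
  have "card S \<le> n" using path_inD(3)[OF S] card_mono[of "{..<n}" S] by simp
  then have "relaxed_walk ord {} s n 0 v (d v)"
    using relaxed_walk_mono[OF relaxed_walk_forward_path[OF ord S]] \<open>d s = 0\<close>
    by (cases "card S = n") auto
  then have "nmem \<tau> Reached v \<noteq> 0" "rmem \<tau> Path_Dist v \<le> d v"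
    using inv by (auto simp: shortest_inv_def relaxed_def)
  then show ?thesis using parent_tree_dist_ge[OF tree v] \<open>d s = 0\<close> by simp
qed

definition distances_time :: nat where
  "distances_time = (m + 1) * 20 + (10 + (shortest_paths_time n + (n + 1) * 20))"

lemma runs_distances:
  assumes input: "has_input \<sigma>" and empty: "nmem \<sigma> Removed = (\<lambda>_. 0)" and "d s = 0"
  shows "runs distances \<sigma> has_levels distances_time"
proof -
  let ?order = "For Index num_arcs (Order\<langle>var Index\<rangle> ::= var Index)"
  let ?copy = "For Index num_verts (Level\<langle>var Index\<rangle>\<^sub>r ::= Path_Dist\<langle>var Index\<rangle>\<^sub>r)"
  have "runs ?order \<sigma> (\<lambda>\<tau>. \<forall>i<m. nmem \<tau> Order i = i) ((m + 1) * 20)"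
    by (rule runs_For_run[where I = "\<lambda>i \<tau>. \<forall>j<i. nmem \<tau> Order j = j"])
      (auto simp: fresh_counter_def has_inputD[OF input] less_Suc_eq)
  then obtain \<tau>1 where \<tau>1: "reaches ?order \<sigma> ((m + 1) * 20) \<tau>1" "frame ?order \<sigma> \<tau>1"
    "\<forall>i<m. nmem \<tau>1 Order i = i"
    by (rule runsE)
  have input1: "has_input \<tau>1" by (rule has_input_frame[OF input \<tau>1(2)]) auto
  let ?\<tau>2 = "run distances_init \<tau>1"
  have \<tau>2: "reaches distances_init \<tau>1 10 ?\<tau>2" by (rule reaches_run) (simp_all add: distances_init_def)
  have input2: "has_input ?\<tau>2" by (rule has_input_frame[OF input1 reaches_frame[OF \<tau>2]]) auto
  have order: "nmem ?\<tau>2 Order i = i" if "i < m" for i using \<tau>1(3) that by (simp add: distances_init_def)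
  have enum: "enumerates (nmem ?\<tau>2 Order) (\<lambda>e. e)" using order by (simp add: enumerates_def)
  have vars: "nmem ?\<tau>2 Source 0 = s" "nmem ?\<tau>2 Rounds 0 = n" "{v. nmem ?\<tau>2 Removed v \<noteq> 0} = {}"
    using has_inputD[OF input1] frameD(1)[OF \<tau>1(2)] empty by (simp_all add: distances_init_def)
  obtain \<tau>3 where \<tau>3: "reaches shortest_paths ?\<tau>2 (shortest_paths_time n) \<tau>3"
    "frame shortest_paths ?\<tau>2 \<tau>3"
    "shortest_inv (nmem ?\<tau>2 Order) {} s n 0 \<tau>3"
    by (rule runsE[OF runs_shortest_paths[OF input2 _ vars(1) s_less vars(2)]])
      (use order vars(3) in simp_all)
  have input3: "has_input \<tau>3" by (rule has_input_frame[OF input2 \<tau>3(2)]) auto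
  have "runs ?copy \<tau>3 has_levels ((n + 1) * 20)"
  proof (rule runs_For_run[where I = "\<lambda>i \<tau>. \<forall>v<i. rmem \<tau> Level v = d v"],
      goal_cases bound fresh stable loop_free init step exit time)
    case (step i \<tau>)
    have "rmem \<tau> Path_Dist i = d i"
      using shortest_inv_levels[OF \<tau>3(3) enum \<open>d s = 0\<close> step(1)] frameD(2)[OF step(4)] by simp
    then show ?case using step(2,3) by (auto simp: less_Suc_eq)
  qed (auto simp: fresh_counter_def has_inputD[OF input3] has_levels_def)
  then obtain \<tau>4 where \<tau>4: "reaches ?copy \<tau>3 ((n + 1) * 20) \<tau>4" "has_levels \<tau>4" by (rule runsE)
  show ?thesis
    unfolding distances_def
    by (rule runsI[OF reaches_Seq[OF \<tau>1(1) reaches_Seq[OF \<tau>2 reaches_Seq[OF \<tau>3(1) \<tau>4(1)]]]])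
      (use \<tau>4(2) in \<open>simp_all add: distances_time_def\<close>)
qed

definition classified_upto :: "nat \<Rightarrow> ram_state \<Rightarrow> bool" where
  "classified_upto i \<tau> \<longleftrightarrow> (\<forall>e. nmem \<tau> Is_Forward e \<noteq> 0 \<longleftrightarrow> e < i \<and> forward e) \<and>
    (\<forall>e<i. forward e \<longrightarrow> forward (nmem \<tau> Some_Out (src e)) \<and> src (nmem \<tau> Some_Out (src e)) = src e) \<and>
    (\<forall>e<i. forward e \<longrightarrow> forward (nmem \<tau> Some_In (dst e)) \<and> dst (nmem \<tau> Some_In (dst e)) = dst e) \<and>
    (\<forall>v. nmem \<tau> Back_Tail v \<noteq> 0 \<longleftrightarrow> (\<exists>e<i. \<not> forward e \<and> src e = v)) \<and>
    (\<forall>v. nmem \<tau> Back_Head v \<noteq> 0 \<longleftrightarrow> (\<exists>e<i. \<not> forward e \<and> dst e = v))"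

lemma classifiedD:
  assumes "classified_upto m \<tau>"
  shows "nmem \<tau> Is_Forward e \<noteq> 0 \<longleftrightarrow> forward e"
    "forward e \<Longrightarrow> forward (nmem \<tau> Some_Out (src e)) \<and> src (nmem \<tau> Some_Out (src e)) = src e"
    "forward e \<Longrightarrow> forward (nmem \<tau> Some_In (dst e)) \<and> dst (nmem \<tau> Some_In (dst e)) = dst e"
    "nmem \<tau> Back_Tail v \<noteq> 0 \<longleftrightarrow> v \<in> back_tails" "nmem \<tau> Back_Head v \<noteq> 0 \<longleftrightarrow> v \<in> back_heads"
  using assms forwardD(1) src_less dst_less
  unfolding classified_upto_def back_tails_def back_heads_def by auto

lemma runs_classify:
  assumes input: "has_input \<sigma>" and levels: "has_levels \<sigma>"
    and empty: "\<And>a. a \<in> {Is_Forward, Back_Tail, Back_Head} \<Longrightarrow> nmem \<sigma> a = (\<lambda>_. 0)"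
  shows "runs classify \<sigma> (classified_upto m) ((m + 1) * 100)"
  unfolding classify_def
proof (rule runs_For_run[where I = classified_upto],
  goal_cases bound fresh stable loop_free init step exit time)
  case (step i \<tau>)
  have input1: "has_input \<tau>" by (rule has_input_frame[OF input step(4)]) (auto simp: classify_step_def)
  have "rmem \<tau> Level = rmem \<sigma> Level" using frameD(2)[OF step(4)] by (simp add: classify_step_def)
  then have test: "rmem \<tau> Level (src i) < rmem \<tau> Level (dst i) \<longleftrightarrow> forward i"
    using levels step(1) src_less dst_less by (simp add: has_levels_def forward_def)
  note inv = step(3)[unfolded classified_upto_def, THEN conjunct1]
    step(3)[unfolded classified_upto_def, THEN conjunct2, THEN conjunct1]
    step(3)[unfolded classified_upto_def, THEN conjunct2, THEN conjunct2, THEN conjunct1]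
    step(3)[unfolded classified_upto_def, THEN conjunct2, THEN conjunct2, THEN conjunct2]
  show ?case
    using test step(1,2) inv unfolding classified_upto_def
    by (cases "forward i") (simp add: classify_step_def has_inputD[OF input1] less_Suc_eq; safe; blast)+
qed (use empty in \<open>auto simp: fresh_counter_def has_inputD[OF input] classify_step_def
  classified_upto_def\<close>)

definition precedes :: "nat \<Rightarrow> nat \<Rightarrow> bool" where
  "precedes f e \<longleftrightarrow> d (src f) < d (src e) \<or> d (src f) = d (src e) \<and> f < e"

definition arc_rank :: "nat \<Rightarrow> nat" where
  "arc_rank e = card {f. f < m \<and> precedes f e}"

lemma arc_rank_mono: "e < m \<Longrightarrow> f < m \<Longrightarrow> precedes f e \<Longrightarrow> arc_rank f < arc_rank e"
  unfolding arc_rank_def by (intro psubset_card_mono psubsetI) (auto simp: precedes_def)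

lemma arc_rank_less:
  assumes "e < m"
  shows "arc_rank e < m"
proof -
  have "{f. f < m \<and> precedes f e} \<subset> {..<m}" using assms by (auto simp: precedes_def)
  then have "card {f. f < m \<and> precedes f e} < card {..<m}" by (intro psubset_card_mono) auto
  then show ?thesis by (simp add: arc_rank_def)
qed

lemma arc_rank_inj: "e < m \<Longrightarrow> f < m \<Longrightarrow> arc_rank e = arc_rank f \<Longrightarrow> e = f"
  using arc_rank_mono[of e f] arc_rank_mono[of f e] unfolding precedes_def
  by (metis less_irrefl linorder_neqE_nat linorder_neqE_linordered_idom)

lemma runs_rank:
  assumes input: "has_input \<sigma>" and levels: "has_levels \<sigma>" and empty: "nmem \<sigma> Rank = (\<lambda>_. 0)"
  shows "runs rank \<sigma> (\<lambda>\<tau>. \<forall>e<m. nmem \<tau> Rank e = arc_rank e) ((m + 1) * ((m + 1) * 80 + 20))"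
  unfolding rank_def
proof (rule runs_For_const[where I = "\<lambda>i \<tau>. nmem \<tau> Rank = (\<lambda>e. if e < i then arc_rank e else 0)"
      and T = "(m + 1) * 80"], goal_cases bound fresh stable init step exit time)
  case (step i \<tau>)
  have input1: "has_input \<tau>" by (rule has_input_frame[OF input step(4)]) auto
  have levels1: "has_levels \<tau>" using levels frameD(2)[OF step(4)] by (simp add: has_levels_def)
  define partial where "partial j = (\<lambda>e. if e < i then arc_rank e else
    if e = i then card {f. f < j \<and> precedes f i} else 0)" for j
  have i: "i < m" "nmem \<tau> Index 0 = i" using step(1,2) .
  show ?case
  proof (rule runs_For_run[where I = "\<lambda>j \<tau>'. nmem \<tau>' Rank = partial j"],
      goal_cases bound fresh stable loop_free init step exit time)
    case (step j \<tau>')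
    have input2: "has_input \<tau>'" by (rule has_input_frame[OF input1 step(4)]) auto
    have "nmem \<tau>' Index 0 = i" using frameD(1)[OF step(4)] i(2) by simp
    moreover have "rmem \<tau>' Level v = d v" if "v < n" for v
      using levels1 frameD(2)[OF step(4)] that by (simp add: has_levels_def)
    ultimately have test: "bval rank_test \<tau>' \<longleftrightarrow> precedes j i"
      using src_less step(1,2) i(1) by (auto simp: rank_test_def precedes_def has_inputD[OF input2])
    have "{f. f < Suc j \<and> precedes f i} = {f. f < j \<and> precedes f i} \<union> (if precedes j i then {j} else {})"
      by (auto simp: less_Suc_eq)
    then have "card {f. f < Suc j \<and> precedes f i} =
      (if precedes j i then Suc (card {f. f < j \<and> precedes f i}) else card {f. f < j \<and> precedes f i})"
      by (simp add: card_insert_if)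
    then show ?case
      using step(3) \<open>nmem \<tau>' Index 0 = i\<close> by (auto simp: test partial_def fun_eq_iff)
  qed (use step(3) has_inputD[OF input1] in
      \<open>auto simp: fresh_counter_def partial_def arc_rank_def rank_test_def fun_eq_iff less_Suc_eq\<close>)
qed (auto simp: fresh_counter_def has_inputD[OF input] empty)

definition ordered :: "ram_state \<Rightarrow> bool" where
  "ordered \<tau> \<longleftrightarrow> (\<forall>e<m. nmem \<tau> Order (arc_rank e) = e \<and> nmem \<tau> Rev_Order (m - 1 - arc_rank e) = e)"

lemma level_order_arc_rank: "ordered \<tau> \<Longrightarrow> level_order (nmem \<tau> Order) arc_rank"
  unfolding level_order_def enumerates_def ordered_def
  using arc_rank_less arc_rank_mono by (auto simp: precedes_def)

lemma runs_arrange: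
  assumes input: "has_input \<sigma>" and rank: "\<forall>e<m. nmem \<sigma> Rank e = arc_rank e"
  shows "runs arrange \<sigma> ordered ((m + 1) * 40)"
  unfolding arrange_def
proof (rule runs_For_run[where I = "\<lambda>i \<tau>.
      \<forall>e<i. nmem \<tau> Order (arc_rank e) = e \<and> nmem \<tau> Rev_Order (m - 1 - arc_rank e) = e"],
    goal_cases bound fresh stable loop_free init step exit time)
  case (step i \<tau>)
  have input1: "has_input \<tau>" by (rule has_input_frame[OF input step(4)]) auto
  have rank_i: "nmem \<tau> Rank i = arc_rank i" using frameD(1)[OF step(4)] rank step(1) by simp
  have distinct: "arc_rank e \<noteq> arc_rank i" "m - Suc (arc_rank e) \<noteq> m - Suc (arc_rank i)" if "e < i" for e
  proof -
    show "arc_rank e \<noteq> arc_rank i" using arc_rank_inj[of e i] that step(1) by auto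
    then show "m - Suc (arc_rank e) \<noteq> m - Suc (arc_rank i)"
      using arc_rank_less[of e] arc_rank_less[of i] that step(1) by linarith
  qed
  show ?case using step(1-3) distinct by (auto simp: has_inputD[OF input1] rank_i less_Suc_eq)
qed (auto simp: fresh_counter_def has_inputD[OF input] ordered_def)

lemma runs_count_heads:
  assumes input: "has_input \<sigma>" and heads: "\<And>v. nmem \<sigma> Back_Head v \<noteq> 0 \<longleftrightarrow> v \<in> back_heads"
  shows "runs count_heads \<sigma> (\<lambda>\<tau>. nmem \<tau> Rounds 0 = Suc (card back_heads)) (3 + (n + 1) * 40)"
  unfolding count_heads_def
proof (rule runs_Seq)
  let ?\<tau> = "run (Rounds ::= NConst 1) \<sigma>"
  show "runs (Rounds ::= NConst 1) \<sigma> (\<lambda>\<tau>. \<tau> = ?\<tau>) 3" by (rule runs_run) auto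
  fix \<tau> assume \<tau>: "\<tau> = ?\<tau>" and frame: "frame (Rounds ::= NConst 1) \<sigma> \<tau>"
  have input1: "has_input \<tau>" by (rule has_input_frame[OF input frame]) auto
  show "runs (For Index num_verts
    (When (Nonzero (Back_Head\<langle>var Index\<rangle>)) (Rounds ::= NAdd (var Rounds) (NConst 1))))
    \<tau> (\<lambda>\<tau>. nmem \<tau> Rounds 0 = Suc (card back_heads)) ((n + 1) * 40)"
  proof (rule runs_For_run[where I = "\<lambda>i \<tau>. nmem \<tau> Rounds 0 = Suc (card (back_heads \<inter> {..<i}))"],
      goal_cases bound fresh stable loop_free init step exit time)
    case (step i \<tau>')
    have "nmem \<tau>' Back_Head = nmem \<sigma> Back_Head" using frameD(1)[OF step(4)] \<tau> by simp
    moreover have "back_heads \<inter> {..<Suc i} =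
      (if i \<in> back_heads then insert i (back_heads \<inter> {..<i}) else back_heads \<inter> {..<i})"
      by (auto simp: less_Suc_eq)
    ultimately show ?case using step(2,3) heads by simp
  next
    case (exit \<tau>')
    moreover have "back_heads \<inter> {..<n} = back_heads" by (auto simp: back_heads_def)
    ultimately show ?case by simp
  qed (auto simp: fresh_counter_def has_inputD[OF input] \<tau>)
qed

lemma runs_multiples:
  assumes input: "has_input \<sigma>" and empty: "nmem \<sigma> a 0 = 0" and a: "a \<notin> {Header, Src, Dst, Index}"
    and x: "nval x \<sigma> = c" "nat_reads x \<inter> {Index, a} = {}" and "ncost x \<le> 5"
  shows "runs (multiples a x) \<sigma> (\<lambda>\<tau>. \<forall>v\<le>n. nmem \<tau> a v = v * c) ((n + 1) * 30)"
  unfolding multiples_def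
proof (rule runs_For_run[where I = "\<lambda>i \<tau>. \<forall>v\<le>i. nmem \<tau> a v = v * c"],
    goal_cases bound fresh stable loop_free init step exit time)
  case (step i \<tau>)
  have "nval x \<tau> = nval x \<sigma>" by (rule nval_cong, rule frameD(1)[OF step(4)]) (use x(2) in auto)
  then show ?case using step(2,3) a x(1) by (auto simp: le_Suc_eq)
qed (use a empty \<open>ncost x \<le> 5\<close> has_inputD(1)[OF input] in \<open>auto simp: fresh_counter_def\<close>)

definition prepared :: "ram_state \<Rightarrow> bool" where
  "prepared \<tau> \<longleftrightarrow> has_input \<tau> \<and> has_levels \<tau> \<and> classified_upto m \<tau> \<and> ordered \<tau> \<and>
    nmem \<tau> Rounds 0 = Suc (card back_heads) \<and>
    (\<forall>v\<le>n. nmem \<tau> Times_N v = v * n \<and> nmem \<tau> Times_N2 v = v * (n * n))"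

abbreviation (input) prepared_arrays :: "nat set" where
  "prepared_arrays \<equiv> {Header, Src, Dst, Order, Rounds, Is_Forward, Rev_Order, Some_Out, Some_In,
    Back_Tail, Back_Head, Times_N, Times_N2}"

lemma preparedD:
  assumes "prepared \<tau>"
  shows "has_input \<tau>" "v < n \<Longrightarrow> rmem \<tau> Level v = d v" "classified_upto m \<tau>" "ordered \<tau>"
    "nmem \<tau> Rounds 0 = Suc (card back_heads)" "v \<le> n \<Longrightarrow> nmem \<tau> Times_N v = v * n"
    "v \<le> n \<Longrightarrow> nmem \<tau> Times_N2 v = v * (n * n)"
  using assms unfolding prepared_def has_levels_def by auto

lemma prepared_frame:
  assumes "prepared \<sigma>" "frame c \<sigma> \<tau>" "nat_writes c \<inter> prepared_arrays = {}"
    "real_writes c \<inter> {Weight, Level} = {}"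
  shows "prepared \<tau>"
proof -
  have "nmem \<tau> a = nmem \<sigma> a" if "a \<in> prepared_arrays" for a
    using frameD(1)[OF assms(2)] assms(3) that by blast
  moreover have "rmem \<tau> a = rmem \<sigma> a" if "a \<in> {Weight, Level}" for a
    using frameD(2)[OF assms(2)] assms(4) that by blast
  ultimately show ?thesis
    using assms(1) unfolding prepared_def has_input_def has_levels_def classified_upto_def
      ordered_def by simp
qed

definition prepare_time :: nat where
  "prepare_time = distances_time + ((m + 1) * 100 + ((m + 1) * ((m + 1) * 80 + 20) + ((m + 1) * 40 +
    ((3 + (n + 1) * 40) + ((n + 1) * 30 + (n + 1) * 30)))))"

lemma runs_prepare:
  assumes input: "has_input \<sigma>" and empty: "\<And>a. a \<in> {33..44} \<Longrightarrow> nmem \<sigma> a = (\<lambda>_. 0)" and "d s = 0"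
  shows "runs prepare \<sigma> prepared prepare_time"
proof -
  obtain \<tau>1 where \<tau>1: "reaches distances \<sigma> distances_time \<tau>1" "frame distances \<sigma> \<tau>1" "has_levels \<tau>1"
    by (rule runsE[OF runs_distances[OF input]]) (use empty \<open>d s = 0\<close> in auto)
  have input1: "has_input \<tau>1" by (rule has_input_frame[OF input \<tau>1(2)]) auto
  obtain \<tau>2 where \<tau>2: "reaches classify \<tau>1 ((m + 1) * 100) \<tau>2" "frame classify \<tau>1 \<tau>2"
    "classified_upto m \<tau>2"
    by (rule runsE[OF runs_classify[OF input1 \<tau>1(3)]]) (use empty frameD[OF \<tau>1(2)] in auto)
  have input2: "has_input \<tau>2" by (rule has_input_frame[OF input1 \<tau>2(2)]) auto
  have levels2: "has_levels \<tau>2" using \<tau>1(3) frameD[OF \<tau>2(2)] by (simp add: has_levels_def)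
  obtain \<tau>3 where \<tau>3: "reaches rank \<tau>2 ((m + 1) * ((m + 1) * 80 + 20)) \<tau>3" "frame rank \<tau>2 \<tau>3"
    "\<forall>e<m. nmem \<tau>3 Rank e = arc_rank e"
    by (rule runsE[OF runs_rank[OF input2 levels2]])
      (use empty frameD[OF \<tau>1(2)] frameD[OF \<tau>2(2)] in auto)
  have input3: "has_input \<tau>3" by (rule has_input_frame[OF input2 \<tau>3(2)]) auto
  obtain \<tau>4 where \<tau>4: "reaches arrange \<tau>3 ((m + 1) * 40) \<tau>4" "frame arrange \<tau>3 \<tau>4" "ordered \<tau>4"
    by (rule runsE[OF runs_arrange[OF input3 \<tau>3(3)]])
  have input4: "has_input \<tau>4" by (rule has_input_frame[OF input3 \<tau>4(2)]) auto
  have classified4: "classified_upto m \<tau>4"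
    using \<tau>2(3) frameD[OF \<tau>3(2)] frameD[OF \<tau>4(2)] by (simp add: classified_upto_def)
  obtain \<tau>5 where \<tau>5: "reaches count_heads \<tau>4 (3 + (n + 1) * 40) \<tau>5" "frame count_heads \<tau>4 \<tau>5"
    "nmem \<tau>5 Rounds 0 = Suc (card back_heads)"
    by (rule runsE[OF runs_count_heads[OF input4 classifiedD(5)[OF classified4]]])
  have input5: "has_input \<tau>5" by (rule has_input_frame[OF input4 \<tau>5(2)]) auto
  note frames = frameD[OF \<tau>1(2)] frameD[OF \<tau>2(2)] frameD[OF \<tau>3(2)] frameD[OF \<tau>4(2)] frameD[OF \<tau>5(2)]
  obtain \<tau>6 where \<tau>6: "reaches (multiples Times_N num_verts) \<tau>5 ((n + 1) * 30) \<tau>6"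
    "frame (multiples Times_N num_verts) \<tau>5 \<tau>6" "\<forall>v\<le>n. nmem \<tau>6 Times_N v = v * n"
    by (rule runsE[OF runs_multiples[OF input5, of Times_N num_verts n]])
      (use empty frames has_inputD(1)[OF input5] in simp_all)
  have input6: "has_input \<tau>6" by (rule has_input_frame[OF input5 \<tau>6(2)]) auto
  obtain \<tau>7 where \<tau>7: "reaches (multiples Times_N2 (Times_N\<langle>num_verts\<rangle>)) \<tau>6 ((n + 1) * 30) \<tau>7"
    "frame (multiples Times_N2 (Times_N\<langle>num_verts\<rangle>)) \<tau>6 \<tau>7" "\<forall>v\<le>n. nmem \<tau>7 Times_N2 v = v * (n * n)"
    by (rule runsE[OF runs_multiples[OF input6, of Times_N2 "Times_N\<langle>num_verts\<rangle>" "n * n"]])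
      (use empty frames frameD[OF \<tau>6(2)] \<tau>6(3) has_inputD(1)[OF input6] in simp_all)
  have "has_input \<tau>7" by (rule has_input_frame[OF input6 \<tau>7(2)]) auto
  then have "prepared \<tau>7"
    using levels2 classified4 \<tau>4(3) \<tau>5(3) \<tau>6(3) \<tau>7(3) frames frameD[OF \<tau>6(2)] frameD[OF \<tau>7(2)]
    by (simp add: prepared_def has_levels_def classified_upto_def ordered_def)
  moreover have "reaches prepare \<sigma> prepare_time \<tau>7"
    unfolding prepare_def prepare_time_def
    by (rule reaches_Seq \<tau>1(1) \<tau>2(1) \<tau>3(1) \<tau>4(1) \<tau>5(1) \<tau>6(1) \<tau>7(1))+
  ultimately show ?thesis by (intro runsI) auto
qed

end

section \<open>Tables of pairs of disjoint forward paths\<close>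

context layered_arcs
begin

definition pair_cell :: "nat \<Rightarrow> nat \<Rightarrow> nat \<Rightarrow> nat" where
  "pair_cell z a b = z * (n * n) + a * n + b"

lemma pair_cell_inj:
  assumes "a < n" "b < n" "a' < n" "b' < n" "pair_cell z a b = pair_cell z' a' b'"
  shows "z = z' \<and> a = a' \<and> b = b'"
proof -
  have cells: "(z * n + a) * n + b = (z' * n + a') * n + b'"
    using assms(5) by (simp add: pair_cell_def algebra_simps)
  have "b = b'" using arg_cong[OF cells, of "\<lambda>k. k mod n"] assms by simp
  then have rows: "z * n + a = z' * n + a'" using cells assms(1) by simp
  have "a = a'" using arg_cong[OF rows, of "\<lambda>k. k mod n"] assms by simp
  then show ?thesis using rows \<open>b = b'\<close> assms(1) by simp
qed

text \<open>
  The two paths of a pair proceed level by level, so they are disjoint iff they differ on each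
  level. The second one starts at \<open>z\<close>.
\<close>

inductive paired :: "(nat \<Rightarrow> nat) \<Rightarrow> nat \<Rightarrow> nat \<Rightarrow> nat \<Rightarrow> nat \<Rightarrow> bool" for ord :: "nat \<Rightarrow> nat" and z :: nat
  where
  start: "a < n \<Longrightarrow> a \<noteq> z \<Longrightarrow> d a = d z \<Longrightarrow> paired ord z i a z"
| step: "paired ord z j (src (ord j)) (src f) \<Longrightarrow> j < i \<Longrightarrow> i \<le> m \<Longrightarrow> forward (ord j) \<Longrightarrow> forward f \<Longrightarrow>
    dst (ord j) \<noteq> dst f \<Longrightarrow> paired ord z i (dst (ord j)) (dst f)"

lemma paired_SucE:
  assumes "paired ord z (Suc i) a b"
  obtains (earlier) "paired ord z i a b"
  | (added) f where "a = dst (ord i)" "b = dst f" "forward (ord i)" "forward f" "dst (ord i) \<noteq> dst f"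
    "paired ord z i (src (ord i)) (src f)"
  using assms
proof (cases rule: paired.cases)
  case (step j f)
  show ?thesis
  proof (cases "j = i")
    case False
    then have "j < i" "i \<le> m" using step(4,5) by auto
    then show ?thesis using step paired.step that(1) by blast
  qed (use step that(2) in blast)
qed (use that(1) paired.start in blast)

definition topological_order :: "(nat \<Rightarrow> nat) \<Rightarrow> (nat \<Rightarrow> nat) \<Rightarrow> bool" where
  "topological_order ord ps \<longleftrightarrow> enumerates ord ps \<and>
    (\<forall>e f. forward e \<longrightarrow> forward f \<longrightarrow> dst e = src f \<longrightarrow> ps e < ps f)"

lemma topological_order_arc_rank: "ordered \<tau> \<Longrightarrow> topological_order (nmem \<tau> Order) arc_rank"
  using level_order_arc_rank[of \<tau>] forwardD(1,2)
  unfolding topological_order_def level_order_def by metis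

lemma paired_complete:
  assumes ord: "topological_order ord ps"
  shows "low_pair z p q A B \<Longrightarrow> d p = d q \<Longrightarrow> i \<le> m \<Longrightarrow> (\<And>g. forward g \<Longrightarrow> dst g = p \<Longrightarrow> ps g < i) \<Longrightarrow>
    paired ord z i p q"
proof (induction "card B" arbitrary: A p B q i rule: less_induct)
  case less
  have A: "forward_path s A p" and B: "forward_path z B q" and disjoint: "A \<inter> B = {}"
    using less.prems(1) by (auto simp: low_pair_def)
  note A' = path_inD[OF A] and B' = path_inD[OF B]
  show ?case
  proof (cases "q = z")
    case True
    then show ?thesis using paired.start[of p z ord i] A' B' disjoint less.prems(2) by auto
  next
    case False
    then have "d z < d q" using forward_path_levels[OF B B'(6)] forward_path_same_level(1)[OF B] by force
    then have "p \<noteq> s" using level_ge_s[OF B'(1)] less.prems(2) by auto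
    then obtain e where e: "forward e" "src e \<in> A" "dst e = p"
      using forward_path_arc_into[OF A A'(6)] by blast
    obtain f where f: "forward f" "src f \<in> B" "dst f = q"
      using forward_path_arc_into[OF B B'(6) False] by blast
    have "q \<notin> below B (src f)" using forwardD(2)[OF f(1)] f(3) by simp
    then have smaller: "card (below B (src f)) < card B" using B'(4,6) by (intro psubset_card_mono) auto
    have pair: "low_pair z (src e) (src f) (below A (src e)) (below B (src f))"
      using forward_path_below[OF A e(2)] forward_path_below[OF B f(2)] disjoint
      by (auto simp: low_pair_def)
    have levels: "d (src e) = d (src f)"
      using forward_same_src_level[OF e(1) f(1)] e(3) f(3) less.prems(2) by simp
    have e_pos: "ord (ps e) = e" "ps e < m" "\<And>g. forward g \<Longrightarrow> dst g = src e \<Longrightarrow> ps g < ps e"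
      using ord e(1) forwardD(1) by (auto simp: topological_order_def enumerates_def)
    have "paired ord z (ps e) (src e) (src f)"
      by (rule less.hyps[OF smaller pair levels]) (use e_pos in auto)
    moreover have "dst e \<noteq> dst f" using A'(6) B'(6) e(3) f(3) disjoint by auto
    ultimately show ?thesis using paired.step[of ord z "ps e" f i] e_pos(1) e f less.prems(3,4) by simp
  qed
qed

definition linked :: "nat \<Rightarrow> (nat \<Rightarrow> nat) \<Rightarrow> (nat \<Rightarrow> nat) \<Rightarrow> bool" where
  "linked z U1 U2 \<longleftrightarrow> (\<forall>a<n. \<forall>b<n. U1 (pair_cell z a b) \<noteq> 0 \<longrightarrow> a \<noteq> b \<and> d a = d b \<and>
    (b = z \<or> (\<exists>e f. forward e \<and> forward f \<and> U1 (pair_cell z a b) = Suc e \<and> U2 (pair_cell z a b) = Suc f \<and>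
      dst e = a \<and> dst f = b \<and> U1 (pair_cell z (src e) (src f)) \<noteq> 0)))"

lemma linkedD:
  assumes "linked z U1 U2" "a < n" "b < n" "U1 (pair_cell z a b) \<noteq> 0"
  shows "a \<noteq> b" "d a = d b"
    "b \<noteq> z \<Longrightarrow> \<exists>e f. forward e \<and> forward f \<and> U1 (pair_cell z a b) = Suc e \<and> U2 (pair_cell z a b) = Suc f \<and>
      dst e = a \<and> dst f = b \<and> U1 (pair_cell z (src e) (src f)) \<noteq> 0"
  using assms unfolding linked_def by blast+

lemma linked_cong:
  assumes linked: "linked z U1 U2"
    and agree: "\<And>a b. a < n \<Longrightarrow> b < n \<Longrightarrow> V1 (pair_cell z a b) = U1 (pair_cell z a b)"
      "\<And>a b. a < n \<Longrightarrow> b < n \<Longrightarrow> V2 (pair_cell z a b) = U2 (pair_cell z a b)"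
  shows "linked z V1 V2"
  unfolding linked_def
proof (intro allI impI conjI)
  fix a b assume ab: "a < n" "b < n" "V1 (pair_cell z a b) \<noteq> 0"
  then have cell: "U1 (pair_cell z a b) \<noteq> 0" using agree by simp
  note old = linkedD[OF linked ab(1,2) cell]
  show "a \<noteq> b" "d a = d b" using old(1,2) .
  show "b = z \<or> (\<exists>e f. forward e \<and> forward f \<and> V1 (pair_cell z a b) = Suc e \<and> V2 (pair_cell z a b) =
    Suc f \<and>
      dst e = a \<and> dst f = b \<and> V1 (pair_cell z (src e) (src f)) \<noteq> 0)"
    using old(3) agree[OF ab(1,2)] agree(1)[OF forwardD(3) forwardD(3)] by metis
qed

lemma linked_update:
  assumes linked: "linked z U1 U2" and ef: "forward e" "forward f" "dst e \<noteq> dst f"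
    "U1 (pair_cell z (src e) (src f)) \<noteq> 0"
  defines "c \<equiv> pair_cell z (dst e) (dst f)"
  shows "linked z (U1(c := Suc e)) (U2(c := Suc f))"
  unfolding linked_def
proof (intro allI impI)
  let ?U1 = "U1(c := Suc e)" and ?U2 = "U2(c := Suc f)"
  note e = forwardD[OF ef(1)] and f = forwardD[OF ef(2)]
  fix a b assume ab: "a < n" "b < n" "?U1 (pair_cell z a b) \<noteq> 0"
  have kept: "U1 k \<noteq> 0 \<Longrightarrow> ?U1 k \<noteq> 0" for k by simp
  show "a \<noteq> b \<and> d a = d b \<and> (b = z \<or> (\<exists>e f. forward e \<and> forward f \<and> ?U1 (pair_cell z a b) = Suc e \<and>
      ?U2 (pair_cell z a b) = Suc f \<and> dst e = a \<and> dst f = b \<and> ?U1 (pair_cell z (src e) (src f)) \<noteq> 0))"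
  proof (cases "pair_cell z a b = c")
    case True
    then have "a = dst e" "b = dst f" using pair_cell_inj[OF ab(1,2) e(4) f(4)] by (auto simp: c_def)
    moreover have "d (dst e) = d (dst f)"
      using forward_same_dst_level[OF ef(1,2) linkedD(2)[OF linked e(3) f(3) ef(4)]] .
    ultimately show ?thesis using True ef kept[OF ef(4)] by auto
  next
    case False
    then have cell: "U1 (pair_cell z a b) \<noteq> 0" using ab(3) by simp
    show ?thesis using linkedD[OF linked ab(1,2) cell] False kept by auto
  qed
qed

definition filled :: "(nat \<Rightarrow> nat) \<Rightarrow> nat \<Rightarrow> nat \<Rightarrow> nat \<Rightarrow> (nat \<Rightarrow> nat) \<Rightarrow> bool" where
  "filled ord z i j U \<longleftrightarrow> (\<forall>a b. paired ord z i a b \<longrightarrow> U (pair_cell z a b) \<noteq> 0) \<and>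
    (\<forall>f<j. forward (ord i) \<longrightarrow> forward f \<longrightarrow> dst (ord i) \<noteq> dst f \<longrightarrow> paired ord z i (src (ord i)) (src f) \<longrightarrow>
      U (pair_cell z (dst (ord i)) (dst f)) \<noteq> 0)"

lemma filled_mono: "filled ord z i j U \<Longrightarrow> (\<And>k. U k \<noteq> 0 \<Longrightarrow> V k \<noteq> 0) \<Longrightarrow> filled ord z i j V"
  unfolding filled_def by blast

lemma filled_Suc:
  assumes "filled ord z i j U"
    "forward (ord i) \<Longrightarrow> forward j \<Longrightarrow> dst (ord i) \<noteq> dst j \<Longrightarrow> U (pair_cell z (src (ord i)) (src j)) \<noteq> 0 \<Longrightarrow>
      U (pair_cell z (dst (ord i)) (dst j)) \<noteq> 0"
  shows "filled ord z i (Suc j) U"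
  using assms unfolding filled_def less_Suc_eq by blast

lemma filled_next:
  assumes "filled ord z i m U"
  shows "filled ord z (Suc i) 0 U"
proof -
  have "U (pair_cell z a b) \<noteq> 0" if "paired ord z (Suc i) a b" for a b
    using that
  proof (cases rule: paired_SucE)
    case (added f)
    then show ?thesis using assms forwardD(1)[OF added(4)] unfolding filled_def by blast
  qed (use assms in \<open>auto simp: filled_def\<close>)
  then show ?thesis unfolding filled_def by simp
qed

definition agree_off :: "nat \<Rightarrow> (nat \<Rightarrow> nat) \<Rightarrow> (nat \<Rightarrow> nat) \<Rightarrow> bool" where
  "agree_off z U V \<longleftrightarrow> (\<forall>z' a b. z' \<noteq> z \<longrightarrow> a < n \<longrightarrow> b < n \<longrightarrow> U (pair_cell z' a b) = V (pair_cell z' a b))"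

lemma agree_off_upd: "agree_off z U V \<Longrightarrow> a < n \<Longrightarrow> b < n \<Longrightarrow> agree_off z (U(pair_cell z a b := k)) V"
  unfolding agree_off_def using pair_cell_inj[of _ _ a b _ z] by auto

definition pairs_table :: "nat \<Rightarrow> (nat \<Rightarrow> nat) \<Rightarrow> (nat \<Rightarrow> nat) \<Rightarrow> bool" where
  "pairs_table z U1 U2 \<longleftrightarrow> linked z U1 U2 \<and>
    (\<forall>p q A B. low_pair z p q A B \<longrightarrow> d p = d q \<longrightarrow> U1 (pair_cell z p q) \<noteq> 0)"

lemma pairs_table_cong:
  assumes table: "pairs_table z U1 U2" and agree: "agree_off z' V1 U1" "agree_off z' V2 U2" "z \<noteq> z'"
  shows "pairs_table z V1 V2"
  unfolding pairs_table_def
proof (intro conjI allI impI)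
  have same: "V1 (pair_cell z a b) = U1 (pair_cell z a b)" "V2 (pair_cell z a b) = U2 (pair_cell z a b)"
    if "a < n" "b < n" for a b
    using agree that by (simp_all add: agree_off_def)
  show "linked z V1 V2" using table same by (auto simp: pairs_table_def intro: linked_cong)
  fix p q A B assume pair: "low_pair z p q A B" "d p = d q"
  then have "p < n" "q < n" by (auto simp: low_pair_def dest: path_inD)
  moreover have "U1 (pair_cell z p q) \<noteq> 0" using table pair unfolding pairs_table_def by blast
  ultimately show "V1 (pair_cell z p q) \<noteq> 0" using same(1) by simp
qed

definition table_inv :: "(nat \<Rightarrow> nat) \<Rightarrow> nat \<Rightarrow> (nat \<Rightarrow> nat) \<Rightarrow> (nat \<Rightarrow> nat) \<Rightarrow> nat \<Rightarrow> nat \<Rightarrow>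
    (nat \<Rightarrow> nat) \<Rightarrow> (nat \<Rightarrow> nat) \<Rightarrow> bool" where
  "table_inv ord z V1 V2 i j U1 U2 \<longleftrightarrow> linked z U1 U2 \<and> filled ord z i j U1 \<and> agree_off z U1 V1 \<and>
    agree_off z U2 V2"

lemma table_inv_update:
  assumes inv: "table_inv ord z V1 V2 i j U1 U2"
    and ef: "forward (ord i)" "forward j" "dst (ord i) \<noteq> dst j"
      "U1 (pair_cell z (src (ord i)) (src j)) \<noteq> 0"
  defines "c \<equiv> pair_cell z (dst (ord i)) (dst j)"
  shows "table_inv ord z V1 V2 i (Suc j) (U1(c := Suc (ord i))) (U2(c := Suc j))"
proof -
  have linked: "linked z U1 U2" and filled: "filled ord z i j U1" using inv by (auto simp: table_inv_def)
  have "filled ord z i j (U1(c := Suc (ord i)))" using filled by (rule filled_mono) simp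
  then have "filled ord z i (Suc j) (U1(c := Suc (ord i)))" by (rule filled_Suc) (simp add: c_def)
  then show ?thesis
    using inv linked_update[OF linked ef] agree_off_upd[OF _ forwardD(4)[OF ef(1)] forwardD(4)[OF ef(2)]]
    unfolding table_inv_def c_def by blast
qed

lemma table_inv_skip:
  assumes "table_inv ord z V1 V2 i j U1 U2"
    "\<not> (forward (ord i) \<and> forward j \<and> dst (ord i) \<noteq> dst j \<and> U1 (pair_cell z (src (ord i)) (src j)) \<noteq> 0)"
  shows "table_inv ord z V1 V2 i (Suc j) U1 U2"
  using assms filled_Suc unfolding table_inv_def by blast

definition pair_table_time :: "nat \<Rightarrow> nat" where
  "pair_table_time k = (n + 1) * 40 + k * ((n + 1) * 60 + (m + 1) * ((m + 1) * 200))"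

lemma table_inv_pairs_table:
  assumes inv: "table_inv ord z V1 V2 m 0 U1 U2" and ord: "topological_order ord ps"
  shows "pairs_table z U1 U2"
  unfolding pairs_table_def
proof (intro conjI allI impI)
  fix p q A B assume pair: "low_pair z p q A B" "d p = d q"
  have "paired ord z m p q"
    by (rule paired_complete[OF ord pair])
      (use ord forwardD(1) in \<open>auto simp: topological_order_def enumerates_def\<close>)
  then show "U1 (pair_cell z p q) \<noteq> 0" using inv by (simp add: table_inv_def filled_def)
qed (use inv in \<open>simp add: table_inv_def\<close>)

end

subsection \<open>The program\<close>

abbreviation (input) Pair_End :: nat where "Pair_End \<equiv> 16"
abbreviation (input) Pair_Arc :: nat where "Pair_Arc \<equiv> 17"
abbreviation (input) Low_Fst :: nat where "Low_Fst \<equiv> 45"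
abbreviation (input) Low_Snd :: nat where "Low_Snd \<equiv> 46"
abbreviation (input) High_Fst :: nat where "High_Fst \<equiv> 47"
abbreviation (input) High_Snd :: nat where "High_Snd \<equiv> 48"

abbreviation pair_index :: "nexp \<Rightarrow> nexp \<Rightarrow> nexp \<Rightarrow> nexp" where
  "pair_index z a b \<equiv> NAdd (NAdd (Times_N2\<langle>z\<rangle>) (Times_N\<langle>a\<rangle>)) b"

definition pair_start :: "nat \<Rightarrow> com" where
  "pair_start T1 = For Index num_verts
    (When (BNot (Eq (var Index) (var Pair_End)) AND
        BNot (RLess (Level\<langle>var Index\<rangle>\<^sub>r) (Level\<langle>var Pair_End\<rangle>\<^sub>r)) AND
        BNot (RLess (Level\<langle>var Pair_End\<rangle>\<^sub>r) (Level\<langle>var Index\<rangle>\<^sub>r)))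
      (T1\<langle>pair_index (var Pair_End) (var Index) (var Pair_End)\<rangle> ::= NConst 1))"

definition pair_step :: "nat \<Rightarrow> nat \<Rightarrow> nat \<Rightarrow> nat \<Rightarrow> com" where
  "pair_step T H T1 T2 =
    When (Nonzero (Is_Forward\<langle>var Pair_Arc\<rangle>) AND Nonzero (Is_Forward\<langle>var Index2\<rangle>) AND
        BNot (Eq (H\<langle>var Pair_Arc\<rangle>) (H\<langle>var Index2\<rangle>)) AND
        Nonzero (T1\<langle>pair_index (var Pair_End) (T\<langle>var Pair_Arc\<rangle>) (T\<langle>var Index2\<rangle>)\<rangle>))
      (T1\<langle>pair_index (var Pair_End) (H\<langle>var Pair_Arc\<rangle>) (H\<langle>var Index2\<rangle>)\<rangle> ::= NAdd (var Pair_Arc)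
        (NConst 1) ;;
       T2\<langle>pair_index (var Pair_End) (H\<langle>var Pair_Arc\<rangle>) (H\<langle>var Index2\<rangle>)\<rangle> ::= NAdd (var Index2) (NConst 1))"

definition pair_steps :: "nat \<Rightarrow> nat \<Rightarrow> nat \<Rightarrow> nat \<Rightarrow> nat \<Rightarrow> com" where
  "pair_steps T H Ord T1 T2 = For Index num_arcs
    (Pair_Arc ::= Ord\<langle>var Index\<rangle> ;; For Index2 num_arcs (pair_step T H T1 T2))"

definition pair_table :: "nat \<Rightarrow> nat \<Rightarrow> nat \<Rightarrow> nat \<Rightarrow> nat \<Rightarrow> nat \<Rightarrow> com" where
  "pair_table T H Ord Mark T1 T2 = For Pair_End num_verts
    (When (Nonzero (Mark\<langle>var Pair_End\<rangle>)) (pair_start T1 ;; pair_steps T H Ord T1 T2))"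

lemma pair_table_writes [simp]:
  "nat_writes (pair_start T1) = {Index, T1}" "real_writes (pair_start T1) = {}"
  "nat_writes (pair_step T H T1 T2) = {T1, T2}" "real_writes (pair_step T H T1 T2) = {}"
  "loop_free (pair_step T H T1 T2)"
  "nat_writes (pair_steps T H Ord T1 T2) = {Index, Index2, Pair_Arc, T1, T2}"
  "real_writes (pair_steps T H Ord T1 T2) = {}"
  "nat_writes (pair_table T H Ord Mark T1 T2) = {Index, Index2, Pair_End, Pair_Arc, T1, T2}"
  "real_writes (pair_table T H Ord Mark T1 T2) = {}"
  by (auto simp: pair_start_def pair_step_def pair_steps_def pair_table_def)

text \<open>
  Instances of this locale with \<open>src\<close> and \<open>dst\<close> swapped yield the tables for pairs of paths to
  \<open>x\<close> and \<open>t\<close>. The tail of an arc in the input graph is \<open>input_tail\<close>.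
\<close>

locale pair_tables = layered_arcs +
  fixes tail_array head_array order_array mark_array fst_array snd_array some_array root_index :: nat
    and input_tail :: "nat \<Rightarrow> nat"
  assumes arrays: "tail_array \<in> {Src, Dst}" "head_array \<in> {Src, Dst}" "order_array \<in> {Order, Rev_Order}"
      "mark_array \<in> {Back_Tail, Back_Head}" "fst_array \<in> {45..48}" "snd_array \<in> {45..48}"
      "fst_array \<noteq> snd_array"
      "some_array \<in> {Some_Out, Some_In}"
    and input_tail: "input_tail = src \<or> input_tail = dst"
begin

lemma arrays_neq [simp]:
  "tail_array \<noteq> k" "head_array \<noteq> k" "k \<noteq> tail_array" "k \<noteq> head_array" if "2 < k" for k
  using that arrays by auto

lemma table_arrays_neq [simp]:
  "k \<noteq> fst_array" "k \<noteq> snd_array" "fst_array \<noteq> k" "snd_array \<noteq> k" if "k < 45 \<or> 48 < k" for k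
  using that arrays by auto

lemma other_arrays_neq [simp]:
  "k \<noteq> order_array" "k \<noteq> mark_array" "k \<noteq> some_array" "order_array \<noteq> k" "mark_array \<noteq> k" "some_array \<noteq> k"
  if "k < 30 \<or> 44 < k" for k
  using that arrays by auto

lemma table_arrays_distinct [simp]:
  "fst_array \<noteq> snd_array" "snd_array \<noteq> fst_array"
  "tail_array \<noteq> fst_array" "tail_array \<noteq> snd_array" "head_array \<noteq> fst_array" "head_array \<noteq> snd_array"
  "order_array \<noteq> fst_array" "order_array \<noteq> snd_array" "mark_array \<noteq> fst_array" "mark_array \<noteq> snd_array"
  "some_array \<noteq> fst_array" "some_array \<noteq> snd_array"
  using arrays by auto

definition oriented :: "ram_state \<Rightarrow> bool" where
  "oriented \<tau> \<longleftrightarrow> nmem \<tau> Header 0 = n \<and> nmem \<tau> Header (Suc 0) = m \<and> nmem \<tau> Header root_index = s \<and>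
    (\<forall>e<m. nmem \<tau> tail_array e = src e \<and> nmem \<tau> head_array e = dst e \<and> nmem \<tau> Src e = input_tail e \<and>
      (nmem \<tau> Is_Forward e \<noteq> 0 \<longleftrightarrow> forward e)) \<and>
    (\<forall>u<n. \<forall>v<n. rmem \<tau> Level u = rmem \<tau> Level v \<longleftrightarrow> d u = d v) \<and>
    (\<forall>v\<le>n. nmem \<tau> Times_N v = v * n \<and> nmem \<tau> Times_N2 v = v * (n * n)) \<and>
    (\<forall>e. forward e \<longrightarrow> forward (nmem \<tau> some_array (dst e)) \<and> dst (nmem \<tau> some_array (dst e)) = dst e)"

lemma orientedD:
  assumes "oriented \<tau>"
  shows "nmem \<tau> Header 0 = n" "nmem \<tau> Header (Suc 0) = m" "nmem \<tau> Header root_index = s"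
    "e < m \<Longrightarrow> nmem \<tau> tail_array e = src e" "e < m \<Longrightarrow> nmem \<tau> head_array e = dst e"
    "e < m \<Longrightarrow> nmem \<tau> Src e = input_tail e" "e < m \<Longrightarrow> nmem \<tau> Is_Forward e = 0 \<longleftrightarrow> \<not> forward e"
    "u < n \<Longrightarrow> v < n \<Longrightarrow> rmem \<tau> Level u = rmem \<tau> Level v \<longleftrightarrow> d u = d v"
    "a < n \<Longrightarrow> z < n \<Longrightarrow> nmem \<tau> Times_N2 z + nmem \<tau> Times_N a + b = pair_cell z a b"
    "forward e \<Longrightarrow> forward (nmem \<tau> some_array (dst e)) \<and> dst (nmem \<tau> some_array (dst e)) = dst e"
  using assms unfolding oriented_def by (auto simp: pair_cell_def)

lemma oriented_frame:
  assumes "oriented \<sigma>" "frame c \<sigma> \<tau>" "nat_writes c \<inter> prepared_arrays = {}" "Level \<notin> real_writes c"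
  shows "oriented \<tau>"
proof -
  have "nmem \<tau> a = nmem \<sigma> a" if "a \<in> prepared_arrays" for a
    using frameD(1)[OF assms(2)] assms(3) that by blast
  moreover from this have "nmem \<tau> tail_array = nmem \<sigma> tail_array" "nmem \<tau> head_array = nmem \<sigma> head_array"
    "nmem \<tau> some_array = nmem \<sigma> some_array"
    using arrays by auto
  moreover have "rmem \<tau> Level = rmem \<sigma> Level" using frameD(2)[OF assms(2,4)] .
  ultimately show ?thesis using assms(1) unfolding oriented_def by simp
qed

lemma runs_pair_start:
  assumes oriented: "oriented \<sigma>" and z: "nmem \<sigma> Pair_End 0 = z" "z < n"
    and empty: "\<And>a b. a < n \<Longrightarrow> b < n \<Longrightarrow> nmem \<sigma> fst_array (pair_cell z a b) = 0"
  shows "runs (pair_start fst_array) \<sigma>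
    (\<lambda>\<tau>. table_inv ord z (nmem \<sigma> fst_array) (nmem \<sigma> snd_array) 0 0 (nmem \<tau> fst_array)
      (nmem \<tau> snd_array)) ((n + 1) * 60)"
  unfolding pair_start_def
proof (rule runs_For_run[where I = "\<lambda>i \<tau>. (\<forall>a<n. \<forall>b<n. nmem \<tau> fst_array (pair_cell z a b) \<noteq> 0 \<longleftrightarrow>
      a < i \<and> b = z \<and> a \<noteq> z \<and> d a = d z) \<and> agree_off z (nmem \<tau> fst_array) (nmem \<sigma> fst_array)"],
    goal_cases bound fresh stable loop_free init step exit time)
  case (step i \<tau>)
  have oriented1: "oriented \<tau>" by (rule oriented_frame[OF oriented step(4)]) auto
  have end1: "nmem \<tau> Pair_End 0 = z" using frameD(1)[OF step(4)] z(1) by simp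
  have test: "\<not> rmem \<tau> Level i < rmem \<tau> Level z \<and> \<not> rmem \<tau> Level z < rmem \<tau> Level i \<longleftrightarrow> d i = d z"
    using orientedD(8)[OF oriented1 step(1) z(2)] by auto
  have same_cell: "pair_cell z a b = pair_cell z i z \<longleftrightarrow> a = i \<and> b = z" if "a < n" "b < n" for a b
    using pair_cell_inj[OF that step(1) z(2)] by auto
  show ?case
  proof (cases "i \<noteq> z \<and> d i = d z")
    case True
    then show ?thesis
      using step(2,3) test end1 agree_off_upd[OF _ step(1) z(2)] orientedD(9)[OF oriented1 step(1) z(2)]
      by (auto simp: same_cell less_Suc_eq)
  next
    case False
    then show ?thesis using step(2,3) test end1 by (auto simp: less_Suc_eq)
  qed
next
  case (exit \<tau>)
  have "nmem \<tau> snd_array = nmem \<sigma> snd_array" using frameD(1)[OF exit(2)] by simp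
  moreover have "linked z (nmem \<tau> fst_array) (nmem \<sigma> snd_array)" using exit(1) unfolding linked_def
    by blast
  moreover have "a < n \<and> b = z \<and> a \<noteq> z \<and> d a = d z" if "paired ord z 0 a b" for a b
    using that by (cases rule: paired.cases) auto
  then have "filled ord z 0 0 (nmem \<tau> fst_array)" using exit(1) z(2) unfolding filled_def by blast
  ultimately show ?case using exit(1) unfolding table_inv_def by (simp add: agree_off_def)
qed (use empty orientedD(1)[OF oriented] in \<open>auto simp: fresh_counter_def agree_off_def\<close>)

lemma table_inv_pair_step:
  assumes inv: "table_inv ord z V1 V2 i j (nmem \<tau> fst_array) (nmem \<tau> snd_array)"
    and oriented: "oriented \<tau>"
    and vars: "nmem \<tau> Pair_End 0 = z" "z < n" "nmem \<tau> Pair_Arc 0 = ord i" "ord i < m"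
      "nmem \<tau> Index2 0 = j" "j < m"
  defines "\<tau>' \<equiv> run (pair_step tail_array head_array fst_array snd_array) \<tau>"
  shows "table_inv ord z V1 V2 i (Suc j) (nmem \<tau>' fst_array) (nmem \<tau>' snd_array)"
proof -
  let ?test = "forward (ord i) \<and> forward j \<and> dst (ord i) \<noteq> dst j \<and>
    nmem \<tau> fst_array (pair_cell z (src (ord i)) (src j)) \<noteq> 0"
  let ?c = "pair_cell z (dst (ord i)) (dst j)"
  note simps = vars orientedD(4,5,7)[OF oriented vars(4)] orientedD(4,5,7)[OF oriented vars(6)]
    orientedD(9)[OF oriented src_less[OF vars(4)] vars(2)]
      orientedD(9)[OF oriented dst_less[OF vars(4)] vars(2)]
  show ?thesis
  proof (cases ?test)
    case True
    then have "nmem \<tau>' fst_array = (nmem \<tau> fst_array)(?c := Suc (ord i))"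
      "nmem \<tau>' snd_array = (nmem \<tau> snd_array)(?c := Suc j)"
      unfolding \<tau>'_def pair_step_def by (simp_all add: simps)
    then show ?thesis using table_inv_update[OF inv] True by simp
  next
    case False
    then have "\<tau>' = \<tau>" unfolding \<tau>'_def pair_step_def by (auto simp: simps)
    then show ?thesis using table_inv_skip[OF inv False] by simp
  qed
qed

lemma runs_pair_steps:
  assumes oriented: "oriented \<sigma>" and z: "nmem \<sigma> Pair_End 0 = z" "z < n"
    and ord: "nmem \<sigma> order_array = ord" "\<And>i. i < m \<Longrightarrow> ord i < m"
    and inv: "table_inv ord z V1 V2 0 0 (nmem \<sigma> fst_array) (nmem \<sigma> snd_array)"
  shows "runs (pair_steps tail_array head_array order_array fst_array snd_array) \<sigma>
    (\<lambda>\<tau>. table_inv ord z V1 V2 m 0 (nmem \<tau> fst_array) (nmem \<tau> snd_array)) ((m + 1) * ((m + 1) * 200))"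
  unfolding pair_steps_def
proof (rule runs_For_const[where I =
  "\<lambda>i \<tau>. table_inv ord z V1 V2 i 0 (nmem \<tau> fst_array) (nmem \<tau> snd_array)"
      and T = "4 + (m + 1) * 170"], goal_cases bound fresh stable init step exit time)
  case (step i \<tau>)
  have oriented1: "oriented \<tau>" by (rule oriented_frame[OF oriented step(4)]) auto
  let ?\<tau> = "run (Pair_Arc ::= order_array\<langle>var Index\<rangle>) \<tau>"
  have assign: "reaches (Pair_Arc ::= order_array\<langle>var Index\<rangle>) \<tau> 5 ?\<tau>" by (rule reaches_run) auto
  have oriented2: "oriented ?\<tau>" by (rule oriented_frame[OF oriented1 reaches_frame[OF assign]]) auto
  have vars: "nmem ?\<tau> Pair_End 0 = z" "nmem ?\<tau> Pair_Arc 0 = ord i" "nmem ?\<tau> fst_array = nmem \<tau> fst_array"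
    "nmem ?\<tau> snd_array = nmem \<tau> snd_array"
    using frameD(1)[OF step(4)] z(1) ord(1) step(2) by simp_all
  have "runs (For Index2 num_arcs (pair_step tail_array head_array fst_array snd_array)) ?\<tau>
    (\<lambda>\<tau>. table_inv ord z V1 V2 (Suc i) 0 (nmem \<tau> fst_array) (nmem \<tau> snd_array)) ((m + 1) * 165)"
  proof (rule runs_For_run[where I =
    "\<lambda>j \<tau>. table_inv ord z V1 V2 i j (nmem \<tau> fst_array) (nmem \<tau> snd_array)"],
      goal_cases bound fresh stable loop_free init step exit time)
    case (step j \<tau>')
    have oriented': "oriented \<tau>'" by (rule oriented_frame[OF oriented2 step(4)]) auto
    have "nmem \<tau>' Pair_End 0 = z" "nmem \<tau>' Pair_Arc 0 = ord i" using frameD(1)[OF step(4)] vars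
      by simp_all
    then show ?case
      using table_inv_pair_step[OF step(3) oriented' _ z(2) _ _ step(2,1)] ord(2)[OF \<open>i < m\<close>] by simp
  next
    case (exit \<tau>')
    then show ?case using filled_next unfolding table_inv_def by blast
  qed (use step(3) vars orientedD(2)[OF oriented2] in \<open>auto simp: fresh_counter_def pair_step_def\<close>)
  then show ?case
    by (rule runs_run_Seq[rotated]) simp_all
qed (use inv orientedD(2)[OF oriented] in \<open>auto simp: fresh_counter_def\<close>)

definition marked :: "ram_state \<Rightarrow> nat set" where
  "marked \<tau> = {z. z < n \<and> nmem \<tau> mark_array z \<noteq> 0}"

definition has_tables :: "ram_state \<Rightarrow> bool" where
  "has_tables \<tau> \<longleftrightarrow> (\<forall>z \<in> marked \<tau>. pairs_table z (nmem \<tau> fst_array) (nmem \<tau> snd_array))"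

lemma runs_pair_table:
  assumes oriented: "oriented \<sigma>" and ord: "topological_order (nmem \<sigma> order_array) ps"
    and empty: "nmem \<sigma> fst_array = (\<lambda>_. 0)"
  shows "runs (pair_table tail_array head_array order_array mark_array fst_array snd_array) \<sigma> has_tables
    (pair_table_time (card (marked \<sigma>)))"
  unfolding pair_table_def pair_table_time_def marked_def
proof (rule runs_For_When[where P = "\<lambda>z. nmem \<sigma> mark_array z \<noteq> 0" and I = "\<lambda>z \<tau>.
      (\<forall>z'<z. nmem \<sigma> mark_array z' \<noteq> 0 \<longrightarrow> pairs_table z' (nmem \<tau> fst_array) (nmem \<tau> snd_array)) \<and>
      (\<forall>z' a b. z \<le> z' \<longrightarrow> a < n \<longrightarrow> b < n \<longrightarrow> nmem \<tau> fst_array (pair_cell z' a b) = 0)"],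
    goal_cases bound fresh stable init guard step skip exit time)
  case (guard z \<tau>)
  then show ?case using frameD(1)[OF guard(4)] by simp
next
  case (step z \<tau>)
  have oriented1: "oriented \<tau>" by (rule oriented_frame[OF oriented step(4)]) auto
  let ?inv = "\<lambda>i \<tau>'. table_inv (nmem \<sigma> order_array) z (nmem \<tau> fst_array) (nmem \<tau> snd_array) i 0
    (nmem \<tau>' fst_array) (nmem \<tau>' snd_array)"
  obtain \<tau>1 where \<tau>1: "reaches (pair_start fst_array) \<tau> ((n + 1) * 60) \<tau>1"
    "frame (pair_start fst_array) \<tau> \<tau>1" "?inv 0 \<tau>1"
    by (rule runsE[OF runs_pair_start[OF oriented1 step(2,1)]]) (use step(3) in auto)
  have oriented2: "oriented \<tau>1" by (rule oriented_frame[OF oriented1 \<tau>1(2)]) auto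
  have vars: "nmem \<tau>1 Pair_End 0 = z" "nmem \<tau>1 order_array = nmem \<sigma> order_array"
    using frameD(1)[OF \<tau>1(2)] frameD(1)[OF step(4)] step(2) by simp_all
  obtain \<tau>2 where \<tau>2: "reaches (pair_steps tail_array head_array order_array fst_array snd_array) \<tau>1
      ((m + 1) * ((m + 1) * 200)) \<tau>2" "?inv m \<tau>2"
    by (rule runsE[OF runs_pair_steps[OF oriented2 vars(1) step(1) vars(2) _ \<tau>1(3)]])
      (use ord enumerates_inverse(1) in \<open>auto simp: topological_order_def\<close>)
  have new: "pairs_table z (nmem \<tau>2 fst_array) (nmem \<tau>2 snd_array)"
    by (rule table_inv_pairs_table[OF \<tau>2(2) ord])
  have off: "agree_off z (nmem \<tau>2 fst_array) (nmem \<tau> fst_array)"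
    "agree_off z (nmem \<tau>2 snd_array) (nmem \<tau> snd_array)"
    using \<tau>2(2) by (simp_all add: table_inv_def)
  have "pairs_table z' (nmem \<tau>2 fst_array) (nmem \<tau>2 snd_array)" if "z' < Suc z"
    "nmem \<sigma> mark_array z' \<noteq> 0" for z'
    using new pairs_table_cong[OF _ off] step(3) that by (cases "z' = z") auto
  moreover have "nmem \<tau>2 fst_array (pair_cell z' a b) = 0" if "Suc z \<le> z'" "a < n" "b < n" for z' a b
    using off(1) step(3) that by (simp add: agree_off_def)
  ultimately show ?case by (intro runsI[OF reaches_Seq[OF \<tau>1(1) \<tau>2(1)]]) auto
next
  case (exit \<tau>)
  then show ?case using frameD(1)[OF exit(2)] by (simp add: has_tables_def marked_def)
qed (use empty orientedD(1)[OF oriented] in \<open>auto simp: fresh_counter_def less_Suc_eq\<close>)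

end

section \<open>Tracing pairs of paths\<close>

abbreviation (input) Pivot :: nat where "Pivot \<equiv> 49"
abbreviation (input) Succ :: nat where "Succ \<equiv> 50"
abbreviation (input) Walk_Fst :: nat where "Walk_Fst \<equiv> 51"
abbreviation (input) Walk_Snd :: nat where "Walk_Snd \<equiv> 52"
abbreviation (input) Arc_Fst :: nat where "Arc_Fst \<equiv> 53"
abbreviation (input) Arc_Snd :: nat where "Arc_Snd \<equiv> 54"

definition trace_step :: "nat \<Rightarrow> nat \<Rightarrow> nat \<Rightarrow> com" where
  "trace_step T T1 T2 = When (BNot (Eq (var Walk_Snd) (var Pivot)))
    (Arc_Fst ::= NSub (T1\<langle>pair_index (var Pivot) (var Walk_Fst) (var Walk_Snd)\<rangle>) (NConst 1) ;;
     Arc_Snd ::= NSub (T2\<langle>pair_index (var Pivot) (var Walk_Fst) (var Walk_Snd)\<rangle>) (NConst 1) ;;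
     Succ\<langle>Src\<langle>var Arc_Fst\<rangle>\<rangle> ::= var Arc_Fst ;;
     Succ\<langle>Src\<langle>var Arc_Snd\<rangle>\<rangle> ::= var Arc_Snd ;;
     Walk_Fst ::= T\<langle>var Arc_Fst\<rangle> ;;
     Walk_Snd ::= T\<langle>var Arc_Snd\<rangle>)"

definition extend_step :: "nat \<Rightarrow> nat \<Rightarrow> nat \<Rightarrow> com" where
  "extend_step T Some_Arc Root = When (BNot (Eq (var Walk_Fst) (Header\<langle>NConst Root\<rangle>)))
    (Arc_Fst ::= Some_Arc\<langle>var Walk_Fst\<rangle> ;;
     Succ\<langle>Src\<langle>var Arc_Fst\<rangle>\<rangle> ::= var Arc_Fst ;;
     Walk_Fst ::= T\<langle>var Arc_Fst\<rangle>)"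

definition trace :: "nat \<Rightarrow> nat \<Rightarrow> nat \<Rightarrow> nat \<Rightarrow> nat \<Rightarrow> com" where
  "trace T T1 T2 Some_Arc Root =
    For Index num_verts (trace_step T T1 T2) ;; For Index num_verts (extend_step T Some_Arc Root)"

lemma trace_writes [simp]:
  "nat_writes (trace_step T T1 T2) = {Succ, Walk_Fst, Walk_Snd, Arc_Fst, Arc_Snd}"
  "real_writes (trace_step T T1 T2) = {}" "loop_free (trace_step T T1 T2)"
  "nat_writes (extend_step T Some_Arc Root) = {Succ, Walk_Fst, Arc_Fst}"
  "real_writes (extend_step T Some_Arc Root) = {}" "loop_free (extend_step T Some_Arc Root)"
  "nat_writes (trace T T1 T2 Some_Arc Root) = {Index, Succ, Walk_Fst, Walk_Snd, Arc_Fst, Arc_Snd}"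
  "real_writes (trace T T1 T2 Some_Arc Root) = {}"
  by (auto simp: trace_step_def extend_step_def trace_def)

context pair_tables
begin

definition followed :: "(nat \<Rightarrow> nat) \<Rightarrow> nat set" where
  "followed succ = {e. succ (input_tail e) = e}"

lemma path_in_followed_upd:
  assumes path: "path_in (followed succ) a S b k" and u: "u \<notin> S \<or> u = a \<and> input_tail = dst"
  shows "path_in (followed (succ(u := e))) a S b k"
  using path
proof (rule path_in_cong)
  fix g assume g: "g \<in> followed succ" "src g \<in> S - {b}" "dst g \<in> S - {a}"
  then have "input_tail g \<noteq> u" using u input_tail by auto
  then show "g \<in> followed (succ(u := e))" using g(1) by (simp add: followed_def)
qed

lemma followed_path_upd:
  assumes path: "path_in (followed succ) a A p 0" and e: "forward e" "dst e = a"
  shows "path_in (followed (succ(input_tail e := e))) (src e) (insert (src e) A) p 0"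
proof -
  have forward_path: "forward_path a A p" using path_in_cong[OF path] by simp
  have new: "src e \<notin> A" using forward_path_levels[OF forward_path] forwardD(2)[OF e(1)] e(2) by force
  then have "path_in (followed (succ(input_tail e := e))) a A p 0"
    by (intro path_in_followed_upd[OF path]) (use input_tail e(2) in auto)
  then show ?thesis
    using path_in.cons[of e "followed (succ(input_tail e := e))" A p 0] e forwardD(1) new excess_forward
    by (simp add: followed_def)
qed

definition traced_to ::
  "(nat \<Rightarrow> nat) \<Rightarrow> nat \<Rightarrow> nat \<Rightarrow> nat \<Rightarrow> nat \<Rightarrow> nat set \<Rightarrow> nat set \<Rightarrow> (nat \<Rightarrow> nat) \<Rightarrow> bool" where
  "traced_to succ0 p q a b A B succ \<longleftrightarrow> path_in (followed succ) a A p 0 \<and> path_in (followed succ) b B q 0 \<and>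
    A \<inter> B = {} \<and> (\<forall>u. u \<notin> A \<union> B \<longrightarrow> succ u = succ0 u)"

lemma traced_toD:
  assumes "traced_to succ0 p q a b A B succ"
  shows "path_in (followed succ) a A p 0" "path_in (followed succ) b B q 0" "A \<inter> B = {}"
    "u \<notin> A \<Longrightarrow> u \<notin> B \<Longrightarrow> succ u = succ0 u" "forward_path a A p" "forward_path b B q"
  using assms path_in_cong[of "followed succ" _ _ _ _ UNIV] unfolding traced_to_def by blast+

lemma traced_to_step:
  assumes traced: "traced_to succ0 p q a b A B succ"
    and e: "forward e" "dst e = a" and f: "forward f" "dst f = b"
    and same: "d a = d b" and distinct: "src e \<noteq> src f"
  shows "traced_to succ0 p q (src e) (src f) (insert (src e) A) (insert (src f) B)
    (succ(input_tail e := e, input_tail f := f))" "src f \<notin> B"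
proof -
  let ?succ = "succ(input_tail e := e, input_tail f := f)"
  note A = traced_toD(1)[OF traced] and B = traced_toD(2)[OF traced]
    and disjoint = traced_toD(3)[OF traced]
  have ends: "a \<in> A" "b \<in> B" using path_inD(5)[OF A] path_inD(5)[OF B] by auto
  have fresh: "src e \<notin> A" "src e \<notin> B" "src f \<notin> A" "src f \<notin> B"
    using forward_path_levels[OF traced_toD(5)[OF traced]]
      forward_path_levels[OF traced_toD(6)[OF traced]]
      forwardD(2)[OF e(1)] forwardD(2)[OF f(1)] e(2) f(2) same by force+
  then show "src f \<notin> B" by blast
  have keys: "input_tail e \<in> {src e, a}" "input_tail f \<in> {src f, b}" "input_tail e \<noteq> input_tail f"
    "input_tail f \<notin> insert (src e) A" "input_tail e \<notin> insert (src f) B"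
    using input_tail e(2) f(2) distinct ends disjoint fresh by auto
  have "path_in (followed ?succ) (src e) (insert (src e) A) p 0"
    by (rule path_in_followed_upd[OF followed_path_upd[OF A e]]) (use keys(4) in blast)
  moreover have "path_in (followed (succ(input_tail f := f, input_tail e := e))) (src f)
    (insert (src f) B) q 0"
    by (rule path_in_followed_upd[OF followed_path_upd[OF B f]]) (use keys(5) in blast)
  then have "path_in (followed ?succ) (src f) (insert (src f) B) q 0" using keys(3)
    by (simp add: fun_upd_twist)
  ultimately show "traced_to succ0 p q (src e) (src f) (insert (src e) A) (insert (src f) B) ?succ"
    unfolding traced_to_def using fresh disjoint distinct keys(1,2) ends traced_toD(4)[OF traced] by auto
qed

lemma traced_to_extend:
  assumes traced: "traced_to succ0 p q a b A B succ" and e: "forward e" "dst e = a"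
    and lower: "d a \<le> d b"
  shows "traced_to succ0 p q (src e) b (insert (src e) A) B (succ(input_tail e := e))" "src e \<notin> A"
proof -
  note A = traced_toD(1)[OF traced] and B = traced_toD(2)[OF traced]
    and disjoint = traced_toD(3)[OF traced]
  have "a \<in> A" using path_inD(5)[OF A] .
  have fresh: "src e \<notin> A" "src e \<notin> B"
    using forward_path_levels[OF traced_toD(5)[OF traced]]
      forward_path_levels[OF traced_toD(6)[OF traced]]
      forwardD(2)[OF e(1)] e(2) lower by force+
  then show "src e \<notin> A" by blast
  have input_tail_cases: "input_tail e \<in> {src e, a}" using input_tail e(2) by auto
  then have "path_in (followed (succ(input_tail e := e))) b B q 0"
    by (intro path_in_followed_upd[OF B]) (use fresh disjoint \<open>a \<in> A\<close> in auto)
  then show "traced_to succ0 p q (src e) b (insert (src e) A) B (succ(input_tail e := e))"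
    unfolding traced_to_def
    using followed_path_upd[OF A e] fresh disjoint input_tail_cases \<open>a \<in> A\<close> traced_toD(4)[OF traced] by auto
qed

definition trace_inv :: "(nat \<Rightarrow> nat) \<Rightarrow> nat \<Rightarrow> nat \<Rightarrow> nat \<Rightarrow> nat \<Rightarrow> ram_state \<Rightarrow> bool" where
  "trace_inv succ0 z p q i \<tau> \<longleftrightarrow>
    nmem \<tau> fst_array (pair_cell z (nmem \<tau> Walk_Fst 0) (nmem \<tau> Walk_Snd 0)) \<noteq> 0 \<and>
    (\<exists>A B. traced_to succ0 p q (nmem \<tau> Walk_Fst 0) (nmem \<tau> Walk_Snd 0) A B (nmem \<tau> Succ) \<and>
      (nmem \<tau> Walk_Snd 0 \<noteq> z \<longrightarrow> card B = Suc i))"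

lemma trace_inv_step:
  assumes inv: "trace_inv succ0 z p q i \<tau>" and oriented: "oriented \<tau>" and z: "nmem \<tau> Pivot 0 = z" "z < n"
    and linked: "linked z (nmem \<tau> fst_array) (nmem \<tau> snd_array)"
  shows "trace_inv succ0 z p q (Suc i) (run (trace_step tail_array fst_array snd_array) \<tau>)"
proof (cases "nmem \<tau> Walk_Snd 0 = z")
  case True
  then have "run (trace_step tail_array fst_array snd_array) \<tau> = \<tau>" using z by (simp add: trace_step_def)
  then show ?thesis using inv True unfolding trace_inv_def by auto
next
  case False
  let ?\<tau> = "run (trace_step tail_array fst_array snd_array) \<tau>"
  define a b where "a = nmem \<tau> Walk_Fst 0" and "b = nmem \<tau> Walk_Snd 0"
  obtain A B where AB: "traced_to succ0 p q a b A B (nmem \<tau> Succ)" "card B = Suc i"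
    using inv False unfolding trace_inv_def a_def b_def by blast
  have ab: "a < n" "b < n"
    using path_inD(1)[OF traced_toD(1)[OF AB(1)]] path_inD(1)[OF traced_toD(2)[OF AB(1)]] .
  have cell: "nmem \<tau> fst_array (pair_cell z a b) \<noteq> 0" using inv unfolding trace_inv_def a_def b_def
    by blast
  obtain e f where ef: "forward e" "forward f" "nmem \<tau> fst_array (pair_cell z a b) = Suc e"
    "nmem \<tau> snd_array (pair_cell z a b) = Suc f" "dst e = a" "dst f = b"
    "nmem \<tau> fst_array (pair_cell z (src e) (src f)) \<noteq> 0"
    using linkedD(3)[OF linked ab cell] False b_def by blast
  note arcs = forwardD[OF ef(1)] forwardD[OF ef(2)]
  have run: "nmem ?\<tau> Walk_Fst 0 = src e" "nmem ?\<tau> Walk_Snd 0 = src f"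
    "nmem ?\<tau> fst_array = nmem \<tau> fst_array"
    "nmem ?\<tau> Succ = (nmem \<tau> Succ)(input_tail e := e, input_tail f := f)"
    using False z orientedD(9)[OF oriented ab(1) z(2)] orientedD(4,6)[OF oriented arcs(1)]
      orientedD(4,6)[OF oriented arcs(5)] ef(3,4)
    by (simp_all add: trace_step_def a_def[symmetric] b_def[symmetric])
  have "src e \<noteq> src f" using linkedD(1)[OF linked arcs(3,7) ef(7)] .
  note new = traced_to_step[OF AB(1) ef(1,5,2,6) linkedD(2)[OF linked ab cell] this]
  have "card (insert (src f) B) = Suc (Suc i)" using new(2) AB(2)
    by (simp add: card_gt_0_iff[THEN iffD1])
  then show ?thesis unfolding trace_inv_def run using new(1) ef(7) by blast
qed

definition extend_inv :: "(nat \<Rightarrow> nat) \<Rightarrow> nat \<Rightarrow> nat \<Rightarrow> nat \<Rightarrow> nat \<Rightarrow> ram_state \<Rightarrow> bool" where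
  "extend_inv succ0 z p q i \<tau> \<longleftrightarrow> d (nmem \<tau> Walk_Fst 0) \<le> d z \<and>
    (\<exists>A B. traced_to succ0 p q (nmem \<tau> Walk_Fst 0) z A B (nmem \<tau> Succ) \<and>
      (nmem \<tau> Walk_Fst 0 \<noteq> s \<longrightarrow> i < card A))"

lemma extend_inv_step:
  assumes inv: "extend_inv succ0 z p q i \<tau>" and oriented: "oriented \<tau>"
  shows "extend_inv succ0 z p q (Suc i) (run (extend_step tail_array some_array root_index) \<tau>)"
proof (cases "nmem \<tau> Walk_Fst 0 = s")
  case True
  then have "run (extend_step tail_array some_array root_index) \<tau> = \<tau>"
    using orientedD(3)[OF oriented] by (simp add: extend_step_def)
  then show ?thesis using inv True unfolding extend_inv_def by auto
next
  case False
  let ?\<tau> = "run (extend_step tail_array some_array root_index) \<tau>"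
  define a e where "a = nmem \<tau> Walk_Fst 0" and "e = nmem \<tau> some_array a"
  obtain A B where AB: "traced_to succ0 p q a z A B (nmem \<tau> Succ)" "i < card A" and lower: "d a \<le> d z"
    using inv False unfolding extend_inv_def a_def by blast
  note A = path_inD[OF traced_toD(1)[OF AB(1)]]
  obtain S where S: "forward_path s S a" using ex_forward_path_from_s[OF A(1)] by blast
  then obtain g where "forward g" "dst g = a"
    using forward_path_arc_into[OF S path_inD(6)[OF S]] False a_def by blast
  then have e: "forward e" "dst e = a" using orientedD(10)[OF oriented] unfolding e_def by metis+
  have run: "nmem ?\<tau> Walk_Fst 0 = src e" "nmem ?\<tau> Succ = (nmem \<tau> Succ)(input_tail e := e)"
    using False orientedD(3)[OF oriented] orientedD(4,6)[OF oriented forwardD(1)[OF e(1)]]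
    by (simp_all add: extend_step_def a_def[symmetric] e_def[symmetric])
  note new = traced_to_extend[OF AB(1) e lower]
  have "Suc i < card (insert (src e) A)" using new(2) AB(2) A(4) by simp
  moreover have "d (src e) \<le> d z" using forwardD(2)[OF e(1)] e(2) lower by simp
  ultimately show ?thesis unfolding extend_inv_def run using new(1) by blast
qed

lemma runs_trace_to_pivot:
  assumes oriented: "oriented \<sigma>" and z: "nmem \<sigma> Pivot 0 = z" "z < n"
    and linked: "linked z (nmem \<sigma> fst_array) (nmem \<sigma> snd_array)"
    and pq: "nmem \<sigma> Walk_Fst 0 = p" "p < n" "nmem \<sigma> Walk_Snd 0 = q" "q < n"
      "nmem \<sigma> fst_array (pair_cell z p q) \<noteq> 0"
  shows "runs (For Index num_verts (trace_step tail_array fst_array snd_array)) \<sigma>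
    (\<lambda>\<tau>. trace_inv (nmem \<sigma> Succ) z p q n \<tau> \<and> nmem \<tau> Walk_Snd 0 = z) ((n + 1) * 160)"
proof (rule runs_For_run[where I = "trace_inv (nmem \<sigma> Succ) z p q"],
    goal_cases bound fresh stable loop_free init step exit time)
  case init
  have "traced_to (nmem \<sigma> Succ) p q p q {p} {q} (nmem \<sigma> Succ)"
    using pq(2,4) linkedD(1)[OF linked pq(2,4,5)] path_in.nil unfolding traced_to_def by auto
  then show ?case using pq unfolding trace_inv_def by (intro conjI exI[of _ "{p}"] exI[of _ "{q}"]) auto
next
  case (step i \<tau>)
  have "oriented \<tau>" by (rule oriented_frame[OF oriented step(4)]) auto
  then show ?case using trace_inv_step[OF step(3)] frameD(1)[OF step(4)] z linked by simp
next
  case (exit \<tau>)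
  have "nmem \<tau> Walk_Snd 0 = z"
  proof (rule ccontr)
    assume "nmem \<tau> Walk_Snd 0 \<noteq> z"
    then obtain B where B: "path_in (followed (nmem \<tau> Succ)) (nmem \<tau> Walk_Snd 0) B q 0" "card B = Suc n"
      using exit(1) traced_toD(2) unfolding trace_inv_def by blast
    then show False using path_inD(3)[OF B(1)] card_mono[of "{..<n}" B] by simp
  qed
  then show ?case using exit(1) by blast
qed (use orientedD(1)[OF oriented] in \<open>auto simp: fresh_counter_def trace_inv_def trace_step_def\<close>)

lemma runs_extend_to_source:
  assumes oriented: "oriented \<sigma>" and v: "nmem \<sigma> Walk_Fst 0 = v" "d v = d z"
    and traced: "traced_to f p q v z A B (nmem \<sigma> Succ)"
  shows "runs (For Index num_verts (extend_step tail_array some_array root_index)) \<sigma>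
    (\<lambda>\<tau>. \<exists>A B. traced_to f p q s z A B (nmem \<tau> Succ)) ((n + 1) * 90)"
proof (rule runs_For_run[where I = "extend_inv f z p q"],
    goal_cases bound fresh stable loop_free init step exit time)
  case init
  have "0 < card A" using path_inD(4,5)[OF traced_toD(1)[OF traced]] by (auto simp: card_gt_0_iff)
  then show ?case using traced v unfolding extend_inv_def by auto
next
  case (step i \<tau>)
  have "oriented \<tau>" by (rule oriented_frame[OF oriented step(4)]) auto
  then show ?case using extend_inv_step[OF step(3)] by simp
next
  case (exit \<tau>)
  then obtain A B where traced': "traced_to f p q (nmem \<tau> Walk_Fst 0) z A B (nmem \<tau> Succ)"
    and visited: "nmem \<tau> Walk_Fst 0 \<noteq> s \<longrightarrow> n < card A" unfolding extend_inv_def by blast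
  have "card A \<le> n" using path_inD(3)[OF traced_toD(1)[OF traced']] card_mono[of "{..<n}" A] by simp
  then show ?case using traced' visited by auto
qed (use orientedD(1)[OF oriented] in \<open>auto simp: fresh_counter_def extend_inv_def extend_step_def\<close>)

lemma runs_trace:
  assumes oriented: "oriented \<sigma>" and z: "nmem \<sigma> Pivot 0 = z" "z < n"
    and linked: "linked z (nmem \<sigma> fst_array) (nmem \<sigma> snd_array)"
    and pq: "nmem \<sigma> Walk_Fst 0 = p" "p < n" "nmem \<sigma> Walk_Snd 0 = q" "q < n"
      "nmem \<sigma> fst_array (pair_cell z p q) \<noteq> 0"
  shows "runs (trace tail_array fst_array snd_array some_array root_index) \<sigma>
    (\<lambda>\<tau>. \<exists>A B. traced_to (nmem \<sigma> Succ) p q s z A B (nmem \<tau> Succ)) ((n + 1) * 250)"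
proof -
  let ?trace = "For Index num_verts (trace_step tail_array fst_array snd_array)"
  obtain \<tau>1 where \<tau>1: "reaches ?trace \<sigma> ((n + 1) * 160) \<tau>1" "frame ?trace \<sigma> \<tau>1"
    "trace_inv (nmem \<sigma> Succ) z p q n \<tau>1" "nmem \<tau>1 Walk_Snd 0 = z"
    using runs_trace_to_pivot[OF assms] by (auto elim: runsE)
  have oriented1: "oriented \<tau>1" by (rule oriented_frame[OF oriented \<tau>1(2)]) auto
  obtain A B where traced: "traced_to (nmem \<sigma> Succ) p q (nmem \<tau>1 Walk_Fst 0) z A B (nmem \<tau>1 Succ)"
    and cell: "nmem \<sigma> fst_array (pair_cell z (nmem \<tau>1 Walk_Fst 0) z) \<noteq> 0"
    using \<tau>1(3,4) frameD(1)[OF \<tau>1(2)] unfolding trace_inv_def by auto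
  have "d (nmem \<tau>1 Walk_Fst 0) = d z"
    using linkedD(2)[OF linked path_inD(1)[OF traced_toD(1)[OF traced]] z(2) cell] .
  from runs_extend_to_source[OF oriented1 refl this traced]
  obtain \<tau>2 where \<tau>2: "reaches (For Index num_verts (extend_step tail_array some_array root_index))
    \<tau>1 ((n + 1) * 90) \<tau>2"
    "\<exists>A B. traced_to (nmem \<sigma> Succ) p q s z A B (nmem \<tau>2 Succ)" by (rule runsE)
  show ?thesis
    unfolding trace_def
    by (rule runsI[OF reaches_Seq[OF \<tau>1(1) \<tau>2(1)]]) (use \<tau>2(2) in simp_all)
qed

end

section \<open>Low and high pairs\<close>

abbreviation low_pairs :: com where
  "low_pairs \<equiv> pair_table Src Dst Order Back_Head Low_Fst Low_Snd"

abbreviation high_pairs :: com where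
  "high_pairs \<equiv> pair_table Dst Src Rev_Order Back_Tail High_Fst High_Snd"

abbreviation low_trace :: com where
  "low_trace \<equiv> trace Src Low_Fst Low_Snd Some_In 2"

abbreviation high_trace :: com where
  "high_trace \<equiv> trace Dst High_Fst High_Snd Some_Out 3"

context layered_arcs
begin

interpretation low: pair_tables n m src dst w s t d Src Dst Order Back_Head Low_Fst Low_Snd Some_In 2 src
  by unfold_locales auto

interpretation high: pair_tables n m dst src w t s "\<lambda>v. - d v" Dst Src Rev_Order Back_Tail High_Fst
  High_Snd
    Some_Out 3 src
  rewrites "layered_arcs.forward m dst src (\<lambda>v. - d v) = forward"
    and "layered_arcs.excess dst src w (\<lambda>v. - d v) = excess"
    and "layered_arcs.path_in n m dst src w (\<lambda>v. - d v) F b S a k = path_in F a S b k"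
  by (intro pair_tables.intro reversed pair_tables_axioms.intro) (auto simp: reversed_rewrites)

definition high_table :: "nat \<Rightarrow> (nat \<Rightarrow> nat) \<Rightarrow> (nat \<Rightarrow> nat) \<Rightarrow> bool" where
  "high_table = high.pairs_table"

lemma low_table_complete: "pairs_table y U1 U2 \<Longrightarrow> low_pair y p q A B \<Longrightarrow> d p = d q \<Longrightarrow>
  U1 (pair_cell y p q) \<noteq> 0"
  unfolding pairs_table_def by blast

lemma high_table_complete:
  assumes "high_table x U1 U2" "high_pair x p q A B" "d p = d q"
  shows "U1 (pair_cell x q p) \<noteq> 0"
proof -
  have "high.low_pair x q p B A" using assms(2) by (auto simp: high.low_pair_def high_pair_def)
  then show ?thesis using assms(1,3) unfolding high_table_def high.pairs_table_def by metis
qed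

lemma high_table_level: "high_table x U1 U2 \<Longrightarrow> p < n \<Longrightarrow> q < n \<Longrightarrow> U1 (pair_cell x q p) \<noteq> 0 \<Longrightarrow> d p = d q"
  using high.linkedD(2)[of x U1 U2 q p] unfolding high_table_def high.pairs_table_def by simp

definition ready :: "ram_state \<Rightarrow> bool" where
  "ready \<tau> \<longleftrightarrow> prepared \<tau> \<and> (\<forall>y\<in>back_heads. pairs_table y (nmem \<tau> Low_Fst) (nmem \<tau> Low_Snd)) \<and>
    (\<forall>x\<in>back_tails. high_table x (nmem \<tau> High_Fst) (nmem \<tau> High_Snd))"

lemma readyD:
  assumes "ready \<tau>"
  shows "prepared \<tau>" "has_input \<tau>" "y \<in> back_heads \<Longrightarrow> pairs_table y (nmem \<tau> Low_Fst) (nmem \<tau> Low_Snd)"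
    "x \<in> back_tails \<Longrightarrow> high_table x (nmem \<tau> High_Fst) (nmem \<tau> High_Snd)"
  using assms preparedD(1) unfolding ready_def by auto

lemma ready_frame:
  assumes "ready \<sigma>" "frame c \<sigma> \<tau>"
    "nat_writes c \<inter> (prepared_arrays \<union> {Low_Fst, Low_Snd, High_Fst, High_Snd}) = {}"
    "real_writes c \<inter> {Weight, Level} = {}"
  shows "ready \<tau>"
proof -
  have "prepared \<tau>" by (rule prepared_frame[OF readyD(1)[OF assms(1)] assms(2)]) (use assms(3,4) in auto)
  moreover have "nmem \<tau> a = nmem \<sigma> a" if "a \<in> {Low_Fst, Low_Snd, High_Fst, High_Snd}" for a
    using frameD(1)[OF assms(2)] assms(3) that by blast
  ultimately show ?thesis using assms(1) unfolding ready_def by simp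
qed

lemma prepared_low_oriented: "prepared \<tau> \<Longrightarrow> low.oriented \<tau>"
  using classifiedD(1,3)[of \<tau>] by (auto simp: low.oriented_def prepared_def has_input_def has_levels_def)

lemma prepared_high_oriented: "prepared \<tau> \<Longrightarrow> high.oriented \<tau>"
  using classifiedD(1,2)[of \<tau>]
  by (auto simp: high.oriented_def prepared_def has_input_def has_levels_def)

lemma enumerates_rev_order: "ordered \<tau> \<Longrightarrow> enumerates (nmem \<tau> Rev_Order) (\<lambda>e. m - 1 - arc_rank e)"
  using arc_rank_less by (auto simp: ordered_def enumerates_def)

lemma high_topological_order:
  assumes "ordered \<tau>"
  shows "high.topological_order (nmem \<tau> Rev_Order) (\<lambda>e. m - 1 - arc_rank e)"
proof -
  have "m - 1 - arc_rank e < m - 1 - arc_rank f" if "forward e" "forward f" "src e = dst f" for e f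
    using that arc_rank_mono[of e f] arc_rank_less[of e] forwardD(1,2)[of e] forwardD(1,2)[of f]
    by (auto simp: precedes_def)
  then show ?thesis using enumerates_rev_order[OF assms] unfolding high.topological_order_def by blast
qed

lemma runs_low_pairs:
  assumes prepared: "prepared \<sigma>" and empty: "nmem \<sigma> Low_Fst = (\<lambda>_. 0)"
  shows "runs low_pairs \<sigma> (\<lambda>\<tau>. \<forall>y\<in>back_heads. pairs_table y (nmem \<tau> Low_Fst) (nmem \<tau> Low_Snd))
    (pair_table_time (card back_heads))"
proof -
  have marked: "low.marked \<tau> = back_heads" if "nmem \<tau> Back_Head = nmem \<sigma> Back_Head" for \<tau>
    using classifiedD(5)[OF preparedD(3)[OF prepared]] that by (auto simp: low.marked_def back_heads_def)
  have "runs low_pairs \<sigma> low.has_tables (pair_table_time (card (low.marked \<sigma>)))"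
    by (rule low.runs_pair_table[OF prepared_low_oriented[OF prepared] _ empty])
      (rule topological_order_arc_rank[OF preparedD(4)[OF prepared]])
  then show ?thesis
    by (rule runs_conseq) (use frameD(1) in \<open>auto simp: low.has_tables_def marked\<close>)
qed

lemma runs_high_pairs:
  assumes prepared: "prepared \<sigma>" and empty: "nmem \<sigma> High_Fst = (\<lambda>_. 0)"
  shows "runs high_pairs \<sigma> (\<lambda>\<tau>. \<forall>x\<in>back_tails. high_table x (nmem \<tau> High_Fst) (nmem \<tau> High_Snd))
    (pair_table_time (card back_tails))"
proof -
  have marked: "high.marked \<tau> = back_tails" if "nmem \<tau> Back_Tail = nmem \<sigma> Back_Tail" for \<tau>
    using classifiedD(4)[OF preparedD(3)[OF prepared]] that
    by (auto simp: high.marked_def back_tails_def)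
  have "runs high_pairs \<sigma> high.has_tables (pair_table_time (card (high.marked \<sigma>)))"
    by (rule high.runs_pair_table[OF prepared_high_oriented[OF prepared] _ empty])
      (rule high_topological_order[OF preparedD(4)[OF prepared]])
  then show ?thesis
    by (rule runs_conseq) (use frameD(1) in \<open>auto simp: high.has_tables_def marked high_table_def\<close>)
qed

definition succ_arcs :: "(nat \<Rightarrow> nat) \<Rightarrow> nat set" where
  "succ_arcs succ = {e. succ (src e) = e}"

lemma runs_low_trace:
  assumes ready: "ready \<sigma>" and y: "nmem \<sigma> Pivot 0 = y" "y \<in> back_heads"
    and pq: "nmem \<sigma> Walk_Fst 0 = p" "p < n" "nmem \<sigma> Walk_Snd 0 = q" "q < n"
      "nmem \<sigma> Low_Fst (pair_cell y p q) \<noteq> 0"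
  shows "runs low_trace \<sigma> (\<lambda>\<tau>. \<exists>A B. path_in (succ_arcs (nmem \<tau> Succ)) s A p 0 \<and>
    path_in (succ_arcs (nmem \<tau> Succ)) y B q 0 \<and> A \<inter> B = {} \<and>
    (\<forall>u. u \<notin> A \<union> B \<longrightarrow> nmem \<tau> Succ u = nmem \<sigma> Succ u)) ((n + 1) * 250)"
proof -
  have "linked y (nmem \<sigma> Low_Fst) (nmem \<sigma> Low_Snd)" using readyD(3)[OF ready y(2)]
    by (simp add: pairs_table_def)
  moreover have "y < n" using y(2) by (simp add: back_heads_def)
  ultimately show ?thesis
    using low.runs_trace[OF prepared_low_oriented[OF readyD(1)[OF ready]] y(1) _ _ pq]
    by (simp add: low.traced_to_def low.followed_def succ_arcs_def)
qed

lemma runs_high_trace: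
  assumes ready: "ready \<sigma>" and x: "nmem \<sigma> Pivot 0 = x" "x \<in> back_tails"
    and pq: "nmem \<sigma> Walk_Fst 0 = q" "q < n" "nmem \<sigma> Walk_Snd 0 = p" "p < n"
      "nmem \<sigma> High_Fst (pair_cell x q p) \<noteq> 0"
  shows "runs high_trace \<sigma> (\<lambda>\<tau>. \<exists>A B. path_in (succ_arcs (nmem \<tau> Succ)) p A x 0 \<and>
    path_in (succ_arcs (nmem \<tau> Succ)) q B t 0 \<and> A \<inter> B = {}) ((n + 1) * 250)"
proof -
  have "high.linked x (nmem \<sigma> High_Fst) (nmem \<sigma> High_Snd)"
    using readyD(4)[OF ready x(2)] by (simp add: high_table_def high.pairs_table_def)
  moreover have "x < n" using x(2) by (simp add: back_tails_def)
  ultimately have "runs high_trace \<sigma>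
    (\<lambda>\<tau>. \<exists>B A. high.traced_to (nmem \<sigma> Succ) q p t x B A (nmem \<tau> Succ)) ((n + 1) * 250)"
    by (intro high.runs_trace[OF prepared_high_oriented[OF readyD(1)[OF ready]] x(1) _ _ pq])
  then show ?thesis
    by (rule runs_conseq) (auto simp: high.traced_to_def high.followed_def succ_arcs_def)
qed

end

section \<open>Removed vertices\<close>

abbreviation (input) Turn :: nat where "Turn \<equiv> 60"
abbreviation (input) Split_Fst :: nat where "Split_Fst \<equiv> 61"
abbreviation (input) Split_Snd :: nat where "Split_Snd \<equiv> 62"

definition clear_removed :: com where
  "clear_removed = For Index num_verts (Removed\<langle>var Index\<rangle> ::= NConst 0)"

definition ancestor_step :: com where
  "ancestor_step = Index2 ::= Rev_Order\<langle>var Index\<rangle> ;;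
    When (Nonzero (Is_Forward\<langle>var Index2\<rangle>) AND Nonzero (Removed\<langle>Dst\<langle>var Index2\<rangle>\<rangle>))
      (Removed\<langle>Src\<langle>var Index2\<rangle>\<rangle> ::= NConst 1)"

definition remove_ancestors :: com where
  "remove_ancestors = Removed\<langle>Src\<langle>var Split_Fst\<rangle>\<rangle> ::= NConst 1 ;; For Index num_arcs ancestor_step"

definition remove_step :: com where
  "remove_step = When (BNot (Eq (var Walk_Fst) end_vertex))
    (Walk_Fst ::= Dst\<langle>Succ\<langle>var Walk_Fst\<rangle>\<rangle> ;; Removed\<langle>var Walk_Fst\<rangle> ::= NConst 1)"

definition remove_path_init :: com where
  "remove_path_init = Removed\<langle>Dst\<langle>var Split_Fst\<rangle>\<rangle> ::= NConst 1 ;;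
    Walk_Fst ::= Dst\<langle>var Split_Snd\<rangle> ;; Removed\<langle>var Walk_Fst\<rangle> ::= NConst 1"

definition remove_path :: com where
  "remove_path = remove_path_init ;; For Index num_verts remove_step"

definition high_init :: com where
  "high_init = Pivot ::= var Turn ;; Walk_Fst ::= Dst\<langle>var Split_Snd\<rangle> ;; Walk_Snd ::= Dst\<langle>var Split_Fst\<rangle>"

definition remove :: com where
  "remove = clear_removed ;; remove_ancestors ;; high_init ;; high_trace ;; remove_path"

lemma remove_writes [simp]:
  "nat_writes clear_removed = {Index, Removed}" "real_writes clear_removed = {}"
  "nat_writes ancestor_step = {Index2, Removed}" "real_writes ancestor_step = {}"
  "loop_free ancestor_step"
  "nat_writes remove_ancestors = {Index, Index2, Removed}" "real_writes remove_ancestors = {}"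
  "nat_writes remove_step = {Walk_Fst, Removed}" "real_writes remove_step = {}" "loop_free remove_step"
  "nat_writes remove_path_init = {Walk_Fst, Removed}" "real_writes remove_path_init = {}"
  "loop_free remove_path_init"
  "nat_writes remove_path = {Index, Walk_Fst, Removed}" "real_writes remove_path = {}"
  "nat_writes high_init = {Pivot, Walk_Fst, Walk_Snd}" "real_writes high_init = {}" "loop_free high_init"
  "nat_writes remove = {Index, Index2, Removed, Pivot, Succ, Walk_Fst, Walk_Snd, Arc_Fst, Arc_Snd}"
  "real_writes remove = {}"
  by (auto simp: high_init_def remove_def clear_removed_def ancestor_step_def remove_ancestors_def
    remove_step_def remove_path_init_def remove_path_def)

context layered_arcs
begin

lemma runs_clear_removed:
  "has_input \<sigma> \<Longrightarrow> runs clear_removed \<sigma> (\<lambda>\<tau>. \<forall>v<n. nmem \<tau> Removed v = 0) ((n + 1) * 20)"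
  unfolding clear_removed_def
  by (rule runs_For_run[where I = "\<lambda>i \<tau>. \<forall>v<i. nmem \<tau> Removed v = 0"])
    (auto simp: fresh_counter_def has_inputD less_Suc_eq)

lemma ancestors_refl: "p < n \<Longrightarrow> p \<in> ancestors p"
  using forward_path_refl unfolding ancestors_def by blast

lemma ancestors_src: "forward e \<Longrightarrow> dst e \<in> ancestors p \<Longrightarrow> src e \<in> ancestors p"
  using forward_path_step unfolding ancestors_def by blast

lemma ancestors_cases:
  assumes "v \<in> ancestors p"
  obtains (self) "v = p" | (arc) e where "forward e" "src e = v" "dst e \<in> ancestors p"
proof -
  obtain S where "forward_path v S p" using assms unfolding ancestors_def by blast
  then show thesis by (cases rule: forward_path_cases) (use that in \<open>auto simp: ancestors_def\<close>)
qed

definition ancestors_inv :: "nat \<Rightarrow> nat \<Rightarrow> ram_state \<Rightarrow> bool" where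
  "ancestors_inv p i \<tau> \<longleftrightarrow> (\<forall>v<n. nmem \<tau> Removed v \<noteq> 0 \<longrightarrow> v \<in> ancestors p) \<and> nmem \<tau> Removed p \<noteq> 0 \<and>
    (\<forall>e. forward e \<longrightarrow> m - 1 - arc_rank e < i \<longrightarrow> dst e \<in> ancestors p \<longrightarrow> nmem \<tau> Removed (src e) \<noteq> 0)"

lemma ancestors_inv_step:
  assumes inv: "ancestors_inv p i \<tau>" and prepared: "prepared \<tau>" and i: "nmem \<tau> Index 0 = i" "i < m"
  shows "ancestors_inv p (Suc i) (run ancestor_step \<tau>)"
proof -
  note input = preparedD(1)[OF prepared] and classified = preparedD(3)[OF prepared]
  define e where "e = nmem \<tau> Rev_Order i"
  note order = enumerates_rev_order[OF preparedD(4)[OF prepared]]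
  have e: "e < m" "m - 1 - arc_rank e = i" using enumerates_inverse[OF order i(2)] unfolding e_def
    by auto
  have marked: "nmem \<tau> Removed (dst e) \<noteq> 0" if "forward e" "dst e \<in> ancestors p"
    using that(2)
  proof (cases rule: ancestors_cases)
    case (arc f)
    have "arc_rank e < arc_rank f"
      using arc_rank_mono[of f e] forwardD(1,2)[OF that(1)] forwardD(1)[OF arc(1)] arc(2)
      by (simp add: precedes_def)
    then have "m - 1 - arc_rank f < i" using e arc_rank_less[OF forwardD(1)[OF arc(1)]] by linarith
    then show ?thesis using inv arc unfolding ancestors_inv_def by metis
  qed (use inv in \<open>simp add: ancestors_inv_def\<close>)
  have only_e: "g = e" if "forward g" "m - 1 - arc_rank g = i" for g
    using order forwardD(1)[OF that(1)] that(2) by (auto simp: enumerates_def e_def)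
  let ?test = "forward e \<and> nmem \<tau> Removed (dst e) \<noteq> 0"
  have run: "nmem (run ancestor_step \<tau>) Removed =
    (if ?test then (nmem \<tau> Removed)(src e := Suc 0) else nmem \<tau> Removed)"
    using e(1) i(1) classifiedD(1)[OF classified, of e]
    by (auto simp: ancestor_step_def has_inputD[OF input] e_def[symmetric])
  have kept: "nmem (run ancestor_step \<tau>) Removed v \<noteq> 0" if "nmem \<tau> Removed v \<noteq> 0" for v
    using that unfolding run by simp
  have ancestor: "src e \<in> ancestors p" if ?test
    using ancestors_src[of e p] inv that forwardD(4)[of e] unfolding ancestors_inv_def by blast
  show ?thesis
    unfolding ancestors_inv_def
  proof (intro conjI allI impI)
    fix v assume "v < n" "nmem (run ancestor_step \<tau>) Removed v \<noteq> 0"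
    then consider "nmem \<tau> Removed v \<noteq> 0" | "v = src e" ?test unfolding run by (auto split: if_splits)
    then show "v \<in> ancestors p" using inv ancestor \<open>v < n\<close> by cases (auto simp: ancestors_inv_def)
  next
    fix g assume g: "forward g" "m - 1 - arc_rank g < Suc i" "dst g \<in> ancestors p"
    show "nmem (run ancestor_step \<tau>) Removed (src g) \<noteq> 0"
    proof (cases "m - 1 - arc_rank g = i")
      case True
      then show ?thesis using only_e[OF g(1)] g marked unfolding run by simp
    next
      case False
      then show ?thesis using inv g kept unfolding ancestors_inv_def by simp
    qed
  qed (use inv kept in \<open>simp add: ancestors_inv_def\<close>)
qed

lemma runs_remove_ancestors:
  assumes prepared: "prepared \<sigma>" and e: "nmem \<sigma> Split_Fst 0 = e" "e < m"
    and cleared: "\<forall>v<n. nmem \<sigma> Removed v = 0"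
  shows "runs remove_ancestors \<sigma> (\<lambda>\<tau>. \<forall>v<n. nmem \<tau> Removed v \<noteq> 0 \<longleftrightarrow>
    v \<in> ancestors (src e)) (10 + (m + 1) * 60)"
  unfolding remove_ancestors_def
proof (rule runs_run_Seq)
  let ?\<tau> = "run (Removed\<langle>Src\<langle>var Split_Fst\<rangle>\<rangle> ::= NConst 1) \<sigma>"
  note input = preparedD(1)[OF prepared]
  have prepared1: "prepared ?\<tau>"
    by (rule prepared_frame[OF prepared reaches_frame[OF reaches_run[OF _ order_refl]]]) auto
  show "runs (For Index num_arcs ancestor_step) ?\<tau>
    (\<lambda>\<tau>. \<forall>v<n. nmem \<tau> Removed v \<noteq> 0 \<longleftrightarrow> v \<in> ancestors (src e)) ((m + 1) * 60)"
  proof (rule runs_For_run[where I = "ancestors_inv (src e)"],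
    goal_cases bound fresh stable loop_free init step exit time)
    case init
    show ?case
      using cleared e ancestors_refl[OF src_less[OF e(2)]] has_inputD(5)[OF input e(2)]
      by (auto simp: ancestors_inv_def)
  next
    case (step i \<tau>)
    have "prepared \<tau>" by (rule prepared_frame[OF prepared1 step(4)]) auto
    then show ?case using ancestors_inv_step[OF step(3) _ step(2,1)] by blast
  next
    case (exit \<tau>)
    have "nmem \<tau> Removed v \<noteq> 0" if "v \<in> ancestors (src e)" for v
      using that
    proof (cases rule: ancestors_cases)
      case (arc f)
      then have "m - 1 - arc_rank f < m" using forwardD(1) by fastforce
      then show ?thesis using exit(1) arc unfolding ancestors_inv_def by metis
    qed (use exit(1) in \<open>simp add: ancestors_inv_def\<close>)
    then show ?case using exit(1) unfolding ancestors_inv_def by blast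
  qed (use has_inputD(2)[OF preparedD(1)[OF prepared1]] in \<open>auto simp: fresh_counter_def
    ancestors_inv_def ancestor_step_def\<close>)
qed auto

definition walk_position ::
  "nat set \<Rightarrow> nat \<Rightarrow> nat set \<Rightarrow> nat \<Rightarrow> real \<Rightarrow> nat \<Rightarrow> nat \<Rightarrow> nat set \<Rightarrow> real \<Rightarrow> bool" where
  "walk_position F a S b k i v S1 k1 \<longleftrightarrow> path_in F a S1 v k1 \<and> (v \<noteq> b \<longrightarrow> card S1 = Suc i) \<and>
    (\<exists>S2 k2. path_in F v S2 b k2 \<and> S1 \<inter> S2 = {v} \<and> S = S1 \<union> S2 \<and> k = k1 + k2)"

lemma walk_position_start: "path_in F a S b k \<Longrightarrow> walk_position F a S b k 0 a {a} 0"
  using path_inD[of F a S b k] path_in.nil unfolding walk_position_def by auto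

lemma walk_position_step:
  assumes position: "walk_position (succ_arcs succ) a S b k i v S1 k1" and v: "v \<noteq> b"
  defines "e \<equiv> succ v"
  shows "e < m" "src e = v" "dst e \<notin> S1"
    "walk_position (succ_arcs succ) a S b k (Suc i) (dst e) (insert (dst e) S1) (k1 + excess e)"
proof -
  obtain S2 k2 where P: "path_in (succ_arcs succ) a S1 v k1" "card S1 = Suc i"
    "path_in (succ_arcs succ) v S2 b k2"
    "S1 \<inter> S2 = {v}" "S = S1 \<union> S2" "k = k1 + k2"
    using position v unfolding walk_position_def by blast
  obtain T l where T: "e \<in> succ_arcs succ" "e < m" "src e = v" "path_in (succ_arcs succ) (dst e) T b l"
    "v \<notin> T" "S2 = insert v T" "k2 = excess e + l"
    using P(3) v by (cases rule: path_in.cases) (auto simp: succ_arcs_def e_def)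
  show "e < m" "src e = v" using T by auto
  have "dst e \<in> T" using path_inD(5)[OF T(4)] .
  then show new: "dst e \<notin> S1" using P(4) T(5,6) by auto
  have "path_in (succ_arcs succ) a (insert (dst e) S1) (dst e) (k1 + excess e)"
    using path_in_snoc[of "succ_arcs succ" a S1 e k1] P(1) T(1-3) new by simp
  moreover have "insert (dst e) S1 \<inter> T = {dst e}" "S = insert (dst e) S1 \<union> T"
    using P(4,5) T(5,6) \<open>dst e \<in> T\<close> path_inD(6)[OF P(1)] by auto
  moreover have "card (insert (dst e) S1) = Suc (Suc i)" using new P(2) path_inD(4)[OF P(1)] by simp
  ultimately show "walk_position (succ_arcs succ) a S b k (Suc i) (dst e) (insert (dst e) S1)
    (k1 + excess e)"
    unfolding walk_position_def using T(4,7) P(6) by (auto simp: add.assoc)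
qed

lemma walk_position_end:
  assumes "walk_position F a S b k n v S1 k1"
  shows "v = b" "S1 = S" "k1 = k"
proof -
  obtain S2 k2 where P: "path_in F a S1 v k1" "v \<noteq> b \<longrightarrow> card S1 = Suc n" "path_in F v S2 b k2"
    "S1 \<inter> S2 = {v}" "S = S1 \<union> S2" "k = k1 + k2"
    using assms unfolding walk_position_def by blast
  have "card S1 \<le> n" using path_inD(3)[OF P(1)] card_mono[of "{..<n}" S1] by simp
  then show "v = b" using P(2) by auto
  then have "S2 = {b}" "k2 = 0" "b \<in> S1" using P(3) path_in_loop path_inD(6)[OF P(1)] by blast+
  then show "S1 = S" "k1 = k" using P(5,6) by (simp_all add: insert_absorb)
qed

lemma runs_remove_path:
  assumes input: "has_input \<sigma>" and e: "nmem \<sigma> Split_Fst 0 = e1" "e1 < m" "nmem \<sigma> Split_Snd 0 = e2"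
    "e2 < m"
    and path: "path_in (succ_arcs (nmem \<sigma> Succ)) (dst e2) S t k"
  shows "runs remove_path \<sigma> (\<lambda>\<tau>. \<forall>v. nmem \<tau> Removed v \<noteq> 0 \<longleftrightarrow>
    nmem \<sigma> Removed v \<noteq> 0 \<or> v \<in> {dst e1} \<union> S) (20 + (n + 1) * 50)"
  unfolding remove_path_def
proof (rule runs_run_Seq)
  let ?\<tau> = "run remove_path_init \<sigma>"
    and ?position = "walk_position (succ_arcs (nmem \<sigma> Succ)) (dst e2) S t k"
  have start: "nmem ?\<tau> Walk_Fst 0 = dst e2"
    "nmem ?\<tau> Removed = (nmem \<sigma> Removed)(dst e1 := Suc 0, dst e2 := Suc 0)"
    "nmem ?\<tau> Succ = nmem \<sigma> Succ"
    using e by (simp_all add: remove_path_init_def has_inputD[OF input])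
  have input1: "has_input ?\<tau>"
    by (rule has_input_frame[OF input reaches_frame[OF reaches_run[OF _ order_refl]]]) auto
  show "runs (For Index num_verts remove_step) ?\<tau>
    (\<lambda>\<tau>. \<forall>v. nmem \<tau> Removed v \<noteq> 0 \<longleftrightarrow> nmem \<sigma> Removed v \<noteq> 0 \<or> v \<in> {dst e1} \<union> S) ((n + 1) * 50)"
  proof (rule runs_For_run[where I = "\<lambda>i \<tau>. \<exists>S1 k1. ?position i (nmem \<tau> Walk_Fst 0) S1 k1 \<and>
      (\<forall>v. nmem \<tau> Removed v \<noteq> 0 \<longleftrightarrow> nmem \<sigma> Removed v \<noteq> 0 \<or> v \<in> {dst e1} \<union> S1)"],
      goal_cases bound fresh stable loop_free init step exit time)
    case init
    show ?case using walk_position_start[OF path] start(1,2) by auto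
  next
    case (step i \<tau>)
    have input2: "has_input \<tau>" by (rule has_input_frame[OF input1 step(4)]) auto
    have succ: "nmem \<tau> Succ = nmem \<sigma> Succ" using frameD(1)[OF step(4)] start(3) by simp
    let ?v = "nmem \<tau> Walk_Fst 0"
    obtain S1 k1 where S1: "?position i ?v S1 k1"
      "\<forall>v. nmem \<tau> Removed v \<noteq> 0 \<longleftrightarrow> nmem \<sigma> Removed v \<noteq> 0 \<or> v \<in> {dst e1} \<union> S1" using step(3) by blast
    show ?case
    proof (cases "?v = t")
      case True
      then have "run remove_step \<tau> = \<tau>" by (simp add: remove_step_def has_inputD[OF input2])
      then show ?thesis using S1 True unfolding walk_position_def by auto
    next
      case False
      note new = walk_position_step[OF S1(1) False]
      have "nmem (run remove_step \<tau>) Walk_Fst 0 = dst (nmem \<sigma> Succ ?v)"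
        "nmem (run remove_step \<tau>) Removed = (nmem \<tau> Removed)(dst (nmem \<sigma> Succ ?v) := Suc 0)"
        using False new(1) succ by (simp_all add: remove_step_def has_inputD[OF input2])
      then show ?thesis using new(4) S1(2) by auto
    qed
  next
    case (exit \<tau>)
    then show ?case using walk_position_end by blast
  qed (use has_inputD(1)[OF input1] in \<open>auto simp: fresh_counter_def remove_step_def\<close>)
qed (auto simp: remove_path_init_def)

definition high_part :: "nat \<Rightarrow> nat \<Rightarrow> nat \<Rightarrow> nat set \<Rightarrow> nat set \<Rightarrow> nat set \<Rightarrow> (nat \<Rightarrow> nat) \<Rightarrow> bool" where
  "high_part x e1 e2 A B R succ \<longleftrightarrow>
    path_in (succ_arcs succ) (dst e1) A x 0 \<and> path_in (succ_arcs succ) (dst e2) B t 0 \<and>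
    A \<inter> B = {} \<and> (\<forall>v<n. v \<in> R \<longleftrightarrow> v \<in> ancestors (src e1) \<union> {dst e1} \<union> B)"

definition split_vars :: "nat \<Rightarrow> nat \<Rightarrow> nat \<Rightarrow> ram_state \<Rightarrow> bool" where
  "split_vars x e1 e2 \<tau> \<longleftrightarrow> nmem \<tau> Turn 0 = x \<and> nmem \<tau> Split_Fst 0 = e1 \<and> nmem \<tau> Split_Snd 0 = e2"

definition remove_time :: nat where
  "remove_time = (n + 1) * 20 + (10 + (m + 1) * 60 + (20 + ((n + 1) * 250 + (20 + (n + 1) * 50))))"

lemma runs_remove:
  assumes ready: "ready \<sigma>" and vars: "split_vars x e1 e2 \<sigma>" and x: "x \<in> back_tails" and e: "e1 < m"
    "e2 < m"
    and cell: "nmem \<sigma> High_Fst (pair_cell x (dst e2) (dst e1)) \<noteq> 0"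
  shows "runs remove \<sigma> (\<lambda>\<tau>. \<exists>A B. high_part x e1 e2 A B {v. nmem \<tau> Removed v \<noteq> 0} (nmem \<tau> Succ))
    remove_time"
proof -
  obtain \<tau>1 where \<tau>1: "reaches clear_removed \<sigma> ((n + 1) * 20) \<tau>1" "frame clear_removed \<sigma> \<tau>1"
    "\<forall>v<n. nmem \<tau>1 Removed v = 0"
    by (rule runsE[OF runs_clear_removed[OF readyD(2)[OF ready]]])
  have ready1: "ready \<tau>1" by (rule ready_frame[OF ready \<tau>1(2)]) auto
  obtain \<tau>2 where \<tau>2: "reaches remove_ancestors \<tau>1 (10 + (m + 1) * 60) \<tau>2" "frame remove_ancestors \<tau>1 \<tau>2"
    "\<forall>v<n. nmem \<tau>2 Removed v \<noteq> 0 \<longleftrightarrow> v \<in> ancestors (src e1)"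
    by (rule runsE[OF runs_remove_ancestors[OF readyD(1)[OF ready1] _ e(1) \<tau>1(3)]])
      (use frameD(1)[OF \<tau>1(2)] vars in \<open>auto simp: split_vars_def\<close>)
  have ready2: "ready \<tau>2" by (rule ready_frame[OF ready1 \<tau>2(2)]) auto
  let ?\<tau>3 = "run high_init \<tau>2"
  have \<tau>3: "reaches high_init \<tau>2 20 ?\<tau>3" by (rule reaches_run) (simp_all add: high_init_def)
  have ready3: "ready ?\<tau>3" by (rule ready_frame[OF ready2 reaches_frame[OF \<tau>3]]) auto
  have vars3: "nmem ?\<tau>3 Pivot 0 = x" "nmem ?\<tau>3 Walk_Fst 0 = dst e2" "nmem ?\<tau>3 Walk_Snd 0 = dst e1"
    "nmem ?\<tau>3 High_Fst = nmem \<sigma> High_Fst"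
    using vars frameD(1)[OF \<tau>1(2)] frameD(1)[OF \<tau>2(2)] has_inputD(6)[OF readyD(2)[OF ready2]] e
    by (simp_all add: high_init_def split_vars_def)
  obtain \<tau>4 where \<tau>4: "reaches high_trace ?\<tau>3 ((n + 1) * 250) \<tau>4" "frame high_trace ?\<tau>3 \<tau>4"
    "\<exists>A B. path_in (succ_arcs (nmem \<tau>4 Succ)) (dst e1) A x 0 \<and>
      path_in (succ_arcs (nmem \<tau>4 Succ)) (dst e2) B t 0 \<and>
      A \<inter> B = {}"
    by (rule runsE[OF runs_high_trace[OF ready3 vars3(1) x vars3(2) dst_less[OF e(2)] vars3(3)
      dst_less[OF e(1)]]])
      (use cell vars3(4) in auto)
  then obtain A B where AB: "path_in (succ_arcs (nmem \<tau>4 Succ)) (dst e1) A x 0"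
    "path_in (succ_arcs (nmem \<tau>4 Succ)) (dst e2) B t 0" "A \<inter> B = {}" by blast
  have ready4: "ready \<tau>4" by (rule ready_frame[OF ready3 \<tau>4(2)]) auto
  have vars4: "nmem \<tau>4 Split_Fst 0 = e1" "nmem \<tau>4 Split_Snd 0 = e2" "nmem \<tau>4 Removed = nmem \<tau>2 Removed"
    using vars frameD(1)[OF \<tau>1(2)] frameD(1)[OF \<tau>2(2)] frameD(1)[OF \<tau>4(2)]
    by (simp_all add: high_init_def split_vars_def)
  obtain \<tau>5 where \<tau>5: "reaches remove_path \<tau>4 (20 + (n + 1) * 50) \<tau>5" "frame remove_path \<tau>4 \<tau>5"
    "\<forall>v. nmem \<tau>5 Removed v \<noteq> 0 \<longleftrightarrow> nmem \<tau>4 Removed v \<noteq> 0 \<or> v \<in> {dst e1} \<union> B"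
    by (rule runsE[OF runs_remove_path[OF readyD(2)[OF ready4] vars4(1) e(1) vars4(2) e(2) AB(2)]])
  have "high_part x e1 e2 A B {v. nmem \<tau>5 Removed v \<noteq> 0} (nmem \<tau>5 Succ)"
    using AB \<tau>5(3) \<tau>2(3) vars4(3) frameD(1)[OF \<tau>5(2)] by (auto simp: high_part_def)
  then show ?thesis
    unfolding remove_def remove_time_def
    by (intro runsI[OF reaches_Seq[OF \<tau>1(1)
      reaches_Seq[OF \<tau>2(1) reaches_Seq[OF \<tau>3 reaches_Seq[OF \<tau>4(1) \<tau>5(1)]]]]]) auto
qed

end

section \<open>Scanning the candidates\<close>

abbreviation (input) Improved :: nat where "Improved \<equiv> 56"
abbreviation (input) Best_Arc :: nat where "Best_Arc \<equiv> 57"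
abbreviation (input) Best_Value :: nat where "Best_Value \<equiv> 4"
abbreviation (input) Cand_Value :: nat where "Cand_Value \<equiv> 5"

definition scan_step :: com where
  "scan_step = When (BNot (Nonzero (Is_Forward\<langle>var Index\<rangle>)) AND Nonzero (Reached\<langle>Src\<langle>var Index\<rangle>\<rangle>) AND
      Nonzero (Low_Fst\<langle>pair_index (Dst\<langle>var Index\<rangle>) (Src\<langle>var Split_Fst\<rangle>) (Src\<langle>var Split_Snd\<rangle>)\<rangle>))
    (Cand_Value\<langle>NConst 0\<rangle>\<^sub>r ::= RAdd (RSub (Level\<langle>var Turn\<rangle>\<^sub>r) (Level\<langle>Dst\<langle>var Index\<rangle>\<rangle>\<^sub>r))
       (RAdd (Path_Dist\<langle>Src\<langle>var Index\<rangle>\<rangle>\<^sub>r) (Weight\<langle>var Index\<rangle>\<^sub>r)) ;;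
     When (BNot (Nonzero (var Found)) OR RLess (Cand_Value\<langle>NConst 0\<rangle>\<^sub>r) (Best_Value\<langle>NConst 0\<rangle>\<^sub>r))
       (Best_Value\<langle>NConst 0\<rangle>\<^sub>r ::= Cand_Value\<langle>NConst 0\<rangle>\<^sub>r ;;
        Found ::= NConst 1 ;; Improved ::= NConst 1 ;; Best_Arc ::= var Index))"

definition scan :: com where
  "scan = Improved ::= NConst 0 ;; For Index num_arcs scan_step"

lemma scan_writes [simp]:
  "nat_writes scan_step = {Found, Improved, Best_Arc}" "real_writes scan_step = {Best_Value, Cand_Value}"
  "loop_free scan_step"
  "nat_writes scan = {Found, Index, Improved, Best_Arc}" "real_writes scan = {Best_Value, Cand_Value}"
  by (auto simp: scan_step_def scan_def)

context layered_arcs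
begin

definition closing_arc :: "nat \<Rightarrow> nat \<Rightarrow> (nat \<Rightarrow> nat) \<Rightarrow> (nat \<Rightarrow> nat) \<Rightarrow> nat \<Rightarrow> bool" where
  "closing_arc e1 e2 U reached e \<longleftrightarrow> e < m \<and> \<not> forward e \<and> reached (src e) \<noteq> 0 \<and>
    U (pair_cell (dst e) (src e1) (src e2)) \<noteq> 0"

definition detour_excess :: "nat \<Rightarrow> (nat \<Rightarrow> real) \<Rightarrow> nat \<Rightarrow> real" where
  "detour_excess x cost e = d x - d (dst e) + (cost (src e) + w e)"

definition scanned_upto :: "(nat \<Rightarrow> bool) \<Rightarrow> (nat \<Rightarrow> real) \<Rightarrow> ram_state \<Rightarrow> nat \<Rightarrow> ram_state \<Rightarrow> bool" where
  "scanned_upto C f \<sigma> i \<tau> \<longleftrightarrow>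
    (\<forall>e<i. C e \<longrightarrow> nmem \<tau> Found 0 \<noteq> 0 \<and> rmem \<tau> Best_Value 0 \<le> f e) \<and>
    (if nmem \<tau> Improved 0 = 0 then nmem \<tau> Found 0 = nmem \<sigma> Found 0 \<and> rmem \<tau> Best_Value 0 =
      rmem \<sigma> Best_Value 0
     else nmem \<tau> Found 0 \<noteq> 0 \<and> C (nmem \<tau> Best_Arc 0) \<and> rmem \<tau> Best_Value 0 = f (nmem \<tau> Best_Arc 0)) \<and>
    (nmem \<sigma> Found 0 \<noteq> 0 \<longrightarrow> nmem \<tau> Found 0 \<noteq> 0 \<and> rmem \<tau> Best_Value 0 \<le> rmem \<sigma> Best_Value 0) \<and>
    nmem \<tau> Found (Suc 0) = nmem \<sigma> Found (Suc 0)"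

lemma runs_scan:
  assumes ready: "ready \<sigma>" and vars: "split_vars x e1 e2 \<sigma>" and x: "x < n" and e: "e1 < m" "e2 < m"
  shows "runs scan \<sigma> (scanned_upto (closing_arc e1 e2 (nmem \<sigma> Low_Fst) (nmem \<sigma> Reached))
    (detour_excess x (rmem \<sigma> Path_Dist)) \<sigma> m) (5 + (m + 1) * 150)"
  unfolding scan_def
proof (rule runs_run_Seq)
  let ?C = "closing_arc e1 e2 (nmem \<sigma> Low_Fst) (nmem \<sigma> Reached)"
    and ?f = "detour_excess x (rmem \<sigma> Path_Dist)"
  let ?\<tau> = "run (Improved ::= NConst 0) \<sigma>"
  have ready1: "ready ?\<tau>"
    by (rule ready_frame[OF ready reaches_frame[OF reaches_run[OF _ order_refl]]]) auto
  show "runs (For Index num_arcs scan_step) ?\<tau> (scanned_upto ?C ?f \<sigma> m) ((m + 1) * 150)"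
  proof (rule runs_For_run[where I = "scanned_upto ?C ?f \<sigma>"],
    goal_cases bound fresh stable loop_free init step exit time)
    case (step i \<tau>)
    have ready2: "ready \<tau>" by (rule ready_frame[OF ready1 step(4)]) auto
    note prepared = readyD(1)[OF ready2] and input = has_inputD[OF readyD(2)[OF ready2]]
    have arrays: "nmem \<tau> Low_Fst = nmem \<sigma> Low_Fst" "nmem \<tau> Reached = nmem \<sigma> Reached"
      "rmem \<tau> Path_Dist = rmem \<sigma> Path_Dist" "nmem \<tau> Turn 0 = x" "nmem \<tau> Split_Fst 0 = e1"
      "nmem \<tau> Split_Snd 0 = e2"
      using frameD[OF step(4)] vars by (simp_all add: split_vars_def)
    have ends: "src i < n" "dst i < n" "src e1 < n" using src_less dst_less step(1) e by auto
    have "nmem \<tau> Times_N2 (dst i) + nmem \<tau> Times_N (src e1) + src e2 =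
      pair_cell (dst i) (src e1) (src e2)"
      using preparedD(6,7)[OF prepared] ends by (simp add: pair_cell_def)
    then have run: "run scan_step \<tau> = (if ?C i
        then (if nmem \<tau> Found 0 = 0 \<or> ?f i < rmem \<tau> Best_Value 0
          then nupd (nupd (nupd (rupd (rupd \<tau> Cand_Value 0 (?f i)) Best_Value 0 (?f i)) Found 0 1)
            Improved 0 1) Best_Arc 0 i
          else rupd \<tau> Cand_Value 0 (?f i)) else \<tau>)"
      using step(1,2) e classifiedD(1)[OF preparedD(3)[OF prepared],
        of i] preparedD(2)[OF prepared] x ends input(5-7)
      by (simp add: scan_step_def arrays closing_arc_def detour_excess_def)
    show ?case using step(3) unfolding run scanned_upto_def by (auto simp: less_Suc_eq split: if_splits)
  qed (use has_inputD(2)[OF readyD(2)[OF ready1]] in \<open>auto simp: fresh_counter_def scanned_upto_def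
    scan_step_def\<close>)
qed auto

end

section \<open>Writing out a candidate\<close>

definition back_step :: com where
  "back_step = When (BNot (Eq (var Walk_Fst) (var Turn)))
    (Arc_Fst ::= Parent\<langle>var Walk_Fst\<rangle> ;;
     Walk_Fst ::= Src\<langle>var Arc_Fst\<rangle> ;;
     Succ\<langle>var Walk_Fst\<rangle> ::= var Arc_Fst)"

definition trace_middle :: com where
  "trace_middle =
    (Walk_Fst ::= Src\<langle>var Best_Arc\<rangle> ;; Succ\<langle>var Walk_Fst\<rangle> ::= var Best_Arc) ;;
      For Index num_verts back_step"

definition low_init :: com where
  "low_init = Pivot ::= Dst\<langle>var Best_Arc\<rangle> ;; Walk_Fst ::= Src\<langle>var Split_Fst\<rangle> ;;
    Walk_Snd ::= Src\<langle>var Split_Snd\<rangle>"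

definition link_splits :: com where
  "link_splits = Succ\<langle>Src\<langle>var Split_Fst\<rangle>\<rangle> ::= var Split_Fst ;;
    Succ\<langle>Src\<langle>var Split_Snd\<rangle>\<rangle> ::= var Split_Snd"

definition trace_low :: com where
  "trace_low = low_init ;; low_trace ;; link_splits"

definition output_step :: com where
  "output_step = When (BNot (Eq (var Walk_Fst) end_vertex))
    (Out_Arcs\<langle>Found\<langle>NConst 1\<rangle>\<rangle> ::= Succ\<langle>var Walk_Fst\<rangle> ;;
     Found\<langle>NConst 1\<rangle> ::= NAdd (Found\<langle>NConst 1\<rangle>) (NConst 1) ;;
     Walk_Fst ::= Dst\<langle>Succ\<langle>var Walk_Fst\<rangle>\<rangle>)"

definition write_output :: com where
  "write_output =
    (Walk_Fst ::= start_vertex ;; Found\<langle>NConst 1\<rangle> ::= NConst 0) ;; For Index num_verts output_step"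

definition write_candidate :: com where
  "write_candidate = trace_middle ;; trace_low ;; write_output"

lemma write_candidate_writes [simp]:
  "nat_writes back_step = {Arc_Fst, Walk_Fst, Succ}" "real_writes back_step = {}" "loop_free back_step"
  "nat_writes trace_middle = {Index, Arc_Fst, Walk_Fst, Succ}" "real_writes trace_middle = {}"
  "nat_writes low_init = {Pivot, Walk_Fst, Walk_Snd}" "real_writes low_init = {}" "loop_free low_init"
  "nat_writes link_splits = {Succ}" "real_writes link_splits = {}" "loop_free link_splits"
  "nat_writes trace_low = {Index, Pivot, Succ, Walk_Fst, Walk_Snd, Arc_Fst, Arc_Snd}"
  "real_writes trace_low = {}"
  "nat_writes output_step = {Found, Out_Arcs, Walk_Fst}" "real_writes output_step = {}"
  "loop_free output_step"
  "nat_writes write_output = {Index, Found, Out_Arcs, Walk_Fst}" "real_writes write_output = {}"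
  "nat_writes write_candidate =
    {Found, Out_Arcs, Index, Pivot, Succ, Walk_Fst, Walk_Snd, Arc_Fst, Arc_Snd}"
  "real_writes write_candidate = {}"
  by (auto simp: back_step_def trace_middle_def low_init_def link_splits_def trace_low_def
    output_step_def
      write_output_def write_candidate_def)

context layered_arcs
begin

lemma path_in_succ_cong:
  assumes path: "path_in (succ_arcs f) a S b k" and same: "\<And>v. v \<in> S \<Longrightarrow> v \<noteq> b \<Longrightarrow> g v = f v"
  shows "path_in (succ_arcs g) a S b k"
  using path by (rule path_in_cong) (use same in \<open>auto simp: succ_arcs_def\<close>)

subsection \<open>The middle part\<close>

definition back_inv ::
  "nat \<Rightarrow> nat set \<Rightarrow> (nat \<Rightarrow> nat) \<Rightarrow> (nat \<Rightarrow> real) \<Rightarrow> nat \<Rightarrow> (nat \<Rightarrow> nat) \<Rightarrow> nat \<Rightarrow> nat \<Rightarrow> (nat \<Rightarrow> nat) \<Rightarrow> bool" where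
  "back_inv x R reached cost e succ0 i v succ \<longleftrightarrow> reached v \<noteq> 0 \<and> succ (src e) = e \<and>
    (\<exists>S k. path_in (succ_arcs succ) v S (src e) k \<and> (\<forall>u\<in>S. (u = x \<or> u \<notin> R) \<and> cost v \<le> cost u) \<and>
      k \<le> cost (src e) - cost v + d v - d (src e) \<and> (\<forall>u. u \<notin> S \<longrightarrow> succ u = succ0 u) \<and>
        (v \<noteq> x \<longrightarrow> card S = Suc i))"

lemma back_inv_step:
  assumes inv: "back_inv x R reached cost e succ0 i v succ"
    and tree: "parent_tree R x reached cost parent" and v: "v \<noteq> x"
  defines "f \<equiv> parent v"
  shows "f < m" "back_inv x R reached cost e succ0 (Suc i) (src f) (succ(src f := f))"
proof -
  obtain S k where S: "path_in (succ_arcs succ) v S (src e) k" "\<forall>u\<in>S. (u = x \<or> u \<notin> R) \<and> cost v \<le> cost u"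
    "k \<le> cost (src e) - cost v + d v - d (src e)" "\<forall>u. u \<notin> S \<longrightarrow> succ u = succ0 u" "card S = Suc i"
    and v_reached: "reached v \<noteq> 0" and last: "succ (src e) = e"
    using inv v unfolding back_inv_def by blast
  note S' = path_inD[OF S(1)]
  have f: "f < m" "dst f = v" "reached (src f) \<noteq> 0" "cost (src f) + w f \<le> cost v"
    using parent_treeD(4)[OF tree S'(1) v_reached v] unfolding f_def by auto
  then show "f < m" by blast
  have closer: "cost (src f) < cost v" using f(4) weight_pos[OF f(1)] by linarith
  then have new: "src f \<notin> S" using S(2) by force
  have "src f = x \<or> src f \<notin> R" using parent_treeD(4)[OF tree src_less[OF f(1)] f(3)] by blast
  then have allowed: "\<forall>u\<in>insert (src f) S. (u = x \<or> u \<notin> R) \<and> cost (src f) \<le> cost u"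
    using S(2) closer by force
  have "path_in (succ_arcs (succ(src f := f))) v S (src e) k"
    by (rule path_in_succ_cong[OF S(1)]) (use new in auto)
  then have path: "path_in (succ_arcs (succ(src f := f))) (src f) (insert (src f) S) (src e)
    (excess f + k)"
    by (intro path_in.cons) (use f new in \<open>auto simp: succ_arcs_def\<close>)
  have "excess f + k \<le> cost (src e) - cost (src f) + d (src f) - d (src e)"
    using S(3) f(2,4) by (simp add: excess_def)
  moreover have "(succ(src f := f)) (src e) = e" using last S'(6) new by auto
  moreover have "card (insert (src f) S) = Suc (Suc i)" using S(5) S'(4) new by simp
  ultimately show "back_inv x R reached cost e succ0 (Suc i) (src f) (succ(src f := f))"
    unfolding back_inv_def using path allowed f(3) S(4)
    by (intro conjI exI[of _ "insert (src f) S"] exI[of _ "excess f + k"]) auto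
qed

definition middle_part ::
  "nat \<Rightarrow> nat set \<Rightarrow> (nat \<Rightarrow> real) \<Rightarrow> nat \<Rightarrow> nat set \<Rightarrow> real \<Rightarrow> (nat \<Rightarrow> nat) \<Rightarrow> (nat \<Rightarrow> nat) \<Rightarrow> bool" where
  "middle_part x R cost e S k succ0 succ \<longleftrightarrow> path_in (succ_arcs succ) x S (src e) k \<and> succ (src e) = e \<and>
    (S - {x}) \<inter> R = {} \<and> k \<le> cost (src e) + d x - d (src e) \<and> (\<forall>u. u \<notin> S \<longrightarrow> succ u = succ0 u)"

lemma back_inv_middle_part:
  assumes inv: "back_inv x R reached cost e succ0 n v succ"
    and tree: "parent_tree R x reached cost parent"
  shows "\<exists>S k. middle_part x R cost e S k succ0 succ"
proof -
  obtain S k where S: "path_in (succ_arcs succ) v S (src e) k" "\<forall>u\<in>S. u = x \<or> u \<notin> R"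
    "k \<le> cost (src e) - cost v + d v - d (src e)" "\<forall>u. u \<notin> S \<longrightarrow> succ u = succ0 u" "v \<noteq> x \<longrightarrow> card S = Suc n"
    and last: "succ (src e) = e"
    using inv unfolding back_inv_def by blast
  have "card S \<le> n" using path_inD(3)[OF S(1)] card_mono[of "{..<n}" S] by simp
  then have "v = x" using S(5) by auto
  then show ?thesis using S last parent_treeD(2)[OF tree] unfolding middle_part_def by auto
qed

lemma runs_trace_middle:
  assumes input: "has_input \<sigma>" and x: "nmem \<sigma> Turn 0 = x" and e: "nmem \<sigma> Best_Arc 0 = e" "e < m"
    "reached (src e) \<noteq> 0"
    and tree: "parent_tree R x reached cost (nmem \<sigma> Parent)"
  shows "runs trace_middle \<sigma> (\<lambda>\<tau>. \<exists>S k. middle_part x R cost e S k (nmem \<sigma> Succ) (nmem \<tau> Succ))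
    (20 + (n + 1) * 60)"
  unfolding trace_middle_def
proof (rule runs_run_Seq)
  let ?init = "Walk_Fst ::= Src\<langle>var Best_Arc\<rangle> ;; Succ\<langle>var Walk_Fst\<rangle> ::= var Best_Arc"
  let ?\<tau> = "run ?init \<sigma>" and ?inv = "back_inv x R reached cost e (nmem \<sigma> Succ)"
  have input1: "has_input ?\<tau>"
    by (rule has_input_frame[OF input reaches_frame[OF reaches_run[OF _ order_refl]]]) auto
  have start: "nmem ?\<tau> Walk_Fst 0 = src e" "nmem ?\<tau> Succ = (nmem \<sigma> Succ)(src e := e)"
    "nmem ?\<tau> Turn 0 = x"
    "nmem ?\<tau> Parent = nmem \<sigma> Parent"
    using x e has_inputD(5)[OF input e(2)] by simp_all
  show "runs (For Index num_verts back_step) ?\<tau>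
    (\<lambda>\<tau>. \<exists>S k. middle_part x R cost e S k (nmem \<sigma> Succ) (nmem \<tau> Succ))
    ((n + 1) * 60)"
  proof (rule runs_For_run[where I = "\<lambda>i \<tau>. ?inv i (nmem \<tau> Walk_Fst 0) (nmem \<tau> Succ)"],
      goal_cases bound fresh stable loop_free init step exit time)
    case init
    have "src e = x \<or> src e \<notin> R" using parent_treeD(4)[OF tree src_less[OF e(2)] e(3)] by blast
    then show ?case
      unfolding back_inv_def start using e(2,3) path_in.nil[OF src_less]
      by (intro conjI exI[of _ "{src e}"] exI[of _ 0]) auto
  next
    case (step i \<tau>)
    have input2: "has_input \<tau>" by (rule has_input_frame[OF input1 step(4)]) auto
    have vars: "nmem \<tau> Turn 0 = x" "nmem \<tau> Parent = nmem \<sigma> Parent" using frameD(1)[OF step(4)] start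
      by simp_all
    show ?case
    proof (cases "nmem \<tau> Walk_Fst 0 = x")
      case True
      then have "run back_step \<tau> = \<tau>" using vars by (simp add: back_step_def)
      then show ?thesis using step(3) True unfolding back_inv_def by auto
    next
      case False
      note new = back_inv_step[OF step(3) tree False]
      then show ?thesis using False vars has_inputD(5)[OF input2 new(1)] by (simp add: back_step_def)
    qed
  next
    case (exit \<tau>)
    then show ?case using back_inv_middle_part[OF _ tree] by blast
  qed (use has_inputD(1)[OF input1] in \<open>auto simp: fresh_counter_def back_step_def\<close>)
qed auto

subsection \<open>The low part\<close>

definition low_part :: "nat \<Rightarrow> nat \<Rightarrow> nat \<Rightarrow> nat set \<Rightarrow> nat set \<Rightarrow> (nat \<Rightarrow> nat) \<Rightarrow> (nat \<Rightarrow> nat) \<Rightarrow> bool" where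
  "low_part y e1 e2 A B succ0 succ \<longleftrightarrow> path_in (succ_arcs succ) s A (src e1) 0 \<and>
    path_in (succ_arcs succ) y B (src e2) 0 \<and> A \<inter> B = {} \<and> succ (src e1) = e1 \<and> succ (src e2) = e2 \<and>
    (\<forall>u. u \<notin> A \<union> B \<longrightarrow> succ u = succ0 u)"

lemma low_part_link:
  assumes A: "path_in (succ_arcs succ) s A (src e1) 0" and B: "path_in (succ_arcs succ) y B (src e2) 0"
    and disjoint: "A \<inter> B = {}" and same: "\<forall>u. u \<notin> A \<union> B \<longrightarrow> succ u = succ0 u"
  shows "low_part y e1 e2 A B succ0 (succ(src e1 := e1, src e2 := e2))"
proof -
  have ends: "src e1 \<in> A" "src e2 \<in> B" using path_inD(6)[OF A] path_inD(6)[OF B] .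
  have "path_in (succ_arcs (succ(src e1 := e1, src e2 := e2))) s A (src e1) 0"
    by (rule path_in_succ_cong[OF A]) (use ends disjoint in auto)
  moreover have "path_in (succ_arcs (succ(src e1 := e1, src e2 := e2))) y B (src e2) 0"
    by (rule path_in_succ_cong[OF B]) (use ends disjoint in auto)
  ultimately show ?thesis using ends disjoint same unfolding low_part_def by auto
qed

lemma runs_trace_low:
  assumes ready: "ready \<sigma>" and vars: "split_vars x e1 e2 \<sigma>" "nmem \<sigma> Best_Arc 0 = e"
    and e: "e < m" "dst e \<in> back_heads" "e1 < m" "e2 < m"
    and cell: "nmem \<sigma> Low_Fst (pair_cell (dst e) (src e1) (src e2)) \<noteq> 0"
  shows "runs trace_low \<sigma> (\<lambda>\<tau>. \<exists>A B. low_part (dst e) e1 e2 A B (nmem \<sigma> Succ) (nmem \<tau> Succ))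
    (20 + ((n + 1) * 250 + 20))"
proof -
  let ?\<tau>1 = "run low_init \<sigma>"
  note input = has_inputD[OF readyD(2)[OF ready]]
  have \<tau>1: "reaches low_init \<sigma> 20 ?\<tau>1" by (rule reaches_run) (simp_all add: low_init_def)
  have ready1: "ready ?\<tau>1" by (rule ready_frame[OF ready reaches_frame[OF \<tau>1]]) auto
  have vars1: "nmem ?\<tau>1 Pivot 0 = dst e" "nmem ?\<tau>1 Walk_Fst 0 = src e1" "nmem ?\<tau>1 Walk_Snd 0 = src e2"
    "nmem ?\<tau>1 Low_Fst = nmem \<sigma> Low_Fst" "nmem ?\<tau>1 Succ = nmem \<sigma> Succ"
    using vars e input(5,6) by (simp_all add: low_init_def split_vars_def)
  obtain \<tau>2 where \<tau>2: "reaches low_trace ?\<tau>1 ((n + 1) * 250) \<tau>2" "frame low_trace ?\<tau>1 \<tau>2"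
    "\<exists>A B. path_in (succ_arcs (nmem \<tau>2 Succ)) s A (src e1) 0 \<and>
      path_in (succ_arcs (nmem \<tau>2 Succ)) (dst e) B (src e2) 0 \<and>
      A \<inter> B = {} \<and> (\<forall>u. u \<notin> A \<union> B \<longrightarrow> nmem \<tau>2 Succ u = nmem \<sigma> Succ u)"
    by (rule runsE[OF runs_low_trace[OF ready1 vars1(1) e(2) vars1(2) src_less[OF e(3)] vars1(3)
      src_less[OF e(4)]]])
      (use cell vars1(4,5) in auto)
  have ready2: "ready \<tau>2" by (rule ready_frame[OF ready1 \<tau>2(2)]) auto
  let ?\<tau>3 = "run link_splits \<tau>2"
  have \<tau>3: "reaches link_splits \<tau>2 20 ?\<tau>3" by (rule reaches_run) (simp_all add: link_splits_def)
  have "nmem ?\<tau>3 Succ = (nmem \<tau>2 Succ)(src e1 := e1, src e2 := e2)"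
    using vars(1) frameD(1)[OF \<tau>2(2)] e has_inputD(5)[OF readyD(2)[OF ready2]]
    by (simp add: link_splits_def split_vars_def low_init_def)
  then have "\<exists>A B. low_part (dst e) e1 e2 A B (nmem \<sigma> Succ) (nmem ?\<tau>3 Succ)"
    using \<tau>2(3) low_part_link by metis
  then show ?thesis
    unfolding trace_low_def by (intro runsI[OF reaches_Seq[OF \<tau>1 reaches_Seq[OF \<tau>2(1) \<tau>3]]]) auto
qed

subsection \<open>The output\<close>

fun arc_list :: "nat \<Rightarrow> nat list \<Rightarrow> nat \<Rightarrow> bool" where
  "arc_list a [] b \<longleftrightarrow> a = b"
| "arc_list a (e # es) b \<longleftrightarrow> e < m \<and> src e = a \<and> arc_list (dst e) es b"

lemma arc_list_snoc: "arc_list a (es @ [e]) b \<longleftrightarrow> arc_list a es (src e) \<and> e < m \<and> dst e = b"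
  by (induction es arbitrary: a) auto

definition listed :: "nat list \<Rightarrow> nat set \<Rightarrow> nat \<Rightarrow> real \<Rightarrow> bool" where
  "listed es S v k \<longleftrightarrow> arc_list s es v \<and> distinct (s # map dst es) \<and> set (s # map dst es) = S \<and>
    sum_list (map excess es) = k"

lemma listed_snoc:
  assumes "listed es S (src e) k" "e < m" "dst e \<notin> S"
  shows "listed (es @ [e]) (insert (dst e) S) (dst e) (k + excess e)"
  using assms unfolding listed_def by (auto simp: arc_list_snoc)

lemma arc_list_excess: "arc_list a es b \<Longrightarrow> sum_list (map excess es) = sum_list (map w es) + d a - d b"
  by (induction es arbitrary: a) (auto simp: excess_def)

lemma arc_list_path:
  "arc_list a es b \<Longrightarrow> distinct (a # map dst es) \<Longrightarrow> a < n \<Longrightarrow>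
    path a (set (a # map dst es)) b (sum_list (map excess es))"
proof (induction es arbitrary: a)
  case (Cons e es)
  then have "path (dst e) (set (dst e # map dst es)) b (sum_list (map excess es))" using dst_less by auto
  then show ?case using Cons.prems path_in.cons[of e UNIV] by fastforce
qed (auto intro: path_in.nil)

lemma listed_path: "listed es S v k \<Longrightarrow> path s S v k"
  using arc_list_path[of s es v] s_less unfolding listed_def by auto

definition output_arcs :: "ram_state \<Rightarrow> nat list" where
  "output_arcs \<tau> = map (nmem \<tau> Out_Arcs) [0..<nmem \<tau> Found (Suc 0)]"

definition output_inv :: "(nat \<Rightarrow> nat) \<Rightarrow> nat set \<Rightarrow> real \<Rightarrow> nat \<Rightarrow> ram_state \<Rightarrow> bool" where
  "output_inv succ S k i \<tau> \<longleftrightarrow>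
    (\<exists>S1 k1. walk_position (succ_arcs succ) s S t k i (nmem \<tau> Walk_Fst 0) S1 k1 \<and>
    listed (output_arcs \<tau>) S1 (nmem \<tau> Walk_Fst 0) k1)"

lemma output_inv_step:
  assumes input: "has_input \<tau>" and inv: "output_inv (nmem \<tau> Succ) S k i \<tau>"
  shows "output_inv (nmem \<tau> Succ) S k (Suc i) (run output_step \<tau>)"
proof -
  let ?v = "nmem \<tau> Walk_Fst 0"
  obtain S1 k1 where S1: "walk_position (succ_arcs (nmem \<tau> Succ)) s S t k i ?v S1 k1"
    "listed (output_arcs \<tau>) S1 ?v k1" using inv unfolding output_inv_def by blast
  show ?thesis
  proof (cases "?v = t")
    case True
    then have "run output_step \<tau> = \<tau>" by (simp add: output_step_def has_inputD[OF input])
    then show ?thesis using S1 True unfolding output_inv_def walk_position_def by auto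
  next
    case False
    let ?e = "nmem \<tau> Succ ?v" and ?\<tau>' = "run output_step \<tau>"
    note new = walk_position_step[OF S1(1) False]
    have "nmem ?\<tau>' Walk_Fst 0 = dst ?e" "output_arcs ?\<tau>' = output_arcs \<tau> @ [?e]"
      using False new(1) has_inputD(4,6)[OF input] by (simp_all add: output_step_def output_arcs_def)
    moreover have "listed (output_arcs \<tau> @ [?e]) (insert (dst ?e) S1) (dst ?e) (k1 + excess ?e)"
      by (rule listed_snoc) (use S1(2) new(1-3) in auto)
    ultimately show ?thesis using new(4) unfolding output_inv_def by auto
  qed
qed

lemma runs_write_output:
  assumes input: "has_input \<sigma>" and path: "path_in (succ_arcs (nmem \<sigma> Succ)) s S t k"
  shows "runs write_output \<sigma> (\<lambda>\<tau>. nmem \<tau> Found 0 = nmem \<sigma> Found 0 \<and>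
    listed (output_arcs \<tau>) S t k) (20 + (n + 1) * 70)"
  unfolding write_output_def
proof (rule runs_run_Seq)
  let ?init = "Walk_Fst ::= start_vertex ;; Found\<langle>NConst 1\<rangle> ::= NConst 0"
  let ?\<tau> = "run ?init \<sigma>" and ?inv = "output_inv (nmem \<sigma> Succ) S k"
  have input1: "has_input ?\<tau>"
    by (rule has_input_frame[OF input reaches_frame[OF reaches_run[OF _ order_refl]]]) auto
  have start: "nmem ?\<tau> Walk_Fst 0 = s" "nmem ?\<tau> Found (Suc 0) = 0" "nmem ?\<tau> Found 0 = nmem \<sigma> Found 0"
    "nmem ?\<tau> Succ = nmem \<sigma> Succ"
    using has_inputD(3)[OF input] by simp_all
  show "runs (For Index num_verts output_step) ?\<tau> (\<lambda>\<tau>. nmem \<tau> Found 0 = nmem \<sigma> Found 0 \<and>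
    listed (output_arcs \<tau>) S t k)
    ((n + 1) * 70)"
  proof (rule runs_For_run[where I = "\<lambda>i \<tau>. nmem \<tau> Found 0 = nmem \<sigma> Found 0 \<and> ?inv i \<tau>"],
      goal_cases bound fresh stable loop_free init step exit time)
    case init
    have "listed (output_arcs ?\<tau>) {s} s 0" using start(2) by (simp add: output_arcs_def listed_def)
    then show ?case using start(1,3) walk_position_start[OF path] unfolding output_inv_def by auto
  next
    case (step i \<tau>)
    have "has_input \<tau>" by (rule has_input_frame[OF input1 step(4)]) auto
    moreover have "nmem \<tau> Succ = nmem \<sigma> Succ" using frameD(1)[OF step(4)] start(4) by simp
    moreover have "nmem (run output_step \<tau>) Found 0 = nmem \<tau> Found 0" by (simp add: output_step_def)
    ultimately show ?case using output_inv_step[of \<tau> S k i] step(3) by simp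
  next
    case (exit \<tau>)
    then obtain S1 k1 where position:
      "walk_position (succ_arcs (nmem \<sigma> Succ)) s S t k n (nmem \<tau> Walk_Fst 0) S1 k1"
      and listed: "listed (output_arcs \<tau>) S1 (nmem \<tau> Walk_Fst 0) k1" unfolding output_inv_def by blast
    then show ?case using exit(1) listed[unfolded walk_position_end[OF position]] by blast
  qed (use has_inputD(1)[OF input1] in
      \<open>auto simp: fresh_counter_def output_step_def output_inv_def output_arcs_def\<close>)
qed auto

lemma runs_write_output_any:
  assumes input: "has_input \<sigma>"
  shows "runs write_output \<sigma> (\<lambda>\<tau>. nmem \<tau> Found 0 = nmem \<sigma> Found 0) (20 + (n + 1) * 70)"
  unfolding write_output_def
proof (rule runs_run_Seq)
  let ?init = "Walk_Fst ::= start_vertex ;; Found\<langle>NConst 1\<rangle> ::= NConst 0"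
  show "runs (For Index num_verts output_step) (run ?init \<sigma>) (\<lambda>\<tau>. nmem \<tau> Found 0 =
    nmem \<sigma> Found 0) ((n + 1) * 70)"
    by (intro runs_For_run[where I = "\<lambda>i \<tau>. nmem \<tau> Found 0 = nmem \<sigma> Found 0"])
      (use has_inputD(1)[OF input] in \<open>auto simp: fresh_counter_def output_step_def\<close>)
qed auto

end

subsection \<open>Joining the parts\<close>

locale traced_candidate = layered_arcs +
  fixes x e1 e2 e :: nat and Ah Bh R S Al Bl :: "nat set" and k :: real and cost :: "nat \<Rightarrow> real"
    and succ0 succ1 succ :: "nat \<Rightarrow> nat"
  assumes e1: "forward e1" and e2: "forward e2" and src_level: "d (src e1) = d (src e2)"
    and back_arc: "e < m" "\<not> forward e"
    and high: "high_part x e1 e2 Ah Bh R succ0" and middle: "middle_part x R cost e S k succ0 succ1"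
    and low: "low_part (dst e) e1 e2 Al Bl succ1 succ"
begin

lemma high_succ0: "path_in (succ_arcs succ0) (dst e1) Ah x 0" "path_in (succ_arcs succ0) (dst e2) Bh t 0"
    "Ah \<inter> Bh = {}" "v < n \<Longrightarrow> v \<in> R \<longleftrightarrow> v \<in> ancestors (src e1) \<union> {dst e1} \<union> Bh"
  and middle_succ1: "path_in (succ_arcs succ1) x S (src e) k" "succ1 (src e) = e" "(S - {x}) \<inter> R = {}"
    "u \<notin> S \<Longrightarrow> succ1 u = succ0 u"
  and low_succ: "path_in (succ_arcs succ) s Al (src e1) 0"
    "path_in (succ_arcs succ) (dst e) Bl (src e2) 0"
    "Al \<inter> Bl = {}" "succ (src e1) = e1" "succ (src e2) = e2" "u \<notin> Al \<union> Bl \<Longrightarrow> succ u = succ1 u"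
  using high middle low unfolding high_part_def middle_part_def low_part_def by auto

lemma path_in_path: "path_in F a T b l \<Longrightarrow> path a T b l"
  by (erule path_in_cong) simp

lemma detour_excess_ge: "k + excess e \<le> detour_excess x cost e"
  using middle unfolding middle_part_def by (simp add: detour_excess_def excess_def)

lemma back_excess: "0 < excess e" "0 \<le> k"
  using excess_back back_arc path_inD(7)[OF middle_succ1(1)] by auto

lemma avoids: "(S - {x}) \<inter> (Al \<union> {dst e1} \<union> Bh) = {}"
proof -
  have "Al \<subseteq> ancestors (src e1)"
    using forward_path_above[OF path_in_path[OF low_succ(1)]] unfolding ancestors_def by blast
  moreover have "Al \<subseteq> {..<n}" "dst e1 < n" "Bh \<subseteq> {..<n}"
    using path_inD(3)[OF low_succ(1)] path_inD(3)[OF high_succ0(2)] forwardD(4)[OF e1] by auto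
  ultimately have "Al \<union> {dst e1} \<union> Bh \<subseteq> R" using high_succ0(4) by blast
  then show ?thesis using middle_succ1(3) by blast
qed

lemma candidate:
  assumes "path x M (dst e) l" "M \<subseteq> insert (dst e) S"
  shows "candidate n m src dst w s t d e1 e2 x (dst e) Al Ah Bl Bh M l"
proof unfold_locales
  show "low_pair (dst e) (src e1) (src e2) Al Bl" "high_pair x (dst e1) (dst e2) Ah Bh"
    using low_succ(1-3) high_succ0(1-3) path_in_path unfolding low_pair_def high_pair_def by auto
  show "(M - {x, dst e}) \<inter> (Al \<union> {dst e1} \<union> Bh) = {}" using avoids assms(2) by blast
qed (use assms e1 e2 src_level in auto)

lemma nonshortest_le_candidate:
  assumes "path x M (dst e) l" "M \<subseteq> insert (dst e) S"
  shows "\<exists>l'. nonshortest_excess l' \<and> l' \<le> l"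
proof -
  interpret candidate n m src dst w s t d e1 e2 x "dst e" Al Ah Bl Bh M l by (rule candidate[OF assms])
  show ?thesis
    using simple_or_cheaper excess_pos unfolding nonshortest_excess_def
    by (metis order_less_imp_le order_refl)
qed

lemma closed_path: "dst e \<notin> S \<Longrightarrow> path x (insert (dst e) S) (dst e) (k + excess e)"
  using path_in_snoc[OF path_in_path[OF middle_succ1(1)]] back_arc(1) by simp

lemma cheaper_if_returns:
  assumes "dst e \<in> S"
  shows "\<exists>l. nonshortest_excess l \<and> l < detour_excess x cost e"
proof -
  obtain S1 S2 k1 k2 where split: "path x S1 (dst e) k1" "path (dst e) S2 (src e) k2" "S = S1 \<union> S2"
    "k = k1 + k2"
    by (rule path_in_split[OF path_in_path[OF middle_succ1(1)] assms])
  then obtain l where "nonshortest_excess l" "l \<le> k1" using nonshortest_le_candidate by blast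
  moreover have "k1 < detour_excess x cost e"
    using split(4) path_inD(7)[OF split(2)] back_excess(1) detour_excess_ge by linarith
  ultimately show ?thesis by (meson order_le_less_trans)
qed

theorem ex_nonshortest_le: "\<exists>l. nonshortest_excess l \<and> l \<le> detour_excess x cost e"
proof (cases "dst e \<in> S")
  case True
  then show ?thesis using cheaper_if_returns by (meson order_less_imp_le)
next
  case False
  then show ?thesis
    using nonshortest_le_candidate[OF closed_path] detour_excess_ge by (meson order_trans subset_refl)
qed

lemma joined_path:
  assumes simple: "dst e \<notin> S" "insert (dst e) S \<inter> (Al \<union> Ah) = {x}"
    "insert (dst e) S \<inter> (Bl \<union> Bh) = {dst e}"
    and disjoint: "(Al \<union> Ah) \<inter> (Bl \<union> Bh) = {}" "(Al \<union> Bl) \<inter> (Ah \<union> Bh) = {}"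
  shows "path_in (succ_arcs succ) s (Al \<union> Ah \<union> S \<union> (Bl \<union> Bh)) t (k + excess e)"
proof -
  have x: "x \<in> Ah" "x \<in> S" and e_src: "src e \<in> S"
    using path_inD(6)[OF high_succ0(1)] path_inD(5,6)[OF middle_succ1(1)] by auto
  have only_x: "u = x" if "u \<in> S" "u \<in> Al \<union> Ah" for u
    using IntI[of u "insert (dst e) S" "Al \<union> Ah"] that unfolding simple(2) by simp
  have S_B: "S \<inter> (Bl \<union> Bh) = {}"
    using IntI[of _ "insert (dst e) S" "Bl \<union> Bh"] simple(1) unfolding simple(3) by auto
  have "x \<notin> Al" using x(1) disjoint(2) by blast
  then have S_Al: "S \<inter> Al = {}" using only_x by blast
  have Ah_path: "path_in (succ_arcs succ) (dst e1) Ah x 0"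
  proof (rule path_in_succ_cong[OF high_succ0(1)])
    fix v assume "v \<in> Ah" "v \<noteq> x"
    then have "v \<notin> S" "v \<notin> Al \<union> Bl" using only_x disjoint(2) by blast+
    then show "succ v = succ0 v" using low_succ(6) middle_succ1(4) by simp
  qed
  have Bh_path: "path_in (succ_arcs succ) (dst e2) Bh t 0"
  proof (rule path_in_succ_cong[OF high_succ0(2)])
    fix v assume "v \<in> Bh"
    then have "v \<notin> S" "v \<notin> Al \<union> Bl" using S_B disjoint(2) by blast+
    then show "succ v = succ0 v" using low_succ(6) middle_succ1(4) by simp
  qed
  have S_path: "path_in (succ_arcs succ) x S (src e) k"
    by (rule path_in_succ_cong[OF middle_succ1(1)]) (use low_succ(6) S_B S_Al in blast)
  have "src e \<notin> Al \<union> Bl" using e_src S_B S_Al by blast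
  then have succ_e: "e \<in> succ_arcs succ" using low_succ(6) middle_succ1(2) by (simp add: succ_arcs_def)
  have splits: "e1 \<in> succ_arcs succ" "e2 \<in> succ_arcs succ" using low_succ(4,5)
    by (simp_all add: succ_arcs_def)
  have "path_in (succ_arcs succ) s (Al \<union> Ah) x (0 + (excess e1 + 0))"
    by (rule path_in_join[OF low_succ(1) splits(1) forwardD(1)[OF e1] Ah_path])
      (use disjoint(2) in blast)
  then have "path_in (succ_arcs succ) s (Al \<union> Ah \<union> S) (src e) (0 + (excess e1 + 0) + k)"
    by (rule path_in_append[OF _ S_path]) (use only_x in blast)
  moreover have "path_in (succ_arcs succ) (dst e) (Bl \<union> Bh) t (0 + (excess e2 + 0))"
    by (rule path_in_join[OF low_succ(2) splits(2) forwardD(1)[OF e2] Bh_path])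
      (use disjoint(2) in blast)
  ultimately have "path_in (succ_arcs succ) s (Al \<union> Ah \<union> S \<union> (Bl \<union> Bh)) t
      (0 + (excess e1 + 0) + k + (excess e + (0 + (excess e2 + 0))))"
    by (rule path_in_join[OF _ succ_e back_arc(1)]) (use S_B disjoint(1) in blast)
  then show ?thesis using excess_forward e1 e2 by simp
qed

theorem optimal_path:
  assumes optimal: "\<And>l. nonshortest_excess l \<Longrightarrow> detour_excess x cost e \<le> l"
  shows "\<exists>P l. path_in (succ_arcs succ) s P t l \<and> 0 < l \<and> l \<le> detour_excess x cost e"
proof -
  have new: "dst e \<notin> S" using cheaper_if_returns optimal by (meson not_less)
  interpret candidate n m src dst w s t d e1 e2 x "dst e" Al Ah Bl Bh "insert (dst e) S" "k + excess e"
    by (rule candidate[OF closed_path[OF new]]) simp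
  have "insert (dst e) S \<inter> A = {x}" "insert (dst e) S \<inter> B = {dst e}"
    using simple_or_cheaper optimal detour_excess_ge by (metis not_le order_trans)+
  then have "path_in (succ_arcs succ) s (A \<union> S \<union> B) t (k + excess e)"
    using joined_path new A_B_disjoint low_high_disjoint by blast
  then show ?thesis using back_excess detour_excess_ge by (meson add_nonneg_pos)
qed

lemma runs_write_output_optimal:
  assumes input: "has_input \<sigma>" and succ: "nmem \<sigma> Succ = succ"
  shows "runs write_output \<sigma> (\<lambda>\<tau>. nmem \<tau> Found 0 = nmem \<sigma> Found 0 \<and>
    ((\<forall>k. nonshortest_excess k \<longrightarrow> detour_excess x cost e \<le> k) \<longrightarrow>
      (\<exists>S k. listed (output_arcs \<tau>) S t k \<and> 0 < k \<and> k \<le> detour_excess x cost e))) (20 + (n + 1) * 70)"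
proof (cases "\<forall>k. nonshortest_excess k \<longrightarrow> detour_excess x cost e \<le> k")
  case True
  then obtain P l where "path_in (succ_arcs (nmem \<sigma> Succ)) s P t l" "0 < l" "l \<le> detour_excess x cost e"
    using optimal_path unfolding succ by blast
  then show ?thesis by (intro runs_conseq[OF runs_write_output[OF input]]) auto
next
  case False
  then show ?thesis by (intro runs_conseq[OF runs_write_output_any[OF input]]) auto
qed

end

context layered_arcs
begin

definition sound_output :: "ram_state \<Rightarrow> bool" where
  "sound_output \<tau> \<longleftrightarrow> nmem \<tau> Found 0 \<noteq> 0 \<longrightarrow> (\<exists>k. nonshortest_excess k \<and> k \<le> rmem \<tau> Best_Value 0) \<and>
    ((\<forall>k. nonshortest_excess k \<longrightarrow> rmem \<tau> Best_Value 0 \<le> k) \<longrightarrow>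
      (\<exists>S k. listed (output_arcs \<tau>) S t k \<and> 0 < k \<and> k \<le> rmem \<tau> Best_Value 0))"

definition write_candidate_time :: nat where
  "write_candidate_time = (20 + (n + 1) * 60) + ((20 + ((n + 1) * 250 + 20)) + (20 + (n + 1) * 70))"

lemma runs_write_candidate:
  assumes ready: "ready \<sigma>" and vars: "split_vars x e1 e2 \<sigma>" "nmem \<sigma> Best_Arc 0 = e"
    and splits: "forward e1" "forward e2" "d (src e1) = d (src e2)"
    and high: "high_part x e1 e2 Ah Bh R (nmem \<sigma> Succ)"
    and tree: "parent_tree R x reached cost (nmem \<sigma> Parent)"
    and closing: "closing_arc e1 e2 (nmem \<sigma> Low_Fst) reached e"
    and best: "rmem \<sigma> Best_Value 0 = detour_excess x cost e"
  shows "runs write_candidate \<sigma> (\<lambda>\<tau>. sound_output \<tau> \<and> nmem \<tau> Found 0 =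
    nmem \<sigma> Found 0) write_candidate_time"
proof -
  have e: "e < m" "\<not> forward e" "reached (src e) \<noteq> 0"
    "nmem \<sigma> Low_Fst (pair_cell (dst e) (src e1) (src e2)) \<noteq> 0"
    using closing by (auto simp: closing_arc_def)
  have head: "dst e \<in> back_heads" using e(1,2) dst_less by (auto simp: back_heads_def)
  have turn: "nmem \<sigma> Turn 0 = x" using vars(1) by (simp add: split_vars_def)
  obtain \<tau>1 where \<tau>1: "reaches trace_middle \<sigma> (20 + (n + 1) * 60) \<tau>1" "frame trace_middle \<sigma> \<tau>1"
    "\<exists>S k. middle_part x R cost e S k (nmem \<sigma> Succ) (nmem \<tau>1 Succ)"
    by (rule runsE[OF runs_trace_middle[OF readyD(2)[OF ready] turn vars(2) e(1,3) tree]])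
  have ready1: "ready \<tau>1" by (rule ready_frame[OF ready \<tau>1(2)]) auto
  have vars1: "split_vars x e1 e2 \<tau>1" "nmem \<tau>1 Best_Arc 0 = e" "nmem \<tau>1 Low_Fst = nmem \<sigma> Low_Fst"
    using vars frameD(1)[OF \<tau>1(2)] by (simp_all add: split_vars_def)
  obtain \<tau>2 where \<tau>2: "reaches trace_low \<tau>1 (20 + ((n + 1) * 250 + 20)) \<tau>2" "frame trace_low \<tau>1 \<tau>2"
    "\<exists>A B. low_part (dst e) e1 e2 A B (nmem \<tau>1 Succ) (nmem \<tau>2 Succ)"
    by (rule runsE[OF runs_trace_low[OF ready1 vars1(1,2) e(1) head forwardD(1)[OF splits(1)]
      forwardD(1)[OF splits(2)]]])
      (use e(4) vars1(3) in auto)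
  have ready2: "ready \<tau>2" by (rule ready_frame[OF ready1 \<tau>2(2)]) auto
  obtain S k Al Bl where parts: "middle_part x R cost e S k (nmem \<sigma> Succ) (nmem \<tau>1 Succ)"
    "low_part (dst e) e1 e2 Al Bl (nmem \<tau>1 Succ) (nmem \<tau>2 Succ)" using \<tau>1(3) \<tau>2(3) by blast
  interpret traced_candidate n m src dst w s t d x e1 e2 e Ah Bh R S Al Bl k cost "nmem \<sigma> Succ"
    "nmem \<tau>1 Succ" "nmem \<tau>2 Succ"
    by unfold_locales (use splits e high parts in auto)
  obtain \<tau>3 where \<tau>3: "reaches write_output \<tau>2 (20 + (n + 1) * 70) \<tau>3" "frame write_output \<tau>2 \<tau>3"
    "nmem \<tau>3 Found 0 = nmem \<tau>2 Found 0 \<and> ((\<forall>k. nonshortest_excess k \<longrightarrow> detour_excess x cost e \<le> k) \<longrightarrow>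
      (\<exists>S k. listed (output_arcs \<tau>3) S t k \<and> 0 < k \<and> k \<le> detour_excess x cost e))"
    by (rule runsE[OF runs_write_output_optimal[OF readyD(2)[OF ready2] refl]])
  have best3: "rmem \<tau>3 Best_Value 0 = detour_excess x cost e"
    using best frameD(2)[OF \<tau>1(2)] frameD(2)[OF \<tau>2(2)] frameD(2)[OF \<tau>3(2)] by simp
  have "sound_output \<tau>3" unfolding sound_output_def best3 using \<tau>3(3) ex_nonshortest_le by blast
  moreover have "nmem \<tau>3 Found 0 = nmem \<sigma> Found 0"
    using \<tau>3(3) frameD(1)[OF \<tau>1(2)] frameD(1)[OF \<tau>2(2)] by simp
  ultimately show ?thesis
    unfolding write_candidate_def write_candidate_time_def
    by (intro runsI[OF reaches_Seq[OF \<tau>1(1) reaches_Seq[OF \<tau>2(1) \<tau>3(1)]]]) auto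
qed

end

section \<open>The main loop\<close>

definition search_middle :: com where
  "search_middle = remove ;; Source ::= var Turn ;; shortest_paths"

definition process :: com where
  "process = search_middle ;; scan ;; When (Nonzero (var Improved)) write_candidate"

definition split_test :: bexp where
  "split_test = (Nonzero (Is_Forward\<langle>var Split_Snd\<rangle>) AND
    Nonzero (High_Fst\<langle>pair_index (var Turn) (Dst\<langle>var Split_Snd\<rangle>) (Dst\<langle>var Split_Fst\<rangle>)\<rangle>))"

definition snd_loop :: com where
  "snd_loop = For Split_Snd num_arcs (When split_test process)"

definition fst_loop :: com where
  "fst_loop = For Split_Fst num_arcs (When (Nonzero (Is_Forward\<langle>var Split_Fst\<rangle>)) snd_loop)"

definition main_loop :: com where
  "main_loop = For Turn num_verts (When (Nonzero (Back_Tail\<langle>var Turn\<rangle>)) fst_loop)"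

definition next_to_shortest_program :: com where
  "next_to_shortest_program = precheck ;;
    When (Nonzero (var Not_Tight)) (prepare ;; low_pairs ;; high_pairs ;; main_loop)"

abbreviation (input) process_arrays :: "nat set" where
  "process_arrays \<equiv> {Found, Out_Arcs, Vertex, Round, Position, Arc, Index, Index2, Reached, Parent,
    Removed, Source, Pivot, Succ, Walk_Fst, Walk_Snd, Arc_Fst, Arc_Snd, Improved, Best_Arc}"

lemma main_loop_writes [simp]:
  "nat_writes search_middle =
    {Vertex, Round, Position, Arc, Index, Index2, Reached, Parent, Removed, Source,
    Pivot, Succ, Walk_Fst, Walk_Snd, Arc_Fst, Arc_Snd}" "real_writes search_middle = {Path_Dist}"
  "nat_writes process = process_arrays" "real_writes process = {Path_Dist, Best_Value, Cand_Value}"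
  "nat_writes snd_loop = process_arrays \<union> {Split_Snd}"
  "real_writes snd_loop = {Path_Dist, Best_Value, Cand_Value}"
  "nat_writes fst_loop = process_arrays \<union> {Split_Fst, Split_Snd}"
  "real_writes fst_loop = {Path_Dist, Best_Value, Cand_Value}"
  "nat_writes main_loop = process_arrays \<union> {Turn, Split_Fst, Split_Snd}"
  "real_writes main_loop = {Path_Dist, Best_Value, Cand_Value}"
  by (auto simp: search_middle_def process_def snd_loop_def fst_loop_def main_loop_def)

context layered_arcs
begin

definition found_within :: "ram_state \<Rightarrow> real \<Rightarrow> bool" where
  "found_within \<tau> C \<longleftrightarrow> nmem \<tau> Found 0 \<noteq> 0 \<and> rmem \<tau> Best_Value 0 \<le> C"

definition split_found :: "(nat \<Rightarrow> nat) \<Rightarrow> nat \<Rightarrow> nat \<Rightarrow> nat \<Rightarrow> bool" where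
  "split_found U x e1 e2 \<longleftrightarrow> forward e1 \<and> forward e2 \<and> U (pair_cell x (dst e2) (dst e1)) \<noteq> 0"

lemma split_found_level:
  assumes "high_table x U1 U2" "split_found U1 x e1 e2"
  shows "d (src e1) = d (src e2)"
  using high_table_level[OF assms(1),
    of "dst e1" "dst e2"] forward_same_src_level[of e1 e2] forwardD(4) assms(2)
  unfolding split_found_def by blast

lemma completes_closing_arc:
  assumes ready: "ready \<tau>" and high: "high_part x e1 e2 A B R succ" and level: "d (src e1) = d (src e2)"
    and inv: "shortest_inv (nmem \<tau> Order) R x (Suc (card back_heads)) 0 \<tau>"
    and completes: "completes x e1 e2 C"
  shows "\<exists>e. closing_arc e1 e2 (nmem \<tau> Low_Fst) (nmem \<tau> Reached) e \<and>
    detour_excess x (rmem \<tau> Path_Dist) e \<le> C"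
proof -
  obtain N k e Al Bl where N: "path x N (src e) k" "e < m" "\<not> forward e" "C = k + excess e"
    "low_pair (dst e) (src e1) (src e2) Al Bl" "(N - {x}) \<inter> (ancestors (src e1) \<union> {dst e1}) = {}"
    "\<forall>Ah Bh. high_pair x (dst e1) (dst e2) Ah Bh \<longrightarrow> (N - {x}) \<inter> Bh = {}"
    using completes unfolding completes_def by blast
  have "high_pair x (dst e1) (dst e2) A B"
    using high path_in_cong[of "succ_arcs succ" _ _ _ _ UNIV] unfolding high_part_def high_pair_def
    by blast
  then have "(N - {x}) \<inter> B = {}" using N(7) by blast
  moreover have "N \<subseteq> {..<n}" using path_inD(3)[OF N(1)] .
  ultimately have avoids: "(N - {x}) \<inter> R = {}" using high N(6) unfolding high_part_def by blast
  let ?rounds = "card ((N - {x}) \<inter> back_heads)"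
  have "relaxed_walk (nmem \<tau> Order) R x (0 + ?rounds) m (src e) (0 + k + d (src e) - d x)"
    by (rule relaxed_walk_path[OF level_order_arc_rank N(1) avoids relaxed_walk.source])
      (rule preparedD(4)[OF readyD(1)[OF ready]])
  moreover have "?rounds < Suc (card back_heads)" using finite_back_heads
    by (intro le_imp_less_Suc card_mono) auto
  ultimately have "relaxed_walk (nmem \<tau> Order) R x (Suc (card back_heads)) 0 (src e)
    (k + d (src e) - d x)"
    using relaxed_walk_later_round by simp
  then have reached: "nmem \<tau> Reached (src e) \<noteq> 0" "rmem \<tau> Path_Dist (src e) \<le> k + d (src e) - d x"
    using inv unfolding shortest_inv_def relaxed_def by blast+
  have "dst e \<in> back_heads" using N(2,3) dst_less by (auto simp: back_heads_def)
  then have "nmem \<tau> Low_Fst (pair_cell (dst e) (src e1) (src e2)) \<noteq> 0"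
    using low_table_complete[OF readyD(3)[OF ready] N(5) level] by blast
  then have "closing_arc e1 e2 (nmem \<tau> Low_Fst) (nmem \<tau> Reached) e" using N(2,3) reached(1)
    by (simp add: closing_arc_def)
  moreover have "detour_excess x (rmem \<tau> Path_Dist) e \<le> C"
    using reached(2) N(4) by (simp add: detour_excess_def excess_def)
  ultimately show ?thesis by blast
qed

definition search_middle_time :: nat where
  "search_middle_time = remove_time + (4 + shortest_paths_time (Suc (card back_heads)))"

lemma runs_search_middle:
  assumes ready: "ready \<sigma>" and vars: "split_vars x e1 e2 \<sigma>" and x: "x \<in> back_tails" and e: "e1 < m"
    "e2 < m"
    and cell: "nmem \<sigma> High_Fst (pair_cell x (dst e2) (dst e1)) \<noteq> 0"
  shows "runs search_middle \<sigma> (\<lambda>\<tau>. \<exists>A B R. high_part x e1 e2 A B R (nmem \<tau> Succ) \<and>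
    shortest_inv (nmem \<tau> Order) R x (Suc (card back_heads)) 0 \<tau>) search_middle_time"
proof -
  obtain \<tau>1 where \<tau>1: "reaches remove \<sigma> remove_time \<tau>1" "frame remove \<sigma> \<tau>1"
    "\<exists>A B. high_part x e1 e2 A B {v. nmem \<tau>1 Removed v \<noteq> 0} (nmem \<tau>1 Succ)"
    by (rule runsE[OF runs_remove[OF ready vars x e cell]])
  have ready1: "ready \<tau>1" by (rule ready_frame[OF ready \<tau>1(2)]) auto
  let ?\<tau>2 = "run (Source ::= var Turn) \<tau>1" and ?R = "{v. nmem \<tau>1 Removed v \<noteq> 0}"
  have \<tau>2: "reaches (Source ::= var Turn) \<tau>1 4 ?\<tau>2" by (rule reaches_run) simp_all
  have ready2: "ready ?\<tau>2" by (rule ready_frame[OF ready1 reaches_frame[OF \<tau>2]]) auto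
  have source: "nmem ?\<tau>2 Source 0 = x" "x < n" "{v. nmem ?\<tau>2 Removed v \<noteq> 0} = ?R"
    using vars frameD(1)[OF \<tau>1(2)] x by (simp_all add: split_vars_def back_tails_def)
  have order: "nmem ?\<tau>2 Order i < m" if "i < m" for i
    using enumerates_inverse(1)[OF _ that] level_order_arc_rank preparedD(4)[OF readyD(1)[OF ready2]]
    unfolding level_order_def by blast
  note rounds = preparedD(5)[OF readyD(1)[OF ready2]]
  obtain \<tau>3 where \<tau>3: "reaches shortest_paths ?\<tau>2 (shortest_paths_time (Suc (card back_heads))) \<tau>3"
    "frame shortest_paths ?\<tau>2 \<tau>3" "shortest_inv (nmem ?\<tau>2 Order) ?R x (Suc (card back_heads)) 0 \<tau>3"
    by (rule runsE[OF runs_shortest_paths[OF readyD(2)[OF ready2] order source(1,2) rounds,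
      unfolded source(3)]])
  have "shortest_inv (nmem \<tau>3 Order) ?R x (Suc (card back_heads)) 0 \<tau>3" "nmem \<tau>3 Succ = nmem \<tau>1 Succ"
    using \<tau>3(3) frameD(1)[OF \<tau>3(2)] by simp_all
  then have "\<exists>A B R. high_part x e1 e2 A B R (nmem \<tau>3 Succ) \<and>
    shortest_inv (nmem \<tau>3 Order) R x (Suc (card back_heads)) 0 \<tau>3" using \<tau>1(3) by metis
  then show ?thesis
    unfolding search_middle_def search_middle_time_def
    by (intro runsI[OF reaches_Seq[OF \<tau>1(1) reaches_Seq[OF \<tau>2 \<tau>3(1)]]]) auto
qed

lemma runs_write_if_improved:
  assumes ready: "ready \<sigma>" and vars: "split_vars x e1 e2 \<sigma>" and split: "forward e1" "forward e2"
    "d (src e1) = d (src e2)"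
    and high: "high_part x e1 e2 A B R (nmem \<sigma> Succ)"
    and tree: "parent_tree R x reached cost (nmem \<sigma> Parent)"
    and scanned: "scanned_upto (closing_arc e1 e2 (nmem \<sigma> Low_Fst) reached) (detour_excess x cost) \<rho> m \<sigma>"
    and old: "sound_output \<rho>" "nmem \<sigma> Out_Arcs = nmem \<rho> Out_Arcs"
  shows "runs (When (Nonzero (var Improved)) write_candidate) \<sigma> (\<lambda>\<tau>. sound_output \<tau> \<and>
    (\<forall>C. found_within \<sigma> C \<longrightarrow> found_within \<tau> C)) (write_candidate_time + 10)"
proof (rule runs_When)
  assume "bval (Nonzero (var Improved)) \<sigma>"
  then have best: "closing_arc e1 e2 (nmem \<sigma> Low_Fst) reached (nmem \<sigma> Best_Arc 0)"
    "rmem \<sigma> Best_Value 0 = detour_excess x cost (nmem \<sigma> Best_Arc 0)"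
    using scanned unfolding scanned_upto_def by simp_all
  show "runs write_candidate \<sigma> (\<lambda>\<tau>. sound_output \<tau> \<and>
    (\<forall>C. found_within \<sigma> C \<longrightarrow> found_within \<tau> C)) write_candidate_time"
  proof (rule runs_conseq[OF runs_write_candidate[OF ready vars refl split high tree best]])
    fix \<tau> assume "sound_output \<tau> \<and> nmem \<tau> Found 0 = nmem \<sigma> Found 0" "frame write_candidate \<sigma> \<tau>"
    then show "sound_output \<tau> \<and> (\<forall>C. found_within \<sigma> C \<longrightarrow> found_within \<tau> C)"
      using frameD(2)[of write_candidate \<sigma> \<tau> Best_Value] by (simp add: found_within_def)
  qed simp
next
  assume "\<not> bval (Nonzero (var Improved)) \<sigma>"
  then have "nmem \<sigma> Found 0 = nmem \<rho> Found 0" "nmem \<sigma> Found (Suc 0) = nmem \<rho> Found (Suc 0)"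
    "rmem \<sigma> Best_Value 0 = rmem \<rho> Best_Value 0"
    using scanned unfolding scanned_upto_def by simp_all
  then show "sound_output \<sigma> \<and> (\<forall>C. found_within \<sigma> C \<longrightarrow> found_within \<sigma> C)"
    using old unfolding sound_output_def output_arcs_def by simp
qed simp

definition process_time :: nat where
  "process_time = search_middle_time + (5 + (m + 1) * 150 + (write_candidate_time + 10))"

lemma runs_process:
  assumes ready: "ready \<sigma>" and vars: "split_vars x e1 e2 \<sigma>" and x: "x \<in> back_tails"
    and split: "split_found (nmem \<sigma> High_Fst) x e1 e2" and sound: "sound_output \<sigma>"
  shows "runs process \<sigma> (\<lambda>\<tau>. sound_output \<tau> \<and>
    (\<forall>C. found_within \<sigma> C \<or> completes x e1 e2 C \<longrightarrow> found_within \<tau> C)) process_time"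
proof -
  have e: "forward e1" "forward e2" "e1 < m" "e2 < m"
    "nmem \<sigma> High_Fst (pair_cell x (dst e2) (dst e1)) \<noteq> 0"
    using split forwardD(1) by (auto simp: split_found_def)
  have level: "d (src e1) = d (src e2)" by (rule split_found_level[OF readyD(4)[OF ready x] split])
  have x_less: "x < n" using x by (simp add: back_tails_def)
  obtain \<tau>1 where \<tau>1: "reaches search_middle \<sigma> search_middle_time \<tau>1" "frame search_middle \<sigma> \<tau>1"
    "\<exists>A B R. high_part x e1 e2 A B R (nmem \<tau>1 Succ) \<and>
      shortest_inv (nmem \<tau>1 Order) R x (Suc (card back_heads)) 0 \<tau>1"
    by (rule runsE[OF runs_search_middle[OF ready vars x e(3-5)]])
  then obtain A B R where high: "high_part x e1 e2 A B R (nmem \<tau>1 Succ)"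
    and inv: "shortest_inv (nmem \<tau>1 Order) R x (Suc (card back_heads)) 0 \<tau>1" by blast
  have ready1: "ready \<tau>1" by (rule ready_frame[OF ready \<tau>1(2)]) auto
  have vars1: "split_vars x e1 e2 \<tau>1" using vars frameD(1)[OF \<tau>1(2)] by (simp add: split_vars_def)
  let ?C = "closing_arc e1 e2 (nmem \<tau>1 Low_Fst) (nmem \<tau>1 Reached)"
    and ?f = "detour_excess x (rmem \<tau>1 Path_Dist)"
  obtain \<tau>2 where \<tau>2: "reaches scan \<tau>1 (5 + (m + 1) * 150) \<tau>2" "frame scan \<tau>1 \<tau>2"
    "scanned_upto ?C ?f \<tau>1 m \<tau>2"
    by (rule runsE[OF runs_scan[OF ready1 vars1 x_less e(3,4)]])
  have ready2: "ready \<tau>2" by (rule ready_frame[OF ready1 \<tau>2(2)]) auto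
  note frames = frameD[OF \<tau>1(2)] frameD[OF \<tau>2(2)]
  have "sound_output \<tau>1" using sound frames by (simp add: sound_output_def output_arcs_def)
  moreover have "split_vars x e1 e2 \<tau>2" using vars1 frames by (simp add: split_vars_def)
  moreover have "parent_tree R x (nmem \<tau>1 Reached) (rmem \<tau>1 Path_Dist) (nmem \<tau>2 Parent)"
    using inv frames by (simp add: shortest_inv_def)
  ultimately have "runs (When (Nonzero (var Improved)) write_candidate) \<tau>2 (\<lambda>\<tau>. sound_output \<tau> \<and>
      (\<forall>C. found_within \<tau>2 C \<longrightarrow> found_within \<tau> C)) (write_candidate_time + 10)"
    using high \<tau>2(3) frames
    by (intro runs_write_if_improved[where \<rho> = \<tau>1, OF ready2 _ e(1,2) level]) simp_all
  then obtain \<tau>3 where \<tau>3: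
    "reaches (When (Nonzero (var Improved)) write_candidate) \<tau>2 (write_candidate_time + 10) \<tau>3"
    "frame (When (Nonzero (var Improved)) write_candidate) \<tau>2 \<tau>3"
    "sound_output \<tau>3 \<and> (\<forall>C. found_within \<tau>2 C \<longrightarrow> found_within \<tau>3 C)" by (rule runsE)
  have "found_within \<tau>2 C" if "found_within \<sigma> C" for C
    using \<tau>2(3) that frames unfolding scanned_upto_def found_within_def by auto
  moreover have "found_within \<tau>2 C" if completes: "completes x e1 e2 C" for C
  proof -
    obtain f where "?C f" "?f f \<le> C" using completes_closing_arc[OF ready1 high level inv completes]
      by blast
    then show ?thesis using \<tau>2(3) unfolding scanned_upto_def found_within_def closing_arc_def by force
  qed
  ultimately have "\<forall>C. found_within \<sigma> C \<or> completes x e1 e2 C \<longrightarrow> found_within \<tau>3 C" using \<tau>3(3) by blast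
  then show ?thesis
    unfolding process_def process_time_def using \<tau>3(3)
    by (intro runsI[OF reaches_Seq[OF \<tau>1(1) reaches_Seq[OF \<tau>2(1) \<tau>3(1)]]]) auto
qed

subsection \<open>Nested loops\<close>

definition covers :: "(nat \<Rightarrow> nat \<Rightarrow> nat \<Rightarrow> bool) \<Rightarrow> ram_state \<Rightarrow> bool" where
  "covers D \<tau> \<longleftrightarrow> sound_output \<tau> \<and> (\<forall>x e1 e2 C. D x e1 e2 \<longrightarrow> completes x e1 e2 C \<longrightarrow> found_within \<tau> C)"

lemma covers_nupd: "a \<notin> {Found, Out_Arcs} \<Longrightarrow> covers D (nupd \<tau> a i v) \<longleftrightarrow> covers D \<tau>"
  by (simp add: covers_def sound_output_def output_arcs_def found_within_def)

lemma covers_mono: "covers D \<tau> \<Longrightarrow> (\<And>x e1 e2. D' x e1 e2 \<Longrightarrow> D x e1 e2) \<Longrightarrow> covers D' \<tau>"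
  unfolding covers_def by blast

definition forward_pairs :: "(nat \<times> nat) set" where
  "forward_pairs = {(e, f). forward e \<and> forward f \<and> d (src e) = d (src f)}"

lemma finite_forward_pairs: "finite forward_pairs"
  unfolding forward_pairs_def by (rule finite_subset[of _ "{..<m} \<times> {..<m}"]) (auto dest: forwardD)

definition snd_loop_time :: "(nat \<Rightarrow> nat) \<Rightarrow> nat \<Rightarrow> nat \<Rightarrow> nat" where
  "snd_loop_time U x e1 = (m + 1) * 60 + card {e2. e2 < m \<and> split_found U x e1 e2} * process_time"

lemma runs_snd_loop:
  assumes ready: "ready \<sigma>" and x: "nmem \<sigma> Turn 0 = x" "x \<in> back_tails"
    and e1: "nmem \<sigma> Split_Fst 0 = e1" "forward e1"
    and covers: "covers D \<sigma>"
  defines "U \<equiv> nmem \<sigma> High_Fst"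
  shows "runs snd_loop \<sigma> (covers (\<lambda>x' e f. D x' e f \<or> x' = x \<and> e = e1 \<and> split_found U x e f))
    (snd_loop_time U x e1)"
  unfolding snd_loop_def snd_loop_time_def
proof (rule runs_For_When[where P = "split_found U x e1" and
      I = "\<lambda>i. covers (\<lambda>x' e f. D x' e f \<or> x' = x \<and> e = e1 \<and> f < i \<and> split_found U x e f)"],
    goal_cases bound fresh stable init guard step skip exit time)
  case (guard i \<tau>)
  have ready1: "ready \<tau>" by (rule ready_frame[OF ready guard(4)]) auto
  note prepared = readyD(1)[OF ready1] and input = has_inputD[OF readyD(2)[OF ready1]]
  have vars: "nmem \<tau> Turn 0 = x" "nmem \<tau> Split_Fst 0 = e1" "nmem \<tau> High_Fst = U"
    using frameD(1)[OF guard(4)] x e1 by (simp_all add: U_def)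
  have "x < n" "dst i < n" "e1 < m" using x(2) dst_less guard(1) forwardD(1)[OF e1(2)]
    by (auto simp: back_tails_def)
  then have "nmem \<tau> Times_N2 x + nmem \<tau> Times_N (dst i) + dst e1 = pair_cell x (dst i) (dst e1)"
    using preparedD(6,7)[OF prepared] by (simp add: pair_cell_def)
  then show ?case
    using classifiedD(1)[OF preparedD(3)[OF prepared], of i] guard(1,2) \<open>e1 < m\<close> e1(2) input(6) vars
    by (simp add: split_test_def split_found_def)
next
  case (step i \<tau>)
  have ready1: "ready \<tau>" by (rule ready_frame[OF ready step(4)]) auto
  have vars: "split_vars x e1 i \<tau>" "nmem \<tau> High_Fst = U"
    using frameD(1)[OF step(4)] x e1 step(2) by (simp_all add: split_vars_def U_def)
  have "sound_output \<tau>" using step(3) by (simp add: covers_def)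
  then have "runs process \<tau> (\<lambda>\<tau>'. sound_output \<tau>' \<and>
      (\<forall>C. found_within \<tau> C \<or> completes x e1 i C \<longrightarrow> found_within \<tau>' C)) process_time"
    using runs_process[OF ready1 vars(1) x(2)] step(5) vars(2) by blast
  then show ?case
    by (rule runs_conseq) (use step(3) in \<open>auto simp: covers_def less_Suc_eq\<close>)
next
  case (skip i \<tau>)
  show ?case using skip(3) by (rule covers_mono) (use skip(5) in \<open>auto simp: less_Suc_eq\<close>)
next
  case (exit \<tau>)
  show ?case using exit(1) by (rule covers_mono) (auto simp: split_found_def dest: forwardD(1))
next
  case init
  show ?case using covers by (rule covers_mono) auto
qed (use has_inputD(2)[OF readyD(2)[OF ready]] in \<open>auto simp: fresh_counter_def covers_nupd
  split_test_def\<close>)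

definition fst_loop_time :: nat where
  "fst_loop_time = (m + 1) * ((m + 1) * 100) + card forward_pairs * process_time"

lemma sum_snd_loop_time:
  assumes table: "high_table x U U'"
  shows "(\<Sum>e1<m. snd_loop_time U x e1 + 10) + m * 20 + 20 \<le> fst_loop_time"
proof -
  have "(\<Sum>e1<m. card {e2. e2 < m \<and> split_found U x e1 e2}) =
    card (SIGMA e1:{..<m}. {e2. e2 < m \<and> split_found U x e1 e2})"
    by (simp add: card_SigmaI)
  also have "\<dots> \<le> card forward_pairs"
    by (rule card_mono[OF finite_forward_pairs])
      (use split_found_level[OF table] in \<open>auto simp: forward_pairs_def split_found_def\<close>)
  finally have "(\<Sum>e1<m. card {e2. e2 < m \<and> split_found U x e1 e2}) * process_time \<le>
    card forward_pairs * process_time"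
    by (rule mult_le_mono1)
  moreover have "(\<Sum>e1<m. snd_loop_time U x e1 + 10) =
    m * ((m + 1) * 60 + 10) + (\<Sum>e1<m. card {e2. e2 < m \<and> split_found U x e1 e2}) * process_time"
    unfolding snd_loop_time_def sum.distrib sum_distrib_right[symmetric] by (simp add: algebra_simps)
  moreover have "m * ((m + 1) * 60 + 10) + m * 20 + 20 \<le> (m + 1) * ((m + 1) * 100)"
    by (simp add: algebra_simps)
  ultimately show ?thesis unfolding fst_loop_time_def by linarith
qed

lemma runs_fst_loop:
  assumes ready: "ready \<sigma>" and x: "nmem \<sigma> Turn 0 = x" "x \<in> back_tails" and covers: "covers D \<sigma>"
  defines "U \<equiv> nmem \<sigma> High_Fst"
  shows "runs fst_loop \<sigma> (covers (\<lambda>x' e f. D x' e f \<or> x' = x \<and> split_found U x e f)) fst_loop_time"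
  unfolding fst_loop_def
proof (rule runs_For[where N = m and T = "\<lambda>e1. snd_loop_time U x e1 + 10" and
      I = "\<lambda>i. covers (\<lambda>x' e f. D x' e f \<or> x' = x \<and> e < i \<and> split_found U x e f)"],
    goal_cases bound fresh stable init step exit time)
  case (step i \<tau>)
  have ready1: "ready \<tau>" by (rule ready_frame[OF ready step(4)]) auto
  have vars: "nmem \<tau> Turn 0 = x" "nmem \<tau> High_Fst = U" using frameD(1)[OF step(4)] x
    by (simp_all add: U_def)
  have test: "bval (Nonzero (Is_Forward\<langle>var Split_Fst\<rangle>)) \<tau> \<longleftrightarrow> forward i"
    using classifiedD(1)[OF preparedD(3)[OF readyD(1)[OF ready1]], of i] step(2) by simp
  show ?case
  proof (rule runs_When[where k = "snd_loop_time U x i"])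
    assume "bval (Nonzero (Is_Forward\<langle>var Split_Fst\<rangle>)) \<tau>"
    then have i: "forward i" using test by blast
    show "runs snd_loop \<tau> (covers (\<lambda>x' e f. D x' e f \<or> x' = x \<and> e < Suc i \<and> split_found U x e f))
      (snd_loop_time U x i)"
      by (rule runs_conseq[OF runs_snd_loop[OF ready1 vars(1) x(2) step(2) i step(3), unfolded vars(2)]])
        (auto elim!: covers_mono simp: less_Suc_eq)
  next
    assume "\<not> bval (Nonzero (Is_Forward\<langle>var Split_Fst\<rangle>)) \<tau>"
    then have "\<not> forward i" using test by blast
    then show "covers (\<lambda>x' e f. D x' e f \<or> x' = x \<and> e < Suc i \<and> split_found U x e f) \<tau>"
      by (intro covers_mono[OF step(3)]) (auto simp: less_Suc_eq split_found_def)
  qed simp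
next
  case (exit \<tau>)
  show ?case using exit(1) by (rule covers_mono) (auto simp: split_found_def dest: forwardD(1))
next
  case init
  show ?case using covers by (rule covers_mono) auto
next
  case time
  show ?case using sum_snd_loop_time readyD(4)[OF ready x(2)] unfolding U_def by fastforce
qed (use has_inputD(2)[OF readyD(2)[OF ready]] in \<open>auto simp: fresh_counter_def covers_nupd\<close>)

definition main_loop_time :: nat where
  "main_loop_time = (n + 1) * 40 + card back_tails * fst_loop_time"

lemma runs_main_loop:
  assumes ready: "ready \<sigma>" and fresh: "nmem \<sigma> Found 0 = 0"
  shows "runs main_loop \<sigma> (covers (\<lambda>x e f. x \<in> back_tails \<and> split_found (nmem \<sigma> High_Fst) x e f))
    main_loop_time"
proof -
  let ?U = "nmem \<sigma> High_Fst"
  have tail: "nmem \<tau> Back_Tail v \<noteq> 0 \<longleftrightarrow> v \<in> back_tails" if "ready \<tau>" for \<tau> v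
    using classifiedD(4)[OF preparedD(3)[OF readyD(1)[OF that]]] .
  have "runs main_loop \<sigma> (covers (\<lambda>x e f. x \<in> back_tails \<and> split_found ?U x e f))
    ((n + 1) * 40 + card {x. x < n \<and> x \<in> back_tails} * fst_loop_time)"
    unfolding main_loop_def
  proof (rule runs_For_When[where P = "\<lambda>x. x \<in> back_tails" and
        I = "\<lambda>i. covers (\<lambda>x e f. x < i \<and> x \<in> back_tails \<and> split_found ?U x e f)"],
      goal_cases bound fresh stable init guard step skip exit time)
    case (guard x \<tau>)
    have "ready \<tau>" by (rule ready_frame[OF ready guard(4)]) auto
    then show ?case using tail guard(2) by simp
  next
    case (step x \<tau>)
    have ready1: "ready \<tau>" by (rule ready_frame[OF ready step(4)]) auto
    have "nmem \<tau> High_Fst = ?U" using frameD(1)[OF step(4)] by simp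
    then have "runs fst_loop \<tau> (covers (\<lambda>x' e f. (x' < x \<and> x' \<in> back_tails \<and> split_found ?U x' e f) \<or>
        x' = x \<and> split_found ?U x e f)) fst_loop_time"
      using runs_fst_loop[OF ready1 step(2,5,3)] by simp
    then show ?case by (rule runs_conseq) (auto elim!: covers_mono simp: less_Suc_eq)
  next
    case (skip x \<tau>)
    show ?case using skip(3) by (rule covers_mono) (use skip(5) in \<open>auto simp: less_Suc_eq\<close>)
  next
    case (exit \<tau>)
    show ?case using exit(1) by (rule covers_mono) (auto simp: back_tails_def)
  next
    case init
    show ?case using fresh by (simp add: covers_def sound_output_def)
  qed (use has_inputD(1)[OF readyD(2)[OF ready]] in \<open>auto simp: fresh_counter_def covers_nupd\<close>)
  moreover have "{x. x < n \<and> x \<in> back_tails} = back_tails" by (auto simp: back_tails_def)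
  ultimately show ?thesis by (simp add: main_loop_time_def)
qed

definition correct_result :: "ram_state \<Rightarrow> bool" where
  "correct_result \<tau> \<longleftrightarrow> (if nmem \<tau> Found 0 = 0 then \<forall>k. \<not> nonshortest_excess k
    else \<exists>S k. listed (output_arcs \<tau>) S t k \<and> 0 < k \<and> (\<forall>l. nonshortest_excess l \<longrightarrow> k \<le> l))"

lemma covers_correct_result:
  assumes ready: "ready \<sigma>"
    and covers: "covers (\<lambda>x e f. x \<in> back_tails \<and> split_found (nmem \<sigma> High_Fst) x e f) \<tau>"
  shows "correct_result \<tau>"
proof (cases "\<exists>k. nonshortest_excess k")
  case True
  then obtain C where C: "nonshortest_excess C" "\<And>l. nonshortest_excess l \<Longrightarrow> C \<le> l"
    using least_nonshortest_excess by blast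
  obtain x e1 e2 e where split: "e < m" "\<not> forward e" "src e = x" "split_arcs x e1 e2"
    "completes x e1 e2 C"
    using ex_completing_split[OF C] .
  have x: "x \<in> back_tails" using split(1-3) src_less by (auto simp: back_tails_def)
  obtain A B where e: "forward e1" "forward e2" "d (src e1) = d (src e2)"
    "high_pair x (dst e1) (dst e2) A B"
    using split(4) unfolding split_arcs_def by blast
  have "split_found (nmem \<sigma> High_Fst) x e1 e2"
    using high_table_complete[OF readyD(4)[OF ready x] e(4) forward_same_dst_level[OF e(1-3)]] e(1,2)
    unfolding split_found_def by blast
  then have best: "nmem \<tau> Found 0 \<noteq> 0" "rmem \<tau> Best_Value 0 \<le> C"
    using covers x split(5) unfolding covers_def found_within_def by blast+
  then have "\<forall>k. nonshortest_excess k \<longrightarrow> rmem \<tau> Best_Value 0 \<le> k" using C(2) by (meson order_trans)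
  then obtain S k where "listed (output_arcs \<tau>) S t k" "0 < k" "k \<le> rmem \<tau> Best_Value 0"
    using covers best(1) unfolding covers_def sound_output_def by blast
  then show ?thesis using best C(2) unfolding correct_result_def by (smt (verit))
next
  case False
  then have "nmem \<tau> Found 0 = 0" using covers unfolding covers_def sound_output_def by blast
  then show ?thesis using False unfolding correct_result_def by simp
qed

subsection \<open>The program\<close>

definition search_time :: nat where
  "search_time = prepare_time +
    (pair_table_time (card back_heads) + (pair_table_time (card back_tails) + main_loop_time))"

lemma runs_search_splits:
  assumes input: "has_input \<sigma>" and "d s = 0" and found: "nmem \<sigma> Found 0 = 0"
    and empty: "\<And>a. a \<in> {33..48} \<Longrightarrow> nmem \<sigma> a = (\<lambda>_. 0)"
  shows "runs (prepare ;; low_pairs ;; high_pairs ;; main_loop) \<sigma> correct_result search_time"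
proof -
  obtain \<tau>1 where \<tau>1: "reaches prepare \<sigma> prepare_time \<tau>1" "frame prepare \<sigma> \<tau>1" "prepared \<tau>1"
    by (rule runsE[OF runs_prepare[OF input _ \<open>d s = 0\<close>]]) (use empty in auto)
  obtain \<tau>2 where \<tau>2: "reaches low_pairs \<tau>1 (pair_table_time (card back_heads)) \<tau>2"
    "frame low_pairs \<tau>1 \<tau>2"
    "\<forall>y\<in>back_heads. pairs_table y (nmem \<tau>2 Low_Fst) (nmem \<tau>2 Low_Snd)"
    by (rule runsE[OF runs_low_pairs[OF \<tau>1(3)]]) (use empty frameD(1)[OF \<tau>1(2)] in auto)
  have prepared2: "prepared \<tau>2" by (rule prepared_frame[OF \<tau>1(3) \<tau>2(2)]) auto
  obtain \<tau>3 where \<tau>3: "reaches high_pairs \<tau>2 (pair_table_time (card back_tails)) \<tau>3"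
    "frame high_pairs \<tau>2 \<tau>3"
    "\<forall>x\<in>back_tails. high_table x (nmem \<tau>3 High_Fst) (nmem \<tau>3 High_Snd)"
    by (rule runsE[OF runs_high_pairs[OF prepared2]])
      (use empty frameD(1)[OF \<tau>1(2)] frameD(1)[OF \<tau>2(2)] in auto)
  have "prepared \<tau>3" by (rule prepared_frame[OF prepared2 \<tau>3(2)]) auto
  then have ready3: "ready \<tau>3" using \<tau>2(3) \<tau>3(3) frameD(1)[OF \<tau>3(2)] by (simp add: ready_def)
  have "nmem \<tau>3 Found 0 = 0" using found frameD(1)[OF \<tau>1(2)] frameD(1)[OF \<tau>2(2)] frameD(1)[OF \<tau>3(2)]
    by simp
  then obtain \<tau>4 where \<tau>4: "reaches main_loop \<tau>3 main_loop_time \<tau>4" "frame main_loop \<tau>3 \<tau>4"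
    "covers (\<lambda>x e f. x \<in> back_tails \<and> split_found (nmem \<tau>3 High_Fst) x e f) \<tau>4"
    by (rule runsE[OF runs_main_loop[OF ready3]])
  show ?thesis
    unfolding search_time_def using covers_correct_result[OF ready3 \<tau>4(3)]
    by (intro runsI[OF reaches_Seq[OF \<tau>1(1) reaches_Seq[OF \<tau>2(1) reaches_Seq[OF \<tau>3(1) \<tau>4(1)]]]]) auto
qed

lemma runs_next_to_shortest_program:
  assumes input: "has_input \<sigma>" and "d s = 0"
    and empty: "\<And>a. 3 \<le> a \<Longrightarrow> nmem \<sigma> a = (\<lambda>_. 0)" "\<And>a. 1 \<le> a \<Longrightarrow> rmem \<sigma> a = (\<lambda>_. 0)"
  shows "runs next_to_shortest_program \<sigma> correct_result
    (precheck_time + 10 + (if \<forall>e<m. forward e then 0 else search_time))"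
proof -
  obtain \<tau>1 where \<tau>1: "reaches precheck \<sigma> precheck_time \<tau>1" "frame precheck \<sigma> \<tau>1"
    "if nmem \<tau>1 Not_Tight 0 = 0 then \<exists>pot. potential pot else \<exists>e<m. \<not> forward e"
    by (rule runsE[OF runs_precheck[OF input _ _ \<open>d s = 0\<close>]]) (use empty in auto)
  have input1: "has_input \<tau>1" by (rule has_input_frame[OF input \<tau>1(2)]) auto
  have found: "nmem \<tau>1 Found 0 = 0" using empty(1) frameD(1)[OF \<tau>1(2)] by simp
  let ?search = "When (Nonzero (var Not_Tight)) (prepare ;; low_pairs ;; high_pairs ;; main_loop)"
  have "runs ?search \<tau>1 correct_result (10 + (if \<forall>e<m. forward e then 0 else search_time))"
  proof (rule runs_When)
    assume "bval (Nonzero (var Not_Tight)) \<tau>1"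
    then have back_arc: "\<not> (\<forall>e<m. forward e)" using \<tau>1(3) by simp
    show "runs (prepare ;; low_pairs ;; high_pairs ;; main_loop) \<tau>1 correct_result
      (if \<forall>e<m. forward e then 0 else search_time)"
      unfolding if_not_P[OF back_arc]
      by (rule runs_search_splits[OF input1 \<open>d s = 0\<close> found]) (use empty(1) frameD(1)[OF \<tau>1(2)] in auto)
  next
    assume "\<not> bval (Nonzero (var Not_Tight)) \<tau>1"
    then show "correct_result \<tau>1" using \<tau>1(3) found potential_no_nonshortest
      by (auto simp: correct_result_def)
  qed simp
  then obtain \<tau>2 where \<tau>2:
    "reaches ?search \<tau>1 (10 + (if \<forall>e<m. forward e then 0 else search_time)) \<tau>2" "correct_result \<tau>2"
    by (rule runsE)
  show ?thesis
    unfolding next_to_shortest_program_def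
    by (rule runsI[OF reaches_Seq[OF \<tau>1(1) \<tau>2(1)]]) (use \<tau>2(2) in simp_all)
qed

end

section \<open>The running time\<close>

context layered_arcs
begin

lemma ex_forward_into: "v < n \<Longrightarrow> v \<noteq> s \<Longrightarrow> \<exists>e. forward e \<and> dst e = v"
  using ex_forward_path_from_s[of v] forward_path_arc_into path_inD(6) by blast

lemma finite_forward: "finite {e. forward e}"
  by (rule finite_subset[of _ "{..<m}"]) (auto dest: forwardD(1))

lemma card_forward_ge: "n - 1 \<le> card {e. forward e}"
proof -
  have "{..<n} - {s} \<subseteq> dst ` {e. forward e}" using ex_forward_into by blast
  then have "card ({..<n} - {s}) \<le> card (dst ` {e. forward e})" using finite_forward
    by (intro card_mono) auto
  also have "\<dots> \<le> card {e. forward e}" using finite_forward by (rule card_image_le)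
  finally show ?thesis using s_less by simp
qed

lemma card_forward_le: "card {e. forward e} \<le> card forward_pairs"
proof -
  have "card ((\<lambda>e. (e, e)) ` {e. forward e}) \<le> card forward_pairs"
    by (rule card_mono[OF finite_forward_pairs]) (auto simp: forward_pairs_def)
  then show ?thesis by (simp add: card_image inj_on_def)
qed

definition back_verts :: "nat set" where
  "back_verts = back_heads \<union> back_tails"

lemma finite_back_verts: "finite back_verts"
  using finite_back_heads finite_back_tails by (simp add: back_verts_def)

lemma back_verts_subset: "back_verts \<subseteq> {..<n}"
  by (auto simp: back_verts_def back_heads_def back_tails_def)

lemma back_arc_ends:
  assumes "e < m" "\<not> forward e"
  shows "src e \<in> back_verts" "dst e \<in> back_verts" "src e \<noteq> dst e"
  using assms src_less dst_less level_neq[of e]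
  by (auto simp: back_verts_def back_heads_def back_tails_def)

lemma card_back_le:
  assumes "inj_on (\<lambda>e. (src e, dst e)) {..<m}"
  shows "card {e. e < m \<and> \<not> forward e} \<le> card back_verts * (card back_verts - 1)"
proof -
  let ?pairs = "back_verts \<times> back_verts - (\<lambda>v. (v, v)) ` back_verts"
  have "card {e. e < m \<and> \<not> forward e} = card ((\<lambda>e. (src e, dst e)) ` {e. e < m \<and> \<not> forward e})"
    using assms by (intro card_image[symmetric]) (auto simp: inj_on_def)
  also have "\<dots> \<le> card ?pairs"
    using finite_back_verts back_arc_ends(1,2) back_arc_ends(3)[symmetric] by (intro card_mono) auto
  also have "\<dots> = card back_verts * card back_verts - card back_verts"
    using finite_back_verts
    by (subst card_Diff_subset) (auto simp: card_image inj_on_def card_cartesian_product)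
  finally show ?thesis by (simp add: diff_mult_distrib2)
qed

lemma size_bounds:
  assumes inj: "inj_on (\<lambda>e. (src e, dst e)) {..<m}" and ex_back: "\<exists>e<m. \<not> forward e"
  shows "2 \<le> card back_verts" "1 \<le> card forward_pairs" "n \<le> m"
    "m \<le> 2 * (card back_verts * card forward_pairs)"
proof -
  let ?F = "{e. forward e}" and ?B = "{e. e < m \<and> \<not> forward e}"
  obtain e where e: "e < m" "\<not> forward e" using ex_back by blast
  have "{src e, dst e} \<subseteq> back_verts" using back_arc_ends[OF e] by blast
  then show two: "2 \<le> card back_verts"
    using card_mono[OF finite_back_verts, of "{src e, dst e}"] back_arc_ends(3)[OF e] by simp
  have verts: "card back_verts \<le> n" using card_mono[OF _ back_verts_subset] by simp
  have pairs: "n - 1 \<le> card forward_pairs" using card_forward_ge card_forward_le by linarith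
  then show "1 \<le> card forward_pairs" using two verts by linarith
  have "card (?F \<union> ?B) = card ?F + card ?B" using finite_forward by (intro card_Un_disjoint) auto
  moreover have "?F \<union> ?B = {..<m}" by (auto dest: forwardD(1))
  ultimately have m: "m = card ?F + card ?B" by simp
  have "0 < card ?B" using e by (auto simp: card_gt_0_iff)
  then show "n \<le> m" using m card_forward_ge by linarith
  have "card back_verts * (card back_verts - 1) \<le> card back_verts * card forward_pairs"
    using verts pairs by (intro mult_le_mono2) linarith
  then have "card ?B \<le> card back_verts * card forward_pairs" using card_back_le[OF inj] by linarith
  moreover have "1 * card forward_pairs \<le> card back_verts * card forward_pairs" using two
    by (intro mult_le_mono1) simp
  then have "card ?F \<le> card back_verts * card forward_pairs" using card_forward_le by linarith
  ultimately show "m \<le> 2 * (card back_verts * card forward_pairs)" using m by linarith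
qed

lemma shortest_paths_time_le:
  assumes "n \<le> m" "1 \<le> m"
  shows "shortest_paths_time r \<le> 50 * m + (r + 1) * (220 * m)"
proof -
  have "(r + 1) * ((m + 1) * 100 + 20) \<le> (r + 1) * (220 * m)" using assms by (intro mult_le_mono2) simp
  moreover have "(n + 1) * 20 + 8 \<le> 50 * m" using assms by simp
  ultimately show ?thesis unfolding shortest_paths_time_def by (rule add_mono[rotated])
qed

lemma prepare_time_le:
  assumes "n \<le> m" "1 \<le> m"
  shows "prepare_time \<le> 1500 * (m * m)"
proof -
  have "(n + 1) * (220 * m) \<le> (2 * m) * (220 * m)" using assms by (intro mult_le_mono) auto
  then have "shortest_paths_time n \<le> 50 * m + 440 * (m * m)"
    using shortest_paths_time_le[OF assms, of n] by simp
  moreover have "(m + 1) * 20 + 10 + (n + 1) * 20 \<le> 90 * m" using assms by simp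
  ultimately have "distances_time \<le> 140 * m + 440 * (m * m)" unfolding distances_time_def by linarith
  moreover have "(m + 1) * ((m + 1) * 80 + 20) \<le> (2 * m) * (180 * m)" using assms
    by (intro mult_le_mono) auto
  then have "(m + 1) * ((m + 1) * 80 + 20) \<le> 360 * (m * m)" by simp
  moreover have "(m + 1) * 100 + (m + 1) * 40 + 3 + (n + 1) * 40 + (n + 1) * 30 + (n + 1) * 30 \<le> 500 * m"
    using assms by simp
  ultimately show ?thesis using le_square[of m] unfolding prepare_time_def by linarith
qed

lemma pair_table_time_le:
  assumes "n \<le> m" "1 \<le> m" "k \<le> V"
  shows "pair_table_time k \<le> 80 * m + 920 * (V * (m * m))"
proof -
  have "(m + 1) * ((m + 1) * 200) \<le> (2 * m) * ((2 * m) * 200)" using assms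
    by (intro mult_le_mono) simp_all
  also have "\<dots> = 800 * (m * m)" by simp
  finally have "(m + 1) * ((m + 1) * 200) \<le> 800 * (m * m)" .
  moreover have "(n + 1) * 60 \<le> 120 * m" using assms by simp
  ultimately have "(n + 1) * 60 + (m + 1) * ((m + 1) * 200) \<le> 920 * (m * m)" using le_square[of m]
    by linarith
  then have "k * ((n + 1) * 60 + (m + 1) * ((m + 1) * 200)) \<le> V * (920 * (m * m))" using assms(3)
    by (intro mult_le_mono)
  moreover have "(n + 1) * 40 \<le> 80 * m" using assms by simp
  ultimately show ?thesis unfolding pair_table_time_def by simp
qed

lemma process_time_le:
  assumes "n \<le> m" "1 \<le> m" "card back_heads \<le> V" "2 \<le> V"
  shows "process_time \<le> 2500 * (V * m)"
proof -
  have "(Suc (card back_heads) + 1) * (220 * m) \<le> (2 * V) * (220 * m)" using assms(3,4)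
    by (intro mult_le_mono1) simp
  then have "shortest_paths_time (Suc (card back_heads)) \<le> 50 * m + 440 * (V * m)"
    using shortest_paths_time_le[OF assms(1,2), of "Suc (card back_heads)"] by simp
  moreover have "process_time \<le> shortest_paths_time (Suc (card back_heads)) + 2000 * m"
    using assms(1,2)
    unfolding process_time_def search_middle_time_def remove_time_def write_candidate_time_def by simp
  moreover have "2 * m \<le> V * m" using assms(4) by (rule mult_le_mono1)
  ultimately show ?thesis by linarith
qed

lemma main_loop_time_le:
  assumes "n \<le> m" "1 \<le> m" "card back_heads \<le> V" "card back_tails \<le> V" "2 \<le> V"
  shows "main_loop_time \<le> 80 * m + 400 * (V * (m * m)) + 2500 * (V * V * card forward_pairs * m)"
proof -
  let ?E = "card forward_pairs"
  have "(m + 1) * ((m + 1) * 100) \<le> (2 * m) * ((2 * m) * 100)" using assms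
    by (intro mult_le_mono) simp_all
  moreover have "?E * process_time \<le> ?E * (2500 * (V * m))" using process_time_le[OF assms(1-3,5)]
    by (rule mult_le_mono2)
  ultimately have "fst_loop_time \<le> (2 * m) * ((2 * m) * 100) + ?E * (2500 * (V * m))"
    unfolding fst_loop_time_def by (rule add_mono)
  then have "card back_tails * fst_loop_time \<le> V * ((2 * m) * ((2 * m) * 100) + ?E * (2500 * (V * m)))"
    using assms(4) by (intro mult_le_mono)
  also have "\<dots> = 400 * (V * (m * m)) + 2500 * (V * V * ?E * m)" by (simp add: algebra_simps)
  finally have "card back_tails * fst_loop_time \<le> \<dots>" .
  moreover have "(n + 1) * 40 \<le> 80 * m" using assms(1,2) by simp
  ultimately show ?thesis unfolding main_loop_time_def by linarith
qed

lemma total_time_le: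
  assumes inj: "inj_on (\<lambda>e. (src e, dst e)) {..<m}" and ex_back: "\<exists>e<m. \<not> forward e"
  shows "precheck_time + 10 + search_time \<le>
    12000 * (card back_verts * card back_verts * card forward_pairs * m)"
proof -
  define V E where "V = card back_verts" and "E = card forward_pairs"
  let ?Q = "V * V * E * m"
  note bounds = size_bounds[OF inj ex_back, folded V_def E_def]
  have m: "n \<le> m" "1 \<le> m" using bounds(3) s_less by linarith+
  have le_V: "card back_heads \<le> V" "card back_tails \<le> V"
    unfolding V_def by (rule card_mono[OF finite_back_verts]; simp add: back_verts_def)+
  have "1 \<le> V * V * E" using bounds(1,2) by simp
  then have "m \<le> ?Q" using mult_le_mono1[of 1 "V * V * E" m] by simp
  moreover have "V * (m * m) \<le> V * (m * (2 * (V * E)))" using bounds(4)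
    by (intro mult_le_mono order_refl)
  then have Vmm: "V * (m * m) \<le> 2 * ?Q" by (simp add: algebra_simps)
  moreover have "2 * (m * m) \<le> V * (m * m)" using bounds(1) by (rule mult_le_mono1)
  moreover have "precheck_time + 10 \<le> 650 * m" using m unfolding precheck_time_def by simp
  ultimately show ?thesis
    using prepare_time_le[OF m] pair_table_time_le[OF m le_V(1)] pair_table_time_le[OF m le_V(2)]
      main_loop_time_le[OF m le_V bounds(1)]
    unfolding search_time_def V_def[symmetric] E_def[symmetric] by linarith
qed

end

section \<open>Distances in layered graphs\<close>

context st_layered
begin

definition level :: "'a \<Rightarrow> real" where
  "level v = real_of_ereal (\<mu> w s v)"

lemma weight_nonneg: "e \<in> arcs G \<Longrightarrow> 0 \<le> w e"
  using weight_pos[of e] by simp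

lemma mu_finite: "v \<in> verts G \<Longrightarrow> \<mu> w s v < \<infinity> \<and> \<mu> w v t < \<infinity>"
  using on_shortest_path[of v] dist_finite by auto

lemma ex_shortest_apath:
  assumes "\<mu> w u v < \<infinity>"
  obtains p where "apath u p v" "\<mu> w u v = ereal (awalk_cost w p)"
  using min_cost_awalk[of u v w] \<mu>_reach_conv assms weight_nonneg by blast

lemma mu_level: "v \<in> verts G \<Longrightarrow> \<mu> w s v = ereal (level v)"
  using ex_shortest_apath[of s v] mu_finite[of v] unfolding level_def by force

lemma level_s: "level s = 0"
proof -
  have "\<mu> w s s \<le> 0"
    using min_cost_le_walk_cost[of s "[]" s w] s_in_verts by (simp add: awalk_Nil_iff zero_ereal_def)
  moreover obtain p where p: "apath s p s" "\<mu> w s s = ereal (awalk_cost w p)"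
    using ex_shortest_apath[of s s] mu_finite[OF s_in_verts] by blast
  moreover have "0 \<le> awalk_cost w p" using pos_cost_pos_awalk_cost p(1) weight_nonneg
    by (auto simp: apath_def)
  ultimately show ?thesis by (simp add: level_def)
qed

lemma level_head_le: "e \<in> arcs G \<Longrightarrow> level (head G e) \<le> level (tail G e) + w e"
  using pos_cost_mu_triangle[of w e "tail G e" "head G e" s] weight_nonneg mu_level
  by (simp add: arc_to_ends_def)

lemma level_awalk_le: "awalk u p v \<Longrightarrow> level v \<le> level u + awalk_cost w p"
proof (induction p arbitrary: u)
  case (Cons e p)
  then have "e \<in> arcs G" "u = tail G e" "awalk (head G e) p v" by (auto simp: awalk_Cons_iff)
  then show ?case using Cons.IH[of "head G e"] level_head_le[of e] by simp
qed (simp add: awalk_Nil_iff)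

lemma tight_awalk_ascends:
  "awalk u p v \<Longrightarrow> level u + awalk_cost w p = level v \<Longrightarrow>
   (u, v) \<in> {(tail G e, head G e) | e. e \<in> arcs G \<and> level (tail G e) < level (head G e)}\<^sup>*"
proof (induction p arbitrary: u)
  case (Cons e p)
  then have e: "e \<in> arcs G" "u = tail G e" "awalk (head G e) p v" by (auto simp: awalk_Cons_iff)
  have tight: "level (head G e) = level u + w e" "level (head G e) + awalk_cost w p = level v"
    using Cons.prems(2) level_head_le[OF e(1)] level_awalk_le[OF e(3)] e(2) by auto
  have "(u, head G e) \<in> {(tail G e, head G e) | e. e \<in> arcs G \<and> level (tail G e) < level (head G e)}"
    using e(1,2) tight(1) weight_pos[OF e(1)] by auto
  then show ?case using Cons.IH[OF e(3) tight(2)] by (rule converse_rtrancl_into_rtrancl)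
qed (simp add: awalk_Nil_iff)

lemma ascends_from_s:
  assumes "v \<in> verts G"
  shows "(s, v) \<in> {(tail G e, head G e) | e. e \<in> arcs G \<and> level (tail G e) < level (head G e)}\<^sup>*"
proof -
  obtain p where "apath s p v" "\<mu> w s v = ereal (awalk_cost w p)"
    using ex_shortest_apath mu_finite assms by blast
  then show ?thesis using tight_awalk_ascends[of s p v] level_s mu_level[OF assms]
    by (simp add: apath_def)
qed

lemma ascends_to_t:
  assumes "v \<in> verts G"
  shows "(v, t) \<in> {(tail G e, head G e) | e. e \<in> arcs G \<and> level (tail G e) < level (head G e)}\<^sup>*"
proof -
  obtain p where "apath v p t" "\<mu> w v t = ereal (awalk_cost w p)"
    using ex_shortest_apath mu_finite assms by blast
  then show ?thesis
    using tight_awalk_ascends[of v p t] mu_level[OF assms] mu_level[OF t_in_verts]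
      on_shortest_path[OF assms]
    by (simp add: apath_def)
qed

lemma no_level_between:
  assumes "e \<in> arcs G" "level (tail G e) < level (head G e)" "x \<in> verts G"
  shows "level x \<le> level (tail G e) \<or> level (tail G e) + w e \<le> level x"
  using no_vertex_between[of e x] assms by (simp add: mu_level)

lemma level_head:
  assumes "e \<in> arcs G" "level (tail G e) < level (head G e)"
  shows "level (head G e) = level (tail G e) + w e"
  using no_level_between[OF assms, of "head G e"] level_head_le[OF assms(1)] assms by auto

end

locale numbered_layered = st_layered G w s t for G :: "(nat, nat) pre_digraph" and w s t +
  assumes numbered: "numbered G"
begin

lemma less_card_verts: "v < card (verts G) \<longleftrightarrow> v \<in> verts G"
  and less_card_arcs: "e < card (arcs G) \<longleftrightarrow> e \<in> arcs G"
  using numbered unfolding numbered_def by blast+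

sublocale graph: layered_arcs "card (verts G)" "card (arcs G)" "tail G" "head G" w s t level
proof (unfold_locales, unfold less_card_verts less_card_arcs)
  show "level (tail G e) \<noteq> level (head G e)" if "e \<in> arcs G" for e
    using dist_ends_neq[OF that] that by (simp add: mu_level)
  show "level x \<le> level (tail G e) \<or> level (head G e) \<le> level x"
    if "e \<in> arcs G" "level (tail G e) < level (head G e)" "x \<in> verts G" for e x
    using no_level_between[OF that] level_head[OF that(1,2)] by simp
qed (use weight_pos s_in_verts t_in_verts level_head ascends_from_s ascends_to_t in auto)

lemma arc_list_iff_awalk: "a \<in> verts G \<Longrightarrow> graph.arc_list a p b \<longleftrightarrow> awalk a p b"
proof (induction p arbitrary: a)
  case (Cons e p)
  then show ?case using less_card_arcs wellformed by (auto simp: awalk_Cons_iff)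
qed (auto simp: awalk_Nil_iff)

lemma apath_iff_listed: "apath s p t \<longleftrightarrow> (\<exists>S k. graph.listed p S t k)"
proof -
  have "awalk_verts s p = s # map (head G) p" if "awalk s p t"
    using awalk_verts_conv'[of s p t] that by (cases p) (auto simp: awalk_def)
  then show ?thesis
    using arc_list_iff_awalk[OF s_in_verts] unfolding apath_def graph.listed_def by auto
qed

lemma listed_excess: "graph.listed p S t k \<Longrightarrow> k = awalk_cost w p - level t"
  using graph.arc_list_excess[of s p t] level_s by (simp add: graph.listed_def awalk_cost_def)

lemma not_shortest_iff_listed: "not_shortest w s t p \<longleftrightarrow> (\<exists>S k. graph.listed p S t k \<and> 0 < k)"
proof -
  have "ereal (level t) < ereal (awalk_cost w p) \<longleftrightarrow> 0 < k" if "graph.listed p S t k" for S k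
    using listed_excess[OF that] by simp
  then show ?thesis unfolding not_shortest_def apath_iff_listed mu_level[OF t_in_verts] by blast
qed

lemma not_shortest_nonshortest_excess:
  assumes "not_shortest w s t p"
  shows "graph.nonshortest_excess (awalk_cost w p - level t)"
proof -
  obtain S k where "graph.listed p S t k" "0 < k" using assms unfolding not_shortest_iff_listed by blast
  then show ?thesis using graph.listed_path listed_excess unfolding graph.nonshortest_excess_def by blast
qed

lemma correct_result_output:
  assumes "graph.correct_result \<tau>"
  shows "correct_output G w s t (ram_output \<tau>)"
proof (cases "nmem \<tau> Found 0 = 0")
  case True
  then have "\<not> not_shortest w s t p" for p
    using assms not_shortest_nonshortest_excess unfolding graph.correct_result_def by auto
  then show ?thesis using True by (simp add: correct_output_def ram_output_def next_to_shortest_def)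
next
  case False
  let ?p = "graph.output_arcs \<tau>"
  obtain S k where k: "graph.listed ?p S t k" "0 < k" "\<And>l. graph.nonshortest_excess l \<Longrightarrow> k \<le> l"
    using assms False unfolding graph.correct_result_def by auto
  have "not_shortest w s t ?p" using k(1,2) not_shortest_iff_listed by blast
  moreover have "awalk_cost w ?p \<le> awalk_cost w q" if "not_shortest w s t q" for q
    using k(3)[OF not_shortest_nonshortest_excess[OF that]] listed_excess[OF k(1)] by simp
  moreover have "ram_output \<tau> = Some ?p" using False by (simp add: ram_output_def graph.output_arcs_def)
  ultimately show ?thesis by (simp add: correct_output_def next_to_shortest_def)
qed

lemma V_B_eq: "V_B w s = graph.back_verts"
proof -
  have "back_edge w s e \<longleftrightarrow> e < card (arcs G) \<and> \<not> graph.forward e" for e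
    using graph.excess_back[of e] graph.excess_forward[of e]
    by (auto simp: back_edge_def graph.excess_def mu_level less_card_arcs)
  then show ?thesis
    unfolding V_B_def graph.back_verts_def graph.back_heads_def graph.back_tails_def less_card_verts
    by blast
qed

lemma E_FP_eq: "E_FP w s = graph.forward_pairs"
proof -
  have "forward_edge w s e \<longleftrightarrow> graph.forward e" for e
    using graph.excess_back[of e] graph.excess_forward[of e] graph.forwardD(1)[of e]
    by (cases "graph.forward e") (auto simp: forward_edge_def graph.excess_def mu_level less_card_arcs)
  then show ?thesis
    unfolding E_FP_def graph.forward_pairs_def using mu_level graph.forwardD(1) less_card_arcs
    by fastforce
qed

lemma inj_on_arc_ends: "inj_on (\<lambda>e. (tail G e, head G e)) {..<card (arcs G)}"
  using no_multi_arcs less_card_arcs by (auto simp: inj_on_def arc_to_ends_def)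

lemma running_time:
  assumes "k \<le> graph.precheck_time + 10 +
    (if \<forall>e<card (arcs G). graph.forward e then 0 else graph.search_time)"
  shows "real k \<le> 12000 * time_bound G w s"
proof (cases "\<forall>e<card (arcs G). graph.forward e")
  case True
  have "1 \<le> card (verts G)" using graph.s_less by linarith
  then have "k \<le> 12000 * (card (verts G) + card (arcs G))" using assms True
    by (simp add: graph.precheck_time_def)
  then have "real k \<le> 12000 * (real (card (verts G)) + real (card (arcs G)))"
    by (metis of_nat_add of_nat_le_iff of_nat_mult of_nat_numeral)
  moreover have "V_B w s = {}"
    using True unfolding V_B_eq graph.back_verts_def graph.back_heads_def graph.back_tails_def by blast
  ultimately show ?thesis by (simp add: time_bound_def)
next
  case False
  let ?V = "card (V_B w s)" and ?E = "card (E_FP w s)" and ?n = "card (verts G)" and ?m = "card (arcs G)"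
  have ex_back: "\<exists>e<?m. \<not> graph.forward e" using False by blast
  have "k \<le> 12000 * (?V * ?V * ?E * ?m)"
    using assms graph.total_time_le[OF inj_on_arc_ends ex_back]
    unfolding if_not_P[OF False] V_B_eq E_FP_eq by linarith
  then have "real k \<le> 12000 * (real ?V ^ 2 * real ?E * real ?m)"
    unfolding power2_eq_square by (metis of_nat_le_iff of_nat_mult of_nat_numeral)
  also have "\<dots> \<le> 12000 * (real ?V ^ 2 * real ?E * (real ?m + real ?n * log 2 (real ?n)))"
  proof -
    have "1 \<le> real ?n" using graph.s_less by linarith
    then show ?thesis by (intro mult_left_mono) auto
  qed
  also have "\<dots> = 12000 * time_bound G w s"
    using graph.size_bounds(1)[OF inj_on_arc_ends ex_back] unfolding V_B_eq[symmetric]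
    by (auto simp: time_bound_def Let_def)
  finally show ?thesis .
qed

lemma has_input_input_state: "graph.has_input (input_state G w s t)"
  by (simp add: graph.has_input_def input_state_def)

theorem next_to_shortest_program_correct:
  obtains k \<sigma> where "exec next_to_shortest_program (input_state G w s t) k \<sigma>"
    "correct_output G w s t (ram_output \<sigma>)" "real k \<le> 12000 * time_bound G w s"
proof -
  have empty: "nmem (input_state G w s t) a = (\<lambda>_. 0)" if "3 \<le> a" for a using that
    by (auto simp: input_state_def)
  have real_empty: "rmem (input_state G w s t) a = (\<lambda>_. 0)" if "1 \<le> a" for a using that
    by (auto simp: input_state_def)
  obtain \<tau> where \<tau>: "reaches next_to_shortest_program (input_state G w s t)
      (graph.precheck_time + 10 +
        (if \<forall>e<card (arcs G). graph.forward e then 0 else graph.search_time)) \<tau>"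
    "graph.correct_result \<tau>"
    using graph.runs_next_to_shortest_program[OF has_input_input_state level_s empty real_empty]
    unfolding runs_def by blast
  then show thesis using that correct_result_output running_time unfolding reaches_def by blast
qed

end

theorem theorem5p4:
  shows "\<exists>(prog :: com) (C :: real).
    \<forall>(G :: (nat, nat) pre_digraph) (w :: nat weight_fun) (s :: nat) (t :: nat).
      st_layered G w s t \<and> numbered G \<longrightarrow>
      (\<exists>k \<sigma>. exec prog (input_state G w s t) k \<sigma> \<and>
             correct_output G w s t (ram_output \<sigma>) \<and>
             real k \<le> C * time_bound G w s)"
proof (intro exI[of _ next_to_shortest_program] exI[of _ "12000 :: real"] allI impI)
  fix G :: "(nat, nat) pre_digraph" and w s t
  assume "st_layered G w s t \<and> numbered G"
  then interpret numbered_layered G w s t by (simp add: numbered_layered_def numbered_layered_axioms_def)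
  show "\<exists>k \<sigma>. exec next_to_shortest_program (input_state G w s t) k \<sigma> \<and>
      correct_output G w s t (ram_output \<sigma>) \<and> real k \<le> 12000 * time_bound G w s"
    using next_to_shortest_program_correct by blast
qed

end
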